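(* Let $X_0:\ x_0^8+x_1^8+x_2^8+x_3^8=0$ be the octic Fermat surface in $\mathbb{P}^3$. Write $x_0^8+x_1^8=f_1f_3f_4$ and $x_2^8+x_3^8=g_1g_3g_4$ with $f_i\in\mathbb{C}[x_0,x_1]$, $g_i\in\mathbb{C}[x_2,x_3]$ homogeneous of degree $i$, and let $C_1:\ f_1=g_1=0$ and $C_2:\ f_3=g_3=0$, which are algebraic curves in $X_0$. Let $r\in\mathbb{Q}$, $r\neq0$. Then, for the full family $\mathsf X\to\mathsf T$ of octic surfaces, the local Noether-Lefschetz locus $V^{\mathsf T}_{[C_1]+r[C_2]}$ is $2$-smooth.
   Context: Let $\mathsf T$ be the full parameter space (near $0$) of the family of smooth octic surfaces $$X_t=\{f_t=0\}\subset\mathbb{P}^3,\qquad f_t:=x_0^8+x_1^8+x_2^8+x_3^8-\sum_\alpha t_\alpha x^\alpha,\quad t=(t_\alpha),$$ where $x^\alpha$ runs through all $165$ monomials of degree $8$ in $x_0,\dots,x_3$. For $\beta\in\mathbb{Z}_{\ge0}^4$ with $\beta_0+\beta_1+\beta_2+\beta_3=4$ let $$\omega_\beta:=\mathrm{Resi}\left(\frac{x_0^{\beta_0}x_1^{\beta_1}x_2^{\beta_2}x_3^{\beta_3}\sum_{i=0}^3(-1)^ix_i\widehat{dx_i}}{f_t}\right)\in H^2_{\mathrm{dR}}(X_t),$$ where $\mathrm{Resi}$ is the residue map $H^3_{\mathrm{dR}}(\mathbb{P}^3\setminus X_t)\to H^2_{\mathrm{dR}}(X_t)$ and $\widehat{dx_i}$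 is the wedge product of the $dx_j$, $j\neq i$, in increasing order. For a Hodge cycle $\delta_0\in H_2(X_0,\mathbb{Q})$ with parallel transport $\delta_t\in H_2(X_t,\mathbb{Q})$ for $t$ near $0$, the local Noether-Lefschetz locus $V_{\delta_0}^{\mathsf T}$ is the analytic space germ at $0\in\mathsf T$ (possibly non-reduced) defined by the ideal $$I_{\delta_0}=\left\langle\int_{\delta_t}\omega_\beta\ :\ \beta_0+\beta_1+\beta_2+\beta_3=4\right\rangle\subset\mathcal{O}_{\mathsf T,0}.$$ It parameterizes those $X_t$ for which $\delta_t$ is still (Poincaré dual to a class) of type $(1,1)$. For $N\ge 2$, the $N$-th infinitesimal locus $V_{\delta_0}^{N}$ is defined by the ideal $I_{\delta_0}+\mathfrak m^{N+1}$, where $\mathfrak m\subset\mathcal{O}_{\mathsf T,0}$ is the maximal ideal. One says that $V_{\delta_0}$ is $N$-smooth if $V_{\delta_0}^N$ is the $N$-jet of a smooth variety at $0$. Equivalently, if $h_1,\dots,h_a\in I_{\delta_0}$ are chosen among the generators so that their linear parts form a basis of the span of the linear parts of all generators, then $I_{\delta_0}\subset\langle h_1,\dots,h_a\rangle+\mathfrak m^{N+1}$. *)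

theory Defs
  imports "HOL-Analysis.Analysis" "HOL-Homology.Homology"
begin

section \<open>The family of octic surfaces\<close>

typedef octic_monomial = "{a :: 4 \<Rightarrow> nat. (\<Sum>i\<in>UNIV. a i) = 8}"
  morphisms exponents Octic_monomial
  by (rule exI[of _ "\<lambda>i. 2"]) simp

instance octic_monomial :: finite
proof
  have "{a :: 4 \<Rightarrow> nat. (\<Sum>i\<in>UNIV. a i) = 8} \<subseteq> Pi\<^sub>E UNIV (\<lambda>_. {..8})"
  proof
    fix a :: "4 \<Rightarrow> nat" assume "a \<in> {a. (\<Sum>i\<in>UNIV. a i) = 8}"
    then have "a i \<le> 8" for i
      using member_le_sum[of i UNIV a] by simp
    then show "a \<in> Pi\<^sub>E UNIV (\<lambda>_. {..8})" by auto
  qed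
  then have "finite {a :: 4 \<Rightarrow> nat. (\<Sum>i\<in>UNIV. a i) = 8}"
    by (rule finite_subset) (simp add: finite_PiE)
  then have "finite (range exponents)"
    using type_definition.Rep_range[OF type_definition_octic_monomial] by simp
  then show "finite (UNIV :: octic_monomial set)"
    by (rule finite_imageD) (simp add: exponents_inject inj_on_def)
qed

type_synonym params = "complex ^ octic_monomial"

definition monomial :: "(4 \<Rightarrow> nat) \<Rightarrow> complex ^ 4 \<Rightarrow> complex" where
  "monomial a x = (\<Prod>i\<in>UNIV. (x $ i) ^ a i)"

definition octic :: "params \<Rightarrow> complex ^ 4 \<Rightarrow> complex" where
  "octic t x = (\<Sum>i\<in>UNIV. (x $ i) ^ 8) - (\<Sum>\<alpha>\<in>UNIV. t $ \<alpha> * monomial (exponents \<alpha>) x)"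

text \<open>A point of projective space is the line in \<open>\<complex>\<^sup>4\<close> that it stands for; \<open>pt x\<close> is
  \<open>[x\<^sub>0 : x\<^sub>1 : x\<^sub>2 : x\<^sub>3]\<close> when \<open>x \<noteq> 0\<close>. The coordinates are indexed by
  \<open>0, 1, 2, 3 :: 4\<close>.\<close>

type_synonym point = "(complex ^ 4) set"

definition pt :: "complex ^ 4 \<Rightarrow> point" where
  "pt x = range (\<lambda>c. c *s x)"

definition surface :: "params \<Rightarrow> point set" where
  "surface t = {pt x | x. x \<noteq> 0 \<and> octic t x = 0}"

definition smooth_octic :: "params \<Rightarrow> bool" where
  "smooth_octic t \<longleftrightarrow>
     (\<forall>x. x \<noteq> 0 \<and> octic t x = 0 \<longrightarrow> (\<exists>v. frechet_derivative (octic t) (at x) v \<noteq> 0))"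

definition binary_form :: "nat \<Rightarrow> (complex \<Rightarrow> complex \<Rightarrow> complex) \<Rightarrow> bool" where
  "binary_form d F \<longleftrightarrow>
     (\<exists>a :: nat \<Rightarrow> complex. \<forall>x y. F x y = (\<Sum>j\<le>d. a j * x ^ j * y ^ (d - j)))"

definition split_curve ::
  "(complex \<Rightarrow> complex \<Rightarrow> complex) \<Rightarrow> (complex \<Rightarrow> complex \<Rightarrow> complex) \<Rightarrow> point set" where
  "split_curve F G = {pt x | x. x \<noteq> 0 \<and> F (x $ 0) (x $ 1) = 0 \<and> G (x $ 2) (x $ 3) = 0}"

section \<open>Smooth singular chains with rational coefficients\<close>

primrec times_differentiable_on ::
  "nat \<Rightarrow> 'a::real_normed_vector set \<Rightarrow> ('a \<Rightarrow> 'b::real_normed_vector) \<Rightarrow> bool" where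
  "times_differentiable_on 0 S f \<longleftrightarrow> continuous_on S f"
| "times_differentiable_on (Suc n) S f \<longleftrightarrow>
     (\<forall>x\<in>S. f differentiable (at x)) \<and>
     (\<forall>v. times_differentiable_on n S (\<lambda>x. frechet_derivative f (at x) v))"

definition smooth_on :: "'a::real_normed_vector set \<Rightarrow> ('a \<Rightarrow> 'b::real_normed_vector) \<Rightarrow> bool" where
  "smooth_on S f \<longleftrightarrow> (\<forall>n. times_differentiable_on n S f)"

text \<open>For \<open>p \<le> 3\<close> the standard \<open>p\<close>-simplex is parametrised by the barycentric coordinates
  \<open>x 1, x 2, x 3\<close> (those beyond \<open>p\<close> vanish). Simplices being contractible, a map from one to
  projective space is smooth iff it has a smooth lift to \<open>\<complex>\<^sup>4 - {0}\<close>.\<close>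

definition smooth_lift ::
  "nat \<Rightarrow> ((nat \<Rightarrow> real) \<Rightarrow> point) \<Rightarrow> (real \<times> real \<times> real \<Rightarrow> complex ^ 4) \<Rightarrow> bool" where
  "smooth_lift p \<sigma> G \<longleftrightarrow>
     (\<exists>W. open W \<and> smooth_on W G \<and>
          (\<forall>x\<in>standard_simplex p.
             (x 1, x 2, x 3) \<in> W \<and> G (x 1, x 2, x 3) \<noteq> 0 \<and> \<sigma> x = pt (G (x 1, x 2, x 3))))"

definition smooth_simplex :: "nat \<Rightarrow> point set \<Rightarrow> ((nat \<Rightarrow> real) \<Rightarrow> point) \<Rightarrow> bool" where
  "smooth_simplex p S \<sigma> \<longleftrightarrow>
     \<sigma> \<in> extensional (standard_simplex p) \<and> \<sigma> ` standard_simplex p \<subseteq> S \<and> (\<exists>G. smooth_lift p \<sigma> G)"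

type_synonym qchain = "((nat \<Rightarrow> real) \<Rightarrow> point) \<Rightarrow>\<^sub>0 rat"

definition smooth_chain :: "nat \<Rightarrow> point set \<Rightarrow> qchain \<Rightarrow> bool" where
  "smooth_chain p S c \<longleftrightarrow> (\<forall>\<sigma>\<in>Poly_Mapping.keys c. smooth_simplex p S \<sigma>)"

definition qchain_boundary :: "nat \<Rightarrow> qchain \<Rightarrow> qchain" where
  "qchain_boundary p c =
     (\<Sum>\<sigma>\<in>Poly_Mapping.keys c. \<Sum>k\<le>p.
        Poly_Mapping.single (singular_face p k \<sigma>) ((- 1) ^ k * Poly_Mapping.lookup c \<sigma>))"

definition qchain_scale :: "rat \<Rightarrow> qchain \<Rightarrow> qchain" where
  "qchain_scale r c = Poly_Mapping.map ((*) r) c"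

definition qchain_map :: "nat \<Rightarrow> (point \<Rightarrow> point) \<Rightarrow> qchain \<Rightarrow> qchain" where
  "qchain_map p g c =
     (\<Sum>\<sigma>\<in>Poly_Mapping.keys c.
        Poly_Mapping.single (simplex_map p g \<sigma>) (Poly_Mapping.lookup c \<sigma>))"

definition cycle2 :: "point set \<Rightarrow> qchain \<Rightarrow> bool" where
  "cycle2 S c \<longleftrightarrow> smooth_chain 2 S c \<and> qchain_boundary 2 c = 0"

definition homologous2 :: "point set \<Rightarrow> qchain \<Rightarrow> qchain \<Rightarrow> bool" where
  "homologous2 S c c' \<longleftrightarrow> (\<exists>e. smooth_chain 3 S e \<and> qchain_boundary 3 e = c - c')"

text \<open>Elements of \<open>H\<^sub>2(S, \<rat>)\<close> are the sets \<open>homology_class2 S c\<close> with \<open>cycle2 S c\<close>.\<close>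

definition homology_class2 :: "point set \<Rightarrow> qchain \<Rightarrow> qchain set" where
  "homology_class2 S c = {c'. cycle2 S c' \<and> homologous2 S c' c}"

section \<open>Fundamental cycles of algebraic curves\<close>

definition open_triangle :: "(nat \<Rightarrow> real) set" where
  "open_triangle = {x \<in> standard_simplex 2. \<forall>i\<le>2. 0 < x i}"

definition d1 :: "(real \<times> real \<times> real \<Rightarrow> complex ^ 4) \<Rightarrow> real \<Rightarrow> real \<Rightarrow> complex ^ 4" where
  "d1 G a b = vector_derivative (\<lambda>s. G (s, b, 0)) (at a)"

definition d2 :: "(real \<times> real \<times> real \<Rightarrow> complex ^ 4) \<Rightarrow> real \<Rightarrow> real \<Rightarrow> complex ^ 4" where
  "d2 G a b = vector_derivative (\<lambda>s. G (a, s, 0)) (at b)"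

text \<open>The tangent space of projective space at \<open>[x]\<close> is \<open>\<complex>\<^sup>4\<close> modulo \<open>x\<close>. For a simplex lying on a
  complex curve both partial derivatives span the same complex line there; it is a positively
  (\<open>s = 1\<close>) or negatively (\<open>s = -1\<close>) oriented immersion on the open triangle iff the second is
  \<open>\<tau>\<close> times the first, the imaginary part of \<open>\<tau>\<close> having the sign \<open>s\<close>.\<close>

definition oriented_immersion :: "rat \<Rightarrow> ((nat \<Rightarrow> real) \<Rightarrow> point) \<Rightarrow> bool" where
  "oriented_immersion s \<sigma> \<longleftrightarrow>
     (\<exists>G. smooth_lift 2 \<sigma> G \<and>
        (\<forall>a b. 0 < a \<and> 0 < b \<and> a + b < 1 \<longrightarrow>
           d1 G a b \<notin> pt (G (a, b, 0)) \<and>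
           (\<exists>\<tau> c. 0 < of_rat s * Im \<tau> \<and> d2 G a b = \<tau> *s d1 G a b + c *s G (a, b, 0))))"

text \<open>A fundamental cycle of a projective curve \<open>C\<close> is a smooth triangulation of \<open>C\<close> in which every
  triangle carries the sign \<open>\<plusminus>1\<close> that turns it into a positively oriented one. It has local degree
  one at the general points of each irreducible component, so it represents \<open>[C]\<close>. (All signs equal
  to \<open>1\<close> would be impossible: the boundary of a simplex has two positive faces and one negative.)\<close>

definition fundamental_cycle :: "point set \<Rightarrow> qchain \<Rightarrow> bool" where
  "fundamental_cycle C c \<longleftrightarrow>
     cycle2 C c \<and>
     (\<forall>\<sigma>\<in>Poly_Mapping.keys c.
        \<bar>Poly_Mapping.lookup c \<sigma>\<bar> = 1 \<and>
        oriented_immersion (Poly_Mapping.lookup c \<sigma>) \<sigma> \<and> inj_on \<sigma> open_triangle) \<and>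
     (\<forall>\<sigma>\<in>Poly_Mapping.keys c. \<forall>\<sigma>'\<in>Poly_Mapping.keys c.
        \<sigma> \<noteq> \<sigma>' \<longrightarrow> \<sigma> ` open_triangle \<inter> \<sigma>' ` open_triangle = {}) \<and>
     (\<Union>\<sigma>\<in>Poly_Mapping.keys c. \<sigma> ` standard_simplex 2) = C"

section \<open>Parallel transport\<close>

definition smooth_projective_map ::
  "(params \<times> point) set \<Rightarrow> (params \<Rightarrow> point \<Rightarrow> point) \<Rightarrow> bool" where
  "smooth_projective_map E F \<longleftrightarrow>
     (\<forall>t x. x \<noteq> 0 \<and> (t, pt x) \<in> E \<longrightarrow>
        (\<exists>W G. open W \<and> (t, x) \<in> W \<and> smooth_on W G \<and>
           (\<forall>s y. (s, y) \<in> W \<and> y \<noteq> 0 \<and> (s, pt y) \<in> E \<longrightarrow>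
              G (s, y) \<noteq> 0 \<and> F s (pt y) = pt (G (s, y)))))"

text \<open>A smooth local trivialisation, as provided by Ehresmann's theorem.\<close>

definition trivialisation :: "params set \<Rightarrow> (params \<Rightarrow> point \<Rightarrow> point) \<Rightarrow> bool" where
  "trivialisation U \<Phi> \<longleftrightarrow>
     open U \<and> connected U \<and> 0 \<in> U \<and>
     (\<forall>t\<in>U. smooth_octic t \<and> bij_betw (\<Phi> t) (surface 0) (surface t)) \<and>
     (\<forall>p\<in>surface 0. \<Phi> 0 p = p) \<and>
     smooth_projective_map (U \<times> surface 0) \<Phi> \<and>
     smooth_projective_map (SIGMA t:U. surface t) (\<lambda>t. inv_into (surface 0) (\<Phi> t))"

text \<open>\<open>\<delta>\<close> is the parallel transport of the class \<open>\<delta>\<^sub>0 \<in> H\<^sub>2(X\<^sub>0, \<rat>)\<close> near \<open>0\<close>. Its values away from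
  \<open>0\<close> are irrelevant.\<close>

definition parallel_transport :: "qchain set \<Rightarrow> (params \<Rightarrow> qchain set) \<Rightarrow> bool" where
  "parallel_transport \<delta>\<^sub>0 \<delta> \<longleftrightarrow>
     (\<exists>U \<Phi>. trivialisation U \<Phi> \<and>
        (\<forall>t\<in>U. \<forall>c\<in>\<delta>\<^sub>0. \<delta> t = homology_class2 (surface t) (qchain_map 2 (\<Phi> t) c)))"

section \<open>Residues and periods\<close>

definition wedge3 ::
  "4 \<Rightarrow> 4 \<Rightarrow> 4 \<Rightarrow> complex ^ 4 \<Rightarrow> complex ^ 4 \<Rightarrow> complex ^ 4 \<Rightarrow> complex" where
  "wedge3 i j k u v w =
     u $ i * (v $ j * w $ k - v $ k * w $ j) -
     u $ j * (v $ i * w $ k - v $ k * w $ i) +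
     u $ k * (v $ i * w $ j - v $ j * w $ i)"

text \<open>The form \<open>\<Sum>\<^sub>i (-1)\<^sup>i x\<^sub>i \<and>\<^bsub>j \<noteq> i\<^esub> dx\<^sub>j\<close> at \<open>x\<close>, evaluated on \<open>u, v, w\<close>.\<close>

definition Omega :: "complex ^ 4 \<Rightarrow> complex ^ 4 \<Rightarrow> complex ^ 4 \<Rightarrow> complex ^ 4 \<Rightarrow> complex" where
  "Omega x u v w =
     x $ 0 * wedge3 1 2 3 u v w - x $ 1 * wedge3 0 2 3 u v w +
     x $ 2 * wedge3 0 1 3 u v w - x $ 3 * wedge3 0 1 2 u v w"

text \<open>As \<open>\<beta>\<close> has degree 4, the form \<open>x\<^sup>\<beta> \<Omega> / f\<close> has a simple pole along \<open>f = 0\<close>, and its residue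
  is the restriction to the surface of any \<open>\<alpha>\<close> with \<open>x\<^sup>\<beta> \<Omega> = df \<and> \<alpha>\<close> along \<open>f = 0\<close>. Such an
  \<open>\<alpha>\<close> is the contraction of \<open>x\<^sup>\<beta> \<Omega>\<close> with any vector \<open>N\<close> satisfying \<open>df N = 1\<close>
  (see \<open>wedge_contraction\<close> below; \<open>df x = 0\<close> is Euler's identity). On vectors tangent to
  \<open>f = 0\<close> it does not depend on \<open>N\<close>.\<close>

definition omega ::
  "params \<Rightarrow> (4 \<Rightarrow> nat) \<Rightarrow> complex ^ 4 \<Rightarrow> complex ^ 4 \<Rightarrow> complex ^ 4 \<Rightarrow> complex" where
  "omega t \<beta> x u v =
     monomial \<beta> x * Omega x (SOME N. frechet_derivative (octic t) (at x) N = 1) u v"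

lemma wedge_contraction:
  fixes D :: "complex ^ 4 \<Rightarrow> complex" and d :: "complex ^ 4"
  assumes D: "\<And>v. D v = (\<Sum>i\<in>UNIV. d $ i * v $ i)" and "D x = 0" and "D N = 1"
  shows "D u * Omega x N v w - D v * Omega x N u w + D w * Omega x N u v = Omega x u v w"
proof -
  have four: "(4 :: 4) = 0" by simp
  have D': "D v = d $ 0 * v $ 0 + d $ 1 * v $ 1 + d $ 2 * v $ 2 + d $ 3 * v $ 3" for v
    unfolding D sum_4 four by simp
  have "D u * Omega x N v w - D v * Omega x N u w + D w * Omega x N u v
        = D N * Omega x u v w - D x * Omega N u v w"
    unfolding D' Omega_def wedge3_def by Groebner_Basis.algebra
  then show ?thesis
    using assms by simp
qed

text \<open>The form \<open>\<omega>\<close> on the cone over the surface is homogeneous of degree \<open>0\<close> and killed by the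
  radial vector field, so the integral does not depend on the lift.\<close>

definition simplex_integral ::
  "(complex ^ 4 \<Rightarrow> complex ^ 4 \<Rightarrow> complex ^ 4 \<Rightarrow> complex) \<Rightarrow> ((nat \<Rightarrow> real) \<Rightarrow> point) \<Rightarrow> complex" where
  "simplex_integral \<omega> \<sigma> =
     (let G = (SOME G. smooth_lift 2 \<sigma> G) in
        integral {(a, b). 0 \<le> a \<and> 0 \<le> b \<and> a + b \<le> 1}
          (\<lambda>(a, b). \<omega> (G (a, b, 0)) (d1 G a b) (d2 G a b)))"

definition chain_integral ::
  "(complex ^ 4 \<Rightarrow> complex ^ 4 \<Rightarrow> complex ^ 4 \<Rightarrow> complex) \<Rightarrow> qchain \<Rightarrow> complex" where
  "chain_integral \<omega> c =
     (\<Sum>\<sigma>\<in>Poly_Mapping.keys c. of_rat (Poly_Mapping.lookup c \<sigma>) * simplex_integral \<omega> \<sigma>)"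

text \<open>Holomorphic 2-forms on a surface are closed, so by Stokes every representative of the class
  gives the same integral.\<close>

definition period :: "params \<Rightarrow> (4 \<Rightarrow> nat) \<Rightarrow> qchain set \<Rightarrow> complex" where
  "period t \<beta> z = chain_integral (omega t \<beta>) (SOME c. c \<in> z)"

section \<open>Ideals of holomorphic germs\<close>

text \<open>A germ at \<open>0\<close> is represented by any function on the whole space that induces it; the sets of
  functions below are closed under equality near \<open>0\<close>.\<close>

definition holomorphic_germs :: "(complex ^ 'n \<Rightarrow> complex) set" where
  "holomorphic_germs =
     {h. \<forall>\<^sub>F t in nhds 0. \<exists>D. (h has_derivative D) (at t) \<and> (\<forall>c v. D (c *s v) = c * D v)}"

definition germ_ideal :: "(complex ^ 'n \<Rightarrow> complex) set \<Rightarrow> (complex ^ 'n \<Rightarrow> complex) set" where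
  "germ_ideal S =
     {h. \<exists>A c. finite A \<and> A \<subseteq> S \<and> (\<forall>s\<in>A. c s \<in> holomorphic_germs) \<and>
           (\<forall>\<^sub>F t in nhds 0. h t = (\<Sum>s\<in>A. c s t * s t))}"

definition max_ideal :: "(complex ^ 'n \<Rightarrow> complex) set" where
  "max_ideal = {h \<in> holomorphic_germs. h 0 = 0}"

definition max_ideal_power :: "nat \<Rightarrow> (complex ^ 'n \<Rightarrow> complex) set" where
  "max_ideal_power k = germ_ideal {\<lambda>t. \<Prod>i<k. u i t | u. \<forall>i<k. u i \<in> max_ideal}"

definition smooth_germ_ideal :: "(complex ^ 'n \<Rightarrow> complex) set \<Rightarrow> bool" where
  "smooth_germ_ideal J \<longleftrightarrow>
     (\<exists>(m :: nat) h. (\<forall>i<m. h i \<in> max_ideal) \<and>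
        (\<forall>c :: nat \<Rightarrow> complex.
           (\<forall>v. (\<Sum>i<m. c i * frechet_derivative (h i) (at 0) v) = 0) \<longrightarrow> (\<forall>i<m. c i = 0)) \<and>
        J = germ_ideal (h ` {..<m}))"

text \<open>The sum of two ideals is the ideal generated by their union.\<close>

definition N_smooth :: "nat \<Rightarrow> (complex ^ 'n \<Rightarrow> complex) set \<Rightarrow> bool" where
  "N_smooth N I \<longleftrightarrow>
     (\<exists>J. smooth_germ_ideal J \<and>
        germ_ideal (I \<union> max_ideal_power (N + 1)) = germ_ideal (J \<union> max_ideal_power (N + 1)))"

definition Noether_Lefschetz_ideal :: "(params \<Rightarrow> qchain set) \<Rightarrow> (params \<Rightarrow> complex) set" where
  "Noether_Lefschetz_ideal \<delta> =
     germ_ideal {\<lambda>t. period t \<beta> (\<delta> t) | \<beta>. (\<Sum>i\<in>UNIV. \<beta> i) = 4}"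

end

theory Submission
  imports Defs "HOL-Complex_Analysis.Cauchy_Integral_Formula"
begin

text \<open>Griffiths' tube map replaces residues by integrals of \<open>x\<^sup>\<beta> \<Omega> / f\<^sub>t\<close> over circle bundles around chains.
  Near \<open>t = 0\<close> such a bundle around a cycle of \<open>X\<^sub>0\<close> computes the periods of \<open>X\<^sub>t\<close> as well, so expanding
  \<open>1 / f\<^sub>t\<close> in powers of \<open>\<Sum>\<^sub>\<alpha> t\<^sub>\<alpha> x\<^sup>\<alpha> / f\<^sub>0\<close> gives the linear and quadratic parts of the periods as
  integrals \<open>\<Lambda>\<^sub>2\<close> and \<open>\<Lambda>\<^sub>3\<close> of \<open>x\<^sup>e \<Omega> / f\<^sub>0\<^sup>2\<close> and \<open>x\<^sup>e \<Omega> / f\<^sub>0\<^sup>3\<close>, with a holomorphic cubic remainder.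

  Both curves are unions of lines \<open>x\<^sub>0 = a x\<^sub>1, x\<^sub>2 = b x\<^sub>3\<close> with \<open>a\<^sup>8 = b\<^sup>8 = - 1\<close>. On such a line the residue
  is explicit: \<open>\<Lambda>\<^sub>2 (x\<^sup>e)\<close> is a universal constant times \<open>\<Sum> a\<^bsup>e\<^sub>0 + 1\<^esup> b\<^bsup>e\<^sub>2 + 1\<^esup>\<close> for \<open>e\<^sub>0 + e\<^sub>1 = 6\<close>. It vanishes
  otherwise, because rotating \<open>(x\<^sub>0, x\<^sub>1)\<close> by an eighth root of unity is isotopic to the identity along the
  lines. Exact forms reduce \<open>\<Lambda>\<^sub>3\<close> to \<open>\<Lambda>\<^sub>2\<close>.

  Two-smoothness then says that \<open>\<Lambda>\<^sub>3 (P v\<^sup>2) = 0\<close> whenever \<open>P\<close> of degree 4 annihilates all linear parts and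
  \<open>v\<close> of degree 8 is a Zariski tangent vector. These conditions are orthogonality relations on one point and
  a \<open>3 \<times> 3\<close> grid of pairs \<open>(a, b)\<close>. They force \<open>P\<close> to vanish there, so that \<open>\<Lambda>\<^sub>3 (P v\<^sup>2)\<close> only involves
  first derivatives of \<open>P\<close> and is killed bidegree by bidegree by Lagrange interpolation.\<close>

section \<open>Smooth maps between normed spaces\<close>

text \<open>The field \<open>normal\<close> is chosen to keep everything explicit. Its conjugate
  seventh powers make df positive on it; the factor \<open>norm x ^ 6\<close> makes a change of
  homogeneous lift rotate the circle instead of rescaling it, so one radius serves all of projective
  space and all small t; rotations by eighth roots of unity commute with it; and along a line with
  slopes a, b it points into the plane with slopes -a, -b, so that determinants factor.

  The tangent space of a complex curve is a complex line, so the numerator of a residue vanishes on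
  it. The periods therefore have no constant term, and a double pole contributes only through the
  derivative of \<open>normal\<close>. What comes out is a nonnegative density in the affine
  coordinate of the line, the same for every line, because the sign of each triangle undoes its
  orientation. Its total mass is never computed: if it were zero, all quadratic parts would vanish
  and the kernel condition would be trivial.

  Simplices enter as cubes with collapsed faces, so one Stokes argument on the unit cube serves
  chains, homotopies and exact forms.\<close>

lemma tdiff_Suc_D:
 "times_differentiable_on (Suc n) S f ==> times_differentiable_on n S f"
proof (induction n arbitrary: f)
 case 0
 then show ?case
  by (auto simp: continuous_on_eq_continuous_at differentiable_imp_continuous_within
    intro!: continuous_at_imp_continuous_on)
next
 case (Suc n)
 then show ?case by simp
qed

lemma tdiff_mono:
 "times_differentiable_on n S f ==> m \<le> n ==> times_differentiable_on m S f"
proof (induction n)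
 case (Suc n)
 then show ?case
  using tdiff_Suc_D[OF Suc.prems(1)] by (cases "m = Suc n") auto
qed simp

lemma tdiff_continuous: "times_differentiable_on n S f ==> continuous_on S f"
 using tdiff_mono[of n S f 0] by simp

lemma tdiff_cong:
 assumes "open S" "!!x. x \<in> S ==> f x = g x"
 shows "times_differentiable_on n S f \<longleftrightarrow> times_differentiable_on n S g"
 using assms(2)
proof (induction n arbitrary: f g)
 case 0
 then show ?case by (auto cong: continuous_on_cong)
next
 case (Suc n)
 have fd: "(f has_derivative D) (at x) \<longleftrightarrow> (g has_derivative D) (at x)" if "x \<in> S" for x D
  using has_derivative_transform_within_open[OF _ assms(1) that] Suc.prems by metis
 have "f differentiable (at x) \<longleftrightarrow> g differentiable (at x)" if "x \<in> S" for x
  using fd[OF that] by (simp add: differentiable_def)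
 moreover have "times_differentiable_on n S (%x. frechet_derivative f (at x) v) \<longleftrightarrow>
   times_differentiable_on n S (%x. frechet_derivative g (at x) v)" for v
  by (rule Suc.IH) (simp add: frechet_derivative_def fd)
 ultimately show ?case by simp
qed

lemma tdiff_subset:
 "times_differentiable_on n S f ==> T \<subseteq> S ==> times_differentiable_on n T f"
 by (induction n arbitrary: f) (auto intro: continuous_on_subset)

lemma tdiff_Union:
 assumes "!!S. S \<in> \<S> ==> open S" "!!S. S \<in> \<S> ==> times_differentiable_on n S f"
 shows "times_differentiable_on n (\<Union>\<S>) f"
 using assms(2)
proof (induction n arbitrary: f)
 case 0
 then show ?case
  using continuous_on_open_Union[of \<S> f] assms(1) by auto
qed auto

lemma tdiff_Suc_I:
 assumes "open S" "!!x. x \<in> S ==> (f has_derivative D x) (at x)"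
  and "!!v. times_differentiable_on n S (%x. D x v)"
 shows "times_differentiable_on (Suc n) S f"
proof -
 have eq: "frechet_derivative f (at x) v = D x v" if "x \<in> S" for x v
  using assms(2)[OF that] frechet_derivative_at by metis
 have "times_differentiable_on n S (%x. frechet_derivative f (at x) v)" for v
  by (rule tdiff_cong[OF assms(1), THEN iffD2, OF eq assms(3)])
 then show ?thesis
  using assms(2) by (auto simp: differentiable_def)
qed

lemma tdiff_SucD:
 assumes "times_differentiable_on (Suc n) S f"
 shows "x \<in> S ==> (f has_derivative frechet_derivative f (at x)) (at x)"
  and "times_differentiable_on n S (%x. frechet_derivative f (at x) v)"
 using assms by (auto simp: frechet_derivative_works)

lemma tdiff_const: "open S ==> times_differentiable_on n S (%x. c)"
proof (induction n arbitrary: c)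
 case (Suc n)
 show ?case
  by (rule tdiff_Suc_I[OF Suc.prems has_derivative_const]) (use Suc in blast)
qed simp

lemma tdiff_linear:
 assumes "open S" "bounded_linear h"
 shows "times_differentiable_on n S h"
proof (cases n)
 case 0
 then show ?thesis using assms linear_continuous_on by auto
next
 case (Suc m)
 then show ?thesis
  using tdiff_Suc_I[OF assms(1) bounded_linear_imp_has_derivative[OF assms(2)]
   tdiff_const[OF assms(1)]] by simp
qed

lemma tdiff_add:
 assumes "open S"
 shows "times_differentiable_on n S f ==> times_differentiable_on n S g ==>
  times_differentiable_on n S (%x. f x + g x)"
proof (induction n arbitrary: f g)
 case (Suc n)
 note f = tdiff_SucD[OF Suc.prems(1)] and g = tdiff_SucD[OF Suc.prems(2)]
 show ?case
  by (rule tdiff_Suc_I[OF assms has_derivative_add[OF f(1) g(1)] Suc.IH[OF f(2) g(2)]])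
qed (auto intro: continuous_intros)

lemma tdiff_sum:
 assumes "open S" "!!i. i \<in> I ==> times_differentiable_on n S (f i)"
 shows "times_differentiable_on n S (%x. \<Sum>i\<in>I. f i x)"
 using assms(2)
 by (induction I rule: infinite_finite_induct)
  (simp_all add: tdiff_const[OF assms(1)] tdiff_add[OF assms(1)])

lemma tdiff_bilinear:
 assumes "open S" "bounded_bilinear B"
 shows "times_differentiable_on n S f ==> times_differentiable_on n S g ==>
  times_differentiable_on n S (%x. B (f x) (g x))"
proof (induction n arbitrary: f g)
 case 0
 then show ?case using bounded_bilinear.continuous_on[OF assms(2)] by auto
next
 case (Suc n)
 note f = tdiff_SucD[OF Suc.prems(1)] and g = tdiff_SucD[OF Suc.prems(2)]
 note IH = Suc.IH[OF tdiff_Suc_D[OF Suc.prems(1)] g(2)]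
  Suc.IH[OF f(2) tdiff_Suc_D[OF Suc.prems(2)]]
 show ?case
  by (rule tdiff_Suc_I[OF assms(1) bounded_bilinear.FDERIV[OF assms(2) f(1) g(1)]
     tdiff_add[OF assms(1) IH]])
qed

text \<open>\<open>times_differentiable_on\<close> only speaks of derivatives in fixed directions,
  while the chain rule produces the moving direction df(x) v. Expanding it in a basis of the middle
  space gives a finite sum of products to which the induction hypothesis applies; this is why that
  space is Euclidean.\<close>

lemma tdiff_compose:
 fixes f :: "'a::real_normed_vector => 'b::euclidean_space"
 assumes "open S" "open T"
 shows "times_differentiable_on n S f ==> times_differentiable_on n T g ==> f ` S \<subseteq> T ==>
  times_differentiable_on n S (%x. g (f x))"
proof (induction n arbitrary: g)
 case 0
 then show ?case using continuous_on_compose2[of T g S f] by simp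
next
 case (Suc n)
 let ?D = "%x v. \<Sum>b\<in>Basis. (frechet_derivative f (at x) v \<bullet> b) *\<^sub>R frechet_derivative g (at (f x)) b"
 have der: "((%x. g (f x)) has_derivative ?D x) (at x)" if "x \<in> S" for x
 proof -
  have f: "(f has_derivative frechet_derivative f (at x)) (at x)"
   using tdiff_SucD(1)[OF Suc.prems(1) that] .
  have g: "(g has_derivative frechet_derivative g (at (f x))) (at (f x))"
   using tdiff_SucD(1)[OF Suc.prems(2)] Suc.prems(3) that by blast
  have lin: "linear (frechet_derivative g (at (f x)))"
   using g has_derivative_linear by blast
  have "frechet_derivative g (at (f x)) w =
    (\<Sum>b\<in>Basis. (w \<bullet> b) *\<^sub>R frechet_derivative g (at (f x)) b)" for w
   by (subst (1) euclidean_representation[of w, symmetric]) (simp add: linear_sum[OF lin] linear_scale[OF lin])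
  then have "frechet_derivative g (at (f x)) (frechet_derivative f (at x) v) = ?D x v" for v
   by blast
  moreover have "((%x. g (f x)) has_derivative (%v. frechet_derivative g (at (f x)) (frechet_derivative f (at x) v))) (at x)"
   using has_derivative_compose[OF f g] .
  ultimately show ?thesis by simp
 qed
 have f: "times_differentiable_on n S (%x. frechet_derivative f (at x) v)"
   and f': "times_differentiable_on n S f" for v
  using Suc.prems(1) tdiff_Suc_D tdiff_SucD(2) by blast+
 have inner: "times_differentiable_on n S (%x. frechet_derivative f (at x) v \<bullet> b)" for v b
  by (rule tdiff_bilinear[OF assms(1) bounded_bilinear_inner f tdiff_const[OF assms(1)]])
 have "times_differentiable_on n S (%x. frechet_derivative g (at (f x)) b)" for b
  using Suc.IH[OF f' tdiff_SucD(2)[OF Suc.prems(2)] Suc.prems(3)] .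
 then have "times_differentiable_on n S (%x. ?D x v)" for v
  by (intro tdiff_sum[OF assms(1)]
    tdiff_bilinear[OF assms(1) bounded_bilinear_scaleR inner])
 from tdiff_Suc_I[OF assms(1) der this] show ?case by simp
qed

text \<open>The derivative of \<open>inverse\<close> is quadratic in \<open>inverse\<close> itself,
  so each order of smoothness yields the next.\<close>

lemma tdiff_inverse:
 "times_differentiable_on n (- {0}) (inverse :: 'a::real_normed_field => 'a)"
proof (induction n)
 case 0
 then show ?case by (auto intro: continuous_intros)
next
 case (Suc n)
 have op: "open (- {0 :: 'a})" by auto
 have 1: "times_differentiable_on n (- {0}) (%x::'a. inverse x * v)" for v
  by (rule tdiff_bilinear[OF op bounded_bilinear_mult Suc tdiff_const[OF op]])
 have 2: "times_differentiable_on n (- {0}) (%x::'a. inverse x * (- v) * inverse x)" for v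
  by (rule tdiff_bilinear[OF op bounded_bilinear_mult 1 Suc])
 have "(inverse has_derivative (%v. inverse x * (- v) * inverse x)) (at x)" if "x \<in> - {0}" for x :: 'a
  using has_derivative_inverse'[of x UNIV] that by simp
 from tdiff_Suc_I[OF op this 2] show ?case .
qed

lemmas smooth_onD = smooth_on_def[THEN iffD1, rule_format]
lemmas smooth_onI = smooth_on_def[THEN iffD2, rule_format]

lemma smooth_on_cong: "open S ==> (!!x. x \<in> S ==> f x = g x) ==> smooth_on S f \<longleftrightarrow> smooth_on S g"
 by (simp only: smooth_on_def tdiff_cong[of S f g])

lemma smooth_on_subset: "smooth_on S f ==> T \<subseteq> S ==> smooth_on T f"
 by (rule smooth_onI, rule tdiff_subset) (simp_all add: smooth_on_def)

lemma smooth_on_Un: "open S ==> open T ==> smooth_on S f ==> smooth_on T f ==> smooth_on (S \<union> T) f"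
 unfolding smooth_on_def using tdiff_Union[of "{S, T}"] by auto

lemma smooth_on_const: "open S ==> smooth_on S (%x. c)"
 by (rule smooth_onI, rule tdiff_const) (simp_all add: smooth_on_def)

lemma smooth_on_linear: "open S ==> bounded_linear h ==> smooth_on S h"
 by (rule smooth_onI, rule tdiff_linear) (simp_all add: smooth_on_def)

lemma smooth_on_add:
 "open S ==> smooth_on S f ==> smooth_on S g ==> smooth_on S (%x. f x + g x)"
 by (rule smooth_onI, rule tdiff_add) (simp_all add: smooth_on_def)

lemma smooth_on_sum:
 "open S ==> (!!i. i \<in> I ==> smooth_on S (f i)) ==> smooth_on S (%x. \<Sum>i\<in>I. f i x)"
 by (rule smooth_onI, rule tdiff_sum) (simp_all add: smooth_on_def)

lemma smooth_on_bilinear: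
 "open S ==> bounded_bilinear B ==> smooth_on S f ==> smooth_on S g ==> smooth_on S (%x. B (f x) (g x))"
 by (rule smooth_onI, rule tdiff_bilinear) (simp_all add: smooth_on_def)

lemma smooth_on_compose:
 fixes f :: "'a::real_normed_vector => 'b::euclidean_space"
 shows "open S ==> open T ==> smooth_on S f ==> smooth_on T g ==> f ` S \<subseteq> T ==>
  smooth_on S (%x. g (f x))"
 by (rule smooth_onI, rule tdiff_compose) (simp_all add: smooth_on_def)

lemma smooth_on_linear_compose:
 fixes f :: "'a::real_normed_vector => 'b::euclidean_space"
 assumes "open S" "bounded_linear h" "smooth_on S f"
 shows "smooth_on S (%x. h (f x))"
 using smooth_on_compose[OF assms(1) open_UNIV assms(3) smooth_on_linear[OF open_UNIV assms(2)]] by simp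

lemma smooth_on_mult:
 fixes f g :: "'a::real_normed_vector => 'b::real_normed_algebra"
 shows "open S ==> smooth_on S f ==> smooth_on S g ==> smooth_on S (%x. f x * g x)"
 by (rule smooth_on_bilinear[OF _ bounded_bilinear_mult])

lemma smooth_on_diff:
 fixes f g :: "'a::real_normed_vector => 'b::euclidean_space"
 assumes "open S" "smooth_on S f" "smooth_on S g"
 shows "smooth_on S (%x. f x - g x)"
 using smooth_on_add[OF assms(1,2) smooth_on_linear_compose[OF assms(1) bounded_linear_minus[OF bounded_linear_ident] assms(3)]]
 by simp

lemma smooth_on_power:
 fixes f :: "'a::real_normed_vector => 'b::real_normed_algebra_1"
 shows "open S ==> smooth_on S f ==> smooth_on S (%x. f x ^ n)"
 by (induction n) (simp_all add: smooth_on_const smooth_on_mult)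

lemma smooth_on_prod:
 fixes f :: "'i => 'a::real_normed_vector => 'b::real_normed_field"
 assumes "open S" "!!i. i \<in> I ==> smooth_on S (f i)"
 shows "smooth_on S (%x. \<Prod>i\<in>I. f i x)"
 using assms(2)
 by (induction I rule: infinite_finite_induct)
  (simp_all add: smooth_on_const[OF assms(1)] smooth_on_mult[OF assms(1)])

lemma smooth_on_inverse:
 fixes f :: "'a::real_normed_vector => 'b::{real_normed_field, euclidean_space}"
 assumes "open S" "smooth_on S f" "!!x. x \<in> S ==> f x ~= 0"
 shows "smooth_on S (%x. inverse (f x))"
proof (rule smooth_on_compose[OF assms(1) _ assms(2)])
 show "smooth_on (- {0}) (inverse :: 'b => 'b)"
  by (rule smooth_onI) (rule tdiff_inverse)
qed (use assms(3) in auto)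

lemma smooth_on_differentiable:
 "smooth_on S f ==> x \<in> S ==> (f has_derivative frechet_derivative f (at x)) (at x)"
 using smooth_onD[of S f 1] tdiff_SucD(1)[of 0 S f] by simp

lemma smooth_on_continuous: "smooth_on S f ==> continuous_on S f"
 by (rule tdiff_continuous[OF smooth_onD])

lemma smooth_on_derivative: "smooth_on S f ==> smooth_on S (%x. frechet_derivative f (at x) v)"
 by (rule smooth_onI, rule tdiff_SucD(2)) (simp only: smooth_on_def)

lemma smooth_on_vec_nth: "open S ==> smooth_on S f ==> smooth_on S (%x. (f x :: complex ^ 'n) $ i)"
 by (rule smooth_on_linear_compose) (auto intro: bounded_linear_vec_nth)

lemma bounded_bilinear_vector_smult: "bounded_bilinear (%(c::complex) (x::complex^'n). c *s x)"
proof (rule bounded_bilinear.intro)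
 have "norm (a *s b) \<le> norm a * norm b * real CARD('n)" for a and b :: "complex ^ 'n"
 proof -
  have "norm (a *s b) \<le> (\<Sum>i\<in>UNIV. norm ((a *s b) $ i))"
   unfolding norm_vec_def by (rule L2_set_le_sum) simp
  also have "\<dots> \<le> (\<Sum>i\<in>(UNIV::'n set). norm a * norm b)"
   by (intro sum_mono) (simp add: norm_mult mult_left_mono Finite_Cartesian_Product.norm_nth_le)
  finally show ?thesis by (simp add: mult.commute)
 qed
 then show "\<exists>K. \<forall>a b. norm (a *s b) \<le> norm a * norm (b :: complex ^ 'n) * K" by blast
qed (auto simp: vec_eq_iff algebra_simps)

lemma smooth_on_smult:
 "open S ==> smooth_on S c ==> smooth_on S f ==> smooth_on S (%x. c x *s (f x :: complex ^ 'n))"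
 by (rule smooth_on_bilinear[OF _ bounded_bilinear_vector_smult])

lemma smooth_on_scaleR:
 "open S ==> smooth_on S c ==> smooth_on S f ==> smooth_on S (%x. c x *\<^sub>R f x)"
 by (rule smooth_on_bilinear[OF _ bounded_bilinear_scaleR])

lemma smooth_on_vec_lambda:
 fixes f :: "'a::real_normed_vector => 'n::finite => complex"
 assumes "open S" "!!i. smooth_on S (%x. f x i)"
 shows "smooth_on S (%x. \<chi> i. f x i)"
proof -
 have "smooth_on S (%x. \<Sum>i\<in>UNIV. f x i *s (axis i 1 :: complex ^ 'n))"
  by (intro smooth_on_sum smooth_on_smult smooth_on_const assms)
 moreover have "(\<Sum>i\<in>UNIV. f x i *s (axis i 1 :: complex ^ 'n)) = (\<chi> i. f x i)" for x
  by (simp add: vec_eq_iff axis_def if_distrib cong: if_cong)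
 ultimately show ?thesis by simp
qed

lemma smooth_on_Pair:
 fixes f :: "'a::real_normed_vector => 'b::euclidean_space" and g :: "'a => 'c::euclidean_space"
 assumes "open S" "smooth_on S f" "smooth_on S g"
 shows "smooth_on S (%x. (f x, g x))"
proof -
 have "smooth_on S (%x. (f x, 0 :: 'c) + (0 :: 'b, g x))"
  by (intro smooth_on_add[OF assms(1)] smooth_on_linear_compose[OF assms(1) _ assms(2)]
    smooth_on_linear_compose[OF assms(1) _ assms(3)] bounded_linear_Pair bounded_linear_ident bounded_linear_zero)
 then show ?thesis by simp
qed

text \<open>Integrate before differentiating: D_u f(x + t v) - D_u f(x) is the integral over [0, t]
  of D_u D_v f(x + s v), obtained by differentiating the fundamental theorem along v under the
  integral sign. The derivatives of both sides at t = 0 are the two mixed derivatives.\<close>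

lemma second_derivative_symmetric:
 fixes f :: "'a::euclidean_space => 'b::euclidean_space"
 assumes "open S" "smooth_on S f" "x \<in> S"
 shows "frechet_derivative (%x. frechet_derivative f (at x) u) (at x) v =
  frechet_derivative (%x. frechet_derivative f (at x) v) (at x) u"
proof -
 let ?D = "%v f x. frechet_derivative f (at x) v"
 obtain r where r: "r > 0" "ball x r \<subseteq> S"
  using assms openE by blast
 \<comment> \<open>Small enough for all x + s u + t v with |s|, |t| at most \<open>e\<close> to stay
   in the ball; the summand 1 covers u = v = 0.\<close>
 define e where "e = r / (norm u + norm v + 1)"
 have "norm u + norm v + 1 > 0"
  using norm_ge_zero[of u] norm_ge_zero[of v] by linarith
 then have e: "e > 0" "e * (norm u + norm v + 1) = r"
  using r by (auto simp: e_def)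
 have inS: "x + s *\<^sub>R u + t *\<^sub>R v \<in> S" if "\<bar>s\<bar> \<le> e" "\<bar>t\<bar> \<le> e" for s t
 proof -
  have "norm (s *\<^sub>R u + t *\<^sub>R v) \<le> e * norm u + e * norm v"
   by (rule norm_triangle_le) (use that in \<open>auto intro!: add_mono mult_right_mono\<close>)
  also have "\<dots> < r" using e by (simp add: algebra_simps)
  finally have "dist x (x + s *\<^sub>R u + t *\<^sub>R v) < r"
   by (simp add: dist_norm algebra_simps norm_minus_commute)
  then show ?thesis using r by (auto simp: mem_ball)
 qed
 have cont: "continuous_on ({-e..e} \<times> {-e..e}) (%(s, t). ?D u (?D v f) (x + s *\<^sub>R u + t *\<^sub>R v))"
  unfolding split_def
  by (rule continuous_on_compose2[OF smooth_on_continuous[OF smooth_on_derivative[OF smooth_on_derivative[OF assms(2), of v], of u]]])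
   (auto intro!: continuous_intros inS)
 have der: "((%t. h (p + t *\<^sub>R w)) has_vector_derivative ?D w h (p + t *\<^sub>R w)) (at t within T)"
  if "smooth_on S h" "p + t *\<^sub>R w \<in> S" for p t w T and h :: "'a => 'b"
 proof -
  have "((%t. h (p + t *\<^sub>R w)) has_derivative (%s. ?D (s *\<^sub>R w) h (p + t *\<^sub>R w))) (at t within T)"
   by (rule has_derivative_compose[OF _ smooth_on_differentiable[OF that(1)]])
    (auto intro!: derivative_eq_intros that)
  then show ?thesis
   unfolding has_vector_derivative_def
   by (simp add: linear_scale[OF has_derivative_linear[OF smooth_on_differentiable[OF that]]])
 qed
 have ftc: "integral {0..t} (%\<tau>. ?D v f (x + s *\<^sub>R u + \<tau> *\<^sub>R v)) = f (x + s *\<^sub>R u + t *\<^sub>R v) - f (x + s *\<^sub>R u)"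
  if "\<bar>s\<bar> \<le> e" "0 \<le> t" "t \<le> e" for s t
  using integral_unique[OF fundamental_theorem_of_calculus[of 0 t "%\<tau>. f (x + s *\<^sub>R u + \<tau> *\<^sub>R v)"]]
   der[OF assms(2)] inS that by auto
 have A: "?D u f (x + t *\<^sub>R v) - ?D u f x = integral {0..t} (%\<tau>. ?D u (?D v f) (x + \<tau> *\<^sub>R v))"
  if t: "0 \<le> t" "t \<le> e" for t
 proof -
  have "((%s. integral (cbox 0 t) (%\<tau>. ?D v f (x + s *\<^sub>R u + \<tau> *\<^sub>R v))) has_vector_derivative
    integral (cbox 0 t) (%\<tau>. ?D u (?D v f) (x + 0 *\<^sub>R u + \<tau> *\<^sub>R v))) (at 0 within {-e..e})"
  proof (rule leibniz_rule_vector_derivative)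
   show "((%s. ?D v f (x + s *\<^sub>R u + \<tau> *\<^sub>R v)) has_vector_derivative ?D u (?D v f) (x + s *\<^sub>R u + \<tau> *\<^sub>R v)) (at s within {-e..e})"
    if "s \<in> {-e..e}" "\<tau> \<in> cbox 0 t" for s \<tau>
    using der[OF smooth_on_derivative[OF assms(2)], of "x + \<tau> *\<^sub>R v" s u v] inS[of s \<tau>] that t
    by (auto simp: algebra_simps)
   show "(%\<tau>. ?D v f (x + s *\<^sub>R u + \<tau> *\<^sub>R v)) integrable_on cbox 0 t" if "s \<in> {-e..e}" for s
    by (rule integrable_continuous, rule continuous_on_compose2[OF smooth_on_continuous[OF smooth_on_derivative[OF assms(2), of v]]])
     (use inS that t in \<open>auto intro!: continuous_intros\<close>)
   show "continuous_on ({-e..e} \<times> cbox 0 t) (%(s, \<tau>). ?D u (?D v f) (x + s *\<^sub>R u + \<tau> *\<^sub>R v))"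
    by (rule continuous_on_subset[OF cont]) (use t in auto)
  qed (use e in auto)
  moreover have "((%s. f (x + s *\<^sub>R u + t *\<^sub>R v) - f (x + s *\<^sub>R u)) has_vector_derivative
    ?D u f (x + t *\<^sub>R v) - ?D u f x) (at 0 within {-e..e})"
   using has_vector_derivative_diff[OF der[OF assms(2), of "x + t *\<^sub>R v" 0 u] der[OF assms(2), of x 0 u], of "{-e..e}"]
    inS[of 0 t] assms t by (simp add: algebra_simps)
  then have "((%s. integral (cbox 0 t) (%\<tau>. ?D v f (x + s *\<^sub>R u + \<tau> *\<^sub>R v))) has_vector_derivative
    ?D u f (x + t *\<^sub>R v) - ?D u f x) (at 0 within {-e..e})"
   by (rule has_vector_derivative_transform[rotated 2]) (use e ftc t in auto)
  ultimately show ?thesis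
   using vector_derivative_unique_within_closed_interval[of "-e" e 0] e by simp
 qed
 have c1: "continuous_on {0..e} (%\<tau>. ?D u (?D v f) (x + \<tau> *\<^sub>R v))"
  by (rule continuous_on_compose2[OF smooth_on_continuous[OF smooth_on_derivative[OF smooth_on_derivative[OF assms(2), of v], of u]]])
   (use inS[of 0] e in \<open>auto intro!: continuous_intros\<close>)
 have "((%t. integral {0..t} (%\<tau>. ?D u (?D v f) (x + \<tau> *\<^sub>R v))) has_vector_derivative ?D u (?D v f) (x + 0 *\<^sub>R v)) (at 0 within {0..e})"
  by (rule integral_has_vector_derivative[OF c1]) (use e in auto)
 then have "((%t. ?D u f (x + t *\<^sub>R v) - ?D u f x) has_vector_derivative ?D u (?D v f) x) (at 0 within {0..e})"
  using A e by (auto intro: has_vector_derivative_transform)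
 moreover have "((%t. ?D u f (x + t *\<^sub>R v) - ?D u f x) has_vector_derivative ?D v (?D u f) x) (at 0 within {0..e})"
  using has_vector_derivative_diff[OF der[OF smooth_on_derivative[OF assms(2)], of x 0 v u] has_vector_derivative_const]
   assms by auto
 ultimately show ?thesis
  using vector_derivative_unique_within_closed_interval[of 0 e 0] e by simp
qed

section \<open>Bump functions\<close>

text \<open>The family exp(-1/x) / x^k is closed under differentiation up to linear combinations, so
  smoothness at the origin becomes an induction for all k at once.\<close>

definition flat :: "nat => real => real" where
 "flat k x = (if 0 < x then exp (- inverse x) * inverse x ^ k else 0)"

lemma flat_tendsto_0: "((%x. exp (- inverse x) * inverse x ^ k :: real) \<longlongrightarrow> 0) (at_right 0)"
proof -
 have "((%y. y ^ k / exp y :: real) \<longlongrightarrow> 0) at_top"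
  by (rule tendsto_power_div_exp_0)
 then have "((%x. inverse x ^ k / exp (inverse x) :: real) \<longlongrightarrow> 0) (at_right 0)"
  by (rule filterlim_compose[OF _ filterlim_inverse_at_top_right])
 then show ?thesis by (simp add: exp_minus divide_inverse mult.commute)
qed

lemma flat_has_derivative:
 "(flat k has_real_derivative flat (k + 2) x - real k * flat (k + 1) x) (at x)"
proof (cases "x = 0")
 case True
 \<comment> \<open>The right difference quotient is \<open>flat (Suc k)\<close>; on the left
   everything is 0.\<close>
 have "((%h. flat k h / h) \<longlongrightarrow> 0) (at_right 0)"
  by (rule Lim_transform_eventually[OF flat_tendsto_0[of "Suc k"]])
   (auto simp: eventually_at_filter flat_def divide_inverse)
 moreover have "((%h. flat k h / h) \<longlongrightarrow> 0) (at_left 0)"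
  by (rule Lim_transform_eventually[OF tendsto_const]) (auto simp: eventually_at_filter flat_def)
 ultimately have "((%h. flat k h / h) \<longlongrightarrow> 0) (at 0)"
  by (simp add: filterlim_split_at)
 then show ?thesis using True by (simp add: DERIV_def flat_def)
next
 case False
 show ?thesis
 proof (cases "x > 0")
  case True
  have "((%x. exp (- inverse x) * inverse x ^ k) has_real_derivative
    flat (k + 2) x - real k * flat (k + 1) x) (at x)"
  proof -
   have "(inverse has_real_derivative - (inverse x * inverse x)) (at x)"
    using True DERIV_inverse[of x] by (simp add: power2_eq_square)
   then have "((%x. exp (- inverse x) * inverse x ^ k) has_real_derivative
    exp (- inverse x) * (inverse x * inverse x) * inverse x ^ k +
    real k * inverse x ^ (k - 1) * (- (inverse x * inverse x)) * exp (- inverse x)) (at x)"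
    using True by (auto intro!: derivative_eq_intros simp: power2_eq_square)
   also have "exp (- inverse x) * (inverse x * inverse x) * inverse x ^ k +
    real k * inverse x ^ (k - 1) * (- (inverse x * inverse x)) * exp (- inverse x) =
    flat (k + 2) x - real k * flat (k + 1) x"
    using True by (cases k) (simp_all add: flat_def algebra_simps del: inverse_eq_divide)
   finally show ?thesis .
  qed
  then show ?thesis
   by (rule has_field_derivative_transform_within_open[of _ _ _ "{0<..}"]) (use True in \<open>auto simp: flat_def\<close>)
 next
  case neg: False
  have "((%x. 0) has_real_derivative flat (k + 2) x - real k * flat (k + 1) x) (at x)"
   using neg by (auto simp: flat_def)
  then show ?thesis
   by (rule has_field_derivative_transform_within_open[of _ _ _ "{..<0}"]) (use neg False in \<open>auto simp: flat_def\<close>)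
 qed
qed

lemma smooth_on_flat: "smooth_on UNIV (flat k)"
proof (rule smooth_onI)
 show "times_differentiable_on n UNIV (flat k)" for n
 proof (induction n arbitrary: k)
  case 0
  then show ?case
   using flat_has_derivative by (auto intro!: DERIV_continuous_on)
 next
  case (Suc n)
  have c: "times_differentiable_on n UNIV (%x. c * flat k x)" for c k
   by (rule tdiff_bilinear[OF open_UNIV bounded_bilinear_mult
      tdiff_const[OF open_UNIV] Suc])
  have "times_differentiable_on n UNIV (%x. v * flat (k + 2) x + (- v * real k) * flat (k + 1) x)" for v
   by (rule tdiff_add[OF open_UNIV c c])
  moreover have "(flat k has_derivative (%v. v * flat (k + 2) x + (- v * real k) * flat (k + 1) x)) (at x)" for x
   using flat_has_derivative[of k x] unfolding has_field_derivative_def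
   by (rule has_derivative_eq_rhs) (simp add: fun_eq_iff algebra_simps)
  ultimately show ?case
   by (intro tdiff_Suc_I[OF open_UNIV])
 qed
qed

definition bump :: "'a::euclidean_space => real => 'a => real" where
 "bump p r x = flat 0 (r\<^sup>2 - (x - p) \<bullet> (x - p))"

lemma bump_pos: "x \<in> ball p r ==> bump p r x > 0"
 by (auto simp: bump_def flat_def dot_square_norm dist_norm norm_minus_commute intro!: power_strict_mono)

lemma bump_nonneg: "bump p r x \<ge> 0"
 by (simp add: bump_def flat_def)

lemma bump_eq_0: "r \<ge> 0 ==> x \<notin> ball p r ==> bump p r x = 0"
 by (auto simp: bump_def flat_def dot_square_norm dist_norm norm_minus_commute not_less intro!: power_mono)

lemma smooth_on_bump: "smooth_on UNIV (bump p r :: 'a::euclidean_space => real)"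
proof -
 have d: "smooth_on UNIV (%x::'a. x - p)"
  by (rule smooth_on_diff[OF open_UNIV smooth_on_linear[OF open_UNIV bounded_linear_ident] smooth_on_const[OF open_UNIV]])
 have "smooth_on UNIV (%x::'a. r\<^sup>2 - (x - p) \<bullet> (x - p))"
  by (rule smooth_on_diff[OF open_UNIV smooth_on_const[OF open_UNIV]
     smooth_on_bilinear[OF open_UNIV bounded_bilinear_inner d d]])
 from smooth_on_compose[OF open_UNIV open_UNIV this smooth_on_flat[of 0]] show ?thesis
  unfolding bump_def by simp
qed

text \<open>Smoothness is local: on V this is a product of smooth functions, on the complement of
  the closed ball it is 0, and these two open sets cover the space.\<close>

lemma smooth_on_bump_scaleR:
 fixes f :: "'a::euclidean_space => 'b::real_normed_vector"
 assumes "open V" "smooth_on V f" "cball p r \<subseteq> V" "r > 0"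
 shows "smooth_on UNIV (%x. bump p r x *\<^sub>R f x)"
proof -
 have "smooth_on V (%x. bump p r x *\<^sub>R f x)"
  by (rule smooth_on_scaleR[OF assms(1) smooth_on_subset[OF smooth_on_bump] assms(2)]) auto
 moreover have "smooth_on (- cball p r) (%x. bump p r x *\<^sub>R f x)"
  by (subst smooth_on_cong[of _ _ "%x. 0"])
   (use assms(4) bump_eq_0[of r _ p] in \<open>auto intro: smooth_on_const\<close>)
 moreover have "V \<union> - cball p r = UNIV" using assms(3) by auto
 ultimately show ?thesis
  using smooth_on_Un[of V "- cball p r"] assms(1) by auto
qed

section \<open>The fundamental theorem of calculus on the unit cube\<close>

definition upd :: "'a::euclidean_space => real => 'a => 'a" where
 "upd b s x = x + (s - x \<bullet> b) *\<^sub>R b"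

abbreviation ucube :: "'a::euclidean_space set" where
 "ucube \<equiv> cbox 0 One"

lemma upd_inner: "b \<in> Basis ==> j \<in> Basis ==> upd b s x \<bullet> j = (if j = b then s else x \<bullet> j)"
 by (auto simp: upd_def inner_simps inner_not_same_Basis)

lemma upd_in_ucube: "b \<in> Basis ==> x \<in> ucube ==> 0 \<le> s ==> s \<le> 1 ==> upd b s x \<in> ucube"
 by (auto simp: mem_box upd_inner)

lemma One_Pair: "(One :: 'a::euclidean_space \<times> 'b::euclidean_space) = (One, One)"
proof (rule euclidean_eqI)
 have One: "One \<bullet> i = 1" if "i \<in> Basis" for i :: "'c::euclidean_space"
  using inner_sum_left_Basis[OF that, of "%_. 1"] by simp
 fix i :: "'a \<times> 'b" assume "i \<in> Basis"
 then show "One \<bullet> i = (One, One) \<bullet> i"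
  by (subst One) (auto simp: Basis_prod_def One)
qed

lemma ucube_Pair: "(ucube :: ('a::euclidean_space \<times> 'b::euclidean_space) set) = ucube \<times> ucube"
 by (simp add: One_Pair cbox_Pair_eq zero_prod_def)

text \<open>Fubini in one coordinate direction: averaging over an extra copy of the coordinate b
  changes nothing. As a property of a basis vector it passes from a factor to a product, so the
  fundamental theorem below is available on every nested product of intervals without reordering
  coordinates.\<close>

definition averaging :: "'a::euclidean_space => bool" where
 "averaging b \<longleftrightarrow> b \<in> Basis & (\<forall>g :: 'a => complex. continuous_on ucube g -->
   integral {0..1} (%s. integral ucube (%x. g (upd b s x))) = integral ucube g)"

lemma averaging_real: "averaging (1 :: real)"
 by (simp add: averaging_def upd_def)

lemma integral_ucube_Pair:
 fixes g :: "'a::euclidean_space \<times> 'b::euclidean_space => complex"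
 assumes "continuous_on ucube g"
 shows "integral ucube g = integral ucube (%x. integral ucube (%y. g (x, y)))"
 using integral_prod_continuous[of 0 0 "One::'a" "One::'b" g] assms
 by (simp add: One_Pair zero_prod_def)

lemma upd_Pair: "upd (b, 0) s (x, y) = (upd b s x, y)"
 by (simp add: upd_def)

lemma upd_Pair': "upd (0, b) s (x, y) = (x, upd b s y)"
 by (simp add: upd_def)

lemma continuous_on_upd: "continuous_on S f ==> continuous_on S g ==> continuous_on S (%x. upd b (f x) (g x))"
 unfolding upd_def by (intro continuous_intros)

lemma averaging_fst:
 assumes "averaging (b :: 'a::euclidean_space)"
 shows "averaging (b, 0 :: 'b::euclidean_space)"
 unfolding averaging_def
proof (intro conjI allI impI)
 show "(b, 0) \<in> Basis" using assms by (auto simp: averaging_def Basis_prod_def)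
 fix g :: "'a \<times> 'b => complex" assume g: "continuous_on ucube g"
 have b: "b \<in> Basis" using assms by (simp add: averaging_def)
 have G: "continuous_on ucube (%x. integral ucube (%y. g (x, y)))"
  using integral_continuous_on_param[of ucube "0::'b" One "%x y. g (x, y)"] g by (simp add: ucube_Pair)
 have "integral ucube (%x. g (upd (b, 0) s x)) = integral ucube (%x. integral ucube (%y. g (upd b s x, y)))"
  if "s \<in> {0..1}" for s
 proof -
  have "continuous_on ucube (%x. g (upd (b, 0) s x))"
   by (rule continuous_on_compose2[OF g])
    (use that b upd_in_ucube in \<open>auto simp: ucube_Pair upd_Pair intro!: continuous_on_upd continuous_intros\<close>)
  from integral_ucube_Pair[OF this] show ?thesis by (simp add: upd_Pair)
 qed
 then have "integral {0..1} (%s. integral ucube (%x. g (upd (b, 0) s x))) =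
   integral {0..1} (%s. integral ucube (%x. integral ucube (%y. g (upd b s x, y))))"
  by (intro integral_cong) auto
 also have "\<dots> = integral ucube (%x. integral ucube (%y. g (x, y)))"
  using assms G by (auto simp: averaging_def)
 finally show "integral {0..1} (%s. integral ucube (%x. g (upd (b, 0) s x))) = integral ucube g"
  using integral_ucube_Pair[OF g] by simp
qed

lemma averaging_snd:
 assumes "averaging (b :: 'b::euclidean_space)"
 shows "averaging (0 :: 'a::euclidean_space, b)"
 unfolding averaging_def
proof (intro conjI allI impI)
 show "(0, b) \<in> Basis" using assms by (auto simp: averaging_def Basis_prod_def)
 fix g :: "'a \<times> 'b => complex" assume g: "continuous_on ucube g"
 have b: "b \<in> Basis" using assms by (simp add: averaging_def)
 have "integral ucube (%x. g (upd (0, b) s x)) = integral ucube (%x. integral ucube (%y. g (x, upd b s y)))"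
  if "s \<in> {0..1}" for s
 proof -
  have "continuous_on ucube (%x. g (upd (0, b) s x))"
   by (rule continuous_on_compose2[OF g])
    (use that b upd_in_ucube in \<open>auto simp: ucube_Pair upd_Pair' intro!: continuous_on_upd continuous_intros\<close>)
  from integral_ucube_Pair[OF this] show ?thesis by (simp add: upd_Pair')
 qed
 then have "integral {0..1} (%s. integral ucube (%x. g (upd (0, b) s x))) =
   integral (cbox 0 1) (%s. integral ucube (%x. integral ucube (%y. g (x, upd b s y))))"
  by (simp add: cbox_interval) (intro integral_cong, auto)
 also have "\<dots> = integral ucube (%x. integral (cbox 0 1) (%s. integral ucube (%y. g (x, upd b s y))))"
 proof (rule integral_swap_continuous)
  have "continuous_on (({0..1} \<times> ucube) \<times> ucube) (%((s, x), y). g (x, upd b s y))"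
   unfolding split_def
   by (rule continuous_on_compose2[OF g])
    (use b upd_in_ucube in \<open>auto simp: ucube_Pair intro!: continuous_on_upd continuous_intros\<close>)
  from integral_continuous_on_param[of "{0..1} \<times> ucube" 0 One "%(s, x) y. g (x, upd b s y)"] this
  show "continuous_on (cbox (0, 0) (1, One)) (%(s, x). integral ucube (%y. g (x, upd b s y)))"
   by (simp add: cbox_Pair_eq split_def)
 qed
 also have "\<dots> = integral ucube (%x. integral ucube (%y. g (x, y)))"
 proof (rule integral_cong)
  fix x :: 'a assume "x \<in> ucube"
  then have "continuous_on ucube (%y. g (x, y))"
   by (intro continuous_on_compose2[OF g]) (auto simp: ucube_Pair intro!: continuous_intros)
  then show "integral (cbox 0 1) (%s. integral ucube (%y. g (x, upd b s y))) = integral ucube (%y. g (x, y))"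
   using assms by (auto simp: averaging_def cbox_interval)
 qed
 finally show "integral {0..1} (%s. integral ucube (%x. g (upd (0, b) s x))) = integral ucube g"
  using integral_ucube_Pair[OF g] by simp
qed

text \<open>The extra integration over s provided by \<open>averaging\<close> is moved inside, where
  for each x the ordinary fundamental theorem applies to s.\<close>

lemma ucube_FTC:
 fixes F :: "'a::euclidean_space => complex"
 assumes "averaging b" "times_differentiable_on 1 S F" "ucube \<subseteq> S"
 shows "integral ucube (%x. frechet_derivative F (at x) b) =
  integral ucube (%x. F (upd b 1 x) - F (upd b 0 x))"
proof -
 have b: "b \<in> Basis" using assms by (simp add: averaging_def)
 have der: "(F has_derivative frechet_derivative F (at x)) (at x)" if "x \<in> ucube" for x
  using tdiff_SucD(1)[of 0 S F] assms that by auto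
 have cont: "continuous_on ucube (%x. frechet_derivative F (at x) b)"
  using tdiff_SucD(2)[of 0 S F b] assms by (auto intro: continuous_on_subset)
 have "integral ucube (%x. frechet_derivative F (at x) b) =
   integral (cbox 0 1) (%s. integral ucube (%x. frechet_derivative F (at (upd b s x)) b))"
  using assms(1)[unfolded averaging_def, THEN conjunct2, rule_format, OF cont] by simp
 also have "\<dots> = integral ucube (%x. integral (cbox 0 1) (%s. frechet_derivative F (at (upd b s x)) b))"
 proof (rule integral_swap_continuous)
  show "continuous_on (cbox (0, 0) (1, One)) (%(s, x). frechet_derivative F (at (upd b s x)) b)"
   unfolding split_def
   by (rule continuous_on_compose2[OF cont])
    (use b upd_in_ucube in \<open>auto simp: cbox_Pair_eq intro!: continuous_on_upd continuous_intros\<close>)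
 qed
 also have "\<dots> = integral ucube (%x. F (upd b 1 x) - F (upd b 0 x))"
 proof (rule integral_cong)
  fix x :: 'a assume x: "x \<in> ucube"
  have "((%s. F (upd b s x)) has_vector_derivative frechet_derivative F (at (upd b s x)) b) (at s within {0..1})"
   if "s \<in> {0..1}" for s
  proof -
   have d: "(F has_derivative frechet_derivative F (at (upd b s x))) (at (upd b s x))"
    using der upd_in_ucube[OF b x] that by auto
   have u: "((%s. upd b s x) has_derivative (%h. h *\<^sub>R b)) (at s within {0..1})"
    unfolding upd_def by (auto intro!: derivative_eq_intros simp: algebra_simps)
   show ?thesis
    unfolding has_vector_derivative_def
    using has_derivative_compose[OF u d] linear_scale[OF has_derivative_linear[OF d]] by simp
  qed
  then have "((%s. frechet_derivative F (at (upd b s x)) b) has_integral F (upd b 1 x) - F (upd b 0 x)) {0..1}"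
   by (intro fundamental_theorem_of_calculus) auto
  then show "integral (cbox 0 1) (%s. frechet_derivative F (at (upd b s x)) b) = F (upd b 1 x) - F (upd b 0 x)"
   by (simp add: integral_unique cbox_interval)
 qed
 finally show ?thesis .
qed

section \<open>Closed forms in homogeneous coordinates\<close>

lemma four_eq_0: "(4 :: 4) = 0"
 by simp

lemma sum_4': "(\<Sum>i\<in>(UNIV :: 4 set). f i) = f 0 + f 1 + f 2 + f 3"
 for f :: "4 => 'a::comm_monoid_add"
 unfolding sum_4 four_eq_0 by (simp add: ac_simps)

lemma prod_4': "(\<Prod>i\<in>(UNIV :: 4 set). f i) = f 0 * f 1 * f 2 * f 3"
 for f :: "4 => 'a::comm_monoid_mult"
proof -
 have U: "(UNIV :: 4 set) = {0, 1, 2, 3}"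
  using UNIV_4 by (auto simp: four_eq_0)
 show ?thesis unfolding U by (simp add: ac_simps)
qed

lemma vec_eq_4: "x = y \<longleftrightarrow> x $ 0 = y $ 0 & x $ 1 = y $ 1 & x $ 2 = y $ 2 & x $ 3 = y $ 3"
 for x y :: "'a ^ 4"
 unfolding vec_eq_iff forall_4 four_eq_0 by auto

lemma Omega_swap:
 "Omega x v u w = - Omega x u v w" "Omega x u w v = - Omega x u v w" "Omega u x v w = - Omega x u v w"
 unfolding Omega_def wedge3_def by (simp_all add: algebra_simps)

lemma Omega_smult:
 "Omega (c *s x) u v w = c * Omega x u v w" "Omega x (c *s u) v w = c * Omega x u v w"
 "Omega x u (c *s v) w = c * Omega x u v w" "Omega x u v (c *s w) = c * Omega x u v w"
 unfolding Omega_def wedge3_def by (simp_all add: algebra_simps)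

lemma Omega_add:
 "Omega (x + y) u v w = Omega x u v w + Omega y u v w"
 "Omega x (u + y) v w = Omega x u v w + Omega x y v w"
 "Omega x u (v + y) w = Omega x u v w + Omega x u y w"
 "Omega x u v (w + y) = Omega x u v w + Omega x u v y"
 unfolding Omega_def wedge3_def by (simp_all add: algebra_simps)

lemma Omega_eq:
 "Omega x x v w = 0" "Omega x u x w = 0" "Omega x u v x = 0"
 "Omega x u u w = 0" "Omega x u v u = 0" "Omega x u v v = 0"
 unfolding Omega_def wedge3_def by (simp_all add: algebra_simps)

lemma Omega_zero:
 "Omega 0 u v w = 0" "Omega x 0 v w = 0" "Omega x u 0 w = 0" "Omega x u v 0 = 0"
 unfolding Omega_def wedge3_def by simp_all

text \<open>\<open>Omega\<close> is the determinant of its four arguments, so this is the linear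
  relation that Cramer's rule gives among five vectors of complex 4-space, evaluated under
  \<open>D\<close>.\<close>

lemma Omega_cramer:
 fixes D :: "complex ^ 4 => complex"
 assumes D: "!!v. D v = (\<Sum>i\<in>UNIV. d $ i * v $ i)"
 shows "D a * Omega b c e f - D b * Omega a c e f + D c * Omega a b e f
  - D e * Omega a b c f + D f * Omega a b c e = 0"
 unfolding D sum_4' Omega_def wedge3_def by Groebner_Basis.algebra

lemma has_derivative_vec_nth [derivative_intros]:
 "(f has_derivative f') F ==> ((%x. f x $ i) has_derivative (%h. f' h $ i)) F"
 by (rule bounded_linear.has_derivative[OF bounded_linear_vec_nth])

lemma has_derivative_Omega:
 fixes X A B C :: "'p::real_normed_vector => complex ^ 4"
 assumes "(X has_derivative X') (at p)" "(A has_derivative A') (at p)"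
  "(B has_derivative B') (at p)" "(C has_derivative C') (at p)"
 shows "((%p. Omega (X p) (A p) (B p) (C p)) has_derivative
  (%h. Omega (X' h) (A p) (B p) (C p) + Omega (X p) (A' h) (B p) (C p)
   + Omega (X p) (A p) (B' h) (C p) + Omega (X p) (A p) (B p) (C' h))) (at p)"
 unfolding Omega_def wedge3_def
 by (rule has_derivative_eq_rhs, (rule derivative_intros assms)+) (simp add: fun_eq_iff algebra_simps)

lemma smooth_on_Omega:
 fixes X A B C :: "'p::euclidean_space => complex ^ 4"
 assumes S: "open S" and "smooth_on S X" "smooth_on S A" "smooth_on S B" "smooth_on S C"
 shows "smooth_on S (%p. Omega (X p) (A p) (B p) (C p))"
 unfolding Omega_def wedge3_def
 by (intro smooth_on_add[OF S] smooth_on_diff[OF S] smooth_on_mult[OF S] smooth_on_vec_nth[OF S] assms)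

abbreviation pd :: "'a::real_normed_vector => ('a => 'b::real_normed_vector) => 'a => 'b" where
 "pd b f p \<equiv> frechet_derivative f (at p) b"

text \<open>This is d(g Omega) = 0 for g homogeneous of degree -4, pulled back along
  \<open>K\<close>. Second derivatives of \<open>K\<close> cancel by symmetry. The derivative of
  Omega is four times the volume form, and by \<open>Omega_cramer\<close> the terms with dg add up
  to D(K) = -4 g times it.\<close>

lemma closed_3_form_pullback:
 fixes K :: "'p::euclidean_space => complex ^ 4"
 assumes S: "open S" and K: "smooth_on S K" and p: "p \<in> S"
  and g: "(g has_derivative D) (at (K p))" and D: "!!v. D v = (\<Sum>i\<in>UNIV. d $ i * v $ i)"
  and euler: "D (K p) = - 4 * g (K p)"
 shows "pd b1 (%p. g (K p) * Omega (K p) (pd b2 K p) (pd b3 K p) (pd b4 K p)) p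
  - pd b2 (%p. g (K p) * Omega (K p) (pd b1 K p) (pd b3 K p) (pd b4 K p)) p
  + pd b3 (%p. g (K p) * Omega (K p) (pd b1 K p) (pd b2 K p) (pd b4 K p)) p
  - pd b4 (%p. g (K p) * Omega (K p) (pd b1 K p) (pd b2 K p) (pd b3 K p)) p = (0 :: complex)"
proof -
 have dK: "(K has_derivative (%b. pd b K p)) (at p)"
  using smooth_on_differentiable[OF K p] by simp
 have ddK: "((%p. pd b K p) has_derivative (%c. pd c (%p. pd b K p) p)) (at p)" for b
  using smooth_on_differentiable[OF smooth_on_derivative[OF K] p] by simp
 have sym: "pd c (%p. pd b K p) p = pd b (%p. pd c K p) p" for b c
  by (rule second_derivative_symmetric[OF S K p])
 let ?K = "K p" let ?k = "%b. pd b K p" let ?kk = "%c b. pd c (%p. pd b K p) p"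
 have der: "pd h (%p. g (K p) * Omega (K p) (pd a K p) (pd b K p) (pd c K p)) p =
   g ?K * (Omega (?k h) (?k a) (?k b) (?k c) + Omega ?K (?kk h a) (?k b) (?k c)
    + Omega ?K (?k a) (?kk h b) (?k c) + Omega ?K (?k a) (?k b) (?kk h c))
   + D (?k h) * Omega ?K (?k a) (?k b) (?k c)" for h a b c
 proof -
  have "((%p. g (K p) * Omega (K p) (pd a K p) (pd b K p) (pd c K p)) has_derivative
   (%h. g ?K * (Omega (?k h) (?k a) (?k b) (?k c) + Omega ?K (?kk h a) (?k b) (?k c)
    + Omega ?K (?k a) (?kk h b) (?k c) + Omega ?K (?k a) (?k b) (?kk h c))
   + D (?k h) * Omega ?K (?k a) (?k b) (?k c))) (at p)"
   by (rule has_derivative_mult[OF has_derivative_compose[OF dK g] has_derivative_Omega[OF dK ddK ddK ddK]])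
  from frechet_derivative_at[OF this, symmetric]
  show ?thesis by (simp only:)
 qed
 have cr: "D ?K * Omega (?k b1) (?k b2) (?k b3) (?k b4) - D (?k b1) * Omega ?K (?k b2) (?k b3) (?k b4)
  + D (?k b2) * Omega ?K (?k b1) (?k b3) (?k b4) - D (?k b3) * Omega ?K (?k b1) (?k b2) (?k b4)
  + D (?k b4) * Omega ?K (?k b1) (?k b2) (?k b3) = 0"
  by (rule Omega_cramer[OF D])
 have s1: "Omega (?k b2) (?k b1) (?k b3) (?k b4) = - Omega (?k b1) (?k b2) (?k b3) (?k b4)"
  "Omega (?k b3) (?k b1) (?k b2) (?k b4) = Omega (?k b1) (?k b2) (?k b3) (?k b4)"
  "Omega (?k b4) (?k b1) (?k b2) (?k b3) = - Omega (?k b1) (?k b2) (?k b3) (?k b4)"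
  using Omega_swap by metis+
 have s2: "Omega ?K (?k b2) (?kk b1 b3) (?k b4) = - Omega ?K (?kk b1 b3) (?k b2) (?k b4)"
   "Omega ?K (?k b2) (?k b3) (?kk b1 b4) = Omega ?K (?kk b1 b4) (?k b2) (?k b3)"
   "Omega ?K (?k b1) (?kk b2 b3) (?k b4) = - Omega ?K (?kk b2 b3) (?k b1) (?k b4)"
   "Omega ?K (?k b1) (?k b3) (?kk b2 b4) = Omega ?K (?kk b2 b4) (?k b1) (?k b3)"
   "Omega ?K (?k b1) (?kk b3 b2) (?k b4) = - Omega ?K (?kk b3 b2) (?k b1) (?k b4)"
   "Omega ?K (?k b1) (?k b2) (?kk b3 b4) = Omega ?K (?kk b3 b4) (?k b1) (?k b2)"
   "Omega ?K (?k b1) (?kk b4 b2) (?k b3) = - Omega ?K (?kk b4 b2) (?k b1) (?k b3)"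
   "Omega ?K (?k b1) (?k b2) (?kk b4 b3) = Omega ?K (?kk b4 b3) (?k b1) (?k b2)"
  using Omega_swap by metis+
 note sy = sym[of b2 b1] sym[of b3 b1] sym[of b4 b1] sym[of b3 b2] sym[of b4 b2] sym[of b4 b3]
 show ?thesis
  unfolding der unfolding sy unfolding s1 s2[unfolded sy] using cr unfolding euler by (simp add: algebra_simps)
qed

text \<open>The potential is g Omega contracted with the constant vector v. Only three columns move,
  which the Euler term of degree -3 balances, and the derivative of g along v remains. This is the
  source of pole order reduction.\<close>

lemma exact_2_form_pullback:
 fixes K :: "'p::euclidean_space => complex ^ 4"
 assumes S: "open S" and K: "smooth_on S K" and p: "p \<in> S"
  and g: "(g has_derivative D) (at (K p))" and D: "!!v. D v = (\<Sum>i\<in>UNIV. d $ i * v $ i)"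
  and euler: "D (K p) = - 3 * g (K p)"
 shows "pd b1 (%p. g (K p) * Omega (K p) v (pd b2 K p) (pd b3 K p)) p
  - pd b2 (%p. g (K p) * Omega (K p) v (pd b1 K p) (pd b3 K p)) p
  + pd b3 (%p. g (K p) * Omega (K p) v (pd b1 K p) (pd b2 K p)) p
  = (D v * Omega (K p) (pd b1 K p) (pd b2 K p) (pd b3 K p) :: complex)"
proof -
 have dK: "(K has_derivative (%b. pd b K p)) (at p)"
  using smooth_on_differentiable[OF K p] by simp
 have ddK: "((%p. pd b K p) has_derivative (%c. pd c (%p. pd b K p) p)) (at p)" for b
  using smooth_on_differentiable[OF smooth_on_derivative[OF K] p] by simp
 have sym: "pd c (%p. pd b K p) p = pd b (%p. pd c K p) p" for b c
  by (rule second_derivative_symmetric[OF S K p])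
 let ?K = "K p" let ?k = "%b. pd b K p" let ?kk = "%c b. pd c (%p. pd b K p) p"
 have der: "pd h (%p. g (K p) * Omega (K p) v (pd b K p) (pd c K p)) p =
   g ?K * (Omega (?k h) v (?k b) (?k c) + Omega ?K 0 (?k b) (?k c)
    + Omega ?K v (?kk h b) (?k c) + Omega ?K v (?k b) (?kk h c))
   + D (?k h) * Omega ?K v (?k b) (?k c)" for h b c
 proof -
  have "((%p. g (K p) * Omega (K p) v (pd b K p) (pd c K p)) has_derivative
   (%h. g ?K * (Omega (?k h) v (?k b) (?k c) + Omega ?K 0 (?k b) (?k c)
    + Omega ?K v (?kk h b) (?k c) + Omega ?K v (?k b) (?kk h c))
   + D (?k h) * Omega ?K v (?k b) (?k c))) (at p)"
   by (rule has_derivative_mult[OF has_derivative_compose[OF dK g] has_derivative_Omega[OF dK has_derivative_const ddK ddK]])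
  from frechet_derivative_at[OF this, symmetric]
  show ?thesis by (simp only:)
 qed
 have cr: "D ?K * Omega v (?k b1) (?k b2) (?k b3) - D v * Omega ?K (?k b1) (?k b2) (?k b3)
  + D (?k b1) * Omega ?K v (?k b2) (?k b3) - D (?k b2) * Omega ?K v (?k b1) (?k b3)
  + D (?k b3) * Omega ?K v (?k b1) (?k b2) = 0"
  by (rule Omega_cramer[OF D])
 have s1: "Omega (?k b1) v (?k b2) (?k b3) = - Omega v (?k b1) (?k b2) (?k b3)"
  "Omega (?k b2) v (?k b1) (?k b3) = Omega v (?k b1) (?k b2) (?k b3)"
  "Omega (?k b3) v (?k b1) (?k b2) = - Omega v (?k b1) (?k b2) (?k b3)"
  using Omega_swap by metis+
 have s2: "Omega ?K v (?k b2) (?kk b1 b3) = - Omega ?K v (?kk b1 b3) (?k b2)"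
   "Omega ?K v (?k b1) (?kk b2 b3) = - Omega ?K v (?kk b2 b3) (?k b1)"
   "Omega ?K v (?k b1) (?kk b3 b2) = - Omega ?K v (?kk b3 b2) (?k b1)"
  using Omega_swap by metis+
 note sy = sym[of b2 b1] sym[of b3 b1] sym[of b3 b2]
 show ?thesis
  unfolding der unfolding sy unfolding s1 s2[unfolded sy] Omega_zero using cr unfolding euler by (simp add: algebra_simps)
qed

section \<open>Tubes\<close>

text \<open>Along the Fermat octic \<open>df\<close> takes the value \<open>8 \<Sum>\<^sub>i \<bar>x\<^sub>i\<bar>\<^sup>1\<^sup>4 / \<bar>x\<bar>\<^sup>6 > 0\<close> on this vector. Scaling \<open>x\<close> by \<open>c\<close>
 multiplies it by \<open>c\<close> times a number of modulus one, so the circle bundle does not depend on the lift.\<close>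

definition normal :: "complex ^ 4 => complex ^ 4" where
 "normal x = (\<chi> i. of_real (inverse (norm x ^ 6)) * cnj (x $ i) ^ 7)"

definition circ :: "real => real => complex" where
 "circ eps th = of_real eps * cis (2 * pi * th)"

lemma norm_smult: "norm (c *s x) = norm c * norm (x :: complex ^ 'n)"
 by (simp add: norm_vec_def norm_mult L2_set_right_distrib)

lemma normal_smult:
 "normal (c *s x) = (of_real (inverse (norm c ^ 6)) * cnj c ^ 7) *s normal x"
 by (simp add: normal_def norm_smult vec_eq_iff power_mult_distrib)

lemma smooth_on_normal: "smooth_on (- {0}) normal"
proof -
 have op: "open (- {0 :: complex ^ 4})" by auto
 have "norm x ^ 6 = (x \<bullet> x) ^ 3" for x :: "complex ^ 4"
  by (simp add: dot_square_norm)
 moreover have i: "smooth_on (- {0}) (%x :: complex ^ 4. x)"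
  by (rule smooth_on_linear[OF op bounded_linear_ident])
 have "smooth_on (- {0}) (%x :: complex ^ 4. inverse ((x \<bullet> x) ^ 3))"
  by (intro smooth_on_inverse smooth_on_power smooth_on_bilinear[OF op bounded_bilinear_inner i i] op) auto
 ultimately have "smooth_on (- {0}) (%x :: complex ^ 4. inverse (norm x ^ 6))"
  by simp
 then have 1: "smooth_on (- {0}) (%x :: complex ^ 4. complex_of_real (inverse (norm x ^ 6)))"
  by (rule smooth_on_linear_compose[OF op bounded_linear_of_real])
 have 2: "smooth_on (- {0}) (%x :: complex ^ 4. cnj (x $ i) ^ 7)" for i
  by (intro smooth_on_power op smooth_on_linear_compose[OF op bounded_linear_cnj] smooth_on_vec_nth i)
 show ?thesis
  unfolding normal_def by (intro smooth_on_vec_lambda smooth_on_mult op 1 2)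
qed

lemma circ_has_vector_derivative: "(circ eps has_vector_derivative 2 * pi * \<i> * circ eps th) (at th)"
proof -
 have "((%th. of_real eps * exp (\<i> * of_real (2 * pi) * of_real th)) has_vector_derivative
   of_real eps * (exp (\<i> * of_real (2 * pi) * of_real th) * (\<i> * of_real (2 * pi)))) (at th)"
  by (rule has_vector_derivative_real_field) (auto intro!: derivative_eq_intros)
 then show ?thesis
  by (simp add: circ_def[abs_def] cis_conv_exp mult_ac)
qed

lemma smooth_on_circ: "smooth_on UNIV (circ eps)"
proof (rule smooth_onI)
 show "times_differentiable_on n UNIV (circ eps)" for n
 proof (induction n)
  case 0
  then show ?case
   by (auto simp: circ_def intro!: continuous_intros)
 next
  case (Suc n)
  have "times_differentiable_on n UNIV (%th. v *\<^sub>R (2 * pi * \<i> * circ eps th))" for v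
   by (rule tdiff_bilinear[OF open_UNIV bounded_bilinear_scaleR
    tdiff_const[OF open_UNIV]
    tdiff_bilinear[OF open_UNIV bounded_bilinear_mult tdiff_const[OF open_UNIV] Suc]])
  from tdiff_Suc_I[OF open_UNIV circ_has_vector_derivative[unfolded has_vector_derivative_def] this]
  show ?case .
 qed
qed

lemma circ_1: "circ eps 1 = circ eps 0"
 by (simp add: circ_def)

lemma norm_circ: "eps > 0 ==> norm (circ eps th) = eps"
 by (simp add: circ_def norm_mult)

text \<open>The density of the pullback of \<open>g \<Omega>\<close> under \<open>x + z n\<close>, with \<open>z\<close> running through a circle.\<close>

definition tint :: "(complex ^ 4 => complex) => complex => complex ^ 4 => complex ^ 4 => complex ^ 4 =>
  complex ^ 4 => complex ^ 4 => complex ^ 4 => complex" where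
 "tint g z x n u1 n1 u2 n2 = g (x + z *s n) *
   Omega (x + z *s n) (u1 + z *s n1) (u2 + z *s n2) ((2 * pi * \<i> * z) *s n)"

definition tden :: "(complex ^ 4 => complex) => real => ('e::real_normed_vector => complex ^ 4) => 'e => 'e => 'e => complex" where
 "tden g eps Y a b e = integral {0..1} (%th. tint g (circ eps th) (Y e) (normal (Y e))
   (pd a Y e) (pd a (%e. normal (Y e)) e) (pd b Y e) (pd b (%e. normal (Y e)) e))"

text \<open>The counterpart of \<open>tden\<close> for the contracted form: the constant vector v
  takes the first column, and its variation along the fibre is the entry 0.\<close>

definition eden :: "(complex ^ 4 => complex) => complex ^ 4 => real => ('e::real_normed_vector => complex ^ 4) => 'e => 'e => complex" where
 "eden h v eps Y a e = integral {0..1} (%th. tint h (circ eps th) (Y e) (normal (Y e))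
   v 0 (pd a Y e) (pd a (%e. normal (Y e)) e))"

definition tubular :: "(complex ^ 4) set => real => complex ^ 4 => bool" where
 "tubular D eps x \<longleftrightarrow> (\<forall>z. norm z = eps --> x + z *s normal x \<in> D)"

text \<open>Holomorphic and homogeneous of degree -k on an open cone. The derivative is recorded as
  a gradient because \<open>Omega_cramer\<close> works in coordinates.\<close>

definition graded :: "nat => (complex ^ 4) set => (complex ^ 4 => complex) => bool" where
 "graded k D g \<longleftrightarrow> open D & smooth_on D g &
   (\<forall>x\<in>D. \<exists>d. (g has_derivative (%v. \<Sum>i\<in>UNIV. d $ i * v $ i)) (at x)) &
   (\<forall>x\<in>D. \<forall>c. c ~= 0 --> c *s x \<in> D & c ^ k * g (c *s x) = g x)"

text \<open>Euler's identity, from differentiating g((1 + s) x) at s = 0 in two ways; real s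
  suffice.\<close>

lemma graded_euler:
 assumes g: "graded k D g" and x: "x \<in> D"
 obtains d where "(g has_derivative (%v. \<Sum>i\<in>UNIV. d $ i * v $ i)) (at x)"
  "(\<Sum>i\<in>UNIV. d $ i * x $ i) = - of_nat k * g x"
proof -
 obtain d where d: "(g has_derivative (%v. \<Sum>i\<in>UNIV. d $ i * v $ i)) (at x)"
  using g x by (auto simp: graded_def)
 have "((%s::real. (1 + s) *\<^sub>R x) has_derivative (%h. h *\<^sub>R x)) (at 0)"
  by (auto intro!: derivative_eq_intros)
 from has_derivative_compose[OF this, of g "%v. \<Sum>i\<in>UNIV. d $ i * v $ i"] d
 have a: "((%s. g ((1 + s) *\<^sub>R x)) has_derivative (%h. h *\<^sub>R (\<Sum>i\<in>UNIV. d $ i * x $ i))) (at 0)"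
  by (simp add: scaleR_sum_right)
 have b: "((%s::real. of_real (1 / (1 + s) ^ k) * g x) has_derivative (%h. h *\<^sub>R (- of_nat k * g x))) (at 0)"
 proof -
  have "((%s::real. 1 / (1 + s) ^ k) has_real_derivative - real k) (at 0)"
   by (cases k) (auto intro!: derivative_eq_intros)
  from has_derivative_mult_left[OF has_derivative_of_real[OF this[unfolded has_field_derivative_def]], of "g x"]
  show ?thesis
   by (rule has_derivative_eq_rhs) (simp add: fun_eq_iff scaleR_conv_of_real mult_ac)
 qed
 \<comment> \<open>The restriction to s > -1 keeps 1 + s nonzero and still leaves a neighbourhood of
   0.\<close>
 have eq: "of_real (1 / (1 + s) ^ k) * g x = g ((1 + s) *\<^sub>R x)" if "s \<in> {-1<..}" for s
 proof -
  define c where "c = complex_of_real (1 + s)"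
  have c: "c ~= 0" "(1 + s) *\<^sub>R x = c *s x" "of_real (1 / (1 + s) ^ k) = 1 / c ^ k"
   unfolding c_def of_real_eq_0_iff vec_eq_iff vector_scaleR_component scaleR_conv_of_real[of _ "x $ _"]
   using that by (auto simp: algebra_simps)
  then have "c ^ k * g (c *s x) = g x"
   using g x by (auto simp: graded_def)
  then show ?thesis
   unfolding c(2,3) using c(1) by (simp add: field_simps)
 qed
 from has_derivative_transform_within_open[OF b open_greaterThan[of "-1"] _ eq]
 have "((%s. g ((1 + s) *\<^sub>R x)) has_derivative (%h. h *\<^sub>R (- of_nat k * g x))) (at 0)"
  by simp
 from has_derivative_unique[OF a this] have "(\<Sum>i\<in>UNIV. d $ i * x $ i) = - of_nat k * g x"
  by (metis scaleR_one)
 with d that show ?thesis by blast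
qed

lemma pd_compose:
 assumes "(L has_derivative L') (at e)" "Y differentiable (at (L e))"
 shows "pd b (%e. Y (L e)) e = pd (L' b) Y (L e)"
proof -
 have "(Y has_derivative frechet_derivative Y (at (L e))) (at (L e))"
  using assms(2) by (simp add: frechet_derivative_works)
 from frechet_derivative_at[OF has_derivative_compose[OF assms(1) this], symmetric]
 show ?thesis by simp
qed

section \<open>Parametrised circle bundles and Stokes' theorem on them\<close>

locale tube =
 fixes V :: "'e::euclidean_space set" and Y :: "'e => complex ^ 4" and eps :: real
 assumes V: "open V" and Y: "smooth_on V Y" and nz: "!!e. e \<in> V ==> Y e ~= 0" and eps: "eps > 0"
begin

abbreviation "N \<equiv> %e. normal (Y e)"

lemma N: "smooth_on V N"
 by (rule smooth_on_compose[OF V _ Y smooth_on_normal]) (use nz in auto)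

lemma diff: "e \<in> V ==> Y differentiable (at e)" "e \<in> V ==> N differentiable (at e)"
 using smooth_on_differentiable[OF Y] smooth_on_differentiable[OF N] by (auto simp: differentiable_def)

definition "K = (%(e, th). Y e + circ eps th *s N e)"

lemma K_apply: "K (e, th) = Y e + circ eps th *s N e"
 by (simp add: K_def)

lemma openVU: "open (V \<times> (UNIV :: real set))"
 using V by (simp add: open_Times)

lemma K: "smooth_on (V \<times> UNIV) K"
proof -
 have fst: "smooth_on (V \<times> UNIV) (%p :: 'e \<times> real. fst p)" and snd: "smooth_on (V \<times> UNIV) (%p :: 'e \<times> real. snd p)"
  by (rule smooth_on_linear[OF openVU bounded_linear_fst], rule smooth_on_linear[OF openVU bounded_linear_snd])
 have "smooth_on (V \<times> UNIV) (%p. Y (fst p) + circ eps (snd p) *s N (fst p))"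
  by (intro smooth_on_add smooth_on_smult openVU smooth_on_compose[OF openVU V fst Y]
    smooth_on_compose[OF openVU V fst N] smooth_on_compose[OF openVU open_UNIV snd smooth_on_circ]) auto
 then show ?thesis by (simp add: K_def split_def)
qed

lemma pd_K:
 assumes "e \<in> V"
 shows "pd (b, 0) K (e, th) = pd b Y e + circ eps th *s pd b N e"
  "pd (0, 1) K (e, th) = (2 * pi * \<i> * circ eps th) *s N e"
proof -
 have fst: "(fst has_derivative fst) (at (e, th))" and snd: "(snd has_derivative snd) (at (e, th))"
  by (rule bounded_linear_imp_has_derivative[OF bounded_linear_fst],
    rule bounded_linear_imp_has_derivative[OF bounded_linear_snd])
 have G: "((%p. Y (fst p)) has_derivative (%h. pd (fst h) Y e)) (at (e, th))"
  using has_derivative_compose[OF fst, of Y "%b. pd b Y e"] smooth_on_differentiable[OF Y assms] by simp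
 have n: "((%p. N (fst p)) has_derivative (%h. pd (fst h) N e)) (at (e, th))"
  using has_derivative_compose[OF fst, of N "%b. pd b N e"] smooth_on_differentiable[OF N assms] by simp
 have c: "((%p. circ eps (snd p)) has_derivative (%h. snd h *\<^sub>R (2 * pi * \<i> * circ eps th))) (at (e, th))"
  using has_derivative_compose[OF snd, of "circ eps"] circ_has_vector_derivative[of eps th]
  by (simp add: has_vector_derivative_def)
 have "((%p. Y (fst p) + circ eps (snd p) *s N (fst p)) has_derivative
  (%h. pd (fst h) Y e + (circ eps (snd (e, th)) *s pd (fst h) N e + (snd h *\<^sub>R (2 * pi * \<i> * circ eps th)) *s N (fst (e, th))))) (at (e, th))"
  by (rule has_derivative_add[OF G bounded_bilinear.FDERIV[OF bounded_bilinear_vector_smult c n]])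
 from frechet_derivative_at[OF this, symmetric]
 have pdK: "pd h K (e, th) = pd (fst h) Y e + (circ eps th *s pd (fst h) N e + (snd h *\<^sub>R (2 * pi * \<i> * circ eps th)) *s N e)" for h
  by (simp add: K_def split_def)
 have z: "pd 0 Y e = 0" "pd 0 N e = 0"
  using smooth_on_differentiable[OF Y assms] smooth_on_differentiable[OF N assms]
   has_derivative_linear linear_0 by blast+
 show "pd (b, 0) K (e, th) = pd b Y e + circ eps th *s pd b N e" by (simp add: pdK)
 show "pd (0, 1) K (e, th) = (2 * pi * \<i> * circ eps th) *s N e" by (simp add: pdK z)
qed

lemma tden_compose:
 assumes "(L has_derivative L') (at e)" "L e \<in> V"
 shows "tden g eps (%e. Y (L e)) a b e = tden g eps Y (L' a) (L' b) (L e)"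
 unfolding tden_def pd_compose[OF assms(1) diff(1)[OF assms(2)]] pd_compose[OF assms(1) diff(2)[OF assms(2)]] ..

lemma eden_compose:
 assumes "(L has_derivative L') (at e)" "L e \<in> V"
 shows "eden h v eps (%e. Y (L e)) a e = eden h v eps Y (L' a) (L e)"
 unfolding eden_def pd_compose[OF assms(1) diff(1)[OF assms(2)]] pd_compose[OF assms(1) diff(2)[OF assms(2)]] ..

end

locale tube_form = tube V Y eps
 for V :: "'e::euclidean_space set" and Y eps +
 fixes D g k
 assumes g: "graded k D g" and sub: "ucube \<subseteq> V" and tubular: "!!e. e \<in> ucube ==> tubular D eps (Y e)"
begin

definition "S = {p \<in> V \<times> UNIV. K p \<in> D}"

lemma S: "open S"
proof -
 have "open D" using g by (simp add: graded_def)
 from continuous_open_preimage[OF smooth_on_continuous[OF K] openVU this]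
 show ?thesis by (simp add: S_def vimage_def Int_def)
qed

lemma KS: "smooth_on S K"
 by (rule smooth_on_subset[OF K]) (auto simp: S_def)

lemma in_S: "e \<in> ucube ==> (e, th) \<in> S"
 using sub tubular norm_circ[OF eps] by (auto simp: S_def K_def tubular_def)

lemma ucube_S: "ucube \<subseteq> S"
 using in_S by (auto simp: ucube_Pair)

lemma gK: "smooth_on S (%p. g (K p))"
 by (rule smooth_on_compose[OF S _ KS]) (use g in \<open>auto simp: graded_def S_def\<close>)

lemma euler:
 assumes "p \<in> S"
 obtains d where "(g has_derivative (%v. \<Sum>i\<in>UNIV. d $ i * v $ i)) (at (K p))"
  "(\<Sum>i\<in>UNIV. d $ i * K p $ i) = - of_nat k * g (K p)"
 using graded_euler[OF g, of "K p"] assms by (auto simp: S_def)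

abbreviation "H a b c \<equiv> %p. g (K p) * Omega (K p) (pd a K p) (pd b K p) (pd c K p)"
abbreviation "E v a b \<equiv> %p. g (K p) * Omega (K p) v (pd a K p) (pd b K p)"

lemma smooth_H: "smooth_on S (H a b c)"
 by (intro smooth_on_mult smooth_on_Omega S gK KS smooth_on_derivative)

lemma smooth_E: "smooth_on S (E v a b)"
 by (intro smooth_on_mult smooth_on_Omega S gK KS smooth_on_derivative smooth_on_const)

lemma H_tint:
 assumes "e \<in> V"
 shows "H (a, 0) (b, 0) (0, 1) (e, th) = tint g (circ eps th) (Y e) (N e) (pd a Y e) (pd a N e) (pd b Y e) (pd b N e)"
 unfolding pd_K[OF assms] by (simp add: K_def tint_def)

lemma E_tint:
 assumes "e \<in> V"
 shows "E v (a, 0) (0, 1) (e, th) = tint g (circ eps th) (Y e) (N e) v 0 (pd a Y e) (pd a N e)"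
 unfolding pd_K[OF assms] by (simp add: K_def tint_def)

lemma continuous_param:
 assumes "continuous_on S F"
 shows "continuous_on ucube (%e. integral {0..1} (%th. F (e, th)) :: complex)"
proof -
 have "continuous_on (ucube \<times> cbox 0 1) (%(e, th). F (e, th))"
  by (rule continuous_on_subset[of S]) (use assms in_S in \<open>auto simp: split_def\<close>)
 from integral_continuous_on_param[OF this] show ?thesis by simp
qed

lemma tden_eq: "e \<in> V ==> tden g eps Y a b e = integral {0..1} (%th. H (a, 0) (b, 0) (0, 1) (e, th))"
 by (simp add: tden_def H_tint)

lemma eden_eq: "e \<in> V ==> eden g v eps Y a e = integral {0..1} (%th. E v (a, 0) (0, 1) (e, th))"
 by (simp add: eden_def E_tint)

lemma continuous_tden: "continuous_on ucube (tden g eps Y a b)"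
 using continuous_param[OF smooth_on_continuous[OF smooth_H]] tden_eq sub
 by (subst continuous_on_cong[OF refl tden_eq]) auto

lemma continuous_eden: "continuous_on ucube (eden g v eps Y a)"
 using continuous_param[OF smooth_on_continuous[OF smooth_E]] eden_eq sub
 by (subst continuous_on_cong[OF refl eden_eq]) auto

lemma integral_face:
 assumes F: "continuous_on S F" and b: "averaging b" and c: "0 \<le> c" "c \<le> 1"
 shows "(%p. F (upd (b, 0) c p)) integrable_on ucube"
  "integral ucube (%p. F (upd (b, 0) c p)) = integral ucube (%e. integral {0..1} (%th. F (upd b c e, th)) :: complex)"
proof -
 have "continuous_on ucube (%p. F (upd (b, 0) c p))"
  by (rule continuous_on_compose2[OF F])
   (use upd_in_ucube[of b _ c] b c in_S in
    \<open>auto simp: ucube_Pair upd_Pair averaging_def intro!: continuous_on_upd continuous_intros\<close>)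
 from integral_ucube_Pair[OF this] integrable_continuous[OF this]
 show "(%p. F (upd (b, 0) c p)) integrable_on ucube"
  "integral ucube (%p. F (upd (b, 0) c p)) = integral ucube (%e. integral {0..1} (%th. F (upd b c e, th)))"
  by (simp_all add: upd_Pair)
qed

lemma FTC:
 assumes F: "smooth_on S F" and b: "averaging b"
 shows "integral ucube (pd (b, 0) F) =
   integral ucube (%e. integral {0..1} (%th. F (upd b 1 e, th))) -
   integral ucube (%e. integral {0..1} (%th. F (upd b 0 e, th)) :: complex)"
 using ucube_FTC[OF averaging_fst[OF b] smooth_onD[OF F] ucube_S]
  integral_face[OF smooth_on_continuous[OF F] b, of 0] integral_face[OF smooth_on_continuous[OF F] b, of 1]
 by (simp add: integral_diff)

text \<open>The circle closes up, so the two faces of the cube transverse to the angle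
  cancel.\<close>

lemma FTC_angle:
 assumes F: "smooth_on S F" and "!!e. e \<in> V ==> F (e, 1) = F (e, 0)"
 shows "integral ucube (pd (0, 1) F) = (0 :: complex)"
proof -
 have "integral ucube (pd (0, 1) F) = integral ucube (%x. F (upd (0, 1) 1 x) - F (upd (0, 1) 0 x))"
  by (rule ucube_FTC[OF averaging_snd[OF averaging_real] smooth_onD[OF F] ucube_S])
 also have "\<dots> = integral ucube (%x :: 'e \<times> real. 0)"
  using assms(2) sub by (intro integral_cong) (auto simp: ucube_Pair upd_Pair' upd_def)
 finally show ?thesis by simp
qed

lemma integrable_pd: "smooth_on S F ==> (pd b F) integrable_on (ucube :: ('e \<times> real) set)"
 for F :: "_ => complex"
 by (rule integrable_continuous, rule continuous_on_subset[OF smooth_on_continuous[OF smooth_on_derivative] ucube_S])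

text \<open>Stokes in three parameter directions and the angle. The angular faces cancel, and each
  of the other six contributes the tube density integrated over a face of the parameter
  cube.\<close>

lemma stokes_closed:
 assumes k: "k = 4" and b: "averaging b1" "averaging b2" "averaging b3"
 defines "T \<equiv> %a b c s. integral ucube (%e. tden g eps Y a b (upd c s e))"
 shows "(T b2 b3 b1 1 - T b2 b3 b1 0) - (T b1 b3 b2 1 - T b1 b3 b2 0) + (T b1 b2 b3 1 - T b1 b2 b3 0) = 0"
proof -
 let ?b1 = "(b1, 0) :: 'e \<times> real" and ?b2 = "(b2, 0) :: 'e \<times> real" and ?b3 = "(b3, 0) :: 'e \<times> real"
 let ?t = "(0, 1) :: 'e \<times> real"
 have pt: "pd ?b1 (H ?b2 ?b3 ?t) p - pd ?b2 (H ?b1 ?b3 ?t) p + pd ?b3 (H ?b1 ?b2 ?t) p - pd ?t (H ?b1 ?b2 ?b3) p = 0"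
  if p: "p \<in> S" for p
 proof -
  obtain d where "(g has_derivative (%v. \<Sum>i\<in>UNIV. d $ i * v $ i)) (at (K p))"
   "(\<Sum>i\<in>UNIV. d $ i * K p $ i) = - of_nat k * g (K p)"
   using euler[OF p] by blast
  then show ?thesis
   using closed_3_form_pullback[OF S KS that, of g "%v. \<Sum>i\<in>UNIV. d $ i * v $ i" d] k by simp
 qed
 have "integral ucube (%p. pd ?b1 (H ?b2 ?b3 ?t) p - pd ?b2 (H ?b1 ?b3 ?t) p + pd ?b3 (H ?b1 ?b2 ?t) p - pd ?t (H ?b1 ?b2 ?b3) p)
   = integral ucube (%p :: 'e \<times> real. 0)"
  using pt ucube_S by (intro integral_cong) blast
 then have "integral ucube (pd ?b1 (H ?b2 ?b3 ?t)) - integral ucube (pd ?b2 (H ?b1 ?b3 ?t))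
   + integral ucube (pd ?b3 (H ?b1 ?b2 ?t)) - integral ucube (pd ?t (H ?b1 ?b2 ?b3)) = 0"
  by (simp add: integral_diff integral_add integrable_pd smooth_H integrable_diff integrable_add)
 moreover have "integral ucube (pd ?t (H ?b1 ?b2 ?b3)) = 0"
  by (rule FTC_angle[OF smooth_H]) (simp only: pd_K K_apply circ_1)
 moreover have "integral ucube (%e. integral {0..1} (%th. H (a, 0) (b, 0) ?t (upd c s e, th))) = T a b c s"
  if "averaging c" "s \<in> {0, 1}" for a b c s
  unfolding T_def using that sub upd_in_ucube[of c _ s]
  by (intro integral_cong tden_eq[symmetric]) (auto simp: averaging_def)
 ultimately show ?thesis
  using b by (simp add: FTC smooth_H)
qed

text \<open>Stokes in two parameter directions and the angle: the tube integral of an exact form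
  reduces to circle integrals of its potential along the four edges.\<close>

lemma stokes_exact:
 assumes k: "k = 3" and b: "averaging b1" "averaging b2"
  and h: "!!x. x \<in> D ==> h x = pd v g x"
 defines "T \<equiv> %a c s. integral ucube (%e. eden g v eps Y a (upd c s e))"
 shows "integral ucube (tden h eps Y b1 b2) = (T b2 b1 1 - T b2 b1 0) - (T b1 b2 1 - T b1 b2 0)"
proof -
 let ?b1 = "(b1, 0) :: 'e \<times> real" and ?b2 = "(b2, 0) :: 'e \<times> real"
 let ?t = "(0, 1) :: 'e \<times> real"
 let ?W = "%p. h (K p) * Omega (K p) (pd ?b1 K p) (pd ?b2 K p) (pd ?t K p)"
 have pt: "pd ?b1 (E v ?b2 ?t) p - pd ?b2 (E v ?b1 ?t) p + pd ?t (E v ?b1 ?b2) p = ?W p"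
  if p: "p \<in> S" for p
 proof -
  obtain d where d: "(g has_derivative (%v. \<Sum>i\<in>UNIV. d $ i * v $ i)) (at (K p))"
   "(\<Sum>i\<in>UNIV. d $ i * K p $ i) = - of_nat k * g (K p)"
   using euler[OF p] by blast
  have "h (K p) = (\<Sum>i\<in>UNIV. d $ i * v $ i)"
   using frechet_derivative_at[OF d(1), symmetric] h that by (simp add: S_def)
  then show ?thesis
   using exact_2_form_pullback[OF S KS that d(1)] d(2) k by simp
 qed
 have int: "integral ucube ?W = integral ucube (pd ?b1 (E v ?b2 ?t)) - integral ucube (pd ?b2 (E v ?b1 ?t))
   + integral ucube (pd ?t (E v ?b1 ?b2))"
 proof -
  have "integral ucube ?W = integral ucube (%p. pd ?b1 (E v ?b2 ?t) p - pd ?b2 (E v ?b1 ?t) p + pd ?t (E v ?b1 ?b2) p)"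
   using pt ucube_S by (intro integral_cong) auto
  then show ?thesis
   by (simp add: integral_diff integral_add integrable_pd smooth_E integrable_diff integrable_add)
 qed
 have "continuous_on S (%p. pd ?b1 (E v ?b2 ?t) p - pd ?b2 (E v ?b1 ?t) p + pd ?t (E v ?b1 ?b2) p)"
  by (intro continuous_intros smooth_on_continuous smooth_on_derivative smooth_E)
 then have "continuous_on S ?W"
  by (subst continuous_on_cong[OF refl pt[symmetric]]) auto
 then have "continuous_on ucube ?W"
  using ucube_S continuous_on_subset by blast
 then have "integral ucube ?W = integral ucube (%e. integral ucube (%th. ?W (e, th)))"
  by (rule integral_ucube_Pair)
 also have "\<dots> = integral ucube (tden h eps Y b1 b2)"
 proof (rule integral_cong)
  fix e :: 'e assume "e \<in> ucube"
  then have "e \<in> V" using sub by blast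
  then show "integral ucube (%th. ?W (e, th)) = tden h eps Y b1 b2 e"
   by (simp add: tden_def tint_def pd_K K_apply)
 qed
 finally have "integral ucube (tden h eps Y b1 b2) = integral ucube ?W" ..
 moreover have "integral ucube (pd ?t (E v ?b1 ?b2)) = 0"
  by (rule FTC_angle[OF smooth_E]) (simp only: pd_K K_apply circ_1)
 moreover have "integral ucube (%e. integral {0..1} (%th. E v (a, 0) ?t (upd c s e, th))) = T a c s"
  if "averaging c" "s \<in> {0, 1}" for a c s
  unfolding T_def using that sub upd_in_ucube[of c _ s]
  by (intro integral_cong eden_eq[symmetric]) (auto simp: averaging_def)
 ultimately show ?thesis
  using b int by (simp add: FTC smooth_E)
qed

end

section \<open>Integrals over singular squares in projective space\<close>

text \<open>Replacing a homogeneous lift by a multiple turns the circle by a phase; an integral over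
  a full period does not notice the shift.\<close>

lemma circle_shift:
 fixes F :: "complex => complex"
 assumes F: "continuous_on (sphere 0 eps) F" and eps: "eps > 0" and \<mu>: "norm \<mu> = 1"
 shows "integral {0..1} (%th. F (circ eps th * \<mu>)) = integral {0..1} (%th. F (circ eps th))"
proof -
 define \<alpha> where "\<alpha> = Arg2pi \<mu> / (2 * pi)"
 define h where "h = (%th. F (circ eps th))"
 have \<alpha>: "0 \<le> \<alpha>" "\<alpha> < 1" "\<mu> = cis (2 * pi * \<alpha>)"
  using Arg2pi_ge_0[of \<mu>] Arg2pi_lt_2pi[of \<mu>] complex_norm_eq_1_exp \<mu> Arg2pi_eq[of \<mu>]
  by (auto simp: \<alpha>_def cis_conv_exp field_simps)
 have sh: "circ eps th * \<mu> = circ eps (th + \<alpha>)" for th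
  by (simp add: circ_def \<alpha>(3) cis_mult algebra_simps)
 have per: "h (th + 1) = h th" for th
 proof -
  have "cis (2 * pi * (th + 1)) = cis (2 * pi * th)"
   by (simp add: distrib_left flip: cis_mult)
  then show ?thesis by (simp add: h_def circ_def)
 qed
 have h: "continuous_on A h" for A
  unfolding h_def
  by (rule continuous_on_compose2[OF F continuous_on_subset[OF smooth_on_continuous[OF smooth_on_circ] subset_UNIV]])
   (use norm_circ[OF eps] in auto)
 have "integral {0..1} (%th. F (circ eps th * \<mu>)) = integral {0..1} (h \<circ> (%th. th + \<alpha>))"
  by (simp add: sh h_def o_def)
 also have "\<dots> = integral {\<alpha>..1 + \<alpha>} h"
  using integral_shift[OF h, of 0 1 \<alpha>] by simp
 also have "\<dots> = integral {\<alpha>..1} h + integral {1..1 + \<alpha>} h"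
  by (rule Henstock_Kurzweil_Integration.integral_combine[symmetric])
   (use \<alpha> h integrable_continuous_interval in auto)
 also have "integral {1..1 + \<alpha>} h = integral {0..\<alpha>} (h \<circ> (%th. th + 1))"
  using integral_shift[OF h, of 0 \<alpha> 1] by (simp add: add.commute)
 also have "h \<circ> (%th. th + 1) = h"
  by (simp add: fun_eq_iff per)
 also have "integral {\<alpha>..1} h + integral {0..\<alpha>} h = integral {0..1} h"
  by (subst add.commute, rule Henstock_Kurzweil_Integration.integral_combine)
   (use \<alpha> h integrable_continuous_interval in auto)
 finally show ?thesis by (simp add: h_def)
qed

text \<open>A new lift multiplies x by c and the normal by k, and adds multiples of x and of the
  normal to the tangent columns and their variations. These recombine into the columns y and n
  already present, so \<open>Omega\<close> drops them, and the remaining factor c^4 is absorbed by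
  homogeneity. What is left is the substitution of z k / c for z.\<close>

lemma tint_rescale:
 assumes c: "c ~= 0" and g: "c ^ 4 * g (c *s (x + (z * k / c) *s n)) = g (x + (z * k / c) *s n)"
 shows "tint g z (c *s x) (k *s n) (c *s u1 + l1 *s x) (k *s n1 + k1 *s n) (c *s u2 + l2 *s x) (k *s n2 + k2 *s n)
  = tint g (z * (k / c)) x n u1 n1 u2 n2"
proof -
 define w y where "w = z * k / c" and "y = x + w *s n"
 have 1: "c *s x + z *s (k *s n) = c *s y"
  using c by (simp add: y_def w_def vec_eq_iff field_simps)
 have 2: "(c *s u + l *s x) + z *s (k *s m + k' *s n) = c *s (u + w *s m) + (l *s y + (z * k' - l * w) *s n)" for u m l k'
  using c by (simp add: y_def w_def vec_eq_iff field_simps)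
 have 3: "(2 * pi * \<i> * z) *s (k *s n) = (c * (2 * pi * \<i> * w)) *s n"
  using c by (simp add: w_def vec_eq_iff field_simps)
 have "tint g z (c *s x) (k *s n) (c *s u1 + l1 *s x) (k *s n1 + k1 *s n) (c *s u2 + l2 *s x) (k *s n2 + k2 *s n)
   = (c ^ 4 * g (c *s y)) * Omega y (u1 + w *s n1) (u2 + w *s n2) ((2 * pi * \<i> * w) *s n)"
  unfolding tint_def 1 2 3
  by (simp only: Omega_add Omega_smult Omega_eq) (simp add: power4_eq_xxxx algebra_simps)
 also have "\<dots> = tint g (z * (k / c)) x n u1 n1 u2 n2"
  using g by (simp add: tint_def y_def w_def)
 finally show ?thesis .
qed

text \<open>As in \<open>tint_rescale\<close>, but the fixed column v does not scale, which is why
  degree -3 is the right one here.\<close>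

lemma eint_rescale:
 assumes c: "c ~= 0" and g: "c ^ 3 * g (c *s (x + (z * k / c) *s n)) = g (x + (z * k / c) *s n)"
 shows "tint g z (c *s x) (k *s n) v 0 (c *s u2 + l2 *s x) (k *s n2 + k2 *s n)
  = tint g (z * (k / c)) x n v 0 u2 n2"
proof -
 define w y where "w = z * k / c" and "y = x + w *s n"
 have 1: "c *s x + z *s (k *s n) = c *s y"
  using c by (simp add: y_def w_def vec_eq_iff field_simps)
 have 2: "(c *s u + l *s x) + z *s (k *s m + k' *s n) = c *s (u + w *s m) + (l *s y + (z * k' - l * w) *s n)" for u m l k'
  using c by (simp add: y_def w_def vec_eq_iff field_simps)
 have 3: "(2 * pi * \<i> * z) *s (k *s n) = (c * (2 * pi * \<i> * w)) *s n"
  using c by (simp add: w_def vec_eq_iff field_simps)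
 have "tint g z (c *s x) (k *s n) v 0 (c *s u2 + l2 *s x) (k *s n2 + k2 *s n)
   = (c ^ 3 * g (c *s y)) * Omega y v (u2 + w *s n2) ((2 * pi * \<i> * w) *s n)"
  unfolding tint_def 1 2 3
  by (simp only: Omega_add Omega_smult Omega_eq vector_smult_rzero add_0_right)
    (simp add: power3_eq_cube algebra_simps)
 also have "\<dots> = tint g (z * (k / c)) x n v 0 u2 n2"
  using g by (simp add: tint_def y_def w_def)
 finally show ?thesis .
qed

lemma pt_eq_iff:
 assumes "x ~= 0" "y ~= 0"
 shows "pt x = pt y \<longleftrightarrow> (\<exists>c. c ~= 0 & y = c *s x)"
proof
 assume eq: "pt x = pt y"
 have "y \<in> pt y" unfolding pt_def by (rule image_eqI[of _ _ 1]) auto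
 then have "y \<in> pt x" using eq by simp
 then obtain c where "y = c *s x" unfolding pt_def by auto
 then show "\<exists>c. c ~= 0 & y = c *s x" using assms(2) by (intro exI[of _ c]) auto
next
 assume "\<exists>c. c ~= 0 & y = c *s x"
 then obtain c where c: "c ~= 0" "y = c *s x" by blast
 have "d *s x = (d / c) *s y" for d using c by simp
 then have "d *s x \<in> range (%c. c *s y)" for d by blast
 moreover have "d *s y \<in> range (%c. c *s x)" for d using c by auto
 ultimately show "pt x = pt y" unfolding pt_def by blast
qed

lemma pt_smult: "c ~= 0 ==> pt (c *s x) = pt x"
proof (cases "x = 0")
 case False
 moreover assume "c ~= 0"
 ultimately have "pt x = pt (c *s x)" by (subst pt_eq_iff) auto
 then show ?thesis ..
qed simp

section \<open>Homogeneous lifts and independence of their choice\<close>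

definition lifts :: "('e::euclidean_space => point) => ('e => complex ^ 4) => bool" where
 "lifts \<gamma> Y \<longleftrightarrow> (\<exists>V. open V & ucube \<subseteq> V & smooth_on V Y & (\<forall>e\<in>V. Y e ~= 0) &
   (\<forall>e\<in>ucube. \<gamma> e = pt (Y e)))"

lemma liftsI:
 assumes "open V" "ucube \<subseteq> V" "smooth_on V Y" "!!e. e \<in> ucube ==> Y e ~= 0 & \<gamma> e = pt (Y e)"
 shows "lifts \<gamma> Y"
proof -
 have "open {e \<in> V. Y e \<in> - {0}}"
  using continuous_open_preimage[OF smooth_on_continuous[OF assms(3)] assms(1), of "- {0}"]
  by (simp add: vimage_def Int_def open_Compl)
 moreover have "smooth_on {e \<in> V. Y e \<in> - {0}} Y"
  by (rule smooth_on_subset[OF assms(3)]) auto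
 ultimately show ?thesis
  unfolding lifts_def by (intro exI[of _ "{e \<in> V. Y e \<in> - {0}}"]) (use assms in auto)
qed

definition tubular_points :: "(complex ^ 4) set => real => point set => bool" where
 "tubular_points D eps X \<longleftrightarrow> (\<forall>x. x ~= 0 & pt x \<in> X --> tubular D eps x)"

lemma smooth_on_phase: "smooth_on (- {0}) (%c. complex_of_real (inverse (norm c ^ 6)) * cnj c ^ 7)"
proof -
 have op: "open (- {0 :: complex})" by auto
 have i: "smooth_on (- {0}) (%x :: complex. x)"
  by (rule smooth_on_linear[OF op bounded_linear_ident])
 have "norm x ^ 6 = (x \<bullet> x) ^ 3" for x :: complex
  by (simp add: dot_square_norm)
 moreover have "smooth_on (- {0}) (%x :: complex. inverse ((x \<bullet> x) ^ 3))"
  by (intro smooth_on_inverse smooth_on_power smooth_on_bilinear[OF op bounded_bilinear_inner i i] op) auto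
 ultimately have 1: "smooth_on (- {0}) (%x :: complex. inverse (norm x ^ 6))"
  by simp
 show ?thesis
  by (intro smooth_on_mult smooth_on_power op smooth_on_linear_compose[OF op bounded_linear_cnj i]
    smooth_on_linear_compose[OF op bounded_linear_of_real 1])
qed

text \<open>Near an interior point the quotient of two lifts is a smooth function, read off from a
  coordinate that does not vanish. The point is interior because lifts are compared only on the
  cube, while derivatives see a neighbourhood.\<close>

lemma lift_derivatives:
 fixes Y Y' :: "'e::euclidean_space => complex ^ 4"
 assumes L: "lifts \<gamma> Y" "lifts \<gamma> Y'" and e: "e \<in> box 0 One"
 obtains c k l m where "c ~= 0" "norm (k / c) = 1" "Y' e = c *s Y e" "normal (Y' e) = k *s normal (Y e)"
  "!!a. pd a Y' e = c *s pd a Y e + l a *s Y e"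
  "!!a. pd a (%e. normal (Y' e)) e = k *s pd a (%e. normal (Y e)) e + m a *s normal (Y e)"
proof -
 obtain V V' where V: "open V" "ucube \<subseteq> V" "smooth_on V Y" "!!e. e \<in> V ==> Y e ~= 0" "!!e. e \<in> ucube ==> \<gamma> e = pt (Y e)"
  and V': "open V'" "ucube \<subseteq> V'" "smooth_on V' Y'" "!!e. e \<in> V' ==> Y' e ~= 0" "!!e. e \<in> ucube ==> \<gamma> e = pt (Y' e)"
  using L unfolding lifts_def by metis
 have sub: "box 0 One \<subseteq> (ucube :: 'e set)" by (rule box_subset_cbox)
 then have eV: "e \<in> V" "e \<in> V'" using e V(2) V'(2) by blast+
 obtain i where i: "Y e $ i ~= 0" using V(4)[OF eV(1)] by (auto simp: vec_eq_iff)
 define U where "U = {e \<in> V. Y e $ i \<in> - {0}} \<inter> V' \<inter> box 0 One"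
 have cont: "continuous_on V (%e. Y e $ i)"
  by (rule smooth_on_continuous[OF smooth_on_vec_nth[OF V(1,3)]])
 have U: "open U" "e \<in> U" "U \<subseteq> V" "U \<subseteq> V'"
  using continuous_open_preimage[OF cont V(1), of "- {0}"] V'(1) e eV i
  by (auto simp: U_def vimage_def Int_def[of V] open_Compl open_box intro!: open_Int)
 define f where "f = (%e. Y' e $ i * inverse (Y e $ i))"
 have f: "smooth_on U f"
  unfolding f_def
  by (intro smooth_on_mult smooth_on_inverse smooth_on_vec_nth U smooth_on_subset[OF V(3)] smooth_on_subset[OF V'(3)])
   (auto simp: U_def)
 have eq: "Y' x = f x *s Y x" "f x ~= 0" if "x \<in> U" for x
 proof -
  have x: "x \<in> V" "x \<in> V'" "x \<in> ucube" "Y x $ i ~= 0" using that sub by (auto simp: U_def)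
  then obtain c where c: "c ~= 0" "Y' x = c *s Y x"
   using pt_eq_iff[of "Y x" "Y' x"] V(4,5) V'(4,5) by metis
  moreover have "f x = c" using c x by (simp add: f_def)
  ultimately show "Y' x = f x *s Y x" "f x ~= 0" by simp_all
 qed
 define ph where "ph = (%c. complex_of_real (inverse (norm c ^ 6)) * cnj c ^ 7)"
 have phf: "smooth_on U (%x. ph (f x))"
  unfolding ph_def by (rule smooth_on_compose[OF U(1) _ f smooth_on_phase]) (use eq in auto)
 have N: "smooth_on U (%x. normal (Y x))"
  by (rule smooth_on_compose[OF U(1) _ smooth_on_subset[OF V(3)] smooth_on_normal]) (use U V(4) in auto)
 have pd: "pd a (%x. c x *s G x) e = c e *s pd a G e + pd a c e *s G e"
  if c: "smooth_on U c" and G: "smooth_on U G" for a c and G :: "'e => complex ^ 4"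
 proof -
  have "((%x. c x *s G x) has_derivative (%h. c e *s pd h G e + pd h c e *s G e)) (at e)"
   by (rule bounded_bilinear.FDERIV[OF bounded_bilinear_vector_smult
     smooth_on_differentiable[OF c U(2)] smooth_on_differentiable[OF G U(2)]])
  from frechet_derivative_at[OF this, symmetric] show ?thesis by simp
 qed
 have tr: "pd a F e = pd a G e" if "!!x. x \<in> U ==> F x = G x" "smooth_on U G" for a and F G :: "'e => complex ^ 4"
 proof -
  have "(F has_derivative frechet_derivative G (at e)) (at e)"
   by (rule has_derivative_transform_within_open[OF smooth_on_differentiable[OF that(2) U(2)] U(1,2)]) (simp add: that)
  from frechet_derivative_at[OF this, symmetric] show ?thesis by simp
 qed
 show ?thesis
 proof (rule that)
  show "f e ~= 0" using eq U by blast
  then show "norm (ph (f e) / f e) = 1"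
   by (simp add: ph_def norm_mult norm_divide norm_power norm_inverse field_simps flip: power_Suc)
  show "Y' e = f e *s Y e" using eq U by blast
  then show "normal (Y' e) = ph (f e) *s normal (Y e)" by (simp add: normal_smult ph_def)
  show "pd a Y' e = f e *s pd a Y e + pd a f e *s Y e" for a
   unfolding pd[OF f smooth_on_subset[OF V(3) U(3)], symmetric]
   by (rule tr[OF eq(1)]) (auto intro!: smooth_on_smult U f smooth_on_subset[OF V(3) U(3)])
  show "pd a (%e. normal (Y' e)) e = ph (f e) *s pd a (%e. normal (Y e)) e + pd a (%x. ph (f x)) e *s normal (Y e)" for a
   unfolding pd[OF phf N, symmetric]
   by (rule tr[OF _ smooth_on_smult[OF U(1) phf N]]) (simp add: eq normal_smult ph_def)
 qed
qed

lemma graded_scale: "graded k D g ==> x \<in> D ==> c ~= 0 ==> c ^ k * g (c *s x) = g x"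
 by (simp add: graded_def)

lemma tubular_lift:
 "tubular_points D eps (\<gamma> ` ucube) ==> lifts \<gamma> Y ==> e \<in> ucube ==> tubular D eps (Y e)"
 unfolding lifts_def tubular_points_def by (metis (no_types, lifting) image_eqI subsetD)

lemma continuous_on_circle:
 assumes "graded k D g" "tubular D eps x"
 shows "continuous_on (sphere 0 eps) (%z. tint g z x (normal x) u1 n1 u2 n2)"
proof -
 have "continuous_on D g"
  using assms by (simp add: graded_def smooth_on_continuous)
 then have "continuous_on (sphere 0 eps) (%z. g (x + z *s normal x))"
  by (rule continuous_on_compose2)
   (use assms in \<open>auto simp: tubular_def intro!: continuous_intros
    bounded_bilinear.continuous_on[OF bounded_bilinear_vector_smult]\<close>)
 then show ?thesis
  unfolding tint_def Omega_def wedge3_def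
  by (auto intro!: continuous_intros)
qed

lemma tden_lift_independent:
 assumes "lifts \<gamma> Y" "lifts \<gamma> Y'" "graded 4 D g" "tubular_points D eps (\<gamma> ` ucube)" "eps > 0" "e \<in> box 0 One"
 shows "tden g eps Y' a b e = tden g eps Y a b e"
proof -
 obtain c k l m where c: "c ~= 0" "norm (k / c) = 1" and eq: "Y' e = c *s Y e" "normal (Y' e) = k *s normal (Y e)"
  "!!a. pd a Y' e = c *s pd a Y e + l a *s Y e"
  "!!a. pd a (%e. normal (Y' e)) e = k *s pd a (%e. normal (Y e)) e + m a *s normal (Y e)"
  using lift_derivatives[OF assms(1,2,6)] by blast
 have t: "tubular D eps (Y e)"
  using tubular_lift[OF assms(4,1)] assms(6) box_subset_cbox by blast
 have kc: "norm k = norm c"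
  using c by (simp add: norm_divide field_simps)
 have "tden g eps Y' a b e = integral {0..1} (%th. tint g (circ eps th * (k / c)) (Y e) (normal (Y e))
   (pd a Y e) (pd a (%e. normal (Y e)) e) (pd b Y e) (pd b (%e. normal (Y e)) e))"
  unfolding tden_def eq(2-4) unfolding eq(1)
 proof (rule integral_cong, rule tint_rescale[OF c(1)])
  fix th :: real
  have "norm (circ eps th * k / c) = eps"
   using c kc norm_circ[OF assms(5)] by (simp add: norm_mult norm_divide)
  then have "Y e + (circ eps th * k / c) *s normal (Y e) \<in> D"
   using t by (simp add: tubular_def)
  then show "c ^ 4 * g (c *s (Y e + (circ eps th * k / c) *s normal (Y e))) = g (Y e + (circ eps th * k / c) *s normal (Y e))"
   by (rule graded_scale[OF assms(3) _ c(1)])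
 qed
 also have "\<dots> = tden g eps Y a b e"
  unfolding tden_def by (rule circle_shift[OF continuous_on_circle[OF assms(3) t] assms(5) c(2)])
 finally show ?thesis .
qed

lemma eden_lift_independent:
 assumes "lifts \<gamma> Y" "lifts \<gamma> Y'" "graded 3 D g" "tubular_points D eps (\<gamma> ` ucube)" "eps > 0" "e \<in> box 0 One"
 shows "eden g v eps Y' a e = eden g v eps Y a e"
proof -
 obtain c k l m where c: "c ~= 0" "norm (k / c) = 1" and eq: "Y' e = c *s Y e" "normal (Y' e) = k *s normal (Y e)"
  "!!a. pd a Y' e = c *s pd a Y e + l a *s Y e"
  "!!a. pd a (%e. normal (Y' e)) e = k *s pd a (%e. normal (Y e)) e + m a *s normal (Y e)"
  using lift_derivatives[OF assms(1,2,6)] by blast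
 have t: "tubular D eps (Y e)"
  using tubular_lift[OF assms(4,1)] assms(6) box_subset_cbox by blast
 have kc: "norm k = norm c"
  using c by (simp add: norm_divide field_simps)
 have "eden g v eps Y' a e = integral {0..1} (%th. tint g (circ eps th * (k / c)) (Y e) (normal (Y e))
   v 0 (pd a Y e) (pd a (%e. normal (Y e)) e))"
  unfolding eden_def eq(2-4) unfolding eq(1)
 proof (rule integral_cong, rule eint_rescale[OF c(1)])
  fix th :: real
  have "norm (circ eps th * k / c) = eps"
   using c kc norm_circ[OF assms(5)] by (simp add: norm_mult norm_divide)
  then have "Y e + (circ eps th * k / c) *s normal (Y e) \<in> D"
   using t by (simp add: tubular_def)
  then show "c ^ 3 * g (c *s (Y e + (circ eps th * k / c) *s normal (Y e))) = g (Y e + (circ eps th * k / c) *s normal (Y e))"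
   by (rule graded_scale[OF assms(3) _ c(1)])
 qed
 also have "\<dots> = eden g v eps Y a e"
  unfolding eden_def by (rule circle_shift[OF continuous_on_circle[OF assms(3) t] assms(5) c(2)])
 finally show ?thesis .
qed

text \<open>For the forms considered the choice of lift is harmless: by
  \<open>tden_lift_independent\<close> the densities agree on the open square, and its boundary
  carries no mass.\<close>

definition square_integral :: "(complex ^ 4 => complex) => real => (real \<times> real => point) => complex" where
 "square_integral g eps \<gamma> = integral ucube (tden g eps (SOME Y. lifts \<gamma> Y) (1, 0) (0, 1))"

definition path_integral :: "(complex ^ 4 => complex) => complex ^ 4 => real => (real => point) => complex" where
 "path_integral h v eps \<gamma> = integral ucube (eden h v eps (SOME Y. lifts \<gamma> Y) 1)"

lemma square_integral_eq:
 assumes "lifts \<gamma> Y" "graded 4 D g" "tubular_points D eps (\<gamma> ` ucube)" "eps > 0"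
 shows "square_integral g eps \<gamma> = integral ucube (tden g eps Y (1, 0) (0, 1))"
 unfolding square_integral_def integral_open_interval[symmetric]
 by (rule integral_cong, rule tden_lift_independent[OF assms(1) someI[of "lifts \<gamma>", OF assms(1)] assms(2-4)])

lemma path_integral_eq:
 assumes "lifts \<gamma> Y" "graded 3 D g" "tubular_points D eps (\<gamma> ` ucube)" "eps > 0"
 shows "path_integral g v eps \<gamma> = integral ucube (eden g v eps Y 1)"
 unfolding path_integral_def integral_open_interval[symmetric]
 by (rule integral_cong, rule eden_lift_independent[OF assms(1) someI[of "lifts \<gamma>", OF assms(1)] assms(2-4)])

lemma content_ucube: "measure lborel (ucube :: 'a::euclidean_space set) = 1"
 by (simp add: content_cbox_cases)

lemma integral_ucube_const: "integral (ucube :: 'a::euclidean_space set) (%x. c) = (c :: complex)"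
 by (simp add: content_ucube)

lemma integral_ucube_first:
 fixes F :: "'b::euclidean_space => complex"
 assumes "continuous_on ucube F"
 shows "integral ucube (%p :: 'a::euclidean_space \<times> 'b. F (snd p)) = integral ucube F"
proof -
 have "continuous_on ucube (%p :: 'a \<times> 'b. F (snd p))"
  by (rule continuous_on_compose2[OF assms]) (auto simp: ucube_Pair intro!: continuous_intros)
 from integral_ucube_Pair[OF this] show ?thesis by (simp add: integral_ucube_const)
qed

lemma integral_ucube_second:
 fixes F :: "'a::euclidean_space => complex"
 assumes "continuous_on ucube F"
 shows "integral ucube (%p :: 'a \<times> 'b::euclidean_space. F (fst p)) = integral ucube F"
proof -
 have "continuous_on ucube (%p :: 'a \<times> 'b. F (fst p))"
  by (rule continuous_on_compose2[OF assms]) (auto simp: ucube_Pair intro!: continuous_intros)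
 from integral_ucube_Pair[OF this] show ?thesis by (simp add: integral_ucube_const)
qed

lemma integral_ucube_middle:
 fixes F :: "'a::euclidean_space \<times> 'c::euclidean_space => complex"
 assumes "continuous_on ucube F"
 shows "integral ucube (%p :: 'a \<times> 'b::euclidean_space \<times> 'c. F (fst p, snd (snd p))) = integral ucube F"
proof -
 have "continuous_on ucube (%p :: 'a \<times> 'b \<times> 'c. F (fst p, snd (snd p)))"
  by (rule continuous_on_compose2[OF assms]) (auto simp: ucube_Pair intro!: continuous_intros)
 from integral_ucube_Pair[OF this]
 have "integral ucube (%p :: 'a \<times> 'b \<times> 'c. F (fst p, snd (snd p))) =
   integral ucube (%x. integral ucube (%y :: 'b \<times> 'c. F (x, snd y)))" by simp
 also have "\<dots> = integral ucube (%x. integral ucube (%y. F (x, y)))"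
 proof (rule integral_cong)
  fix x :: 'a assume "x \<in> ucube"
  then have "continuous_on ucube (%y. F (x, y))"
   by (intro continuous_on_compose2[OF assms]) (auto simp: ucube_Pair intro!: continuous_intros)
  from integral_ucube_first[OF this] show "integral ucube (%y :: 'b \<times> 'c. F (x, snd y)) = integral ucube (%y. F (x, y))"
   by simp
 qed
 finally show ?thesis using integral_ucube_Pair[OF assms] by simp
qed

lemma integral_ucube_last:
 fixes F :: "'a::euclidean_space \<times> 'b::euclidean_space => complex"
 assumes "continuous_on ucube F"
 shows "integral ucube (%p :: 'a \<times> 'b \<times> 'c::euclidean_space. F (fst p, fst (snd p))) = integral ucube F"
proof -
 have "continuous_on ucube (%p :: 'a \<times> 'b \<times> 'c. F (fst p, fst (snd p)))"
  by (rule continuous_on_compose2[OF assms]) (auto simp: ucube_Pair intro!: continuous_intros)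
 from integral_ucube_Pair[OF this]
 have "integral ucube (%p :: 'a \<times> 'b \<times> 'c. F (fst p, fst (snd p))) =
   integral ucube (%x. integral ucube (%y :: 'b \<times> 'c. F (x, fst y)))" by simp
 also have "\<dots> = integral ucube (%x. integral ucube (%y. F (x, y)))"
 proof (rule integral_cong)
  fix x :: 'a assume "x \<in> ucube"
  then have "continuous_on ucube (%y. F (x, y))"
   by (intro continuous_on_compose2[OF assms]) (auto simp: ucube_Pair intro!: continuous_intros)
  from integral_ucube_second[OF this] show "integral ucube (%y :: 'b \<times> 'c. F (x, fst y)) = integral ucube (%y. F (x, y))"
   by simp
 qed
 finally show ?thesis using integral_ucube_Pair[OF assms] by simp
qed

lemma lifts_compose:
 fixes L :: "'f::euclidean_space => 'e::euclidean_space"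
 assumes "lifts \<gamma> Y" "smooth_on UNIV L" "!!e. e \<in> ucube ==> L e \<in> ucube"
 shows "lifts (%e. \<gamma> (L e)) (%e. Y (L e))"
proof -
 obtain V where V: "open V" "ucube \<subseteq> V" "smooth_on V Y" "!!e. e \<in> V ==> Y e ~= 0" "!!e. e \<in> ucube ==> \<gamma> e = pt (Y e)"
  using assms(1) unfolding lifts_def by metis
 have op: "open (L -` V)"
  using continuous_open_preimage[OF smooth_on_continuous[OF assms(2)] open_UNIV V(1)] by simp
 show ?thesis
 proof (rule liftsI[OF op])
  show "smooth_on (L -` V) (%e. Y (L e))"
   by (rule smooth_on_compose[OF op V(1) smooth_on_subset[OF assms(2)] V(3)]) auto
 qed (use V(2,4,5) assms(3) in \<open>blast+\<close>)
qed

lemma square_integral_compose: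
 fixes L :: "real \<times> real => 'e::euclidean_space"
 assumes "lifts \<gamma> Y" "graded 4 D g" "tubular_points D eps (\<gamma> ` ucube)" "eps > 0"
  and L: "smooth_on UNIV L" "!!e. e \<in> ucube ==> L e \<in> ucube"
  and L': "!!e. e \<in> ucube ==> (L has_derivative L' e) (at e)"
 shows "square_integral g eps (%e. \<gamma> (L e)) = integral ucube (%e. tden g eps Y (L' e (1, 0)) (L' e (0, 1)) (L e))"
proof -
 obtain V where VV: "open V" "ucube \<subseteq> V" "smooth_on V Y" "!!e. e \<in> V ==> Y e ~= 0"
  using assms(1) unfolding lifts_def by metis
 interpret tube V Y eps by standard (use VV assms in auto)
 have "tubular_points D eps ((%e. \<gamma> (L e)) ` ucube)"
  using assms(3) L(2) unfolding tubular_points_def by blast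
 from square_integral_eq[OF lifts_compose[OF assms(1) L] assms(2) this assms(4)]
 have "square_integral g eps (%e. \<gamma> (L e)) = integral ucube (tden g eps (%e. Y (L e)) (1, 0) (0, 1))" .
 also have "\<dots> = integral ucube (%e. tden g eps Y (L' e (1, 0)) (L' e (0, 1)) (L e))"
  by (rule integral_cong, rule tden_compose) (use L' L(2) VV(2) in auto)
 finally show ?thesis .
qed

lemma path_integral_compose:
 fixes L :: "real => 'e::euclidean_space"
 assumes "lifts \<gamma> Y" "graded 3 D g" "tubular_points D eps (\<gamma> ` ucube)" "eps > 0"
  and L: "smooth_on UNIV L" "!!e. e \<in> ucube ==> L e \<in> ucube"
  and L': "!!e. e \<in> ucube ==> (L has_derivative L' e) (at e)"
 shows "path_integral g v eps (%e. \<gamma> (L e)) = integral ucube (%e. eden g v eps Y (L' e 1) (L e))"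
proof -
 obtain V where VV: "open V" "ucube \<subseteq> V" "smooth_on V Y" "!!e. e \<in> V ==> Y e ~= 0"
  using assms(1) unfolding lifts_def by metis
 interpret tube V Y eps by standard (use VV assms in auto)
 have "tubular_points D eps ((%e. \<gamma> (L e)) ` ucube)"
  using assms(3) L(2) unfolding tubular_points_def by blast
 from path_integral_eq[OF lifts_compose[OF assms(1) L] assms(2) this assms(4)]
 have "path_integral g v eps (%e. \<gamma> (L e)) = integral ucube (eden g v eps (%e. Y (L e)) 1)" .
 also have "\<dots> = integral ucube (%e. eden g v eps Y (L' e 1) (L e))"
  by (rule integral_cong, rule eden_compose) (use L' L(2) VV(2) in auto)
 finally show ?thesis .
qed

lemma smooth_on_fst: "smooth_on UNIV (fst :: 'a::real_normed_vector \<times> 'b::real_normed_vector => 'a)"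
 by (rule smooth_on_linear[OF open_UNIV bounded_linear_fst])

lemma smooth_on_snd: "smooth_on UNIV (snd :: 'a::real_normed_vector \<times> 'b::real_normed_vector => 'b)"
 by (rule smooth_on_linear[OF open_UNIV bounded_linear_snd])

lemma smooth_on_id: "smooth_on UNIV (%x. x)"
 by (rule smooth_on_linear[OF open_UNIV bounded_linear_ident])

lemma ucube_real: "(ucube :: real set) = {0..1}"
 by (simp add: cbox_interval)

lemma tden_zero: "tden g eps Y 0 b e = 0" "tden g eps Y a 0 e = 0" "eden g v eps Y 0 e = 0"
 if "Y differentiable (at e)" "(%e. normal (Y e)) differentiable (at e)"
proof -
 have "pd 0 Y e = 0" "pd 0 (%e. normal (Y e)) e = 0"
  using that linear_0[OF linear_frechet_derivative] by blast+
 then show "tden g eps Y 0 b e = 0" "tden g eps Y a 0 e = 0" "eden g v eps Y 0 e = 0"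
  by (simp_all add: tden_def eden_def tint_def Omega_zero)
qed

text \<open>One of the two tangent vectors is zero. Collapsed faces of simplices and prisms have
  this form.\<close>

lemma square_integral_degenerate:
 assumes "lifts \<gamma> Y" "graded 4 D g" "tubular_points D eps (\<gamma> ` ucube)" "eps > 0"
 shows "square_integral g eps (%(x, y). \<gamma> x) = 0" "square_integral g eps (%(x, y). \<gamma> y) = 0"
proof -
 obtain V where VV: "open V" "ucube \<subseteq> V" "smooth_on V Y" "!!e. e \<in> V ==> Y e ~= 0"
  using assms(1) unfolding lifts_def by metis
 interpret tube V Y eps by standard (use VV assms in auto)
 have d: "Y differentiable (at e)" "(%e. normal (Y e)) differentiable (at e)" if "e \<in> ucube" for e
  using diff VV(2) that by blast+
 have "square_integral g eps (%e. \<gamma> (fst e)) = integral ucube (%e :: real \<times> real. tden g eps Y (fst (1 :: real, 0 :: real)) (fst (0 :: real, 1 :: real)) (fst e))"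
  by (rule square_integral_compose[OF assms smooth_on_fst, where L' = "%e. fst"])
   (auto simp: ucube_Pair intro: bounded_linear_imp_has_derivative bounded_linear_fst)
 also have "\<dots> = integral ucube (%e :: real \<times> real. 0)"
  by (rule integral_cong) (auto simp: ucube_Pair ucube_real tden_zero d)
 finally show "square_integral g eps (%(x, y). \<gamma> x) = 0" by (simp add: split_def)
 have "square_integral g eps (%e. \<gamma> (snd e)) = integral ucube (%e :: real \<times> real. tden g eps Y (snd (1 :: real, 0 :: real)) (snd (0 :: real, 1 :: real)) (snd e))"
  by (rule square_integral_compose[OF assms smooth_on_snd, where L' = "%e. snd"])
   (auto simp: ucube_Pair intro: bounded_linear_imp_has_derivative bounded_linear_snd)
 also have "\<dots> = integral ucube (%e :: real \<times> real. 0)"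
  by (rule integral_cong) (auto simp: ucube_Pair ucube_real tden_zero d)
 finally show "square_integral g eps (%(x, y). \<gamma> y) = 0" by (simp add: split_def)
qed

lemma lifts_const: "x ~= 0 ==> lifts (%e. pt x) (%e. x)"
 by (rule liftsI[OF open_UNIV subset_UNIV smooth_on_const[OF open_UNIV]]) auto

lemma path_integral_degenerate:
 assumes "x ~= 0" "graded 3 D g" "tubular D eps x" "eps > 0"
  and "tubular_points D eps {pt x}"
 shows "path_integral g v eps (%e. pt x) = 0"
proof -
 have "path_integral g v eps (%e. pt x) = integral ucube (eden g v eps (%e :: real. x) 1)"
  by (rule path_integral_eq[OF lifts_const[OF assms(1)] assms(2) _ assms(4)]) (use assms(5) in \<open>auto simp: tubular_points_def\<close>)
 also have "eden g v eps (%e :: real. x) 1 = (%e. 0)"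
  by (simp add: fun_eq_iff eden_def tint_def Omega_zero frechet_derivative_const)
 finally show ?thesis by simp
qed

lemma averaging_real_prod:
 "averaging (1 :: real, 0 :: 'a::euclidean_space)" "averaging (0 :: 'a::euclidean_space, 1 :: real)"
 "averaging (0 :: real, 1 :: real, 0 :: real)" "averaging (0 :: real, 0 :: real, 1 :: real)"
 by (intro averaging_fst averaging_snd averaging_real)+

theorem cube_stokes:
 fixes \<gamma> :: "real \<times> real \<times> real => point"
 assumes "lifts \<gamma> Y" "graded 4 D g" "tubular_points D eps (\<gamma> ` ucube)" "eps > 0"
 defines "I \<equiv> square_integral g eps"
 shows "(I (%(y, z). \<gamma> (1, y, z)) - I (%(y, z). \<gamma> (0, y, z)))
  - (I (%(x, z). \<gamma> (x, 1, z)) - I (%(x, z). \<gamma> (x, 0, z)))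
  + (I (%(x, y). \<gamma> (x, y, 1)) - I (%(x, y). \<gamma> (x, y, 0))) = 0"
proof -
 obtain V where VV: "open V" "ucube \<subseteq> V" "smooth_on V Y" "!!e. e \<in> V ==> Y e ~= 0"
  using assms(1) unfolding lifts_def by metis
 interpret tube_form V Y eps D g 4
  by standard (use VV assms tubular_lift[OF assms(3,1)] in auto)
 let ?b1 = "(1, 0, 0) :: real \<times> real \<times> real" and ?b2 = "(0, 1, 0) :: real \<times> real \<times> real" and ?b3 = "(0, 0, 1) :: real \<times> real \<times> real"
 have av: "averaging ?b1" "averaging ?b2" "averaging ?b3"
  using averaging_real_prod(1)[where 'a="real \<times> real"] averaging_real_prod(3,4) by (simp_all add: zero_prod_def)
 have face: "I (%e. \<gamma> (c + L e)) = integral ucube (%e. tden g eps Y (L (1, 0)) (L (0, 1)) (c + L e))"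
  if "bounded_linear L" "!!e. e \<in> ucube ==> c + L e \<in> ucube" for c L
  unfolding I_def
  by (rule square_integral_compose[OF assms(1-4) _ that(2), where L' = "%e. L"])
   (use has_derivative_add[OF has_derivative_const bounded_linear_imp_has_derivative[OF that(1)]] in \<open>simp_all add:
    smooth_on_add[OF open_UNIV smooth_on_const[OF open_UNIV] smooth_on_linear[OF open_UNIV that(1)]]\<close>)
 have cont: "continuous_on ucube (%e. tden g eps Y a b (c + L e))"
  if "bounded_linear L" "!!e. e \<in> ucube ==> c + L e \<in> ucube" for a b c and L :: "real \<times> real => real \<times> real \<times> real"
  by (rule continuous_on_compose2[OF continuous_tden])
   (use that continuous_on_add[OF continuous_on_const linear_continuous_on[OF that(1)]] in auto)
 have 1: "I (%(y, z). \<gamma> (s, y, z)) = integral ucube (%e. tden g eps Y ?b2 ?b3 (upd ?b1 s e))" if s: "s \<in> {0..1}" for s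
 proof -
  let ?L = "%e :: real \<times> real. (0 :: real, e)" and ?c = "(s, 0) :: real \<times> real \<times> real"
  have L: "bounded_linear ?L" "!!e. e \<in> ucube ==> ?c + ?L e \<in> ucube"
   using s by (auto intro: bounded_linear_Pair bounded_linear_zero bounded_linear_ident simp: ucube_Pair ucube_real)
  have "(%e. tden g eps Y ?b2 ?b3 (upd ?b1 s e)) = (%p. tden g eps Y ?b2 ?b3 (?c + ?L (snd p)))"
   by (auto simp: fun_eq_iff upd_def)
  then show ?thesis
   using face[OF L] integral_ucube_first[OF cont[OF L, of ?b2 ?b3], where 'a=real] by (simp add: split_def)
 qed
 have 2: "I (%(x, z). \<gamma> (x, s, z)) = integral ucube (%e. tden g eps Y ?b1 ?b3 (upd ?b2 s e))" if s: "s \<in> {0..1}" for s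
 proof -
  let ?L = "%e :: real \<times> real. (fst e, 0 :: real, snd e)" and ?c = "(0, s, 0) :: real \<times> real \<times> real"
  have L: "bounded_linear ?L" "!!e. e \<in> ucube ==> ?c + ?L e \<in> ucube"
   using s by (auto intro!: bounded_linear_Pair bounded_linear_zero bounded_linear_fst bounded_linear_snd simp: ucube_Pair ucube_real)
  have "(%e. tden g eps Y ?b1 ?b3 (upd ?b2 s e)) = (%p. tden g eps Y ?b1 ?b3 (?c + ?L (fst p, snd (snd p))))"
   by (auto simp: fun_eq_iff upd_def)
  then show ?thesis
   using face[OF L] integral_ucube_middle[OF cont[OF L, of ?b1 ?b3], where 'b=real] by (simp add: split_def)
 qed
 have 3: "I (%(x, y). \<gamma> (x, y, s)) = integral ucube (%e. tden g eps Y ?b1 ?b2 (upd ?b3 s e))" if s: "s \<in> {0..1}" for s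
 proof -
  let ?L = "%e :: real \<times> real. (fst e, snd e, 0 :: real)" and ?c = "(0, 0, s) :: real \<times> real \<times> real"
  have L: "bounded_linear ?L" "!!e. e \<in> ucube ==> ?c + ?L e \<in> ucube"
   using s by (auto intro!: bounded_linear_Pair bounded_linear_zero bounded_linear_fst bounded_linear_snd simp: ucube_Pair ucube_real)
  have "(%e. tden g eps Y ?b1 ?b2 (upd ?b3 s e)) = (%p. tden g eps Y ?b1 ?b2 (?c + ?L (fst p, fst (snd p))))"
   by (auto simp: fun_eq_iff upd_def)
  then show ?thesis
   using face[OF L] integral_ucube_last[OF cont[OF L, of ?b1 ?b2], where 'c=real] by (simp add: split_def)
 qed
 show ?thesis
  using stokes_closed[OF refl av] by (simp add: 1 2 3)
qed

theorem square_stokes: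
 fixes \<gamma> :: "real \<times> real => point"
 assumes "lifts \<gamma> Y" "graded 3 D g" "graded 4 D h" "tubular_points D eps (\<gamma> ` ucube)" "eps > 0"
  and h: "!!x. x \<in> D ==> h x = pd v g x"
 defines "I \<equiv> path_integral g v eps"
 shows "square_integral h eps \<gamma> = (I (%y. \<gamma> (1, y)) - I (%y. \<gamma> (0, y))) - (I (%x. \<gamma> (x, 1)) - I (%x. \<gamma> (x, 0)))"
proof -
 obtain V where VV: "open V" "ucube \<subseteq> V" "smooth_on V Y" "!!e. e \<in> V ==> Y e ~= 0"
  using assms(1) unfolding lifts_def by metis
 interpret tube_form V Y eps D g 3
  by standard (use VV assms tubular_lift[OF assms(4,1)] in auto)
 let ?b1 = "(1, 0) :: real \<times> real" and ?b2 = "(0, 1) :: real \<times> real"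
 have av: "averaging ?b1" "averaging ?b2"
  using averaging_real_prod(1,2)[where 'a=real] by simp_all
 have face: "I (%e. \<gamma> (c + L e)) = integral ucube (%e. eden g v eps Y (L 1) (c + L e))"
  if "bounded_linear L" "!!e. e \<in> ucube ==> c + L e \<in> ucube" for c L
  unfolding I_def
  by (rule path_integral_compose[OF assms(1,2,4,5) _ that(2), where L' = "%e. L"])
   (use has_derivative_add[OF has_derivative_const bounded_linear_imp_has_derivative[OF that(1)]] in \<open>simp_all add:
    smooth_on_add[OF open_UNIV smooth_on_const[OF open_UNIV] smooth_on_linear[OF open_UNIV that(1)]]\<close>)
 have cont: "continuous_on ucube (%e. eden g v eps Y a (c + L e))"
  if "bounded_linear L" "!!e. e \<in> ucube ==> c + L e \<in> ucube" for a c and L :: "real => real \<times> real"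
  by (rule continuous_on_compose2[OF continuous_eden])
   (use that continuous_on_add[OF continuous_on_const linear_continuous_on[OF that(1)]] in auto)
 have 1: "I (%y. \<gamma> (s, y)) = integral ucube (%e. eden g v eps Y ?b2 (upd ?b1 s e))" if s: "s \<in> {0..1}" for s
 proof -
  let ?L = "%e :: real. (0 :: real, e)" and ?c = "(s, 0) :: real \<times> real"
  have L: "bounded_linear ?L" "!!e. e \<in> ucube ==> ?c + ?L e \<in> ucube"
   using s by (auto intro: bounded_linear_Pair bounded_linear_zero bounded_linear_ident simp: ucube_Pair ucube_real)
  have "(%e. eden g v eps Y ?b2 (upd ?b1 s e)) = (%p. eden g v eps Y ?b2 (?c + ?L (snd p)))"
   by (auto simp: fun_eq_iff upd_def)
  then show ?thesis
   using face[OF L] integral_ucube_first[OF cont[OF L, of ?b2], where 'a=real] by simp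
 qed
 have 2: "I (%x. \<gamma> (x, s)) = integral ucube (%e. eden g v eps Y ?b1 (upd ?b2 s e))" if s: "s \<in> {0..1}" for s
 proof -
  let ?L = "%e :: real. (e, 0 :: real)" and ?c = "(0, s) :: real \<times> real"
  have L: "bounded_linear ?L" "!!e. e \<in> ucube ==> ?c + ?L e \<in> ucube"
   using s by (auto intro: bounded_linear_Pair bounded_linear_zero bounded_linear_ident simp: ucube_Pair ucube_real)
  have "(%e. eden g v eps Y ?b1 (upd ?b2 s e)) = (%p. eden g v eps Y ?b1 (?c + ?L (fst p)))"
   by (auto simp: fun_eq_iff upd_def)
  then show ?thesis
   using face[OF L] integral_ucube_second[OF cont[OF L, of ?b1], where 'b=real] by simp
 qed
 show ?thesis
  unfolding square_integral_eq[OF assms(1,3-5)]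
  using stokes_exact[OF refl av h] by (simp add: 1 2)
qed

section \<open>Rational chains\<close>

definition chain_sum :: "(((nat => real) => point) => complex) => qchain => complex" where
 "chain_sum B c = (\<Sum>\<sigma>\<in>Poly_Mapping.keys c. of_rat (Poly_Mapping.lookup c \<sigma>) * B \<sigma>)"

lemma chain_sum_superset:
 assumes "finite A" "Poly_Mapping.keys c \<subseteq> A"
 shows "chain_sum B c = (\<Sum>\<sigma>\<in>A. of_rat (Poly_Mapping.lookup c \<sigma>) * B \<sigma>)"
 unfolding chain_sum_def
 by (rule sum.mono_neutral_left[OF assms]) (simp add: in_keys_iff)

lemma chain_sum_add: "chain_sum B (c + c') = chain_sum B c + chain_sum B c'"
proof -
 let ?A = "Poly_Mapping.keys c \<union> Poly_Mapping.keys c'"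
 have "chain_sum B (c + c') = (\<Sum>\<sigma>\<in>?A. of_rat (Poly_Mapping.lookup (c + c') \<sigma>) * B \<sigma>)"
  by (rule chain_sum_superset) (auto dest: subsetD[OF Poly_Mapping.keys_add])
 also have "\<dots> = (\<Sum>\<sigma>\<in>?A. of_rat (Poly_Mapping.lookup c \<sigma>) * B \<sigma>) + (\<Sum>\<sigma>\<in>?A. of_rat (Poly_Mapping.lookup c' \<sigma>) * B \<sigma>)"
  by (simp add: lookup_add of_rat_add algebra_simps sum.distrib)
 also have "\<dots> = chain_sum B c + chain_sum B c'"
  by (simp add: chain_sum_superset[of ?A])
 finally show ?thesis .
qed

lemma chain_sum_0: "chain_sum B 0 = 0"
 by (simp add: chain_sum_def)

lemma chain_sum_uminus: "chain_sum B (- c) = - chain_sum B c"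
 using chain_sum_add[of B c "- c"] by (simp add: chain_sum_0 add_eq_0_iff)

lemma chain_sum_diff: "chain_sum B (c - c') = chain_sum B c - chain_sum B c'"
 using chain_sum_add[of B c "- c'"] by (simp add: chain_sum_uminus)

lemma chain_sum_single: "chain_sum B (Poly_Mapping.single \<sigma> r) = of_rat r * B \<sigma>"
 by (cases "r = 0") (simp_all add: chain_sum_def)

lemma chain_sum_sum: "chain_sum B (\<Sum>i\<in>I. f i) = (\<Sum>i\<in>I. chain_sum B (f i))"
 by (induction I rule: infinite_finite_induct) (simp_all add: chain_sum_0 chain_sum_add)

lemma lookup_qchain_scale: "Poly_Mapping.lookup (qchain_scale r c) \<sigma> = r * Poly_Mapping.lookup c \<sigma>"
 unfolding qchain_scale_def by (transfer) (simp add: when_def)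

lemma chain_sum_scale: "chain_sum B (qchain_scale r c) = of_rat r * chain_sum B c"
proof -
 have "Poly_Mapping.keys (qchain_scale r c) \<subseteq> Poly_Mapping.keys c"
  by (auto simp: in_keys_iff lookup_qchain_scale)
 from chain_sum_superset[OF _ this] show ?thesis
  by (simp add: lookup_qchain_scale chain_sum_def sum_distrib_left of_rat_mult mult_ac)
qed

lemma chain_sum_cong:
 "(!!\<sigma>. \<sigma> \<in> Poly_Mapping.keys c ==> B \<sigma> = B' \<sigma>) ==> chain_sum B c = chain_sum B' c"
 unfolding chain_sum_def by (rule sum.cong) auto

lemma chain_sum_boundary:
 "chain_sum B (qchain_boundary p c) = chain_sum (%\<sigma>. \<Sum>k\<le>p. (- 1) ^ k * B (singular_face p k \<sigma>)) c"
 unfolding qchain_boundary_def chain_sum_sum chain_sum_single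
 unfolding chain_sum_def
 by (simp add: sum_distrib_left of_rat_mult of_rat_power of_rat_minus mult_ac)

lemma chain_sum_diff_fun: "chain_sum (%\<sigma>. B \<sigma> - B' \<sigma>) c = chain_sum B c - chain_sum B' c"
 unfolding chain_sum_def by (simp add: right_diff_distrib sum_subtractf)

lemma chain_sum_uminus_fun: "chain_sum (%\<sigma>. - B \<sigma>) c = - chain_sum B c"
 unfolding chain_sum_def by (simp add: sum_negf)

lemma chain_sum_map:
 "chain_sum B (qchain_map p g c) = chain_sum (%\<sigma>. B (simplex_map p g \<sigma>)) c"
 unfolding qchain_map_def chain_sum_sum chain_sum_single unfolding chain_sum_def ..

text \<open>Indicator functions recover the coefficients, so identities between chains can be
  checked on sums over simplices.\<close>

lemma poly_mapping_eqI_chain_sum: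
 assumes "!!B. chain_sum B c = chain_sum B c'"
 shows "c = c'"
proof (rule poly_mapping_eqI)
 fix \<sigma>
 have *: "chain_sum (%\<tau>. if \<tau> = \<sigma> then 1 else 0) c = of_rat (Poly_Mapping.lookup c \<sigma>)" for c
  by (simp add: chain_sum_def if_distrib sum.If_cases in_keys_iff cong: if_cong)
 show "Poly_Mapping.lookup c \<sigma> = Poly_Mapping.lookup c' \<sigma>"
  using assms[of "%\<tau>. if \<tau> = \<sigma> then 1 else 0"] by (simp add: *)
qed

lemma qchain_boundary_add: "qchain_boundary p (c + c') = qchain_boundary p c + qchain_boundary p c'"
 by (rule poly_mapping_eqI_chain_sum)
  (simp add: chain_sum_add chain_sum_boundary)

lemma qchain_boundary_scale: "qchain_boundary p (qchain_scale r c) = qchain_scale r (qchain_boundary p c)"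
 by (rule poly_mapping_eqI_chain_sum)
  (simp add: chain_sum_scale chain_sum_boundary)

lemma qchain_boundary_map:
 assumes "1 \<le> p"
 shows "qchain_boundary p (qchain_map p g c) = qchain_map (p - 1) g (qchain_boundary p c)"
proof (rule poly_mapping_eqI_chain_sum)
 fix B
 have "singular_face p k (simplex_map p g \<sigma>) = simplex_map (p - 1) g (singular_face p k \<sigma>)" if "k \<le> p" for \<sigma> k
  using singular_face_simplex_map[OF assms that, of g \<sigma>]
  by (simp add: singular_face_def simplex_map_def o_def restrict_def fun_eq_iff)
 then show "chain_sum B (qchain_boundary p (qchain_map p g c)) = chain_sum B (qchain_map (p - 1) g (qchain_boundary p c))"
  unfolding chain_sum_map chain_sum_boundary by (intro chain_sum_cong sum.cong) auto
qed

section \<open>Simplices as degenerate cubes\<close>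

definition bary1 :: "real => nat => real" where
 "bary1 a = (%i. if i = 0 then 1 - a else if i = 1 then a else 0)"

definition bary2 :: "real \<times> real => nat => real" where
 "bary2 = (%(a, b) i. if i = 0 then 1 - a - b else if i = 1 then a else if i = 2 then b else 0)"

definition bary3 :: "real \<times> real \<times> real => nat => real" where
 "bary3 = (%(a, b, c) i. if i = 0 then 1 - a - b - c else if i = 1 then a else if i = 2 then b else if i = 3 then c else 0)"

text \<open>Collapses the edge y = 1 of the square to a vertex; the other three edges become the
  sides of the triangle.\<close>

definition q2 :: "real \<times> real => real \<times> real" where
 "q2 = (%(x, y). ((1 - y) * x, y))"

text \<open>The iterated collapse: the face y = 1 becomes an edge and z = 1 a vertex of the
  tetrahedron, while the remaining four faces of the cube become its faces.\<close>

definition q3 :: "real \<times> real \<times> real => real \<times> real \<times> real" where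
 "q3 = (%(x, y, z). ((1 - z) * ((1 - y) * x), (1 - z) * y, z))"

abbreviation tri :: "((nat => real) => point) => real \<times> real => point" where
 "tri \<sigma> e \<equiv> \<sigma> (bary2 (q2 e))"

lemma bary_in_simplex:
 "0 \<le> a ==> a \<le> 1 ==> bary1 a \<in> standard_simplex 1"
 "0 \<le> a ==> 0 \<le> b ==> a + b \<le> 1 ==> bary2 (a, b) \<in> standard_simplex 2"
 "0 \<le> a ==> 0 \<le> b ==> 0 \<le> c ==> a + b + c \<le> 1 ==> bary3 (a, b, c) \<in> standard_simplex 3"
 by (auto simp: standard_simplex_def bary1_def bary2_def bary3_def eval_nat_numeral)

lemma q2_bounds:
 fixes x y :: real
 assumes "(x, y) \<in> ucube"
 shows "0 \<le> (1 - y) * x" "0 \<le> y" "(1 - y) * x + y \<le> 1"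
proof -
 have xy: "0 \<le> x" "x \<le> 1" "0 \<le> y" "y \<le> 1"
  using assms by (auto simp: ucube_Pair ucube_real)
 then show "0 \<le> (1 - y) * x" "0 \<le> y" by auto
 have "(1 - y) * x \<le> (1 - y) * 1" by (rule mult_left_mono) (use xy in auto)
 then show "(1 - y) * x + y \<le> 1" by simp
qed

lemma bary2_q2: "e \<in> ucube ==> bary2 (q2 e) \<in> standard_simplex 2"
 using q2_bounds bary_in_simplex(2) by (cases e) (auto simp: q2_def)

lemma bary3_q3:
 assumes "e \<in> ucube"
 shows "bary3 (q3 e) \<in> standard_simplex 3"
proof -
 obtain x y z where e: "e = (x, y, z)" by (cases e)
 have z: "0 \<le> z" "z \<le> 1" and xy: "(x, y) \<in> ucube"
  using assms by (auto simp: e ucube_Pair ucube_real)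
 have "(1 - z) * ((1 - y) * x + y) \<le> (1 - z) * 1"
  by (rule mult_left_mono) (use q2_bounds[OF xy] z in auto)
 then show ?thesis
  unfolding e q3_def split_conv
  by (intro bary_in_simplex(3)) (use q2_bounds[OF xy] z in \<open>auto simp: distrib_left mult.assoc\<close>)
qed

lemma faces_2:
 assumes "0 \<le> a" "a \<le> 1"
 shows "singular_face 2 0 \<sigma> (bary1 a) = tri \<sigma> (1, a)"
  "singular_face 2 1 \<sigma> (bary1 a) = tri \<sigma> (0, a)"
  "singular_face 2 2 \<sigma> (bary1 a) = tri \<sigma> (a, 0)"
proof -
 have "simplical_face 0 (bary1 a) = bary2 (q2 (1, a))" "simplical_face 1 (bary1 a) = bary2 (q2 (0, a))"
  "simplical_face 2 (bary1 a) = bary2 (q2 (a, 0))"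
  by (auto simp: simplical_face_def bary1_def bary2_def q2_def fun_eq_iff)
 then show "singular_face 2 0 \<sigma> (bary1 a) = tri \<sigma> (1, a)"
  "singular_face 2 1 \<sigma> (bary1 a) = tri \<sigma> (0, a)"
  "singular_face 2 2 \<sigma> (bary1 a) = tri \<sigma> (a, 0)"
  using bary_in_simplex(1)[OF assms] by (simp_all add: singular_face_def)
qed

text \<open>Once the collapsed faces y = 1 and z = 1 contribute 0, the boundary of the cube reads (x
  = 1) - (x = 0) + (y = 0) - (z = 0), which is the alternating sum over the faces 0, 1, 2,
  3.\<close>

lemma faces_3:
 assumes "(x, y) \<in> ucube"
 shows "tri (singular_face 3 0 \<sigma>) (x, y) = \<sigma> (bary3 (q3 (1, x, y)))"
  "tri (singular_face 3 1 \<sigma>) (x, y) = \<sigma> (bary3 (q3 (0, x, y)))"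
  "tri (singular_face 3 2 \<sigma>) (x, y) = \<sigma> (bary3 (q3 (x, 0, y)))"
  "tri (singular_face 3 3 \<sigma>) (x, y) = \<sigma> (bary3 (q3 (x, y, 0)))"
proof -
 have "simplical_face 0 (bary2 (q2 (x, y))) = bary3 (q3 (1, x, y))"
  "simplical_face 1 (bary2 (q2 (x, y))) = bary3 (q3 (0, x, y))"
  "simplical_face 2 (bary2 (q2 (x, y))) = bary3 (q3 (x, 0, y))"
  "simplical_face 3 (bary2 (q2 (x, y))) = bary3 (q3 (x, y, 0))"
  by (auto simp: simplical_face_def bary2_def bary3_def q2_def q3_def fun_eq_iff algebra_simps)
 then show "tri (singular_face 3 0 \<sigma>) (x, y) = \<sigma> (bary3 (q3 (1, x, y)))"
  "tri (singular_face 3 1 \<sigma>) (x, y) = \<sigma> (bary3 (q3 (0, x, y)))"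
  "tri (singular_face 3 2 \<sigma>) (x, y) = \<sigma> (bary3 (q3 (x, 0, y)))"
  "tri (singular_face 3 3 \<sigma>) (x, y) = \<sigma> (bary3 (q3 (x, y, 0)))"
  using bary2_q2[OF assms] by (simp_all add: singular_face_def numeral_2_eq_2)
qed

lemma smooth_on_q2: "smooth_on UNIV q2"
proof -
 have "q2 = (%e. ((1 - snd e) * fst e, snd e))" by (auto simp: q2_def fun_eq_iff)
 moreover have "smooth_on UNIV (%e :: real \<times> real. ((1 - snd e) * fst e, snd e))"
  by (intro smooth_on_Pair smooth_on_mult smooth_on_diff smooth_on_const smooth_on_fst smooth_on_snd open_UNIV)
 ultimately show ?thesis by simp
qed

lemma smooth_on_q3: "smooth_on UNIV q3"
proof -
 have f: "smooth_on UNIV (%e :: real \<times> real \<times> real. fst e)" "smooth_on UNIV (%e :: real \<times> real \<times> real. fst (snd e))"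
   "smooth_on UNIV (%e :: real \<times> real \<times> real. snd (snd e))"
  by (auto intro!: smooth_on_linear bounded_linear_fst bounded_linear_snd
     bounded_linear_compose[OF bounded_linear_fst] bounded_linear_compose[OF bounded_linear_snd])
 have "q3 = (%e. ((1 - snd (snd e)) * ((1 - fst (snd e)) * fst e), (1 - snd (snd e)) * fst (snd e), snd (snd e)))"
  by (auto simp: q3_def fun_eq_iff)
 moreover have "smooth_on UNIV (%e :: real \<times> real \<times> real. ((1 - snd (snd e)) * ((1 - fst (snd e)) * fst e), (1 - snd (snd e)) * fst (snd e), snd (snd e)))"
  by (intro smooth_on_Pair smooth_on_mult smooth_on_diff smooth_on_const f open_UNIV)
 ultimately show ?thesis by simp
qed

lemma lifts_smooth_lift:
 fixes q :: "'e::euclidean_space => real \<times> real \<times> real"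
 assumes "smooth_lift p \<sigma> G" "smooth_on UNIV q" "!!e. e \<in> ucube ==> b e \<in> standard_simplex p"
  and "!!e. e \<in> ucube ==> q e = (b e 1, b e 2, b e 3)"
 shows "lifts (%e. \<sigma> (b e)) (%e. G (q e))"
proof -
 obtain W where W: "open W" "smooth_on W G"
  "!!x. x \<in> standard_simplex p ==> (x 1, x 2, x 3) \<in> W & G (x 1, x 2, x 3) ~= 0 & \<sigma> x = pt (G (x 1, x 2, x 3))"
  using assms(1) unfolding smooth_lift_def by metis
 have op: "open (q -` W)"
  using continuous_open_preimage[OF smooth_on_continuous[OF assms(2)] open_UNIV W(1)] by simp
 show ?thesis
 proof (rule liftsI[OF op])
  show "smooth_on (q -` W) (%e. G (q e))"
   by (rule smooth_on_compose[OF op W(1) smooth_on_subset[OF assms(2)] W(2)]) auto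
 qed (use W(3) assms(3,4) in auto)
qed

lemma lifts_tri:
 assumes "smooth_lift 2 \<sigma> G"
 shows "lifts (tri \<sigma>) (%e. G (fst (q2 e), snd (q2 e), 0))"
proof (rule lifts_smooth_lift[OF assms _ bary2_q2])
 show "smooth_on UNIV (%e. (fst (q2 e), snd (q2 e), 0 :: real))"
  by (intro smooth_on_Pair smooth_on_const open_UNIV smooth_on_compose[OF open_UNIV open_UNIV smooth_on_q2]
   smooth_on_fst smooth_on_snd) auto
qed (auto simp: bary2_def split_def)

lemma lifts_tet:
 assumes "smooth_lift 3 \<sigma> G"
 shows "lifts (%e. \<sigma> (bary3 (q3 e))) (%e. G (q3 e))"
 by (rule lifts_smooth_lift[OF assms smooth_on_q3 bary3_q3]) (auto simp: bary3_def split_def)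

lemma tubular_points_subset: "tubular_points D eps X ==> Y \<subseteq> X ==> tubular_points D eps Y"
 unfolding tubular_points_def by blast

lemma square_integral_cong':
 assumes "!!e. e \<in> ucube ==> \<gamma> e = \<gamma>' e"
 shows "square_integral g eps \<gamma> = square_integral g eps \<gamma>'"
proof -
 have "lifts \<gamma> = lifts \<gamma>'" using assms by (simp add: lifts_def fun_eq_iff)
 then show ?thesis by (simp add: square_integral_def)
qed

lemma path_integral_cong:
 assumes "!!e. e \<in> ucube ==> \<gamma> e = \<gamma>' e"
 shows "path_integral g v eps \<gamma> = path_integral g v eps \<gamma>'"
proof -
 have "lifts \<gamma> = lifts \<gamma>'" using assms by (simp add: lifts_def fun_eq_iff)
 then show ?thesis by (simp add: path_integral_def)
qed

section \<open>Stokes' theorem for tubes over chains\<close>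

definition tube_integral :: "(complex ^ 4 => complex) => real => qchain => complex" where
 "tube_integral g eps = chain_sum (%\<sigma>. square_integral g eps (tri \<sigma>))"

lemma sum_atMost_2_3:
 "(\<Sum>k\<le>2. h k) = h 0 + h 1 + h (2 :: nat)" "(\<Sum>k\<le>3. h k) = h 0 + h 1 + h 2 + h (3 :: nat)"
 for h :: "nat => complex"
 by (simp_all add: eval_nat_numeral)

lemma affine_smooth:
 "smooth_on UNIV (%e :: real. (a, b, e) :: real \<times> real \<times> real)"
 by (intro smooth_on_Pair smooth_on_const smooth_on_id open_UNIV)

theorem tube_integral_boundary:
 assumes "smooth_chain 3 X c" "graded 4 D g" "tubular_points D eps X" "eps > 0"
 shows "tube_integral g eps (qchain_boundary 3 c) = 0"
 unfolding tube_integral_def chain_sum_boundary unfolding chain_sum_def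
proof (intro sum.neutral ballI)
 fix \<sigma> assume "\<sigma> \<in> Poly_Mapping.keys c"
 then obtain G where G: "smooth_lift 3 \<sigma> G" and X: "\<sigma> ` standard_simplex 3 \<subseteq> X"
  using assms(1) by (auto simp: smooth_chain_def smooth_simplex_def)
 let ?\<gamma> = "%e. \<sigma> (bary3 (q3 e))" and ?I = "square_integral g eps"
 have t: "tubular_points D eps (?\<gamma> ` ucube)"
  by (rule tubular_points_subset[OF assms(3)]) (use X bary3_q3 in auto)
 have st: "(?I (%(y, z). ?\<gamma> (1, y, z)) - ?I (%(y, z). ?\<gamma> (0, y, z)))
  - (?I (%(x, z). ?\<gamma> (x, 1, z)) - ?I (%(x, z). ?\<gamma> (x, 0, z)))
  + (?I (%(x, y). ?\<gamma> (x, y, 1)) - ?I (%(x, y). ?\<gamma> (x, y, 0))) = 0"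
  by (rule cube_stokes[OF lifts_tet[OF G] assms(2) t assms(4)])
 have "lifts (%z. ?\<gamma> (0, 1, z)) (%z. G (q3 (0, 1, z)))"
  by (rule lifts_compose[OF lifts_tet[OF G] affine_smooth]) (auto simp: ucube_Pair ucube_real)
 moreover have "tubular_points D eps ((%z. ?\<gamma> (0, 1, z)) ` ucube)"
  by (rule tubular_points_subset[OF t]) (auto simp: ucube_Pair ucube_real)
 ultimately have "?I (%(x, z). ?\<gamma> (0, 1, z)) = 0"
  by (rule square_integral_degenerate(2)[OF _ assms(2) _ assms(4)])
 moreover have "(%(x, z). ?\<gamma> (x, 1, z)) = (%(x, z). ?\<gamma> (0, 1, z))"
  by (auto simp: q3_def)
 ultimately have d1: "?I (%(x, z). ?\<gamma> (x, 1, z)) = 0" by simp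
 have "lifts (%z :: real. ?\<gamma> (0, 0, 1)) (%z. G (q3 (0, 0, 1)))"
  using lifts_compose[OF lifts_tet[OF G], of "%z :: real. (0, 0, 1)"] smooth_on_const[OF open_UNIV]
  by (auto simp: ucube_Pair ucube_real)
 moreover have "tubular_points D eps ((%z :: real. ?\<gamma> (0, 0, 1)) ` ucube)"
  by (rule tubular_points_subset[OF t]) (auto simp: ucube_Pair ucube_real)
 ultimately have "?I (%(x, z). ?\<gamma> (0, 0, 1)) = 0"
  by (rule square_integral_degenerate(2)[OF _ assms(2) _ assms(4)])
 moreover have "(%(x, z). ?\<gamma> (x, z, 1)) = (%(x, z). ?\<gamma> (0, 0, 1))"
  by (auto simp: q3_def)
 ultimately have d2: "?I (%(x, y). ?\<gamma> (x, y, 1)) = 0" by simp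
 have f: "?I (tri (singular_face 3 0 \<sigma>)) = ?I (%(y, z). ?\<gamma> (1, y, z))"
  "?I (tri (singular_face 3 1 \<sigma>)) = ?I (%(y, z). ?\<gamma> (0, y, z))"
  "?I (tri (singular_face 3 2 \<sigma>)) = ?I (%(x, z). ?\<gamma> (x, 0, z))"
  "?I (tri (singular_face 3 3 \<sigma>)) = ?I (%(x, y). ?\<gamma> (x, y, 0))"
  using faces_3 by (auto intro!: square_integral_cong')
 have "(\<Sum>k\<le>3. (- 1) ^ k * ?I (tri (singular_face 3 k \<sigma>))) = 0"
  using st unfolding sum_atMost_2_3 f d1 d2 by simp
 then show "of_rat (Poly_Mapping.lookup c \<sigma>) * (\<Sum>k\<le>3. (- 1) ^ k * ?I (tri (singular_face 3 k \<sigma>))) = 0"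
  by simp
qed

text \<open>A prism over each simplex, with time as the third coordinate of the cube.
  \<open>F\<close> acts on points, so a shared edge sweeps out the same square in every simplex that
  contains it; hence the sides of the prisms define a function of 1-simplices, and they cancel over
  a cycle.\<close>

theorem tube_integral_homotopy:
 fixes F :: "real => point => point"
 assumes "qchain_boundary 2 c = 0" "graded 4 D g" "tubular_points D eps X" "eps > 0"
  and lift: "!!\<sigma>. \<sigma> \<in> Poly_Mapping.keys c ==> \<exists>Y. lifts (%(x, y, s). F s (tri \<sigma> (x, y))) Y"
  and X: "!!\<sigma> x y s. \<sigma> \<in> Poly_Mapping.keys c ==> (x, y, s) \<in> ucube ==> F s (tri \<sigma> (x, y)) \<in> X"
 shows "chain_sum (%\<sigma>. square_integral g eps (%e. F 1 (tri \<sigma> e))) c =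
  chain_sum (%\<sigma>. square_integral g eps (%e. F 0 (tri \<sigma> e))) c"
proof -
 let ?I = "square_integral g eps"
 define B where "B = (%\<tau>. ?I (%(x, s). F s (\<tau> (bary1 x))))"
 have *: "?I (%e. F 1 (tri \<sigma> e)) - ?I (%e. F 0 (tri \<sigma> e)) = - (\<Sum>k\<le>2. (- 1) ^ k * B (singular_face 2 k \<sigma>))"
  if \<sigma>: "\<sigma> \<in> Poly_Mapping.keys c" for \<sigma>
 proof -
  let ?\<gamma> = "%(x, y, s). F s (tri \<sigma> (x, y))"
  obtain Y where L: "lifts ?\<gamma> Y" using lift[OF \<sigma>] by blast
  have t: "tubular_points D eps (?\<gamma> ` ucube)"
   by (rule tubular_points_subset[OF assms(3)]) (use X[OF \<sigma>] in auto)
  have st: "(?I (%(y, z). ?\<gamma> (1, y, z)) - ?I (%(y, z). ?\<gamma> (0, y, z)))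
   - (?I (%(x, z). ?\<gamma> (x, 1, z)) - ?I (%(x, z). ?\<gamma> (x, 0, z)))
   + (?I (%(x, y). ?\<gamma> (x, y, 1)) - ?I (%(x, y). ?\<gamma> (x, y, 0))) = 0"
   by (rule cube_stokes[OF L assms(2) t assms(4)])
  have "lifts (%z. ?\<gamma> (0, 1, z)) (%z. Y (0, 1, z))"
   by (rule lifts_compose[OF L affine_smooth]) (auto simp: ucube_Pair ucube_real)
  moreover have "tubular_points D eps ((%z. ?\<gamma> (0, 1, z)) ` ucube)"
   by (rule tubular_points_subset[OF t]) (force simp: ucube_Pair ucube_real)
  ultimately have "?I (%(x, z). ?\<gamma> (0, 1, z)) = 0"
   by (rule square_integral_degenerate(2)[OF _ assms(2) _ assms(4)])
  moreover have "(%(x, z). ?\<gamma> (x, 1, z)) = (%(x, z). ?\<gamma> (0, 1, z))"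
   by (auto simp: q2_def)
  ultimately have d1: "?I (%(x, z). ?\<gamma> (x, 1, z)) = 0" by simp
  have f: "B (singular_face 2 0 \<sigma>) = ?I (%(y, z). ?\<gamma> (1, y, z))"
   "B (singular_face 2 1 \<sigma>) = ?I (%(y, z). ?\<gamma> (0, y, z))"
   "B (singular_face 2 2 \<sigma>) = ?I (%(x, z). ?\<gamma> (x, 0, z))"
   unfolding B_def using faces_2 by (auto intro!: square_integral_cong' simp: ucube_Pair ucube_real)
  have e: "?I (%(x, y). ?\<gamma> (x, y, s)) = ?I (%e. F s (tri \<sigma> e))" for s
   by (rule square_integral_cong') auto
  show ?thesis
   using st unfolding d1 e f(1,2)[symmetric] f(3)[symmetric]
   unfolding sum_atMost_2_3 by (simp add: algebra_simps)
 qed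
 have "chain_sum (%\<sigma>. ?I (%e. F 1 (tri \<sigma> e))) c - chain_sum (%\<sigma>. ?I (%e. F 0 (tri \<sigma> e))) c
   = - chain_sum B (qchain_boundary 2 c)"
  unfolding chain_sum_boundary chain_sum_diff_fun[symmetric] chain_sum_uminus_fun[symmetric]
  by (rule chain_sum_cong, rule *)
 then show ?thesis by (simp add: assms(1) chain_sum_0)
qed

text \<open>On each simplex Stokes leaves a function of its edges, and the boundary of a cycle
  vanishes.\<close>

theorem tube_integral_exact:
 assumes "cycle2 X c" "graded 3 D g" "graded 4 D h" "tubular_points D eps X" "eps > 0"
  and h: "!!x. x \<in> D ==> h x = pd v g x"
 shows "tube_integral h eps c = 0"
proof -
 let ?I = "path_integral g v eps"
 define B where "B = (%\<tau>. ?I (%x. \<tau> (bary1 x)))"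
 have *: "square_integral h eps (tri \<sigma>) = (\<Sum>k\<le>2. (- 1) ^ k * B (singular_face 2 k \<sigma>))"
  if \<sigma>: "\<sigma> \<in> Poly_Mapping.keys c" for \<sigma>
 proof -
  obtain G where G: "smooth_lift 2 \<sigma> G" and X: "\<sigma> ` standard_simplex 2 \<subseteq> X"
   using assms(1) \<sigma> by (auto simp: cycle2_def smooth_chain_def smooth_simplex_def)
  have t: "tubular_points D eps (tri \<sigma> ` ucube)"
   by (rule tubular_points_subset[OF assms(4)]) (use X bary2_q2 in auto)
  have st: "square_integral h eps (tri \<sigma>) = (?I (%y. tri \<sigma> (1, y)) - ?I (%y. tri \<sigma> (0, y))) - (?I (%x. tri \<sigma> (x, 1)) - ?I (%x. tri \<sigma> (x, 0)))"
   by (rule square_stokes[OF lifts_tri[OF G] assms(2,3) t assms(5) h])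
  obtain x where x: "x ~= 0" "tri \<sigma> (0, 1) = pt x"
  proof -
   have m: "(0, 1) \<in> (ucube :: (real \<times> real) set)" by (simp add: ucube_Pair ucube_real)
   from lifts_tri[OF G] obtain V where V: "ucube \<subseteq> V" "\<forall>e\<in>V. G (fst (q2 e), snd (q2 e), 0) ~= 0"
    "\<forall>e\<in>ucube. tri \<sigma> e = pt (G (fst (q2 e), snd (q2 e), 0))"
    unfolding lifts_def by (elim exE conjE)
   show ?thesis
    by (rule that[OF V(2)[rule_format, OF subsetD[OF V(1) m]] V(3)[rule_format, OF m]])
  qed
  have "tubular_points D eps {pt x}"
  proof (rule tubular_points_subset[OF t])
   have "(0, 1) \<in> (ucube :: (real \<times> real) set)" by (simp add: ucube_Pair ucube_real)
   then show "{pt x} \<subseteq> tri \<sigma> ` ucube" unfolding x(2)[symmetric] using imageI[of "(0, 1)" ucube "tri \<sigma>"] by simp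
  qed
  then have "?I (%e. pt x) = 0"
   using x(1) by (intro path_integral_degenerate[OF x(1) assms(2) _ assms(5)]) (auto simp: tubular_points_def)
  moreover have "(%e. tri \<sigma> (e, 1)) = (%e. pt x)"
   using x(2) by (auto simp: q2_def)
  ultimately have d1: "?I (%x. tri \<sigma> (x, 1)) = 0" by simp
  have f: "B (singular_face 2 0 \<sigma>) = ?I (%y. tri \<sigma> (1, y))"
   "B (singular_face 2 1 \<sigma>) = ?I (%y. tri \<sigma> (0, y))"
   "B (singular_face 2 2 \<sigma>) = ?I (%x. tri \<sigma> (x, 0))"
   unfolding B_def using faces_2 by (auto intro!: path_integral_cong simp: ucube_real)
  show ?thesis
   using st unfolding d1 f[symmetric] sum_atMost_2_3 by simp
 qed
 have "tube_integral h eps c = chain_sum B (qchain_boundary 2 c)"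
  unfolding tube_integral_def chain_sum_boundary by (rule chain_sum_cong, rule *)
 then show ?thesis using assms(1) by (simp add: cycle2_def chain_sum_0)
qed

section \<open>Rational functions with poles along an octic\<close>

definition quot :: "params => nat => (4 => nat) => complex ^ 4 => complex" where
 "quot t k e x = monomial e x / octic t x ^ k"

abbreviation off :: "params => (complex ^ 4) set" where
 "off t \<equiv> {x. octic t x ~= 0}"

definition total :: "(4 => nat) => nat" where
 "total e = (\<Sum>i\<in>UNIV. e i)"

lemma total_exponents: "total (exponents \<alpha>) = 8"
 using exponents[of \<alpha>] by (simp add: total_def)

lemma monomial_smult: "monomial e (c *s x) = c ^ total e * monomial e x"
 by (simp add: monomial_def total_def power_mult_distrib prod.distrib power_sum)

lemma octic_smult: "octic t (c *s x) = c ^ 8 * octic t x"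
 by (simp add: octic_def monomial_smult total_exponents power_mult_distrib sum_distrib_left algebra_simps)

lemma smooth_on_monomial: "smooth_on UNIV (monomial e)"
 unfolding monomial_def
 by (intro smooth_on_prod smooth_on_power smooth_on_vec_nth smooth_on_id open_UNIV)

lemma smooth_on_octic: "smooth_on UNIV (octic t)"
 unfolding octic_def
 by (intro smooth_on_diff smooth_on_sum smooth_on_mult smooth_on_const smooth_on_monomial
   smooth_on_power smooth_on_vec_nth smooth_on_id open_UNIV)

lemma open_off: "open (off t)"
 using continuous_open_preimage[OF smooth_on_continuous[OF smooth_on_octic[of t]] open_UNIV, of "- {0}"]
 by (simp add: vimage_def open_Compl)

lemma monomial_has_derivative:
 "(monomial e has_derivative (%v. \<Sum>i\<in>UNIV. (of_nat (e i) * monomial (e(i := e i - 1)) x) * v $ i)) (at x)"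
 unfolding monomial_def prod_4' sum_4'
 by (rule has_derivative_eq_rhs, (rule derivative_intros)+) (simp add: fun_eq_iff algebra_simps)

lemma octic_has_derivative:
 "(octic t has_derivative (%v. \<Sum>i\<in>UNIV. (8 * (x $ i) ^ 7 -
   (\<Sum>\<alpha>\<in>UNIV. t $ \<alpha> * (of_nat (exponents \<alpha> i) * monomial ((exponents \<alpha>)(i := exponents \<alpha> i - 1)) x))) * v $ i)) (at x)"
proof -
 have "((%x. (\<Sum>i\<in>UNIV. (x $ i) ^ 8) - (\<Sum>\<alpha>\<in>UNIV. t $ \<alpha> * monomial (exponents \<alpha>) x)) has_derivative
   (%v. (\<Sum>i\<in>UNIV. of_nat 8 * v $ i * (x $ i) ^ (8 - 1)) - (\<Sum>\<alpha>\<in>UNIV. t $ \<alpha> *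
    (\<Sum>i\<in>UNIV. (of_nat (exponents \<alpha> i) * monomial ((exponents \<alpha>)(i := exponents \<alpha> i - 1)) x) * v $ i)))) (at x)"
  by (intro has_derivative_diff has_derivative_sum has_derivative_power has_derivative_vec_nth
    has_derivative_ident has_derivative_mult_right monomial_has_derivative)
 moreover have "(\<Sum>i\<in>UNIV. of_nat 8 * v $ i * (x $ i) ^ (8 - 1)) - (\<Sum>\<alpha>\<in>UNIV. t $ \<alpha> *
    (\<Sum>i\<in>UNIV. (of_nat (exponents \<alpha> i) * monomial ((exponents \<alpha>)(i := exponents \<alpha> i - 1)) x) * v $ i))
   = (\<Sum>i\<in>UNIV. (8 * (x $ i) ^ 7 -
   (\<Sum>\<alpha>\<in>UNIV. t $ \<alpha> * (of_nat (exponents \<alpha> i) * monomial ((exponents \<alpha>)(i := exponents \<alpha> i - 1)) x))) * v $ i)" for v :: "complex ^ 4"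
  unfolding sum_4' by (simp add: sum.distrib sum_distrib_left sum_distrib_right algebra_simps)
 ultimately show ?thesis
  unfolding octic_def[abs_def] by (metis (no_types, lifting) has_derivative_eq_rhs ext)
qed

lemma octic_derivative:
 "((%s. octic t (x + s *s v)) has_field_derivative frechet_derivative (octic t) (at (x + s *s v)) v) (at s)"
proof -
 let ?D = "%v. \<Sum>i\<in>UNIV. (8 * ((x + s *s v) $ i) ^ 7 -
   (\<Sum>\<alpha>\<in>UNIV. t $ \<alpha> * (of_nat (exponents \<alpha> i) * monomial ((exponents \<alpha>)(i := exponents \<alpha> i - 1)) (x + s *s v)))) * v $ i"
 obtain d where d: "(octic t has_derivative (%w. \<Sum>i\<in>UNIV. d i * w $ i)) (at (x + s *s v))"
  by (rule that, rule octic_has_derivative)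
 have "((%s. x + s *s v) has_derivative (%h. 0 + h *s v)) (at s)"
  by (intro has_derivative_add has_derivative_const bounded_linear_imp_has_derivative
    bounded_bilinear.bounded_linear_left[OF bounded_bilinear_vector_smult])
 from has_derivative_compose[OF this d]
 have "((%s. octic t (x + s *s v)) has_derivative (%h. h * (\<Sum>i\<in>UNIV. d i * v $ i))) (at s)"
  by (simp add: sum_distrib_left mult_ac)
 then show ?thesis
  unfolding has_field_derivative_def frechet_derivative_at[OF d, symmetric] by (simp add: mult.commute[of _ "sum _ _"])
qed

lemma quot_has_derivative:
 assumes "octic t x ~= 0"
 shows "\<exists>d. (quot t k e has_derivative (%v. \<Sum>i\<in>UNIV. d $ i * v $ i)) (at x)"
proof -
 obtain m where m: "(monomial e has_derivative (%v. \<Sum>i\<in>UNIV. m i * v $ i)) (at x)"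
  by (rule that, rule monomial_has_derivative)
 obtain f where f: "(octic t has_derivative (%v. \<Sum>i\<in>UNIV. f i * v $ i)) (at x)"
  by (rule that, rule octic_has_derivative)
 have nz: "octic t x ^ k ~= 0" using assms by simp
 have 1: "(quot t k e has_derivative (%v. - monomial e x * (inverse (octic t x ^ k) *
   (of_nat k * (\<Sum>i\<in>UNIV. f i * v $ i) * octic t x ^ (k - 1)) * inverse (octic t x ^ k))
   + (\<Sum>i\<in>UNIV. m i * v $ i) / octic t x ^ k)) (at x)"
  unfolding quot_def by (rule has_derivative_divide[OF m has_derivative_power[OF f] nz])
 have 2: "- monomial e x * (inverse (octic t x ^ k) *
   (of_nat k * (\<Sum>i\<in>UNIV. f i * v $ i) * octic t x ^ (k - 1)) * inverse (octic t x ^ k))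
   + (\<Sum>i\<in>UNIV. m i * v $ i) / octic t x ^ k = (\<Sum>i\<in>UNIV. (\<chi> i. - monomial e x * (inverse (octic t x ^ k) *
   (of_nat k * f i * octic t x ^ (k - 1)) * inverse (octic t x ^ k)) + m i / octic t x ^ k) $ i * v $ i)" for v :: "complex ^ 4"
  unfolding sum_4' by (simp add: algebra_simps add_divide_distrib)
 show ?thesis by (rule exI, rule has_derivative_eq_rhs[OF 1], rule ext, rule 2)
qed

lemma graded_quot:
 assumes "total e + m = 8 * k"
 shows "graded m (off t) (quot t k e)"
 unfolding graded_def
proof (intro conjI ballI allI impI)
 show "smooth_on (off t) (quot t k e)"
  unfolding quot_def divide_inverse
  by (intro smooth_on_mult smooth_on_inverse smooth_on_power open_off)
   (auto intro: smooth_on_subset[OF smooth_on_monomial] smooth_on_subset[OF smooth_on_octic])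
 fix x and c :: complex assume x: "x \<in> off t" and c: "c ~= 0"
 then show "c *s x \<in> off t" by (simp add: octic_smult)
 have "c ^ m * c ^ total e = c ^ (8 * k)" using assms by (simp flip: power_add add: add.commute)
 then show "c ^ m * quot t k e (c *s x) = quot t k e x"
  using x c by (simp add: quot_def monomial_smult octic_smult power_mult_distrib power_mult[symmetric] field_simps)
qed (use open_off quot_has_derivative in auto)

lemma monomial_upd_mult:
 "monomial e x * (x $ i) ^ n = monomial (e(i := e i + n)) x"
 unfolding monomial_def
 by (simp add: prod.remove[of UNIV i] power_add mult_ac)

lemma pd_quot_0:
 assumes "octic 0 x ~= 0"
 shows "pd (axis i 1) (quot 0 k e) x =
  of_nat (e i) * quot 0 k (e(i := e i - 1)) x - of_nat (8 * k) * quot 0 (Suc k) (e(i := e i + 7)) x"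
proof -
 let ?f = "octic 0 x"
 have f: "(octic 0 has_derivative (%v. \<Sum>i\<in>UNIV. (8 * (x $ i) ^ 7) * v $ i)) (at x)"
  using octic_has_derivative[of 0 x] by simp
 have nz: "?f ^ k ~= 0" using assms by simp
 have "(quot 0 k e has_derivative (%v. - monomial e x * (inverse (?f ^ k) *
   (of_nat k * (\<Sum>i\<in>UNIV. (8 * (x $ i) ^ 7) * v $ i) * ?f ^ (k - 1)) * inverse (?f ^ k))
   + (\<Sum>i\<in>UNIV. (of_nat (e i) * monomial (e(i := e i - 1)) x) * v $ i) / ?f ^ k)) (at x)"
  unfolding quot_def by (rule has_derivative_divide[OF monomial_has_derivative has_derivative_power[OF f] nz])
 from frechet_derivative_at[OF this, symmetric]
 have "pd (axis i 1) (quot 0 k e) x = - monomial e x * (inverse (?f ^ k) *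
   (of_nat k * (8 * (x $ i) ^ 7) * ?f ^ (k - 1)) * inverse (?f ^ k))
   + (of_nat (e i) * monomial (e(i := e i - 1)) x) / ?f ^ k"
  by (simp add: axis_def if_distrib cong: if_cong)
 also have "\<dots> = of_nat (e i) * quot 0 k (e(i := e i - 1)) x - of_nat (8 * k) * quot 0 (Suc k) (e(i := e i + 7)) x"
  unfolding quot_def monomial_upd_mult[symmetric] using assms by (cases k) (auto simp: field_simps)
 finally show ?thesis .
qed

section \<open>A uniform tubular neighbourhood\<close>

lemma norm_prod_diff_power:
 fixes x y :: "4 => complex"
 assumes "!!i. norm (x i) \<le> 1" "!!i. norm (y i) \<le> 1" "!!i. norm (x i - y i) \<le> d"
 shows "norm ((\<Prod>i\<in>UNIV. x i ^ e i) - (\<Prod>i\<in>UNIV. y i ^ e i)) \<le> of_nat (total e) * d"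
proof -
 have "norm ((\<Prod>i\<in>UNIV. x i ^ e i) - (\<Prod>i\<in>UNIV. y i ^ e i)) \<le> (\<Sum>i\<in>UNIV. norm (x i ^ e i - y i ^ e i))"
  by (rule norm_prod_diff) (simp_all add: norm_power power_le_one assms)
 also have "\<dots> \<le> (\<Sum>i\<in>UNIV. of_nat (e i) * d)"
 proof (rule sum_mono)
  fix i
  have "norm (x i ^ e i - y i ^ e i) \<le> of_nat (e i) * norm (x i - y i)"
   by (rule norm_power_diff) (use assms in auto)
  also have "\<dots> \<le> of_nat (e i) * d"
   by (rule mult_left_mono) (use assms in auto)
  finally show "norm (x i ^ e i - y i ^ e i) \<le> of_nat (e i) * d" .
 qed
 finally show ?thesis by (simp add: total_def sum_distrib_right)
qed

text \<open>Telescoping the eighth power and subtracting the linear term gives h times a sum whose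
  k-th term is at most k |h|; and 28 = 0 + 1 + ... + 7.\<close>

lemma norm_power8_expansion:
 fixes x h :: complex
 assumes "norm x \<le> 1" "norm (x + h) \<le> 1"
 shows "norm ((x + h) ^ 8 - x ^ 8 - 8 * x ^ 7 * h) \<le> 28 * norm h ^ 2"
proof -
 have sum8: "(\<Sum>k<8. f k) = f 0 + f 1 + f 2 + f 3 + f 4 + f 5 + f 6 + f (7::nat)" for f :: "nat => 'c::comm_monoid_add"
  by (simp add: eval_nat_numeral)
 have eq: "(x + h) ^ 8 - x ^ 8 - 8 * x ^ 7 * h = (\<Sum>k<8. x ^ (7 - k) * ((x + h) ^ k - x ^ k)) * h"
  unfolding sum8 by simp Groebner_Basis.algebra
 have "norm (\<Sum>k<8. x ^ (7 - k) * ((x + h) ^ k - x ^ k)) \<le> (\<Sum>k<8. of_nat k * norm h)"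
 proof (rule sum_norm_le)
  fix k :: nat
  have "norm (x ^ (7 - k) * ((x + h) ^ k - x ^ k)) \<le> 1 * norm ((x + h) ^ k - x ^ k)"
   unfolding norm_mult by (rule mult_right_mono) (use assms in \<open>auto simp: norm_power power_le_one\<close>)
  also have "norm ((x + h) ^ k - x ^ k) \<le> of_nat k * norm (x + h - x)"
   by (rule norm_power_diff) (use assms in auto)
  finally show "norm (x ^ (7 - k) * ((x + h) ^ k - x ^ k)) \<le> of_nat k * norm h" by simp
 qed
 also have "\<dots> = 28 * norm h" unfolding sum8 by simp
 finally have "norm (\<Sum>k<8. x ^ (7 - k) * ((x + h) ^ k - x ^ k)) * norm h \<le> 28 * norm h * norm h"
  by (rule mult_right_mono) simp
 then show ?thesis unfolding eq norm_mult by (simp add: power2_eq_square)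
qed

definition nmon :: real where "nmon = real CARD(octic_monomial)"

lemma nmon_pos: "nmon > 0"
 by (simp add: nmon_def)

text \<open>With |x| = 1/2 all coordinates stay in the unit disc, and the normal consists of 64
  times the conjugate seventh powers, as (1/2)^-6 = 64. Its linear effect on f_0 is 8 z times the
  sum of 64 |x_i|^14; some |x_i| is at least 1/4, whence 64 / 4^14. The second order error is at
  most four times 28 |z|^2, and each of the \<open>nmon\<close> monomials of degree 8 moves by at
  most 8 |z|.\<close>

lemma octic_tube_estimate:
 fixes x :: "complex ^ 4"
 assumes x: "norm x = 1 / 2" and z: "norm z \<le> 1"
 shows "norm (octic t (x + z *s normal x)) \<ge>
  norm z * (8 * (64 / 4 ^ 14) - 112 * norm z - 8 * nmon * norm t) - norm (octic t x)"
proof -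
 let ?n = "normal x" and ?K = "x + z *s normal x"
 have xi: "norm (x $ i) \<le> 1 / 2" for i
  using Finite_Cartesian_Product.norm_nth_le[of x i] x by simp
 have n: "normal x $ i = 64 * cnj (x $ i) ^ 7" for i
  by (simp add: normal_def x power_divide)
 have ni: "norm (normal x $ i) \<le> 1 / 2" for i
 proof -
  have "norm (x $ i) ^ 7 \<le> (1 / 2) ^ 7" by (rule power_mono[OF xi]) simp
  then show ?thesis by (simp add: n norm_mult norm_power power_divide)
 qed
 have zn: "norm (z * normal x $ i) \<le> norm z / 2" for i
  unfolding norm_mult using mult_left_mono[OF ni, of "norm z" i] by simp
 have Ki: "norm (?K $ i) \<le> 1" for i
  using norm_triangle_ineq[of "x $ i" "z * normal x $ i"] xi[of i] zn[of i] z by simp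
 define S where "S = (\<Sum>i\<in>UNIV. 64 * norm (x $ i) ^ 14)"
 have S: "(\<Sum>i\<in>UNIV. 8 * (x $ i) ^ 7 * (z * ?n $ i)) = 8 * z * of_real S"
 proof -
  have "(x $ i) ^ 7 * cnj (x $ i) ^ 7 = of_real (norm (x $ i) ^ 14)" for i
   unfolding power_mult_distrib[symmetric] complex_norm_square[symmetric] by (simp flip: power_mult)
  then have "8 * (x $ i) ^ 7 * (z * ?n $ i) = 8 * z * of_real (64 * norm (x $ i) ^ 14)" for i
   by (simp add: n algebra_simps)
  then show ?thesis by (simp only: S_def of_real_sum sum_distrib_left)
 qed
 obtain j where j: "norm (x $ j) \<ge> 1 / 4"
 proof (rule ccontr)
  assume "\<not> thesis"
  then have lt: "norm (x $ i) < 1 / 4" for i using that by (meson not_le)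
  have "norm x ^ 2 = (\<Sum>i\<in>UNIV. norm (x $ i) ^ 2)"
   by (simp add: norm_vec_def L2_set_def sum_nonneg)
  also have "\<dots> < (\<Sum>i\<in>(UNIV :: 4 set). (1 / 4) ^ 2)"
   by (rule sum_strict_mono) (auto intro!: power_strict_mono lt)
  finally show False using x by (simp add: power2_eq_square)
 qed
 have "64 / 4 ^ 14 \<le> 64 * norm (x $ j) ^ 14"
  using power_mono[OF j, of 14] by (simp add: power_divide)
 also have "\<dots> \<le> S"
  unfolding S_def by (rule member_le_sum) auto
 finally have S0: "64 / 4 ^ 14 \<le> S" .
 have a: "norm ((\<Sum>i\<in>UNIV. (?K $ i) ^ 8) - (\<Sum>i\<in>UNIV. (x $ i) ^ 8) - 8 * z * of_real S) \<le> 112 * norm z ^ 2"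
 proof -
  have "(\<Sum>i\<in>UNIV. (?K $ i) ^ 8) - (\<Sum>i\<in>UNIV. (x $ i) ^ 8) - 8 * z * of_real S =
    (\<Sum>i\<in>UNIV. (x $ i + z * ?n $ i) ^ 8 - (x $ i) ^ 8 - 8 * (x $ i) ^ 7 * (z * ?n $ i))"
   unfolding S[symmetric] by (simp add: sum_subtractf)
  also have "norm \<dots> \<le> (\<Sum>i\<in>(UNIV :: 4 set). 28 * norm z ^ 2)"
  proof (rule sum_norm_le)
   fix i :: 4
   have "norm ((x $ i + z * ?n $ i) ^ 8 - (x $ i) ^ 8 - 8 * (x $ i) ^ 7 * (z * ?n $ i)) \<le> 28 * norm (z * ?n $ i) ^ 2"
    by (rule norm_power8_expansion) (use xi[of i] Ki[of i] in auto)
   also have "norm (z * ?n $ i) ^ 2 \<le> norm z ^ 2"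
    by (rule power_mono) (use zn[of i] norm_ge_zero[of z] in linarith, simp)
   finally show "norm ((x $ i + z * ?n $ i) ^ 8 - (x $ i) ^ 8 - 8 * (x $ i) ^ 7 * (z * ?n $ i)) \<le> 28 * norm z ^ 2"
    by simp
  qed
  finally show ?thesis by simp
 qed
 have b: "norm (\<Sum>\<alpha>\<in>UNIV. t $ \<alpha> * (monomial (exponents \<alpha>) ?K - monomial (exponents \<alpha>) x)) \<le> 8 * nmon * norm t * norm z"
 proof -
  have "norm (t $ \<alpha> * (monomial (exponents \<alpha>) ?K - monomial (exponents \<alpha>) x)) \<le> norm t * (8 * norm z)" for \<alpha>
  proof -
   have "norm (monomial (exponents \<alpha>) ?K - monomial (exponents \<alpha>) x) \<le> of_nat (total (exponents \<alpha>)) * norm z"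
    unfolding monomial_def
   proof (rule norm_prod_diff_power)
    show "norm (?K $ i) \<le> 1" "norm (x $ i) \<le> 1" "norm (?K $ i - x $ i) \<le> norm z" for i
     using Ki[of i] xi[of i] zn[of i] norm_ge_zero[of z] by (auto simp del: norm_ge_zero)
   qed
   then show ?thesis
    unfolding norm_mult total_exponents
    by (intro mult_mono Finite_Cartesian_Product.norm_nth_le) auto
  qed
  then have "norm (\<Sum>\<alpha>\<in>UNIV. t $ \<alpha> * (monomial (exponents \<alpha>) ?K - monomial (exponents \<alpha>) x))
    \<le> (\<Sum>\<alpha>\<in>(UNIV :: octic_monomial set). norm t * (8 * norm z))"
   by (intro sum_norm_le)
  then show ?thesis by (simp add: nmon_def mult_ac)
 qed
 have "octic t ?K = octic t x + 8 * z * of_real S +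
   ((\<Sum>i\<in>UNIV. (?K $ i) ^ 8) - (\<Sum>i\<in>UNIV. (x $ i) ^ 8) - 8 * z * of_real S) -
   (\<Sum>\<alpha>\<in>UNIV. t $ \<alpha> * (monomial (exponents \<alpha>) ?K - monomial (exponents \<alpha>) x))"
  by (simp add: octic_def right_diff_distrib sum_subtractf)
 then have "norm (8 * z * of_real S) \<le> norm (octic t ?K) + norm (octic t x) + 112 * norm z ^ 2 + 8 * nmon * norm t * norm z"
  using a b norm_triangle_ineq4
  by (smt (verit, del_insts) add_diff_cancel_left' diff_add_cancel norm_triangle_ineq norm_triangle_sub norm_minus_commute)
 moreover have "norm (8 * z * of_real S) \<ge> 8 * norm z * (64 / 4 ^ 14)"
 proof -
  have "(0 :: real) \<le> 64 / 4 ^ 14" by simp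
  then have "S \<ge> 0" using S0 by linarith
  then show ?thesis
   unfolding norm_mult using mult_left_mono[OF S0, of "8 * norm z"] by (simp add: mult_ac)
 qed
 ultimately show ?thesis
  by (simp add: algebra_simps power2_eq_square)
qed

lemma octic_diff_bound:
 assumes "!!i. norm (x $ i) \<le> 1"
 shows "norm (octic t x - octic s x) \<le> nmon * norm (t - s)"
proof -
 have m: "norm (monomial (exponents \<alpha>) x) \<le> 1" for \<alpha>
  unfolding monomial_def prod_norm[symmetric] norm_power by (intro prod_le_1) (auto intro: power_le_one assms)
 have "octic t x - octic s x = (\<Sum>\<alpha>\<in>UNIV. (s - t) $ \<alpha> * monomial (exponents \<alpha>) x)"
  by (simp add: octic_def left_diff_distrib sum_subtractf)
 also have "norm \<dots> \<le> (\<Sum>\<alpha>\<in>(UNIV :: octic_monomial set). norm (t - s))"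
 proof (rule sum_norm_le)
  fix \<alpha> :: octic_monomial
  have "norm ((s - t) $ \<alpha>) * norm (monomial (exponents \<alpha>) x) \<le> norm (s - t) * 1"
   by (rule mult_mono) (use m Finite_Cartesian_Product.norm_nth_le[of "s - t" \<alpha>] in auto)
  then show "norm ((s - t) $ \<alpha> * monomial (exponents \<alpha>) x) \<le> norm (t - s)"
   by (simp add: norm_mult norm_minus_commute)
 qed
 finally show ?thesis by (simp add: nmon_def)
qed

text \<open>It suffices to treat |x| = 1/2, since rescaling x only turns z. The radius
  \<open>eps\<close> makes the second order error at most a |z|, and \<rho> does the same for the
  perturbation, which leaves 6 a |z| of the main term 8 a |z|. The factor \<open>eps\<close> inside
  \<rho> moreover keeps |f_t| at normalised points of X_s below a third quantity, a eps / 4, too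
  small to cancel it.\<close>

lemma tubular_neighbourhood:
 obtains eps \<rho> :: real where "eps > 0" "\<rho> > 0"
  "!!s t x. norm s < \<rho> ==> norm t < \<rho> ==> x ~= 0 ==> octic s x = 0 ==> tubular (off t) eps x"
  "!!t x. norm t < \<rho> ==> x ~= 0 ==> octic t x = 0 ==>
    \<exists>c>0. \<forall>z. norm z \<le> eps --> norm (octic t (x + z *s normal x)) \<ge> c * norm z"
proof -
 define a :: real where "a = 64 / 4 ^ 14"
 have a: "0 < a" "a < 1" by (auto simp: a_def)
 define eps where "eps = a / 112"
 define \<rho> where "\<rho> = a * eps / (8 * nmon)"
 have eps: "eps > 0" "eps \<le> 1" "112 * eps = a" using a by (auto simp: eps_def)
 have \<rho>: "\<rho> > 0" "8 * nmon * \<rho> = a * eps" using a eps nmon_pos by (auto simp: \<rho>_def)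
 have key: "norm (octic t (x + z *s normal x)) \<ge> 6 * a * norm z - norm (octic t x)"
  if "norm x = 1 / 2" "norm z \<le> eps" "norm t < \<rho>" for x z and t :: params
 proof -
  have "8 * nmon * norm t \<le> 8 * nmon * \<rho>" using that nmon_pos by (intro mult_left_mono) auto
  also have "\<dots> \<le> a" unfolding \<rho>(2) using a eps mult_left_mono[of eps 1 a] by simp
  finally have "6 * a \<le> 8 * a - 112 * norm z - 8 * nmon * norm t" using that eps by linarith
  then have "norm z * (6 * a) \<le> norm z * (8 * a - 112 * norm z - 8 * nmon * norm t)"
   by (rule mult_left_mono) simp
  then show ?thesis
   using octic_tube_estimate[OF that(1), of z t] that eps unfolding a_def[symmetric] by (simp add: mult.commute)
 qed
 have scale: "\<exists>c y k. c ~= 0 & norm y = 1 / 2 & x = c *s y & norm k = 1 & (\<forall>z. x + z *s normal x = c *s (y + (z * k) *s normal y))"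
  if "x ~= 0" for x :: "complex ^ 4"
 proof -
  define c where "c = complex_of_real (2 * norm x)"
  define y where "y = (1 / c) *s x"
  define k where "k = of_real (inverse (norm c ^ 6)) * cnj c ^ 7 / c"
  have c: "c ~= 0" "norm c = 2 * norm x" using that by (auto simp: c_def norm_mult)
  then have x: "x = c *s y" using that by (simp add: y_def)
  have "norm x > 0" using that by simp
  then have "norm y = 1 / 2" unfolding y_def norm_smult norm_divide c(2) by simp
  moreover have "norm k = 1"
   using c(1) by (simp add: k_def norm_mult norm_divide norm_power norm_inverse field_simps flip: power_Suc)
  moreover have "x + z *s normal x = c *s (y + (z * k) *s normal y)" for z
   unfolding x normal_smult using c(1) by (simp add: k_def vec_eq_iff field_simps)
  ultimately show ?thesis using c x by blast
 qed
 show thesis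
 proof (rule that[OF eps(1) \<rho>(1)])
  fix s t :: params and x :: "complex ^ 4" assume st: "norm s < \<rho>" "norm t < \<rho>" and x: "x ~= 0" "octic s x = 0"
  show "tubular (off t) eps x"
   unfolding tubular_def
  proof (intro allI impI)
   fix z :: complex assume z: "norm z = eps"
   obtain c y k where c: "c ~= 0" "norm y = 1 / 2" "x = c *s y" "norm k = 1"
    "x + z *s normal x = c *s (y + (z * k) *s normal y)"
    using scale[OF x(1)] by blast
   have "octic s y = 0" using x(2) c by (simp add: octic_smult)
   moreover have "norm (octic t y - octic s y) \<le> nmon * norm (t - s)"
    by (rule octic_diff_bound, rule order_trans[OF Finite_Cartesian_Product.norm_nth_le]) (use c(2) in simp)
   moreover have "nmon * norm (t - s) \<le> nmon * (2 * \<rho>)"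
    by (rule mult_left_mono) (use st norm_triangle_ineq4[of t s] nmon_pos in linarith)+
   moreover have "nmon * (2 * \<rho>) = a * eps / 4" using \<rho>(2) by simp
   ultimately have "norm (octic t y) \<le> a * eps / 4" by simp
   moreover have "norm (octic t (y + (z * k) *s normal y)) \<ge> 6 * a * eps - norm (octic t y)"
    using key[OF c(2), of "z * k" t] st z c(4) by (simp add: norm_mult)
   moreover have "0 < a * eps" using a eps by simp
   ultimately have "norm (octic t (y + (z * k) *s normal y)) > 0" by linarith
   then show "x + z *s normal x \<in> off t"
    unfolding c(5) mem_Collect_eq octic_smult using c(1) by simp
  qed
 next
  fix t :: params and x :: "complex ^ 4" assume t: "norm t < \<rho>" and x: "x ~= 0" "octic t x = 0"
  obtain c y k where c: "c ~= 0" "norm y = 1 / 2" "x = c *s y" "norm k = 1"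
    "!!z. x + z *s normal x = c *s (y + (z * k) *s normal y)"
   using scale[OF x(1)] by blast
  have y: "octic t y = 0" using x(2) c by (simp add: octic_smult)
  show "\<exists>c>0. \<forall>z. norm z \<le> eps --> norm (octic t (x + z *s normal x)) \<ge> c * norm z"
  proof (intro exI[of _ "norm c ^ 8 * (6 * a)"] conjI allI impI)
   show "norm c ^ 8 * (6 * a) > 0" using c a by simp
   fix z :: complex assume z: "norm z \<le> eps"
   have "norm (octic t (y + (z * k) *s normal y)) \<ge> 6 * a * norm z"
    using key[OF c(2), of "z * k" t] t z c(4) y by (simp add: norm_mult)
   then show "norm c ^ 8 * (6 * a) * norm z \<le> norm (octic t (x + z *s normal x))"
    unfolding c(5) octic_smult norm_mult norm_power mult.assoc by (intro mult_left_mono) (simp_all add: mult.assoc)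
  qed
 qed
qed

section \<open>Change of variables in the plane\<close>

text \<open>The change of variables formula with determinants concerns functions between spaces such
  as \<open>real ^ 2\<close>, while here parameters are pairs and integrands complex. These maps,
  and later \<open>complex2vec\<close>, translate.\<close>

definition vec2pair :: "real ^ 2 => real \<times> real" where
 "vec2pair v = (v $ 1, v $ 2)"

definition pair2vec :: "real \<times> real => real ^ 2" where
 "pair2vec p = vector [fst p, snd p]"

lemma vec2pair_inverse: "pair2vec (vec2pair v) = v" "vec2pair (pair2vec p) = p"
 by (simp_all add: vec2pair_def pair2vec_def vec_eq_iff forall_2)

lemma bounded_linear_vec2pair: "bounded_linear vec2pair"
 unfolding vec2pair_def by (intro bounded_linear_Pair bounded_linear_vec_nth)

lemma bounded_linear_pair2vec: "bounded_linear pair2vec"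
 by (rule linear_conv_bounded_linear[THEN iffD1], rule linearI)
  (simp_all add: pair2vec_def vec_eq_iff forall_2)

lemma norm_vec2pair: "norm (vec2pair v) = norm v"
 by (simp add: vec2pair_def norm_Pair norm_vec_def L2_set_def sum_2)

lemma vec2pair_cbox: "vec2pair ` cbox a b = cbox (vec2pair a) (vec2pair b)"
proof -
 have "vec2pair x \<in> cbox (vec2pair a) (vec2pair b) \<longleftrightarrow> x \<in> cbox a b" for x
  by (auto simp: vec2pair_def cbox_Pair_iff mem_box_cart forall_2)
 note iff = this
 show ?thesis
 proof
  show "vec2pair ` cbox a b \<subseteq> cbox (vec2pair a) (vec2pair b)" using iff by blast
  show "cbox (vec2pair a) (vec2pair b) \<subseteq> vec2pair ` cbox a b"
  proof
   fix p assume "p \<in> cbox (vec2pair a) (vec2pair b)"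
   then have "pair2vec p \<in> cbox a b" using iff[of "pair2vec p"] by (simp add: vec2pair_inverse)
   from imageI[OF this, of vec2pair] show "p \<in> vec2pair ` cbox a b" by (simp add: vec2pair_inverse)
  qed
 qed
qed

lemma pair2vec_cbox: "pair2vec ` cbox a b = cbox (pair2vec a) (pair2vec b)"
proof -
 have "cbox a b = vec2pair ` cbox (pair2vec a) (pair2vec b)"
  by (simp add: vec2pair_cbox vec2pair_inverse)
 then show ?thesis by (simp only: image_image vec2pair_inverse image_ident)
qed

lemma vec2pair_content: "measure lborel (vec2pair ` cbox a b) = measure lborel (cbox a b)"
proof (cases "cbox a b = {}")
 case False
 then have le: "a $ 1 \<le> b $ 1" "a $ 2 \<le> b $ 2" by (auto simp: interval_ne_empty_cart)
 have "measure lborel (cbox a b) = (b $ 1 - a $ 1) * (b $ 2 - a $ 2)"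
  using False by (simp add: content_cbox_cart UNIV_2)
 moreover have "measure lborel (cbox (vec2pair a) (vec2pair b)) = (b $ 1 - a $ 1) * (b $ 2 - a $ 2)"
  using le by (simp add: vec2pair_def content_Pair)
 ultimately show ?thesis by (simp add: vec2pair_cbox)
qed simp

lemma pair2vec_content: "measure lborel (pair2vec ` cbox a b) = measure lborel (cbox a b)"
proof -
 have "measure lborel (vec2pair ` cbox (pair2vec a) (pair2vec b)) = measure lborel (cbox (pair2vec a) (pair2vec b))"
  by (rule vec2pair_content)
 then show ?thesis
  by (simp only: pair2vec_cbox vec2pair_cbox vec2pair_inverse)
qed

text \<open>Preservation of the norm makes large boxes exhaust both spaces at the same rate, so the
  limit in the definition of the integral carries over.\<close>

lemma has_integral_isometry:
 fixes f :: "'b::euclidean_space => 'c::banach" and h :: "'a::euclidean_space => 'b" and k :: "'b => 'a"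
  and y :: 'c and S :: "'b set"
 assumes kh: "!!x. k (h x) = x" and hk: "!!y. h (k y) = y"
  and norm: "!!x. norm (h x) = norm x" and lin: "bounded_linear h"
  and h: "!!a b. h ` cbox a b = cbox (h a) (h b)" and k: "!!a b. k ` cbox a b = cbox (k a) (k b)"
  and content: "!!a b. measure lborel (h ` cbox a b) = measure lborel (cbox a b)"
  and f: "(f has_integral y) S"
 shows "((%x. f (h x)) has_integral y) (h -` S)"
proof (rule has_integral'[THEN iffD2], intro allI impI)
 fix e :: real assume "e > 0"
 then obtain B where B: "B > 0" "!!a b. ball 0 B \<subseteq> cbox a b ==>
   \<exists>z. ((%x. if x \<in> S then f x else 0) has_integral z) (cbox a b) & norm (z - y) < e"
  using has_integral'[THEN iffD1, OF f] by meson
 show "\<exists>B>0. \<forall>a b. ball 0 B \<subseteq> cbox a b --> (\<exists>z. ((%x. if x \<in> h -` S then f (h x) else 0) has_integral z) (cbox a b) & norm (z - y) < e)"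
 proof (intro exI[of _ B] conjI allI impI)
  fix a b :: 'a assume ab: "ball 0 B \<subseteq> cbox a b"
  have "ball 0 B \<subseteq> cbox (h a) (h b)"
  proof
   fix x :: 'b assume "x \<in> ball 0 B"
   then have "k x \<in> cbox a b" using ab norm[of "k x"] by (auto simp: hk)
   then have "h (k x) \<in> h ` cbox a b" by (rule imageI)
   then show "x \<in> cbox (h a) (h b)" by (simp add: h hk)
  qed
  then obtain z where z: "((%x. if x \<in> S then f x else 0) has_integral z) (cbox (h a) (h b))" "norm (z - y) < e"
   using B(2) by blast
  have "((%x. (%x. if x \<in> S then f x else 0) (h x)) has_integral (1 / 1) *\<^sub>R z) (k ` cbox (h a) (h b))"
   by (rule has_integral_twiddle[OF _ kh hk _ _ _ _ z(1)])
    (use h k content linear_continuous_at[OF lin] in auto)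
  then show "\<exists>z. ((%x. if x \<in> h -` S then f (h x) else 0) has_integral z) (cbox a b) & norm (z - y) < e"
   using z(2) by (auto simp: k kh)
 qed (use B in auto)
qed

lemma has_integral_vec2pair:
 fixes f :: "real \<times> real => 'c::banach"
 shows "((%v. f (vec2pair v)) has_integral y) (vec2pair -` S) \<longleftrightarrow> (f has_integral y) S"
proof
 assume "(f has_integral y) S"
 then show "((%v. f (vec2pair v)) has_integral y) (vec2pair -` S)"
  by (rule has_integral_isometry[OF vec2pair_inverse norm_vec2pair bounded_linear_vec2pair vec2pair_cbox pair2vec_cbox vec2pair_content])
next
 assume a: "((%v. f (vec2pair v)) has_integral y) (vec2pair -` S)"
 have n: "norm (pair2vec p) = norm p" for p
  using norm_vec2pair[of "pair2vec p"] by (simp add: vec2pair_inverse)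
 show "(f has_integral y) S"
  using has_integral_isometry[OF vec2pair_inverse(2,1) n bounded_linear_pair2vec pair2vec_cbox vec2pair_cbox pair2vec_content a]
  by (simp add: vec2pair_inverse vimage_def)
qed

lemma integrable_vec2pair:
 fixes f :: "real \<times> real => 'c::banach"
 shows "(%v. f (vec2pair v)) integrable_on (vec2pair -` S) \<longleftrightarrow> f integrable_on S"
  "integral (vec2pair -` S) (%v. f (vec2pair v)) = integral S f"
proof -
 show 1: "(%v. f (vec2pair v)) integrable_on (vec2pair -` S) \<longleftrightarrow> f integrable_on S"
  by (simp add: integrable_on_def has_integral_vec2pair)
 show "integral (vec2pair -` S) (%v. f (vec2pair v)) = integral S f"
 proof (cases "f integrable_on S")
  case True
  then show ?thesis
   using has_integral_vec2pair[of f "integral S f" S] by (blast intro: integral_unique)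
 next
  case False
  then show ?thesis using 1 by (simp add: not_integrable_integral)
 qed
qed

lemma absolutely_integrable_vec2pair:
 fixes f :: "real \<times> real => 'c::euclidean_space"
 shows "(%v. f (vec2pair v)) absolutely_integrable_on (vec2pair -` S) \<longleftrightarrow> f absolutely_integrable_on S"
 using integrable_vec2pair(1)[of f S] integrable_vec2pair(1)[of "%x. norm (f x)" S]
 by (simp add: absolutely_integrable_on_def)

definition complex2vec :: "complex => real ^ 2" where "complex2vec z = vector [Re z, Im z]"
definition vec2complex :: "real ^ 2 => complex" where "vec2complex v = Complex (v $ 1) (v $ 2)"

lemma complex2vec:
 "bounded_linear complex2vec" "bounded_linear vec2complex" "vec2complex (complex2vec z) = z"
proof -
 have "linear complex2vec" by (rule linearI) (simp_all add: complex2vec_def vec_eq_iff forall_2)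
 then show "bounded_linear complex2vec" by (simp add: linear_conv_bounded_linear)
 have "linear vec2complex" by (rule linearI) (simp_all add: vec2complex_def complex_eq_iff)
 then show "bounded_linear vec2complex" by (simp add: linear_conv_bounded_linear)
qed (simp add: complex2vec_def vec2complex_def)

lemma absolutely_integrable_complex2vec:
 fixes f :: "'a::euclidean_space => complex"
 shows "(%x. complex2vec (f x)) absolutely_integrable_on S & integral S (%x. complex2vec (f x)) = complex2vec b
  \<longleftrightarrow> f absolutely_integrable_on S & integral S f = b"
proof (cases "f absolutely_integrable_on S")
 case True
 have i: "f integrable_on S" using True by (rule set_lebesgue_integral_eq_integral)
 have "(%x. complex2vec (f x)) absolutely_integrable_on S"
  using absolutely_integrable_linear[OF True complex2vec(1)] by (simp add: o_def)
 moreover have "integral S (%x. complex2vec (f x)) = complex2vec (integral S f)"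
  using integral_linear[OF i complex2vec(1)] by (simp add: o_def)
 ultimately show ?thesis using True complex2vec(3) by metis
next
 case False
 moreover have "f absolutely_integrable_on S" if "(%x. complex2vec (f x)) absolutely_integrable_on S"
  using absolutely_integrable_linear[OF that complex2vec(2)] by (simp add: o_def complex2vec(3))
 ultimately show ?thesis by blast
qed

theorem change_of_variables_plane:
 fixes f :: "real \<times> real => complex" and g :: "real \<times> real => real \<times> real"
 assumes S: "S \<in> sets borel" and g: "!!x. x \<in> S ==> (g has_derivative g' x) (at x within S)" and inj: "inj_on g S"
 defines "J \<equiv> %x. fst (g' x (1, 0)) * snd (g' x (0, 1)) - snd (g' x (1, 0)) * fst (g' x (0, 1))"
 shows "(%x. \<bar>J x\<bar> *\<^sub>R f (g x)) absolutely_integrable_on S & integral S (%x. \<bar>J x\<bar> *\<^sub>R f (g x)) = b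
  \<longleftrightarrow> f absolutely_integrable_on (g ` S) & integral (g ` S) f = b"
proof -
 define S' where "S' = vec2pair -` S"
 define G where "G = (%v. pair2vec (g (vec2pair v)))"
 define G' where "G' = (%v h. pair2vec (g' (vec2pair v) (vec2pair h)))"
 define F where "F = (%v. complex2vec (f (vec2pair v)))"
 have S': "S' \<in> sets lebesgue"
 proof -
  have "vec2pair \<in> borel_measurable borel"
   by (intro borel_measurable_continuous_onI linear_continuous_on bounded_linear_vec2pair)
  from measurable_sets[OF this S] have "S' \<in> sets borel" by (simp add: S'_def)
  then show ?thesis by (simp add: sets_completionI_sets)
 qed
 have der: "(G has_derivative G' v) (at v within S')" if "v \<in> S'" for v
 proof -
  have a: "(vec2pair has_derivative vec2pair) (at v within S')"
   by (rule bounded_linear_imp_has_derivative[OF bounded_linear_vec2pair])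
  have "(g has_derivative g' (vec2pair v)) (at (vec2pair v) within S)"
   using g that by (simp add: S'_def)
  then have "(g has_derivative g' (vec2pair v)) (at (vec2pair v) within vec2pair ` S')"
   by (rule has_derivative_subset) (auto simp: S'_def)
  from has_derivative_in_compose[OF a this]
  have "((%v. g (vec2pair v)) has_derivative (%h. g' (vec2pair v) (vec2pair h))) (at v within S')" .
  from bounded_linear.has_derivative[OF bounded_linear_pair2vec this] show ?thesis
   by (simp add: G_def G'_def)
 qed
 have injG: "inj_on G S'"
 proof (rule inj_onI)
  fix u v assume uv: "u \<in> S'" "v \<in> S'" "G u = G v"
  then have "g (vec2pair u) = g (vec2pair v)" unfolding G_def using vec2pair_inverse by metis
  then have "vec2pair u = vec2pair v" using inj uv by (auto simp: S'_def inj_on_def)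
  then show "u = v" using vec2pair_inverse by metis
 qed
 have det: "det (matrix (G' v)) = J (vec2pair v)" for v
  unfolding det_2 matrix_def G'_def pair2vec_def J_def
  by (simp add: vec2pair_def axis_def)
 have img: "G ` S' = vec2pair -` (g ` S)"
 proof
  show "G ` S' \<subseteq> vec2pair -` (g ` S)" by (auto simp: G_def S'_def vec2pair_inverse)
  show "vec2pair -` (g ` S) \<subseteq> G ` S'"
  proof
   fix v assume "v \<in> vec2pair -` (g ` S)"
   then obtain x where x: "x \<in> S" "vec2pair v = g x" by auto
   then have "v = G (pair2vec x)" by (metis G_def vec2pair_inverse)
   moreover have "pair2vec x \<in> S'" using x by (simp add: S'_def vec2pair_inverse)
   ultimately show "v \<in> G ` S'" by blast
  qed
 qed
 have c: "complex2vec (r *\<^sub>R z) = r *\<^sub>R complex2vec z" for r z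
  using complex2vec(1) by (simp add: linear_simps)
 have "(%x. \<bar>det (matrix (G' x))\<bar> *\<^sub>R F (G x)) absolutely_integrable_on S' &
   integral S' (%x. \<bar>det (matrix (G' x))\<bar> *\<^sub>R F (G x)) = complex2vec b \<longleftrightarrow>
   F absolutely_integrable_on G ` S' & integral (G ` S') F = complex2vec b"
  by (rule has_absolute_integral_change_of_variables[OF S' der injG])
 moreover have "(%x. \<bar>det (matrix (G' x))\<bar> *\<^sub>R F (G x)) = (%v. complex2vec ((%x. \<bar>J x\<bar> *\<^sub>R f (g x)) (vec2pair v)))"
  by (simp add: fun_eq_iff det F_def G_def c vec2pair_inverse)
 ultimately have "(%v. (%x. \<bar>J x\<bar> *\<^sub>R f (g x)) (vec2pair v)) absolutely_integrable_on S' &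
   integral S' (%v. (%x. \<bar>J x\<bar> *\<^sub>R f (g x)) (vec2pair v)) = b \<longleftrightarrow>
   (%v. f (vec2pair v)) absolutely_integrable_on G ` S' & integral (G ` S') (%v. f (vec2pair v)) = b"
  unfolding F_def by (simp only: absolutely_integrable_complex2vec)
 then show ?thesis
  unfolding S'_def img[unfolded S'_def]
  using absolutely_integrable_vec2pair[of S "%x. \<bar>J x\<bar> *\<^sub>R f (g x)"] integrable_vec2pair(2)[of S "%x. \<bar>J x\<bar> *\<^sub>R f (g x)"]
   absolutely_integrable_vec2pair[of "g ` S" f] integrable_vec2pair(2)[of "g ` S" f] by simp
qed

section \<open>Residues and periods\<close>

lemma circle_mean_value:
 assumes "f holomorphic_on UNIV \<or> (continuous_on (cball 0 eps) f & f holomorphic_on ball 0 eps)" and eps: "eps > 0"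
 shows "integral {0..1} (%th. f (circ eps th)) = f 0"
proof -
 have "continuous_on (cball 0 eps) f" "f holomorphic_on ball 0 eps"
  using assms(1) holomorphic_on_imp_continuous_on holomorphic_on_subset by blast+
 then have "((%u. f u / (u - 0)) has_contour_integral 2 * of_real pi * \<i> * f 0) (circlepath 0 eps)"
  by (rule Cauchy_integral_circlepath) (use eps in simp)
 then have a: "((%x. f (circlepath 0 eps x) / circlepath 0 eps x * vector_derivative (circlepath 0 eps) (at x within {0..1}))
   has_integral 2 * of_real pi * \<i> * f 0) {0..1}"
  by (simp add: has_contour_integral_def)
 have c: "circlepath 0 eps x = circ eps x" for x
  by (simp add: circlepath circ_def cis_conv_exp mult_ac)
 have "((%x. (2 * of_real pi * \<i>) * f (circ eps x)) has_integral 2 * of_real pi * \<i> * f 0) {0..1}"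
 proof (rule has_integral_eq[OF _ a])
  fix x :: real assume "x \<in> {0..1}"
  then have "vector_derivative (circlepath 0 eps) (at x within {0..1}) = 2 * of_real pi * \<i> * circ eps x"
   by (simp add: vector_derivative_circlepath01 circ_def cis_conv_exp mult_ac)
  moreover have "circ eps x ~= 0" using norm_circ[OF eps, of x] eps by auto
  ultimately show "f (circlepath 0 eps x) / circlepath 0 eps x * vector_derivative (circlepath 0 eps) (at x within {0..1})
    = (2 * of_real pi * \<i>) * f (circ eps x)" unfolding c by simp
 qed
 from has_integral_mult_right[OF this, of "1 / (2 * of_real pi * \<i>)"]
 have "((%x. f (circ eps x)) has_integral f 0) {0..1}" by simp
 then show ?thesis by (rule integral_unique)
qed

text \<open>The lower bound c |z| says that the octic has no other zero on the normal disc and that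
  the one at the centre is simple: the bound survives division by z and passes to the limit z =
  0.\<close>

lemma octic_quotient:
 assumes c: "c > 0" "!!z. norm z \<le> eps ==> norm (octic t (x + z *s n)) \<ge> c * norm z" and eps: "eps > 0" and x: "octic t x = 0"
 obtains u where "u holomorphic_on UNIV" "!!z. octic t (x + z *s n) = z * u z" "u 0 = pd n (octic t) x"
  "!!z. norm z \<le> eps ==> u z ~= 0"
proof -
 define f where "f = (%z. octic t (x + z *s n))"
 have der: "(f has_field_derivative pd n (octic t) (x + z *s n)) (at z)" for z
  unfolding f_def by (rule octic_derivative)
 then have f: "f holomorphic_on UNIV"
  by (auto simp: holomorphic_on_def field_differentiable_def)
 define u where "u = (%z. if z = 0 then deriv f 0 else (f z - f 0) / (z - 0))"
 have u: "u holomorphic_on UNIV"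
  unfolding u_def by (rule pole_lemma[OF f]) simp
 have f0: "f 0 = 0" using x by (simp add: f_def)
 have fu: "f z = z * u z" for z by (simp add: u_def f0)
 have u0: "u 0 = pd n (octic t) x" using DERIV_imp_deriv[OF der[of 0]] by (simp add: u_def)
 have le: "c \<le> norm (u z)" if "z ~= 0" "norm z \<le> eps" for z
  using c(2)[OF that(2)] that(1) fu[of z] by (simp add: f_def norm_mult)
 have "isCont u 0"
  using u by (meson UNIV_I field_differentiable_imp_continuous_at holomorphic_on_imp_differentiable_at open_UNIV)
 then have lim: "((%z. norm (u z)) \<longlongrightarrow> norm (u 0)) (at 0)"
  by (intro tendsto_norm) (simp add: isCont_def)
 have ev: "\<forall>\<^sub>F z in at 0. c \<le> norm (u z)"
  unfolding eventually_at by (intro exI[of _ eps]) (use eps le in auto)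
 have "c \<le> norm (u 0)"
  by (rule tendsto_lowerbound[OF lim ev]) simp
 then have "u 0 ~= 0" using c by auto
 then have "u z ~= 0" if "norm z \<le> eps" for z using le[OF _ that] c by (cases "z = 0") auto
 with that[OF u] fu u0 show thesis by (simp add: f_def)
qed

lemma monomial_line_holomorphic: "(%z. monomial e (x + z *s n)) holomorphic_on A"
 unfolding monomial_def by (auto intro!: holomorphic_intros)

lemma Omega_line: "Omega (x + z *s n) a b ((2 * pi * \<i> * z) *s n) = 2 * pi * \<i> * z * Omega x a b n"
 by (simp add: Omega_add Omega_smult Omega_eq)

lemma Omega_line_expand:
 "Omega x (u1 + z *s n1) (u2 + z *s n2) n = Omega x u1 u2 n + z * (Omega x n1 u2 n + Omega x u1 n2 n) + z ^ 2 * Omega x n1 n2 n"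
 by (simp add: Omega_add Omega_smult algebra_simps power2_eq_square)

text \<open>The angular column supplies the factor z that cancels the pole, after which the circle
  average is the value at the centre.\<close>

lemma residue_simple:
 assumes c: "c > 0" "!!z. norm z \<le> eps ==> norm (octic t (x + z *s n)) \<ge> c * norm z" and eps: "eps > 0" and x: "octic t x = 0"
 shows "integral {0..1} (%th. tint (quot t 1 e) (circ eps th) x n u1 n1 u2 n2) =
  2 * pi * \<i> * (monomial e x * Omega x u1 u2 n / pd n (octic t) x)" "pd n (octic t) x ~= 0"
proof -
 obtain u where u: "u holomorphic_on UNIV" "!!z. octic t (x + z *s n) = z * u z" "u 0 = pd n (octic t) x"
  "!!z. norm z \<le> eps ==> u z ~= 0"
  using octic_quotient[OF assms] by metis
 show nz: "pd n (octic t) x ~= 0" using u(3) u(4)[of 0] eps by simp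
 let ?f = "%z. 2 * pi * \<i> * (monomial e (x + z *s n) * Omega x (u1 + z *s n1) (u2 + z *s n2) n / u z)"
 have hol: "?f holomorphic_on cball 0 eps"
  unfolding Omega_line_expand
  by (intro holomorphic_intros monomial_line_holomorphic holomorphic_on_subset[OF u(1)]) (use u(4) in auto)
 have "integral {0..1} (%th. tint (quot t 1 e) (circ eps th) x n u1 n1 u2 n2) = integral {0..1} (%th. ?f (circ eps th))"
 proof (rule integral_cong)
  fix th
  have nz: "circ eps th ~= 0" using norm_circ[OF eps, of th] eps by auto
  show "tint (quot t 1 e) (circ eps th) x n u1 n1 u2 n2 = ?f (circ eps th)"
   unfolding tint_def quot_def u(2) Omega_line using nz by simp
 qed
 also have "\<dots> = ?f 0"
  by (rule circle_mean_value[OF _ eps])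
   (use hol holomorphic_on_imp_continuous_on holomorphic_on_subset[OF hol ball_subset_cball] in blast)
 finally show "integral {0..1} (%th. tint (quot t 1 e) (circ eps th) x n u1 n1 u2 n2) =
  2 * pi * \<i> * (monomial e x * Omega x u1 u2 n / pd n (octic t) x)"
  by (simp add: u(3))
qed

text \<open>When the tangent columns are dependent modulo x and n, their determinant along the fibre
  starts at order z. Together with the angular column this cancels the double pole, and the value at
  the centre is the first variation of the columns. On complex curves this situation always
  occurs.\<close>

lemma residue_double:
 assumes c: "c > 0" "!!z. norm z \<le> eps ==> norm (octic t (x + z *s n)) \<ge> c * norm z" and eps: "eps > 0" and x: "octic t x = 0"
  and zero: "Omega x u1 u2 n = 0"
 shows "integral {0..1} (%th. tint (quot t 2 e) (circ eps th) x n u1 n1 u2 n2) =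
  2 * pi * \<i> * (monomial e x * (Omega x n1 u2 n + Omega x u1 n2 n) / pd n (octic t) x ^ 2)"
proof -
 obtain u where u: "u holomorphic_on UNIV" "!!z. octic t (x + z *s n) = z * u z" "u 0 = pd n (octic t) x"
  "!!z. norm z \<le> eps ==> u z ~= 0"
  using octic_quotient[OF assms(1-4)] by metis
 let ?f = "%z. 2 * pi * \<i> * (monomial e (x + z *s n) * (Omega x n1 u2 n + Omega x u1 n2 n + z * Omega x n1 n2 n) / u z ^ 2)"
 have hol: "?f holomorphic_on cball 0 eps"
  by (intro holomorphic_intros monomial_line_holomorphic holomorphic_on_subset[OF u(1)]) (use u(4) in auto)
 have "integral {0..1} (%th. tint (quot t 2 e) (circ eps th) x n u1 n1 u2 n2) = integral {0..1} (%th. ?f (circ eps th))"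
 proof (rule integral_cong)
  fix th
  have nz: "circ eps th ~= 0" using norm_circ[OF eps, of th] eps by auto
  have eq: "m / (z * v) ^ 2 * (p * z * (0 + z * a + z ^ 2 * b)) = p * (m * (a + z * b) / v ^ 2)" if "z ~= 0" for m z v p a b :: complex
   using that by (simp add: power2_eq_square divide_simps) (simp add: algebra_simps)
  show "tint (quot t 2 e) (circ eps th) x n u1 n1 u2 n2 = ?f (circ eps th)"
   unfolding tint_def quot_def u(2) Omega_line unfolding Omega_line_expand zero by (rule eq[OF nz])
 qed
 also have "\<dots> = ?f 0"
  by (rule circle_mean_value[OF _ eps])
   (use hol holomorphic_on_imp_continuous_on holomorphic_on_subset[OF hol ball_subset_cball] in blast)
 finally show ?thesis by (simp add: u(3))
qed

lemma octic_pd_linear: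
 "pd (a *s v) (octic t) x = a * pd v (octic t) x" "pd (v + w) (octic t) x = pd v (octic t) x + pd w (octic t) x"
 "\<exists>d. \<forall>v. pd v (octic t) x = (\<Sum>i\<in>UNIV. d $ i * v $ i)"
proof -
 obtain d where d: "(octic t has_derivative (%w. \<Sum>i\<in>UNIV. d i * w $ i)) (at x)"
  by (rule that, rule octic_has_derivative)
 note eq = frechet_derivative_at[OF d, symmetric]
 show "pd (a *s v) (octic t) x = a * pd v (octic t) x" by (simp add: eq sum_distrib_left mult_ac)
 show "pd (v + w) (octic t) x = pd v (octic t) x + pd w (octic t) x" by (simp add: eq distrib_left sum.distrib)
 show "\<exists>d. \<forall>v. pd v (octic t) x = (\<Sum>i\<in>UNIV. d $ i * v $ i)"
  by (rule exI[of _ "\<chi> i. d i"]) (simp add: eq)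
qed

lemma octic_euler:
 assumes "octic t x = 0"
 shows "pd x (octic t) x = 0"
proof -
 have "((%s. octic t (x + s *s x)) has_field_derivative pd x (octic t) (x + 0 *s x)) (at 0)"
  by (rule octic_derivative)
 moreover have "octic t (x + s *s x) = 0" for s
 proof -
  have "x + s *s x = (1 + s) *s x" by (simp add: vec_eq_iff algebra_simps)
  then show ?thesis by (simp only: octic_smult assms mult_zero_right)
 qed
 ultimately have "((%s :: complex. 0) has_field_derivative pd x (octic t) x) (at 0)" by simp
 then show ?thesis using DERIV_unique[OF _ DERIV_const] by blast
qed

text \<open>\<open>omega\<close> contracts with an arbitrary vector on which df is 1. Since df kills
  x, u and v, \<open>Omega_cramer\<close> for that vector, n, x, u and v allows replacing it by a
  multiple of n.\<close>

lemma omega_eq: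
 assumes "octic t x = 0" "pd n (octic t) x ~= 0" "pd u (octic t) x = 0" "pd v (octic t) x = 0"
 shows "omega t \<beta> x u v = monomial \<beta> x * Omega x u v n / pd n (octic t) x"
proof -
 let ?D = "pd n (octic t) x"
 have "pd ((1 / ?D) *s n) (octic t) x = 1"
  using assms(2) by (simp add: octic_pd_linear(1))
 then have N: "pd (SOME N. pd N (octic t) x = 1) (octic t) x = 1"
  by (rule someI)
 define N where "N = (SOME N. pd N (octic t) x = 1)"
 obtain d where d: "!!v. pd v (octic t) x = (\<Sum>i\<in>UNIV. d $ i * v $ i)"
  using octic_pd_linear(3) by blast
 have "pd N (octic t) x * Omega n x u v - ?D * Omega N x u v + pd x (octic t) x * Omega N n u v
  - pd u (octic t) x * Omega N n x v + pd v (octic t) x * Omega N n x u = 0"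
  by (rule Omega_cramer[OF d])
 then have "Omega n x u v = ?D * Omega N x u v"
  using N assms(3,4) octic_euler[OF assms(1)] by (simp add: N_def)
 moreover have "Omega n x u v = - Omega x u v n" "Omega N x u v = - Omega x N u v"
  using Omega_swap by metis+
 ultimately have "Omega x N u v = Omega x u v n / ?D"
  using assms(2) by (simp add: field_simps)
 then show ?thesis by (simp add: omega_def N_def)
qed

lemma d1_d2_eq:
 assumes "(G has_derivative G') (at (a, b, 0))"
 shows "d1 G a b = G' (1, 0, 0)" "d2 G a b = G' (0, 1, 0)"
proof -
 have lin: "linear G'" using assms has_derivative_linear by blast
 have e: "G' (s, 0, 0) = s *\<^sub>R G' (1, 0, 0)" "G' (0, s, 0) = s *\<^sub>R G' (0, 1, 0)" for s
  using linear_scale[OF lin, of s "(1, 0, 0)"] linear_scale[OF lin, of s "(0, 1, 0)"] by simp_all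
 have "((%s. (s, b, 0 :: real)) has_derivative (%s. (s, 0, 0))) (at a)"
  by (intro has_derivative_Pair has_derivative_ident has_derivative_const)
 from has_derivative_compose[OF this assms]
 have "((%s. G (s, b, 0)) has_vector_derivative G' (1, 0, 0)) (at a)"
  unfolding has_vector_derivative_def e[symmetric] .
 then show "d1 G a b = G' (1, 0, 0)" by (simp add: d1_def vector_derivative_at)
 have "((%s. (a, s, 0 :: real)) has_derivative (%s. (0, s, 0))) (at b)"
  by (intro has_derivative_Pair has_derivative_ident has_derivative_const)
 from has_derivative_compose[OF this assms]
 have "((%s. G (a, s, 0)) has_vector_derivative G' (0, 1, 0)) (at b)"
  unfolding has_vector_derivative_def e[symmetric] .
 then show "d2 G a b = G' (0, 1, 0)" by (simp add: d2_def vector_derivative_at)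
qed

lemma q2_has_derivative: "(q2 has_derivative (%(h, k). ((1 - y) * h - x * k, k))) (at (x, y))"
proof -
 have "((%e. ((1 - snd e) * fst e, snd e)) has_derivative (%h. ((1 - y) * fst h - x * snd h, snd h))) (at (x, y))"
  by (auto intro!: derivative_eq_intros simp: fun_eq_iff algebra_simps)
 then show ?thesis by (simp add: q2_def split_def)
qed

definition otri :: "(real \<times> real) set" where
 "otri = {(a, b). 0 < a & 0 < b & a + b < 1}"

lemma box_pair: "box 0 (One :: real \<times> real) = {(x, y). 0 < x & x < 1 & 0 < y & y < 1}"
 by (auto simp: mem_box Basis_prod_def)

lemma q2_image: "q2 ` box 0 One = otri"
proof
 show "q2 ` box 0 One \<subseteq> otri"
 proof
  fix p assume "p \<in> q2 ` box 0 One"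
  then obtain x y where xy: "0 < x" "x < 1" "0 < y" "y < 1" "p = ((1 - y) * x, y)"
   by (auto simp: box_pair q2_def)
  then have "(1 - y) * x < (1 - y) * 1" by (intro mult_strict_left_mono) auto
  then have "(1 - y) * x + y < 1" by (simp add: algebra_simps)
  then show "p \<in> otri" using xy by (simp add: otri_def)
 qed
 show "otri \<subseteq> q2 ` box 0 One"
 proof
  fix p assume "p \<in> otri"
  then obtain a b where ab: "0 < a" "0 < b" "a + b < 1" "p = (a, b)" by (auto simp: otri_def)
  then have "(1 - b) * (a / (1 - b)) = a" "0 < a / (1 - b)" "a / (1 - b) < 1" "b < 1" by simp_all
  then have "p = q2 (a / (1 - b), b)" "(a / (1 - b), b) \<in> box 0 One"
   using ab by (simp_all add: q2_def box_pair)
  then show "p \<in> q2 ` box 0 One" by blast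
 qed
qed

lemma q2_inj: "inj_on q2 (box 0 One)"
 by (auto simp: inj_on_def box_pair q2_def)

lemma smooth_lift_derivatives:
 assumes "smooth_lift 2 \<sigma> G" "(x, y) \<in> box 0 One"
 defines "a \<equiv> (1 - y) * x"
 shows "pd (1, 0) (%e. G (fst (q2 e), snd (q2 e), 0)) (x, y) = complex_of_real (1 - y) *s d1 G a y"
  "pd (0, 1) (%e. G (fst (q2 e), snd (q2 e), 0)) (x, y) = d2 G a y + complex_of_real (- x) *s d1 G a y"
  "G differentiable (at (a, y, 0))"
proof -
 obtain W where W: "open W" "smooth_on W G"
  "!!x. x \<in> standard_simplex 2 ==> (x 1, x 2, x 3) \<in> W"
  using assms(1) unfolding smooth_lift_def by metis
 have xy: "0 < x" "x < 1" "0 < y" "y < 1" using assms(2) by (auto simp: box_pair)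
 have "bary2 (a, y) \<in> standard_simplex 2"
  using bary2_q2[of "(x, y)"] assms(2) box_subset_cbox by (auto simp: q2_def a_def)
 from W(3)[OF this] have "(a, y, 0) \<in> W" by (simp add: bary2_def)
 from smooth_on_differentiable[OF W(2) this]
 have G: "(G has_derivative frechet_derivative G (at (a, y, 0))) (at (a, y, 0))" .
 then show "G differentiable (at (a, y, 0))" by (auto simp: differentiable_def)
 let ?G = "frechet_derivative G (at (a, y, 0))"
 have lin: "linear ?G" using G has_derivative_linear by blast
 have "((%e. (fst (q2 e), snd (q2 e), 0 :: real)) has_derivative
  (%h. (fst ((%(h, k). ((1 - y) * h - x * k, k)) h), snd ((%(h, k). ((1 - y) * h - x * k, k)) h), 0))) (at (x, y))"
  by (intro has_derivative_Pair has_derivative_fst has_derivative_snd q2_has_derivative has_derivative_const)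
 from has_derivative_compose[OF this, of G ?G] G
 have "((%e. G (fst (q2 e), snd (q2 e), 0)) has_derivative (%h. ?G ((1 - y) * fst h - x * snd h, snd h, 0))) (at (x, y))"
  by (simp add: q2_def a_def split_def)
 from frechet_derivative_at[OF this, symmetric]
 have eq: "pd h (%e. G (fst (q2 e), snd (q2 e), 0)) (x, y) = ?G ((1 - y) * fst h - x * snd h, snd h, 0)" for h
  by simp
 have sc: "r *\<^sub>R v = complex_of_real r *s v" for r and v :: "complex ^ 4"
  unfolding vec_eq_iff vector_scaleR_component vector_smult_component by (simp add: scaleR_conv_of_real)
 show "pd (1, 0) (%e. G (fst (q2 e), snd (q2 e), 0)) (x, y) = complex_of_real (1 - y) *s d1 G a y"
  unfolding eq d1_d2_eq[OF G] sc[symmetric] linear_scale[OF lin, symmetric] by simp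
 have "(- x, 1, 0) = (0, 1, 0) + (- x) *\<^sub>R (1 :: real, 0 :: real, 0 :: real)" by simp
 then have "?G (- x, 1, 0) = ?G (0, 1, 0) + (- x) *\<^sub>R ?G (1, 0, 0)"
  using linear_add[OF lin] linear_scale[OF lin] by metis
 then show "pd (0, 1) (%e. G (fst (q2 e), snd (q2 e), 0)) (x, y) = d2 G a y + complex_of_real (- x) *s d1 G a y"
  unfolding eq d1_d2_eq[OF G] sc[symmetric] by simp
qed

lemma bary2_simplex: "(a, b) \<in> otri ==> bary2 (a, b) \<in> standard_simplex 2"
 by (auto simp: otri_def intro!: bary_in_simplex)

lemma open_otri: "open otri"
proof -
 have "otri = fst -` {0<..} \<inter> snd -` {0<..} \<inter> (%p. fst p + snd p) -` {..<1}" by (auto simp: otri_def)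
 also have "open \<dots>"
  by (intro open_Int open_vimage continuous_intros)
 finally show ?thesis .
qed

lemma tangent_octic:
 assumes G: "smooth_lift 2 \<sigma> G" and \<sigma>: "\<sigma> ` standard_simplex 2 \<subseteq> surface t" and ab: "(a, b) \<in> otri"
 shows "octic t (G (a, b, 0)) = 0" "pd (d1 G a b) (octic t) (G (a, b, 0)) = 0" "pd (d2 G a b) (octic t) (G (a, b, 0)) = 0"
proof -
 obtain W where W: "open W" "smooth_on W G"
  "!!x. x \<in> standard_simplex 2 ==> (x 1, x 2, x 3) \<in> W & G (x 1, x 2, x 3) ~= 0 & \<sigma> x = pt (G (x 1, x 2, x 3))"
  using G unfolding smooth_lift_def by metis
 have on: "(a, b, 0) \<in> W" "octic t (G (a, b, 0)) = 0" if "(a, b) \<in> otri" for a b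
 proof -
  have s: "bary2 (a, b) \<in> standard_simplex 2" by (rule bary2_simplex[OF that])
  from W(3)[OF this] have w: "(a, b, 0) \<in> W" "G (a, b, 0) ~= 0" "\<sigma> (bary2 (a, b)) = pt (G (a, b, 0))"
   by (simp_all add: bary2_def)
  then show "(a, b, 0) \<in> W" by simp
  have "pt (G (a, b, 0)) \<in> surface t" using \<sigma> s w(3) by auto
  then obtain x where x: "x ~= 0" "octic t x = 0" "pt (G (a, b, 0)) = pt x" unfolding surface_def by auto
  then obtain c where "G (a, b, 0) = c *s x" using pt_eq_iff[OF x(1) w(2)] by metis
  then show "octic t (G (a, b, 0)) = 0" using x by (simp add: octic_smult)
 qed
 show "octic t (G (a, b, 0)) = 0" by (rule on(2)[OF ab])
 let ?G = "frechet_derivative G (at (a, b, 0))"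
 have D: "(G has_derivative ?G) (at (a, b, 0))" by (rule smooth_on_differentiable[OF W(2) on(1)[OF ab]])
 have "(octic t has_derivative (%v. pd v (octic t) (G (a, b, 0)))) (at (G (a, b, 0)))"
  using smooth_on_differentiable[OF smooth_on_octic, of "G (a, b, 0)" t] by simp
 from has_derivative_compose[OF D this]
 have DD: "((%p. octic t (G p)) has_derivative (%h. pd (?G h) (octic t) (G (a, b, 0)))) (at (a, b, 0))" .
 have "((%p. (fst p, snd p, 0 :: real)) has_derivative (%p. (fst p, snd p, 0))) (at (a, b))"
  by (intro has_derivative_Pair has_derivative_fst has_derivative_snd has_derivative_ident has_derivative_const)
 from has_derivative_compose[OF this, of "%p. octic t (G p)"] DD
 have A: "((%p. octic t (G (fst p, snd p, 0))) has_derivative (%h. pd (?G (fst h, snd h, 0)) (octic t) (G (a, b, 0)))) (at (a, b))"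
  by simp
 have B: "((%p. octic t (G (fst p, snd p, 0))) has_derivative (%h. 0)) (at (a, b))"
  by (rule has_derivative_transform_within_open[OF has_derivative_const open_otri ab]) (use on(2) in auto)
 have "pd (?G (fst h, snd h, 0)) (octic t) (G (a, b, 0)) = 0" for h
  using fun_cong[OF has_derivative_unique[OF A B], of h] by simp
 from this[of "(1, 0)"] this[of "(0, 1)"]
 show "pd (d1 G a b) (octic t) (G (a, b, 0)) = 0" "pd (d2 G a b) (octic t) (G (a, b, 0)) = 0"
  unfolding d1_d2_eq[OF D] by simp_all
qed

text \<open>Fibrewise this is \<open>residue_simple\<close>. The factor 1 - y produced by the
  collapsed square is the Jacobian of \<open>q2\<close>, so a change of variables leads to the
  triangle of \<open>simplex_integral\<close>.\<close>

theorem simplex_integral_omega: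
 assumes \<sigma>: "smooth_simplex 2 (surface t) \<sigma>" and eps: "eps > 0"
  and tub: "!!x. x ~= 0 ==> octic t x = 0 ==> tubular (off t) eps x"
  and bd: "!!x. x ~= 0 ==> octic t x = 0 ==> \<exists>c>0. \<forall>z. norm z \<le> eps --> norm (octic t (x + z *s normal x)) \<ge> c * norm z"
  and \<beta>: "total \<beta> = 4"
 shows "square_integral (quot t 1 \<beta>) eps (tri \<sigma>) = 2 * pi * \<i> * simplex_integral (omega t \<beta>) \<sigma>"
proof -
 define G where "G = (SOME G. smooth_lift 2 \<sigma> G)"
 have G: "smooth_lift 2 \<sigma> G"
 proof -
  have "\<exists>G. smooth_lift 2 \<sigma> G" using \<sigma> by (simp add: smooth_simplex_def)
  from someI_ex[OF this] show ?thesis by (simp add: G_def)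
 qed
 have sub: "\<sigma> ` standard_simplex 2 \<subseteq> surface t" using \<sigma> by (simp add: smooth_simplex_def)
 define Y where "Y = (%e. G (fst (q2 e), snd (q2 e), 0))"
 have L: "lifts (tri \<sigma>) Y" unfolding Y_def by (rule lifts_tri[OF G])
 obtain V where V: "open V" "ucube \<subseteq> V" "smooth_on V Y" and V': "\<forall>e\<in>V. Y e ~= 0"
  using L unfolding lifts_def by (elim exE conjE)
 have tp: "tubular_points (off t) eps (tri \<sigma> ` ucube)"
  unfolding tubular_points_def
 proof (intro allI impI, elim conjE)
  fix x :: "complex ^ 4" assume x: "x ~= 0" "pt x \<in> tri \<sigma> ` ucube"
  then have "pt x \<in> surface t" using sub bary2_q2 by blast
  then obtain y where y: "y ~= 0" "octic t y = 0" "pt x = pt y" unfolding surface_def by auto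
  then obtain c where "x = c *s y" using pt_eq_iff[OF y(1) x(1)] by metis
  then show "tubular (off t) eps x" using tub x(1) y(2) by (simp add: octic_smult)
 qed
 have gr: "graded 4 (off t) (quot t 1 \<beta>)" by (rule graded_quot) (use \<beta> in simp)
 define F where "F = (%(a, b). omega t \<beta> (G (a, b, 0)) (d1 G a b) (d2 G a b))"
 have pt: "tden (quot t 1 \<beta>) eps Y (1, 0) (0, 1) e = 2 * pi * \<i> * (\<bar>1 - snd e\<bar> *\<^sub>R F (q2 e))" if e: "e \<in> box 0 One" for e
 proof -
  obtain x y where xy: "e = (x, y)" by (cases e)
  define a where "a = (1 - y) * x"
  have e': "(x, y) \<in> box 0 One" using e xy by simp
  have q: "q2 (x, y) = (a, y)" by (simp add: q2_def a_def)
  have ab: "(a, y) \<in> otri" using q2_image imageI[OF e', of q2] q by simp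
  note tan = tangent_octic[OF G sub ab]
  note der = smooth_lift_derivatives[OF G e', folded a_def]
  let ?x = "G (a, y, 0)"
  have Ye: "Y e = ?x" by (simp add: Y_def xy q)
  have nz: "?x ~= 0"
   using V' V(2) e box_subset_cbox Ye by (metis subsetD)
  obtain c where c: "c > 0" "!!z. norm z \<le> eps ==> norm (octic t (?x + z *s normal ?x)) \<ge> c * norm z"
   using bd[OF nz tan(1)] by metis
  note res = residue_simple[OF c eps tan(1)]
  let ?D = "pd (normal ?x) (octic t) ?x"
  have y: "0 < 1 - y" using e' by (simp add: box_pair)
  have "tden (quot t 1 \<beta>) eps Y (1, 0) (0, 1) e = 2 * pi * \<i> * (monomial \<beta> ?x *
    Omega ?x (complex_of_real (1 - y) *s d1 G a y) (d2 G a y + complex_of_real (- x) *s d1 G a y) (normal ?x) / ?D)"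
   unfolding tden_def Ye unfolding xy Y_def der by (rule res(1))
  also have "Omega ?x (complex_of_real (1 - y) *s d1 G a y) (d2 G a y + complex_of_real (- x) *s d1 G a y) (normal ?x)
    = complex_of_real (1 - y) * Omega ?x (d1 G a y) (d2 G a y) (normal ?x)"
   by (simp only: Omega_add Omega_smult Omega_eq) simp
  also have "2 * pi * \<i> * (monomial \<beta> ?x * (complex_of_real (1 - y) * Omega ?x (d1 G a y) (d2 G a y) (normal ?x)) / ?D)
    = 2 * pi * \<i> * (complex_of_real (1 - y) * omega t \<beta> ?x (d1 G a y) (d2 G a y))"
   by (simp add: omega_eq[OF tan(1) res(2) tan(2,3)])
  finally show ?thesis using y by (simp add: F_def xy q scaleR_conv_of_real)
 qed
 define T where "T = {(a, b). 0 \<le> a & 0 \<le> b & a + b \<le> (1 :: real)}"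
 interpret tube_form V Y eps "off t" "quot t 1 \<beta>" 4
  by standard (use V V' eps gr tubular_lift[OF tp L] in auto)
 let ?H = "%e. \<bar>1 - snd e\<bar> *\<^sub>R F (q2 e)"
 have "(%e. 1 / (2 * pi * \<i>) * tden (quot t 1 \<beta>) eps Y (1, 0) (0, 1) e) absolutely_integrable_on ucube"
  by (intro absolutely_integrable_continuous continuous_intros continuous_tden)
 then have A: "(%e. 1 / (2 * pi * \<i>) * tden (quot t 1 \<beta>) eps Y (1, 0) (0, 1) e) absolutely_integrable_on box 0 One"
  by (rule set_integrable_subset) (use box_subset_cbox in auto)
 have B: "1 / (2 * pi * \<i>) * tden (quot t 1 \<beta>) eps Y (1, 0) (0, 1) e = ?H e" if "e \<in> box 0 One" for e
  unfolding pt[OF that] by simp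
 have ai: "?H absolutely_integrable_on box 0 One"
  by (rule iffD1[OF set_integrable_cong[OF refl refl B] A])
 \<comment> \<open>The change of variables is applied with the value of its own left-hand side, so
   that it transports integrability and value together.\<close>
 have cv: "?H absolutely_integrable_on box 0 One & integral (box 0 One) ?H = integral (box 0 One) ?H
  \<longleftrightarrow> F absolutely_integrable_on (q2 ` box 0 One) & integral (q2 ` box 0 One) F = integral (box 0 One) ?H"
 proof -
  define D where "D = (%(e :: real \<times> real) (h :: real, k :: real). ((1 - snd e) * h - fst e * k, k))"
  have "(q2 has_derivative D e) (at e within box 0 One)" for e
   using q2_has_derivative[of "snd e" "fst e"] by (simp add: D_def has_derivative_at_withinI)
  from change_of_variables_plane[OF _ this q2_inj, of F "integral (box 0 One) ?H"] show ?thesis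
   by (simp add: D_def)
 qed
 have "integral (box 0 One) ?H = integral otri F"
  using cv ai by (simp add: q2_image)
 also have "\<dots> = integral T F"
 proof (rule integral_subset_negligible)
  show "otri \<subseteq> T" by (auto simp: otri_def T_def)
  have "negligible ({p. (1, 0) \<bullet> p = 0} \<union> {p. (0, 1) \<bullet> p = 0} \<union> {p :: real \<times> real. (1, 1) \<bullet> p = 1})"
   by (intro negligible_Un negligible_hyperplane) (auto simp: prod_eq_iff)
  then show "negligible (T - otri)"
   by (rule negligible_subset) (auto simp: T_def otri_def)
 qed
 also have "\<dots> = simplex_integral (omega t \<beta>) \<sigma>"
  unfolding simplex_integral_def Let_def G_def[symmetric] F_def T_def ..
 finally have fin: "integral (box 0 One) ?H = simplex_integral (omega t \<beta>) \<sigma>" .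
 have "square_integral (quot t 1 \<beta>) eps (tri \<sigma>) = integral (box 0 One) (tden (quot t 1 \<beta>) eps Y (1, 0) (0, 1))"
  unfolding square_integral_eq[OF L gr tp eps] integral_open_interval ..
 also have "\<dots> = integral (box 0 One) (%e. 2 * pi * \<i> * ?H e)"
  by (rule integral_cong) (rule pt)
 also have "\<dots> = 2 * pi * \<i> * simplex_integral (omega t \<beta>) \<sigma>"
  by (simp only: integral_mult_right fin)
 finally show ?thesis .
qed

section \<open>Periods along the parallel transport\<close>

definition coords :: "(nat => real) => real \<times> real \<times> real" where
 "coords x = (x 1, x 2, x 3)"

lemma coords_simplex: "coords ` standard_simplex 2 = {(a, b, c). 0 \<le> a & 0 \<le> b & a + b \<le> 1 & c = 0}"
proof
 have "coords x \<in> {(a, b, c). 0 \<le> a & 0 \<le> b & a + b \<le> 1 & c = 0}" if "x \<in> standard_simplex 2" for x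
 proof -
  have "x 0 + x 1 + x 2 = 1" "0 \<le> x 0" "0 \<le> x 1" "0 \<le> x 2" "x 3 = 0"
   using that by (auto simp: standard_simplex_def eval_nat_numeral)
  then show ?thesis by (simp add: coords_def)
 qed
 then show "coords ` standard_simplex 2 \<subseteq> {(a, b, c). 0 \<le> a & 0 \<le> b & a + b \<le> 1 & c = 0}"
  by (rule image_subsetI)
 show "{(a, b, c). 0 \<le> a & 0 \<le> b & a + b \<le> 1 & c = 0} \<subseteq> coords ` standard_simplex 2"
 proof clarify
  fix a b :: real assume "0 \<le> a" "0 \<le> b" "a + b \<le> 1"
  then have "bary2 (a, b) \<in> standard_simplex 2" by (rule bary_in_simplex)
  moreover have "(a, b, 0) = coords (bary2 (a, b))" by (simp add: coords_def bary2_def)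
  ultimately show "(a, b, 0) \<in> coords ` standard_simplex 2"
   using image_eqI[of "(a, b, 0)" coords "bary2 (a, b)"] by simp
 qed
qed

lemma compact_coords_simplex: "compact (coords ` standard_simplex 2)"
proof -
 have "closed {p :: real \<times> real \<times> real. 0 \<le> fst p & 0 \<le> fst (snd p) & fst p + fst (snd p) \<le> 1 & snd (snd p) = 0}"
  by (intro closed_Collect_conj closed_Collect_le closed_Collect_eq continuous_intros)
 moreover have "bounded {p :: real \<times> real \<times> real. 0 \<le> fst p & 0 \<le> fst (snd p) & fst p + fst (snd p) \<le> 1 & snd (snd p) = 0}"
  by (rule bounded_subset[OF bounded_cbox[of 0 "(1, 1, 1)"]]) (auto simp: mem_box Basis_prod_def)
 moreover have "coords ` standard_simplex 2 = {p :: real \<times> real \<times> real. 0 \<le> fst p & 0 \<le> fst (snd p) & fst p + fst (snd p) \<le> 1 & snd (snd p) = 0}"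
  unfolding coords_simplex by auto
 ultimately show ?thesis by (simp add: compact_eq_bounded_closed)
qed

lemma pt_in_surface: "x ~= 0 ==> pt x \<in> surface t \<longleftrightarrow> octic t x = 0"
proof
 assume x: "x ~= 0" and "pt x \<in> surface t"
 then obtain y where y: "y ~= 0" "octic t y = 0" "pt x = pt y" unfolding surface_def by auto
 then obtain c where "x = c *s y" using pt_eq_iff[OF y(1) x] by metis
 then show "octic t x = 0" using y by (simp add: octic_smult)
qed (auto simp: surface_def)

text \<open>The trivialisation supplies lifts only up to a scalar. Dividing by the scalar c found at
  the centre makes the lift agree with \<open>G\<close> there, so its inner product with
  \<open>G\<close> stays positive nearby.\<close>

lemma local_transport:
 fixes G :: "real \<times> real \<times> real => complex ^ 4"
 assumes triv: "trivialisation U \<Phi>" and G: "open W" "smooth_on W G" and p: "p \<in> W" "G p ~= 0" "pt (G p) \<in> surface 0"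
 obtains r F where "r > 0" "smooth_on (ball (0, p) (2 * r)) F" "ball (0, p) (2 * r) \<subseteq> U \<times> W"
  "!!t e. (t, e) \<in> ball (0, p) (2 * r) ==> F (t, e) \<bullet> G e > 0"
  "!!t e. (t, e) \<in> ball (0, p) (2 * r) ==> G e ~= 0 ==> pt (G e) \<in> surface 0 ==> \<Phi> t (pt (G e)) = pt (F (t, e))"
proof -
 have U: "open U" "0 \<in> U" and id: "!!p. p \<in> surface 0 ==> \<Phi> 0 p = p"
  and sm: "smooth_projective_map (U \<times> surface 0) \<Phi>"
  using triv by (auto simp: trivialisation_def)
 obtain W' H where H: "open W'" "(0, G p) \<in> W'" "smooth_on W' H"
  "!!s y. (s, y) \<in> W' ==> y ~= 0 ==> (s, pt y) \<in> U \<times> surface 0 ==> H (s, y) ~= 0 & \<Phi> s (pt y) = pt (H (s, y))"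
  using sm[unfolded smooth_projective_map_def, rule_format, of "G p" 0] p(2,3) U(2) by blast
 have "H (0, G p) ~= 0" "pt (G p) = pt (H (0, G p))"
  using H(4)[OF H(2) p(2)] id[OF p(3)] p(3) U(2) by auto
 then obtain c where c: "c ~= 0" "H (0, G p) = c *s G p"
  using pt_eq_iff[OF p(2)] by metis
 have opUW: "open (U \<times> W)" using U(1) G(1) by (rule open_Times)
 have fst: "smooth_on (U \<times> W) (%q. fst q)" and snd: "smooth_on (U \<times> W) (%q. snd q)"
  by (rule smooth_on_linear[OF opUW bounded_linear_fst], rule smooth_on_linear[OF opUW bounded_linear_snd])
 have Gs: "smooth_on (U \<times> W) (%q. G (snd q))"
  by (rule smooth_on_compose[OF opUW G(1) snd G(2)]) auto
 define pre where "pre = (%q :: params \<times> real \<times> real \<times> real. (fst q, G (snd q)))"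
 have pre: "smooth_on (U \<times> W) pre" unfolding pre_def by (rule smooth_on_Pair[OF opUW fst Gs])
 define V where "V = {q \<in> U \<times> W. pre q \<in> W'}"
 have V: "open V"
  using continuous_open_preimage[OF smooth_on_continuous[OF pre] opUW H(1)]
  by (simp add: V_def vimage_def Int_def)
 have VUW: "V \<subseteq> U \<times> W" by (auto simp: V_def)
 define F where "F = (%q. (1 / c) *s H (pre q))"
 have F: "smooth_on V F" unfolding F_def
  by (intro smooth_on_smult V smooth_on_const smooth_on_compose[OF V H(1) smooth_on_subset[OF pre VUW] H(3)])
   (auto simp: V_def)
 have "smooth_on V (%q. F q \<bullet> G (snd q))"
  by (rule smooth_on_bilinear[OF V bounded_bilinear_inner F smooth_on_subset[OF Gs VUW]])
 from continuous_open_preimage[OF smooth_on_continuous[OF this] V, of "{0<..}"]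
 have O: "open {q \<in> V. F q \<bullet> G (snd q) > 0}" by (simp add: vimage_def Int_def)
 have "(0, p) \<in> V" using p U(2) H(2) by (simp add: V_def pre_def)
 moreover have "F (0, p) = G p" using c by (simp add: F_def pre_def)
 ultimately have "(0, p) \<in> {q \<in> V. F q \<bullet> G (snd q) > 0}" using p by simp
 then obtain r where r: "r > 0" "ball (0, p) r \<subseteq> {q \<in> V. F q \<bullet> G (snd q) > 0}"
  using O openE by blast
 show thesis
 proof (rule that[of "r / 2" F])
  show "r / 2 > 0" using r by simp
  have sub: "ball (0, p) (2 * (r / 2)) \<subseteq> V" using r by auto
  show "smooth_on (ball (0, p) (2 * (r / 2))) F" by (rule smooth_on_subset[OF F sub])
  show "ball (0, p) (2 * (r / 2)) \<subseteq> U \<times> W" using sub VUW by blast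
  fix t :: params and e assume te: "(t, e) \<in> ball (0, p) (2 * (r / 2))"
  then have "(t, e) \<in> {q \<in> V. F q \<bullet> G (snd q) > 0}" using r(2) by auto
  then show "F (t, e) \<bullet> G e > 0" by simp
  have "(t, e) \<in> V" using te sub by blast
  then have "(t, G e) \<in> W'" "t \<in> U" by (auto simp: V_def pre_def)
  then show "\<Phi> t (pt (G e)) = pt (F (t, e))" if "G e ~= 0" "pt (G e) \<in> surface 0"
   using H(4)[of t "G e"] that c(1) by (simp add: F_def pre_def pt_smult)
 qed
qed

text \<open>Local lifts of the transported points are multiples of each other with positive inner product with
 \<open>G\<close>, so they can be glued by a sum of bump functions without introducing zeros.\<close>

lemma simplex_transport:
 assumes triv: "trivialisation U \<Phi>" and \<sigma>: "smooth_simplex 2 (surface 0) \<sigma>"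
 obtains Y :: "params \<times> real \<times> real \<times> real => complex ^ 4" and W where "open W" "smooth_on UNIV Y"
  "!!x. x \<in> standard_simplex 2 ==> (0, coords x) \<in> W"
  "!!t x. x \<in> standard_simplex 2 ==> (t, coords x) \<in> W ==> t \<in> U & Y (t, coords x) ~= 0 & \<Phi> t (\<sigma> x) = pt (Y (t, coords x))"
proof -
 obtain G where "smooth_lift 2 \<sigma> G" using \<sigma> by (auto simp: smooth_simplex_def)
 then obtain V where V: "open V" "smooth_on V G"
  and G: "!!x. x \<in> standard_simplex 2 ==> coords x \<in> V & G (coords x) ~= 0 & \<sigma> x = pt (G (coords x))"
  unfolding smooth_lift_def coords_def by metis
 have G0: "pt (G (coords x)) \<in> surface 0" if "x \<in> standard_simplex 2" for x
  using G[OF that] \<sigma> that by (auto simp: smooth_simplex_def)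
 define good where "good = (%p r F. r > 0 & smooth_on (ball (0, p) (2 * r)) F & ball (0, p) (2 * r) \<subseteq> U \<times> V &
  (\<forall>t e. (t, e) \<in> ball (0, p) (2 * r) --> F (t, e) \<bullet> G e > 0) &
  (\<forall>t e. (t, e) \<in> ball (0, p) (2 * r) --> G e ~= 0 --> pt (G e) \<in> surface 0 --> \<Phi> t (pt (G e)) = pt (F (t, e))))"
 have "\<exists>r F. good p r F" if p: "p \<in> coords ` standard_simplex 2" for p
 proof -
  from p obtain x where x: "x \<in> standard_simplex 2" "p = coords x" by blast
  obtain r F where "r > 0" "smooth_on (ball (0, p) (2 * r)) F" "ball (0, p) (2 * r) \<subseteq> U \<times> V"
   "!!t e. (t, e) \<in> ball (0, p) (2 * r) ==> F (t, e) \<bullet> G e > 0"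
   "!!t e. (t, e) \<in> ball (0, p) (2 * r) ==> G e ~= 0 ==> pt (G e) \<in> surface 0 ==> \<Phi> t (pt (G e)) = pt (F (t, e))"
   by (rule local_transport[OF triv V, of p]) (use G[OF x(1)] G0[OF x(1)] x(2) in auto)
  then show ?thesis unfolding good_def by metis
 qed
 then obtain R F where RF: "!!p. p \<in> coords ` standard_simplex 2 ==> good p (R p) (F p)"
  by metis
 have R: "R p > 0" if "p \<in> coords ` standard_simplex 2" for p using RF[OF that] by (simp add: good_def)
 define K where "K = {0 :: params} \<times> coords ` standard_simplex 2"
 have K: "compact K" unfolding K_def by (intro compact_Times compact_coords_simplex) auto
 have cover: "K \<subseteq> (\<Union>p\<in>coords ` standard_simplex 2. ball (0, p) (R p))"
 proof
  fix q assume "q \<in> K"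
  then obtain p where p: "p \<in> coords ` standard_simplex 2" "q = (0, p)" by (auto simp only: K_def)
  then show "q \<in> (\<Union>p\<in>coords ` standard_simplex 2. ball (0, p) (R p))"
   using R[OF p(1)] by (intro UN_I[of p]) simp_all
 qed
 obtain P where P: "P \<subseteq> coords ` standard_simplex 2" "finite P" "K \<subseteq> (\<Union>p\<in>P. ball (0, p) (R p))"
  by (rule compactE_image[OF K open_ball cover])
 define W where "W = (\<Union>p\<in>P. ball (0 :: params, p) (R p))"
 define Y where "Y = (%q. \<Sum>p\<in>P. bump (0, p) (R p) q *\<^sub>R F p q)"
 have ball: "good p (R p) (F p)" "R p > 0" if "p \<in> P" for p
  using RF R that P(1) by blast+
 show thesis
 proof (rule that[of W Y])
  show "open W" unfolding W_def by auto
  show "smooth_on UNIV Y"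
   unfolding Y_def
  proof (rule smooth_on_sum[OF open_UNIV])
   fix p assume p: "p \<in> P"
   have "smooth_on (ball (0, p) (2 * R p)) (F p)" using ball(1)[OF p] by (simp add: good_def)
   then show "smooth_on UNIV (%q. bump (0, p) (R p) q *\<^sub>R F p q)"
    by (rule smooth_on_bump_scaleR[OF open_ball]) (use ball(2)[OF p] in auto)
  qed
  show "(0, coords x) \<in> W" if "x \<in> standard_simplex 2" for x
  proof -
   have "(0, coords x) \<in> K" unfolding K_def by (rule SigmaI, simp, rule imageI[OF that])
   then show ?thesis unfolding W_def by (rule subsetD[OF P(3)])
  qed
  fix t x assume x: "x \<in> standard_simplex 2" and tx: "(t, coords x) \<in> W"
  let ?e = "coords x" let ?q = "(t, coords x)"
  obtain p0 where p0: "p0 \<in> P" "?q \<in> ball (0, p0) (R p0)" using tx by (auto simp: W_def)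
  have F: "F p ?q \<bullet> G ?e > 0" "\<Phi> t (\<sigma> x) = pt (F p ?q)" "t \<in> U" if "p \<in> P" "?q \<in> ball (0, p) (R p)" for p
  proof -
   have "?q \<in> ball (0, p) (2 * R p)" using that ball(2)[OF that(1)] by (auto simp: mem_ball)
   note b = this
   note g = ball(1)[OF that(1), unfolded good_def]
   from g have g1: "ball (0, p) (2 * R p) \<subseteq> U \<times> V"
    and g2: "\<forall>t e. (t, e) \<in> ball (0, p) (2 * R p) --> F p (t, e) \<bullet> G e > 0"
    and g3: "\<forall>t e. (t, e) \<in> ball (0, p) (2 * R p) --> G e ~= 0 --> pt (G e) \<in> surface 0 --> \<Phi> t (pt (G e)) = pt (F p (t, e))"
    by - (elim conjE, assumption)+
   show "F p ?q \<bullet> G ?e > 0" by (rule g2[rule_format, OF b])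
   show "t \<in> U" using subsetD[OF g1 b] by (rule SigmaD1)
   show "\<Phi> t (\<sigma> x) = pt (F p ?q)"
    using g3[rule_format, OF b] G[OF x] G0[OF x] by simp
  qed
  have nz: "F p ?q ~= 0" if "p \<in> P" "?q \<in> ball (0, p) (R p)" for p
   using F(1)[OF that] by auto
  have term0: "bump (0, p) (R p) ?q = 0" if "p \<in> P" "?q \<notin> ball (0, p) (R p)" for p
   by (rule bump_eq_0) (use that ball(2)[OF that(1)] in auto)
  have "Y ?q \<bullet> G ?e = (\<Sum>p\<in>P. bump (0, p) (R p) ?q * (F p ?q \<bullet> G ?e))"
   by (simp add: Y_def inner_sum_left)
  also have "\<dots> > 0"
  proof (rule sum_pos2[OF P(2) p0(1)])
   show "0 < bump (0, p0) (R p0) ?q * (F p0 ?q \<bullet> G ?e)"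
    using bump_pos[OF p0(2)] F(1)[OF p0] by simp
   show "0 \<le> bump (0, p) (R p) ?q * (F p ?q \<bullet> G ?e)" if "p \<in> P" for p
   proof (cases "?q \<in> ball (0, p) (R p)")
    case True
    then show ?thesis using F(1)[OF that True] bump_nonneg[of "(0, p)" "R p" ?q] by simp
   next
    case False
    then show ?thesis using term0[OF that False] by simp
   qed
  qed
  finally have nzY: "Y ?q ~= 0" by auto
  let ?y = "F p0 ?q"
  have "\<exists>c. bump (0, p) (R p) ?q *\<^sub>R F p ?q = c *s ?y" if "p \<in> P" for p
  proof (cases "?q \<in> ball (0, p) (R p)")
   case True
   have "pt ?y = pt (F p ?q)" using F(2)[OF p0] F(2)[OF that True] by simp
   then have "\<exists>c. F p ?q = c *s ?y"
    using pt_eq_iff[OF nz[OF p0] nz[OF that True]] by metis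
   then obtain c where "F p ?q = c *s ?y" by (rule exE)
   then have "bump (0, p) (R p) ?q *\<^sub>R F p ?q = (of_real (bump (0, p) (R p) ?q) * c) *s ?y"
    unfolding vec_eq_iff vector_scaleR_component vector_smult_component by (simp add: scaleR_conv_of_real mult.assoc)
   then show ?thesis by blast
  next
   case False
   then show ?thesis using term0[OF that False] by (intro exI[of _ 0]) simp
  qed
  then obtain c where c: "!!p. p \<in> P ==> bump (0, p) (R p) ?q *\<^sub>R F p ?q = c p *s ?y" by metis
  have "Y ?q = (\<Sum>p\<in>P. c p *s ?y)" unfolding Y_def by (rule sum.cong[OF refl c])
  also have "\<dots> = (\<Sum>p\<in>P. c p) *s ?y" by (simp add: vec_eq_iff sum_distrib_right)
  finally have eq: "Y ?q = (\<Sum>p\<in>P. c p) *s ?y" .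
  then have "(\<Sum>p\<in>P. c p) ~= 0" using nzY by auto
  then have "pt (Y ?q) = pt ?y" unfolding eq by (rule pt_smult)
  then show "t \<in> U & Y ?q ~= 0 & \<Phi> t (\<sigma> x) = pt (Y ?q)"
   using F(2,3)[OF p0] nzY by simp
 qed
qed

text \<open>Compactness of the simplex turns the neighbourhood \<open>W\<close> into a uniform
  radius for t, and a ball contains the segment from 0 to t along which the homotopy runs.\<close>

lemma simplex_transport_ball:
 assumes triv: "trivialisation U \<Phi>" and \<sigma>: "smooth_simplex 2 (surface 0) \<sigma>"
 obtains r where "r > 0"
  "!!t. norm t < r ==> smooth_simplex 2 (surface t) (simplex_map 2 (\<Phi> t) \<sigma>)"
  "!!t. norm t < r ==> \<exists>Y. lifts (%(x, y, s). \<Phi> (s *\<^sub>R t) (tri \<sigma> (x, y))) Y"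
proof -
 obtain Y W where Y: "open W" "smooth_on UNIV Y"
  "!!x. x \<in> standard_simplex 2 ==> (0, coords x) \<in> W"
  "!!t x. x \<in> standard_simplex 2 ==> (t, coords x) \<in> W ==> t \<in> U & Y (t, coords x) ~= 0 & \<Phi> t (\<sigma> x) = pt (Y (t, coords x))"
  using simplex_transport[OF assms] by metis
 define K where "K = {0 :: params} \<times> coords ` standard_simplex 2"
 have "compact K" unfolding K_def by (intro compact_Times compact_coords_simplex) auto
 moreover have "K \<subseteq> W" using Y(3) by (auto simp: K_def)
 ultimately obtain r where r: "r > 0" "(\<Union>x\<in>K. ball x r) \<subseteq> W"
  using compact_subset_open_imp_ball_epsilon_subset Y(1) by metis
 have inW: "(t, coords x) \<in> W" if "norm t < r" "x \<in> standard_simplex 2" for t x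
 proof -
  have "(t, coords x) \<in> ball (0, coords x) r" using that by (simp add: dist_Pair_Pair)
  moreover have "(0, coords x) \<in> K" using that by (auto simp: K_def)
  ultimately show ?thesis using r(2) by blast
 qed
 note on = Y(4)[OF _ inW]
 show thesis
 proof (rule that[OF r(1)])
  fix t :: params assume t: "norm t < r"
  have sub: "\<sigma> ` standard_simplex 2 \<subseteq> surface 0" using \<sigma> by (simp add: smooth_simplex_def)
  have "t \<in> U" using on[OF _ t] nonempty_standard_simplex[of 2] by blast
  then have bij: "\<Phi> t ` surface 0 = surface t" using triv by (auto simp: trivialisation_def bij_betw_def)
  have "smooth_lift 2 (simplex_map 2 (\<Phi> t) \<sigma>) (%e. Y (t, e))"
   unfolding smooth_lift_def
  proof (intro exI[of _ UNIV] conjI ballI)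
   show "smooth_on UNIV (%e. Y (t, e))"
    by (rule smooth_on_compose[OF open_UNIV open_UNIV smooth_on_Pair[OF open_UNIV smooth_on_const[OF open_UNIV] smooth_on_id] Y(2)]) auto
  qed (use on[OF _ t] in \<open>auto simp: coords_def simplex_map_def\<close>)
  moreover have "simplex_map 2 (\<Phi> t) \<sigma> ` standard_simplex 2 \<subseteq> surface t"
   using sub bij by (auto simp: simplex_map_def)
  ultimately show "smooth_simplex 2 (surface t) (simplex_map 2 (\<Phi> t) \<sigma>)"
   by (auto simp: smooth_simplex_def simplex_map_def)
  define L where "L = (%e :: real \<times> real \<times> real. (snd (snd e) *\<^sub>R t, fst (q2 (fst e, fst (snd e))), snd (q2 (fst e, fst (snd e))), 0 :: real))"
  have q: "smooth_on UNIV (%e :: real \<times> real \<times> real. q2 (fst e, fst (snd e)))"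
   by (intro smooth_on_compose[OF open_UNIV open_UNIV _ smooth_on_q2] smooth_on_Pair smooth_on_fst open_UNIV
     smooth_on_compose[OF open_UNIV open_UNIV smooth_on_snd smooth_on_fst]) auto
  have L: "smooth_on UNIV L"
   unfolding L_def
   by (intro smooth_on_Pair smooth_on_scaleR smooth_on_const open_UNIV
     smooth_on_compose[OF open_UNIV open_UNIV smooth_on_snd smooth_on_snd]
     smooth_on_compose[OF open_UNIV open_UNIV q smooth_on_fst] smooth_on_compose[OF open_UNIV open_UNIV q smooth_on_snd]) auto
  have "lifts (%(x, y, s). \<Phi> (s *\<^sub>R t) (tri \<sigma> (x, y))) (%e. Y (L e))"
  proof (rule liftsI[OF open_UNIV subset_UNIV])
   show "smooth_on UNIV (%e. Y (L e))" by (rule smooth_on_compose[OF open_UNIV open_UNIV L Y(2)]) auto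
   fix e :: "real \<times> real \<times> real" assume e: "e \<in> ucube"
   obtain x y s where xys: "e = (x, y, s)" by (cases e)
   have s: "0 \<le> s" "s \<le> 1" and xy: "(x, y) \<in> ucube" using e by (auto simp: xys ucube_Pair ucube_real)
   have "norm (s *\<^sub>R t) \<le> norm t" using s mult_right_mono[of s 1 "norm t"] by simp
   then have st: "norm (s *\<^sub>R t) < r" using t by simp
   have "L e = (s *\<^sub>R t, coords (bary2 (q2 (x, y))))"
    by (simp add: L_def xys coords_def bary2_def split_def)
   then show "Y (L e) ~= 0 & (case e of (x, y, s) => \<Phi> (s *\<^sub>R t) (tri \<sigma> (x, y))) = pt (Y (L e))"
    using on[OF bary2_q2[OF xy] st bary2_q2[OF xy]] by (simp add: xys)
  qed
  then show "\<exists>Y. lifts (%(x, y, s). \<Phi> (s *\<^sub>R t) (tri \<sigma> (x, y))) Y" by blast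
 qed
qed

section \<open>Periods as tube integrals over a fixed cycle of the Fermat surface\<close>

locale octic_tube =
 fixes eps \<rho> :: real
 assumes eps: "eps > 0" and \<rho>: "\<rho> > 0"
  and tub: "!!s t x. norm s < \<rho> ==> norm t < \<rho> ==> x ~= 0 ==> octic s x = 0 ==> tubular (off t) eps x"
  and bd: "!!t x. norm t < \<rho> ==> x ~= 0 ==> octic t x = 0 ==>
    \<exists>c>0. \<forall>z. norm z \<le> eps --> norm (octic t (x + z *s normal x)) \<ge> c * norm z"
begin

lemma tubular_surface: "norm s < \<rho> ==> norm t < \<rho> ==> tubular_points (off t) eps (surface s)"
 using tub pt_in_surface by (auto simp: tubular_points_def)

text \<open>The chosen representative of the transported class differs from the image of c under
  \<open>\<Phi> t\<close> by a boundary, and that image is joined to c through points of the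
  surfaces with parameter s t. The tubes around all these surfaces avoid the zero set of f_t, so
  neither change affects the tube integral.\<close>

theorem period_eq_tube_integral:
 assumes c: "cycle2 (surface 0) c" and \<delta>: "parallel_transport (homology_class2 (surface 0) c) \<delta>"
 obtains r where "r > 0" "r \<le> \<rho>"
  "!!t \<beta>. norm t < r ==> total \<beta> = 4 ==> 2 * pi * \<i> * period t \<beta> (\<delta> t) = tube_integral (quot t 1 \<beta>) eps c"
proof -
 have "homologous2 (surface 0) c c"
  unfolding homologous2_def by (intro exI[of _ 0]) (simp add: smooth_chain_def qchain_boundary_def)
 then have cc: "c \<in> homology_class2 (surface 0) c" using c by (simp add: homology_class2_def)
 obtain U \<Phi> where triv: "trivialisation U \<Phi>"
  and \<delta>t: "!!t. t \<in> U ==> \<delta> t = homology_class2 (surface t) (qchain_map 2 (\<Phi> t) c)"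
  using \<delta> cc unfolding parallel_transport_def by blast
 have U: "open U" "0 \<in> U" and \<Phi>0: "!!p. p \<in> surface 0 ==> \<Phi> 0 p = p"
  using triv by (auto simp: trivialisation_def)
 obtain r0 where r0: "r0 > 0" "ball 0 r0 \<subseteq> U" using U openE by blast
 have simp: "smooth_simplex 2 (surface 0) \<sigma>" if "\<sigma> \<in> Poly_Mapping.keys c" for \<sigma>
  using c that by (auto simp: cycle2_def smooth_chain_def)
 have "\<exists>r>0. \<forall>t. norm t < r --> smooth_simplex 2 (surface t) (simplex_map 2 (\<Phi> t) \<sigma>) &
   (\<exists>Y. lifts (%(x, y, s). \<Phi> (s *\<^sub>R t) (tri \<sigma> (x, y))) Y)" if "\<sigma> \<in> Poly_Mapping.keys c" for \<sigma>
  using simplex_transport_ball[OF triv simp[OF that]] by metis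
 then obtain R where R: "!!\<sigma>. \<sigma> \<in> Poly_Mapping.keys c ==> R \<sigma> > 0"
  "!!\<sigma> t. \<sigma> \<in> Poly_Mapping.keys c ==> norm t < R \<sigma> ==> smooth_simplex 2 (surface t) (simplex_map 2 (\<Phi> t) \<sigma>)"
  "!!\<sigma> t. \<sigma> \<in> Poly_Mapping.keys c ==> norm t < R \<sigma> ==> \<exists>Y. lifts (%(x, y, s). \<Phi> (s *\<^sub>R t) (tri \<sigma> (x, y))) Y"
  by metis
 define r where "r = Min (insert \<rho> (insert r0 (R ` Poly_Mapping.keys c)))"
 have "r \<le> y" if "y \<in> insert \<rho> (insert r0 (R ` Poly_Mapping.keys c))" for y
  unfolding r_def by (rule Min_le) (use that in auto)
 moreover have "r > 0"
  unfolding r_def by (subst Min_gr_iff) (use R(1) r0(1) \<rho> in auto)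
 ultimately have r: "r > 0" "r \<le> \<rho>" "r \<le> r0" "!!\<sigma>. \<sigma> \<in> Poly_Mapping.keys c ==> r \<le> R \<sigma>"
  by auto
 show thesis
 proof (rule that[OF r(1,2)])
  fix t :: params and \<beta> :: "4 => nat" assume t: "norm t < r" and \<beta>: "total \<beta> = 4"
  let ?g = "quot t 1 \<beta>" let ?ct = "qchain_map 2 (\<Phi> t) c"
  have t\<rho>: "norm t < \<rho>" and tU: "t \<in> U" using t r r0 by auto
  have gr: "graded 4 (off t) ?g" by (rule graded_quot) (use \<beta> in simp)
  have keys: "Poly_Mapping.keys ?ct \<subseteq> simplex_map 2 (\<Phi> t) ` Poly_Mapping.keys c"
  proof -
   have "Poly_Mapping.keys (\<Sum>\<sigma>\<in>A. Poly_Mapping.single (simplex_map 2 (\<Phi> t) \<sigma>) (Poly_Mapping.lookup c \<sigma>)) \<subseteq> simplex_map 2 (\<Phi> t) ` A"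
    if "finite A" for A
    using that
   proof (induction A rule: finite_induct)
    case (insert \<sigma> A)
    have "Poly_Mapping.keys (Poly_Mapping.single (simplex_map 2 (\<Phi> t) \<sigma>) (Poly_Mapping.lookup c \<sigma>)) \<subseteq> {simplex_map 2 (\<Phi> t) \<sigma>}"
     by simp
    then show ?case
     using insert Poly_Mapping.keys_add[of "Poly_Mapping.single (simplex_map 2 (\<Phi> t) \<sigma>) (Poly_Mapping.lookup c \<sigma>)"
      "\<Sum>\<sigma>\<in>A. Poly_Mapping.single (simplex_map 2 (\<Phi> t) \<sigma>) (Poly_Mapping.lookup c \<sigma>)"] by auto
   qed simp
   then show ?thesis unfolding qchain_map_def by simp
  qed
  have smt: "smooth_simplex 2 (surface t) (simplex_map 2 (\<Phi> t) \<sigma>)" if "\<sigma> \<in> Poly_Mapping.keys c" for \<sigma>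
   by (rule R(2)[OF that]) (use t r(4)[OF that] in simp)
  have "smooth_chain 2 (surface t) ?ct" using keys smt by (auto simp: smooth_chain_def)
  moreover have "qchain_boundary 2 ?ct = 0"
   using c qchain_boundary_map[of 2 "\<Phi> t" c] by (simp add: cycle2_def qchain_map_def)
  ultimately have "cycle2 (surface t) ?ct" by (simp add: cycle2_def)
  moreover have "homologous2 (surface t) ?ct ?ct"
   unfolding homologous2_def by (intro exI[of _ 0]) (simp add: smooth_chain_def qchain_boundary_def)
  ultimately have "?ct \<in> \<delta> t" by (simp add: \<delta>t[OF tU] homology_class2_def)
  then have "(SOME c. c \<in> \<delta> t) \<in> \<delta> t" by (rule someI)
  define c' where "c' = (SOME c. c \<in> \<delta> t)"
  have c': "cycle2 (surface t) c'" "homologous2 (surface t) c' ?ct"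
   using \<open>(SOME c. c \<in> \<delta> t) \<in> \<delta> t\<close> by (auto simp: c'_def \<delta>t[OF tU] homology_class2_def)
  obtain e where e: "smooth_chain 3 (surface t) e" "qchain_boundary 3 e = c' - ?ct"
   using c'(2) by (auto simp: homologous2_def)
  have "tube_integral ?g eps (qchain_boundary 3 e) = 0"
   by (rule tube_integral_boundary[OF e(1) gr tubular_surface[OF t\<rho> t\<rho>] eps])
  then have "tube_integral ?g eps c' = tube_integral ?g eps ?ct"
   unfolding e(2) tube_integral_def chain_sum_diff by simp
  also have "\<dots> = chain_sum (%\<sigma>. square_integral ?g eps (%e. \<Phi> (1 *\<^sub>R t) (tri \<sigma> e))) c"
   unfolding tube_integral_def chain_sum_map
   by (intro chain_sum_cong square_integral_cong') (simp add: simplex_map_def bary2_q2)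
  also have "\<dots> = chain_sum (%\<sigma>. square_integral ?g eps (%e. \<Phi> (0 *\<^sub>R t) (tri \<sigma> e))) c"
  proof (rule tube_integral_homotopy[where D = "off t" and X = "\<Union>s\<in>{0..1}. surface (s *\<^sub>R t)" and F = "%s. \<Phi> (s *\<^sub>R t)"])
   have st: "norm (s *\<^sub>R t) \<le> norm t" if "s \<in> {0..1}" for s
    using that mult_right_mono[of s 1 "norm t"] by simp
   have st': "norm (s *\<^sub>R t) < \<rho>" "s *\<^sub>R t \<in> U" if "s \<in> {0..1}" for s
   proof -
    have "norm (s *\<^sub>R t) < r" using st[OF that] t by linarith
    then show "norm (s *\<^sub>R t) < \<rho>" using r(2) by linarith
    have "s *\<^sub>R t \<in> ball 0 r0" using \<open>norm (s *\<^sub>R t) < r\<close> r(3) unfolding mem_ball_0 by linarith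
    then show "s *\<^sub>R t \<in> U" by (rule subsetD[OF r0(2)])
   qed
   show "qchain_boundary 2 c = 0" using c by (simp add: cycle2_def)
   show "tubular_points (off t) eps (\<Union>s\<in>{0..1}. surface (s *\<^sub>R t))"
    using tubular_surface[OF st'(1) t\<rho>] unfolding tubular_points_def by blast
   show "\<exists>Y. lifts (%(x, y, s). \<Phi> (s *\<^sub>R t) (tri \<sigma> (x, y))) Y" if "\<sigma> \<in> Poly_Mapping.keys c" for \<sigma>
    by (rule R(3)[OF that]) (use t r(4)[OF that] in simp)
   fix \<sigma> and x y s :: real assume \<sigma>: "\<sigma> \<in> Poly_Mapping.keys c" and xys: "(x, y, s) \<in> ucube"
   have s: "s \<in> {0..1}" and xy: "(x, y) \<in> ucube" using xys by (auto simp: ucube_Pair ucube_real)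
   have "tri \<sigma> (x, y) \<in> surface 0"
    using simp[OF \<sigma>] bary2_q2[OF xy] by (auto simp: smooth_simplex_def)
   then have "\<Phi> (s *\<^sub>R t) (tri \<sigma> (x, y)) \<in> surface (s *\<^sub>R t)"
    using triv st'(2)[OF s] by (auto simp: trivialisation_def bij_betw_def)
   then show "\<Phi> (s *\<^sub>R t) (tri \<sigma> (x, y)) \<in> (\<Union>s\<in>{0..1}. surface (s *\<^sub>R t))" using s by blast
  qed (use gr eps in auto)
  also have "\<dots> = tube_integral ?g eps c"
   unfolding tube_integral_def
  proof (intro chain_sum_cong square_integral_cong')
   fix \<sigma> and e :: "real \<times> real" assume \<sigma>: "\<sigma> \<in> Poly_Mapping.keys c" and e: "e \<in> ucube"
   have "tri \<sigma> e \<in> surface 0" using simp[OF \<sigma>] bary2_q2[OF e] by (auto simp: smooth_simplex_def)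
   then show "\<Phi> (0 *\<^sub>R t) (tri \<sigma> e) = tri \<sigma> e" by (simp add: \<Phi>0)
  qed
  finally have "tube_integral ?g eps c' = tube_integral ?g eps c" .
  moreover have "2 * pi * \<i> * period t \<beta> (\<delta> t) = tube_integral ?g eps c'"
  proof -
   have "square_integral ?g eps (tri \<sigma>) = 2 * pi * \<i> * simplex_integral (omega t \<beta>) \<sigma>" if "\<sigma> \<in> Poly_Mapping.keys c'" for \<sigma>
    by (rule simplex_integral_omega[OF _ eps tub[OF t\<rho> t\<rho>] bd[OF t\<rho>] \<beta>])
     (use c'(1) that in \<open>auto simp: cycle2_def smooth_chain_def\<close>)
   then have "tube_integral ?g eps c' = chain_sum (%\<sigma>. 2 * pi * \<i> * simplex_integral (omega t \<beta>) \<sigma>) c'"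
    unfolding tube_integral_def by (rule chain_sum_cong)
   then show ?thesis
    by (simp add: period_def chain_integral_def c'_def[symmetric] chain_sum_def sum_distrib_left mult_ac)
  qed
  ultimately show "2 * pi * \<i> * period t \<beta> (\<delta> t) = tube_integral ?g eps c" by simp
 qed
qed

end

section \<open>Torus symmetry\<close>

definition torus :: "complex => complex ^ 4 => complex ^ 4" where
 "torus \<zeta> x = (\<chi> i. if i = 0 \<or> i = 1 then \<zeta> * x $ i else x $ i)"

lemma torus_nth [simp]:
 "torus \<zeta> x $ 0 = \<zeta> * x $ 0" "torus \<zeta> x $ 1 = \<zeta> * x $ 1" "torus \<zeta> x $ 2 = x $ 2" "torus \<zeta> x $ 3 = x $ 3"
 by (simp_all add: torus_def)

lemma torus_1 [simp]: "torus 1 x = x"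
 by (simp add: vec_eq_4)

lemma torus_add: "torus \<zeta> (x + y) = torus \<zeta> x + torus \<zeta> y"
 by (simp add: vec_eq_4 algebra_simps)

lemma torus_smult: "torus \<zeta> (c *s x) = c *s torus \<zeta> x"
 by (simp add: vec_eq_4 algebra_simps)

lemma bounded_linear_torus: "bounded_linear (torus \<zeta>)"
 by (rule linear_conv_bounded_linear[THEN iffD1], rule linearI) (simp_all add: vec_eq_4 algebra_simps)

lemma torus_eq_0: "\<zeta> ~= 0 ==> torus \<zeta> x = 0 \<longleftrightarrow> x = 0"
 by (simp add: vec_eq_4)

lemma torus_pt: "torus \<zeta> ` pt x = pt (torus \<zeta> x)"
 unfolding pt_def image_image torus_smult ..

lemma Omega_torus:
 "Omega (torus \<zeta> x) (torus \<zeta> u) (torus \<zeta> v) (torus \<zeta> w) = \<zeta>\<^sup>2 * Omega x u v w"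
 unfolding Omega_def wedge3_def torus_nth by Groebner_Basis.algebra

lemma norm_torus: "norm \<zeta> = 1 ==> norm (torus \<zeta> x) = norm x"
 by (simp add: norm_vec_def L2_set_def sum_4' norm_mult)

text \<open>For |\<zeta>| = 1 the conjugate seventh power of \<zeta> is \<zeta>^-7, which equals
  \<zeta> exactly for eighth roots of unity.\<close>

lemma normal_torus:
 assumes "norm \<zeta> = 1" "\<zeta> ^ 8 = 1"
 shows "normal (torus \<zeta> x) = torus \<zeta> (normal x)"
proof -
 have "cnj \<zeta> * \<zeta> = 1" using assms(1) complex_norm_square[of \<zeta>] by (simp add: mult.commute)
 then have "(cnj \<zeta> * \<zeta>) ^ 7 = 1" by simp
 then have "cnj \<zeta> ^ 7 * \<zeta> ^ 7 * \<zeta> = \<zeta>" by (simp add: power_mult_distrib)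
 moreover have "\<zeta> ^ 7 * \<zeta> = 1" using assms(2) by (simp add: eval_nat_numeral mult_ac)
 ultimately have "cnj \<zeta> ^ 7 = \<zeta>" by (simp add: mult.assoc)
 then show ?thesis
  by (simp add: vec_eq_4 normal_def norm_torus[OF assms(1)] power_mult_distrib)
qed

lemma tint_torus:
 assumes "!!y. g (torus \<zeta> y) = m * g y"
 shows "tint g z (torus \<zeta> x) (torus \<zeta> n) (torus \<zeta> u1) (torus \<zeta> n1) (torus \<zeta> u2) (torus \<zeta> n2) =
  \<zeta>\<^sup>2 * m * tint g z x n u1 n1 u2 n2"
 unfolding tint_def torus_smult[symmetric] torus_add[symmetric] Omega_torus assms by simp

lemma pd_linear:
 assumes "bounded_linear T" "f differentiable (at e)"
 shows "pd a (%e. T (f e)) e = T (pd a f e)"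
proof -
 have "(f has_derivative frechet_derivative f (at e)) (at e)" using assms(2) by (simp add: frechet_derivative_works)
 from frechet_derivative_at[OF bounded_linear.has_derivative[OF assms(1) this], symmetric]
 show ?thesis by simp
qed

lemma tden_torus:
 assumes "norm \<zeta> = 1" "\<zeta> ^ 8 = 1" "!!y. g (torus \<zeta> y) = m * g y"
  and "Y differentiable (at e)" "(%e. normal (Y e)) differentiable (at e)"
 shows "tden g eps (%e. torus \<zeta> (Y e)) a b e = \<zeta>\<^sup>2 * m * tden g eps Y a b e"
 unfolding tden_def normal_torus[OF assms(1,2)] pd_linear[OF bounded_linear_torus assms(4)]
  pd_linear[OF bounded_linear_torus assms(5)] tint_torus[of g, OF assms(3)]
 by simp

text \<open>Rotation by any unit number preserves X, so an eighth turn is reached by a homotopy and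
  does not change the integral. Only the end of the path has to respect the normal and g; there the
  integral is multiplied by \<zeta>^2 m, which is not 1.\<close>

theorem torus_vanishing:
 assumes c: "cycle2 X c" and g: "graded 4 D g" and X: "tubular_points D eps X" and eps: "eps > 0"
  and inv: "!!\<zeta> x. norm \<zeta> = 1 ==> x ~= 0 ==> pt x \<in> X ==> pt (torus \<zeta> x) \<in> X"
  and m: "!!y. g (torus (cis (pi / 4)) y) = m * g y" and m1: "cis (pi / 4) ^ 2 * m ~= 1"
 shows "tube_integral g eps c = 0"
proof -
 let ?\<zeta> = "cis (pi / 4)"
 have \<zeta>: "norm ?\<zeta> = 1" "?\<zeta> ^ 8 = 1" by (simp_all add: Complex.DeMoivre)
 define F where "F = (%s p. torus (circ 1 (s / 8)) ` p)"
 have F0: "F 0 p = p" for p by (simp add: F_def circ_def image_def)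
 have F1: "F 1 p = torus ?\<zeta> ` p" for p by (simp add: F_def circ_def)
 have sim: "smooth_simplex 2 X \<sigma>" if "\<sigma> \<in> Poly_Mapping.keys c" for \<sigma>
  using c that by (auto simp: cycle2_def smooth_chain_def)
 have ex: "\<exists>Y. lifts (tri \<sigma>) Y" if "\<sigma> \<in> Poly_Mapping.keys c" for \<sigma>
  using sim[OF that] lifts_tri unfolding smooth_simplex_def by blast
 have triX: "tri \<sigma> ` ucube \<subseteq> X" if "\<sigma> \<in> Poly_Mapping.keys c" for \<sigma>
  using sim[OF that] bary2_q2 unfolding smooth_simplex_def by blast
 have FX: "F s p \<in> X" if "p \<in> X" "p = pt x" "x ~= 0" for s p x
  using inv[of "circ 1 (s / 8)" x] that by (simp add: F_def torus_pt norm_circ)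
 have hom: "chain_sum (%\<sigma>. square_integral g eps (%e. F 1 (tri \<sigma> e))) c =
  chain_sum (%\<sigma>. square_integral g eps (%e. F 0 (tri \<sigma> e))) c"
 proof (rule tube_integral_homotopy[OF _ g X eps])
  show "qchain_boundary 2 c = 0" using c by (simp add: cycle2_def)
  fix \<sigma> assume \<sigma>: "\<sigma> \<in> Poly_Mapping.keys c"
  obtain Y where "lifts (tri \<sigma>) Y" using ex[OF \<sigma>] by (rule exE)
  then obtain V where V: "open V" "ucube \<subseteq> V" "smooth_on V Y" "\<forall>e\<in>V. Y e ~= 0" and Y: "\<forall>e\<in>ucube. tri \<sigma> e = pt (Y e)"
   unfolding lifts_def by (elim exE conjE)
  show "F s (tri \<sigma> (x, y)) \<in> X" if "(x, y, s) \<in> ucube" for x y s :: real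
  proof (rule FX)
   have xy: "(x, y) \<in> ucube" using that by (auto simp: ucube_Pair)
   show "tri \<sigma> (x, y) \<in> X" using triX[OF \<sigma>] imageI[OF xy, of "tri \<sigma>"] by (rule subsetD)
   show "tri \<sigma> (x, y) = pt (Y (x, y))" using Y xy by (rule bspec)
   show "Y (x, y) ~= 0" using V(4) subsetD[OF V(2) xy] by (rule bspec)
  qed
  \<comment> \<open>Splitting off the projection \<open>P\<close> shows that \<open>torus\<close>
    depends smoothly on \<zeta> and x jointly.\<close>
  define P where "P = (%x :: complex ^ 4. \<chi> i. if i = 0 \<or> i = 1 then x $ i else 0)"
  have P: "bounded_linear P"
   unfolding P_def by (rule linear_conv_bounded_linear[THEN iffD1], rule linearI) (simp_all add: vec_eq_iff)
  have TP: "torus \<zeta> x = x + (\<zeta> - 1) *s P x" for \<zeta> x by (simp add: vec_eq_4 P_def algebra_simps)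
  define W where "W = {e :: real \<times> real \<times> real. (fst e, fst (snd e)) \<in> V}"
  have pr: "smooth_on UNIV (%e :: real \<times> real \<times> real. (fst e, fst (snd e)))"
   by (intro smooth_on_Pair smooth_on_fst open_UNIV smooth_on_compose[OF open_UNIV open_UNIV smooth_on_snd smooth_on_fst]) auto
  have W: "open W"
   using continuous_open_preimage[OF smooth_on_continuous[OF pr] open_UNIV V(1)] by (simp add: W_def vimage_def)
  have Gp: "smooth_on W (%e. Y (fst e, fst (snd e)))"
   by (rule smooth_on_compose[OF W V(1) smooth_on_subset[OF pr subset_UNIV] V(3)]) (auto simp: W_def)
  have cs: "smooth_on W (%e. circ 1 (snd (snd e) / 8))"
  proof (rule smooth_on_compose[OF W open_UNIV _ smooth_on_circ])
   have "bounded_linear (%e :: real \<times> real \<times> real. snd (snd e) / 8)"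
    by (rule linear_conv_bounded_linear[THEN iffD1], rule linearI) (simp_all add: add_divide_distrib)
   then show "smooth_on W (%e. snd (snd e) / 8)" by (rule smooth_on_linear[OF W])
  qed auto
  have "smooth_on W (%e. torus (circ 1 (snd (snd e) / 8)) (Y (fst e, fst (snd e))))"
   unfolding TP
   by (intro smooth_on_add[OF W] Gp smooth_on_smult[OF W] smooth_on_diff[OF W] cs smooth_on_const[OF W]
     smooth_on_compose[OF W open_UNIV Gp smooth_on_linear[OF open_UNIV P]]) auto
  then have "lifts (%(x, y, s). F s (tri \<sigma> (x, y))) (%e. torus (circ 1 (snd (snd e) / 8)) (Y (fst e, fst (snd e))))"
  proof (rule liftsI[OF W, rotated])
   show "ucube \<subseteq> W" using V(2) by (auto simp: W_def ucube_Pair)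
   fix e :: "real \<times> real \<times> real" assume e: "e \<in> ucube"
   obtain x y s where xys: "e = (x, y, s)" by (cases e)
   have xy: "(x, y) \<in> ucube" using e xys by (auto simp: ucube_Pair)
   have "circ 1 (s / 8) ~= 0" using norm_circ[of 1 "s / 8"] by auto
   then show "torus (circ 1 (snd (snd e) / 8)) (Y (fst e, fst (snd e))) ~= 0 &
     (case e of (x, y, s) => F s (tri \<sigma> (x, y))) = pt (torus (circ 1 (snd (snd e) / 8)) (Y (fst e, fst (snd e))))"
    using bspec[OF V(4) subsetD[OF V(2) xy]] bspec[OF Y xy] by (simp add: xys F_def torus_pt torus_eq_0)
  qed
  then show "\<exists>Y. lifts (%(x, y, s). F s (tri \<sigma> (x, y))) Y" by - (rule exI)
 qed
 have eq: "square_integral g eps (%e. F 1 (tri \<sigma> e)) = ?\<zeta>\<^sup>2 * m * square_integral g eps (tri \<sigma>)"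
  if \<sigma>: "\<sigma> \<in> Poly_Mapping.keys c" for \<sigma>
 proof -
  obtain Y where L: "lifts (tri \<sigma>) Y" using ex[OF \<sigma>] by (rule exE)
  then obtain V where V: "open V" "ucube \<subseteq> V" "smooth_on V Y" "\<forall>e\<in>V. Y e ~= 0" and Y: "\<forall>e\<in>ucube. tri \<sigma> e = pt (Y e)"
   unfolding lifts_def by (elim exE conjE)
  interpret t: tube V Y eps by standard (use V eps in auto)
  have "smooth_on V (%e. torus ?\<zeta> (Y e))"
   by (rule smooth_on_compose[OF V(1) open_UNIV V(3) smooth_on_linear[OF open_UNIV bounded_linear_torus]]) auto
  then have L1: "lifts (%e. F 1 (tri \<sigma> e)) (%e. torus ?\<zeta> (Y e))"
  proof (rule liftsI[OF V(1,2)])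
   fix e :: "real \<times> real" assume e: "e \<in> ucube"
   show "torus ?\<zeta> (Y e) ~= 0 & F 1 (tri \<sigma> e) = pt (torus ?\<zeta> (Y e))"
    using bspec[OF V(4) subsetD[OF V(2) e]] bspec[OF Y e] by (simp add: F1 torus_pt torus_eq_0)
  qed
  have sub: "(%e. F 1 (tri \<sigma> e)) ` ucube \<subseteq> X"
  proof (rule image_subsetI)
   fix e :: "real \<times> real" assume e: "e \<in> ucube"
   show "F 1 (tri \<sigma> e) \<in> X"
    by (rule FX[OF subsetD[OF triX[OF \<sigma>] imageI[OF e]] bspec[OF Y e] bspec[OF V(4) subsetD[OF V(2) e]]])
  qed
  have "square_integral g eps (%e. F 1 (tri \<sigma> e)) = integral ucube (tden g eps (%e. torus ?\<zeta> (Y e)) (1, 0) (0, 1))"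
   by (rule square_integral_eq[OF L1 g tubular_points_subset[OF X sub] eps])
  also have "\<dots> = integral ucube (%e. ?\<zeta>\<^sup>2 * m * tden g eps Y (1, 0) (0, 1) e)"
   by (rule integral_cong, rule tden_torus[of _ g, OF \<zeta> m]) (use t.diff V(2) in auto)
  also have "\<dots> = ?\<zeta>\<^sup>2 * m * square_integral g eps (tri \<sigma>)"
   unfolding square_integral_eq[OF L g tubular_points_subset[OF X triX[OF \<sigma>]] eps] by (rule integral_mult_right)
  finally show ?thesis .
 qed
 have "tube_integral g eps c = chain_sum (%\<sigma>. square_integral g eps (%e. F 1 (tri \<sigma> e))) c"
  unfolding hom unfolding F0 tube_integral_def ..
 also have "\<dots> = chain_sum (%\<sigma>. ?\<zeta>\<^sup>2 * m * square_integral g eps (tri \<sigma>)) c"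
  by (rule chain_sum_cong, rule eq)
 also have "\<dots> = ?\<zeta>\<^sup>2 * m * tube_integral g eps c"
  unfolding tube_integral_def chain_sum_def by (simp add: sum_distrib_left mult_ac)
 finally have "(1 - ?\<zeta>\<^sup>2 * m) * tube_integral g eps c = 0" by (simp add: algebra_simps)
 then show ?thesis using m1 by simp
qed

section \<open>Residues along a line of the Fermat surface\<close>

lemma normal_eq: "normal x = complex_of_real (inverse (norm x ^ 6)) *s (\<chi> i. cnj (x $ i) ^ 7)"
 by (simp add: normal_def vec_eq_iff)

lemma has_derivative_vec_lambda:
 fixes f :: "'a::real_normed_vector => 'n::finite => complex"
 assumes "!!i. ((%x. f x i) has_derivative (%h. f' h i)) F"
 shows "((%x. \<chi> i. f x i) has_derivative (%h. \<chi> i. f' h i)) F"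
proof -
 have lin: "bounded_linear (%z. z *s (axis i 1 :: complex ^ 'n))" for i
  by (rule linear_conv_bounded_linear[THEN iffD1], rule linearI) (simp_all add: vec_eq_iff algebra_simps)
 have "((%x. \<Sum>i\<in>UNIV. f x i *s (axis i 1 :: complex ^ 'n)) has_derivative (%h. \<Sum>i\<in>UNIV. f' h i *s axis i 1)) F"
  by (intro has_derivative_sum bounded_linear.has_derivative[OF lin] assms)
 moreover have "(\<Sum>i\<in>UNIV. g i *s (axis i 1 :: complex ^ 'n)) = (\<chi> i. g i)" for g
  by (simp add: vec_eq_iff axis_def if_distrib cong: if_cong)
 ultimately show ?thesis by simp
qed

text \<open>The derivative of the norm stays an unknown scalar r: it only adds a multiple of the
  normal itself, which \<open>Omega\<close> kills.\<close>

lemma normal_derivative: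
 fixes Y :: "'e::real_normed_vector => complex ^ 4"
 assumes "Y differentiable (at e)" "Y e ~= 0"
 shows "\<exists>r. pd h (%e. normal (Y e)) e = r *s (\<chi> i. cnj (Y e $ i) ^ 7) +
  complex_of_real (inverse (norm (Y e) ^ 6)) *s (\<chi> i. 7 * cnj (Y e $ i) ^ 6 * cnj (pd h Y e $ i))"
proof -
 let ?D = "frechet_derivative Y (at e)"
 have D: "(Y has_derivative ?D) (at e)" using assms(1) by (simp add: frechet_derivative_works)
 have "(norm :: complex ^ 4 => real) differentiable (at (Y e))" by (rule differentiable_norm_at[OF assms(2)])
 then obtain N where "(norm has_derivative N) (at (Y e))" by (auto simp: differentiable_def)
 from has_derivative_compose[OF D this] have N: "((%e. norm (Y e)) has_derivative (%h. N (?D h))) (at e)" .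
 have "\<exists>R. ((%e. inverse (norm (Y e) ^ 6)) has_derivative R) (at e)"
  by (rule exI, rule Deriv.has_derivative_inverse[OF _ has_derivative_power[OF N]]) (use assms(2) in simp)
 then obtain R where R: "((%e. inverse (norm (Y e) ^ 6)) has_derivative R) (at e)" by (rule exE)
 have 1: "((%e. complex_of_real (inverse (norm (Y e) ^ 6))) has_derivative (%h. of_real (R h))) (at e)"
  by (rule bounded_linear.has_derivative[OF bounded_linear_of_real R])
 have 2: "((%e. cnj (Y e $ i) ^ 7) has_derivative (%h. 7 * cnj (Y e $ i) ^ 6 * cnj (?D h $ i))) (at e)" for i
  by (rule has_derivative_eq_rhs, rule has_derivative_power, rule bounded_linear.has_derivative[OF bounded_linear_cnj],
    rule has_derivative_vec_nth[OF D]) (simp add: fun_eq_iff mult_ac)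
 have "((%e. normal (Y e)) has_derivative (%h. \<chi> i. of_real (R h) * cnj (Y e $ i) ^ 7 +
   complex_of_real (inverse (norm (Y e) ^ 6)) * (7 * cnj (Y e $ i) ^ 6 * cnj (?D h $ i)))) (at e)"
  unfolding normal_def
  by (rule has_derivative_vec_lambda, rule has_derivative_eq_rhs, rule has_derivative_mult[OF 1 2]) (simp add: fun_eq_iff mult_ac)
 from frechet_derivative_at[OF this, symmetric] show ?thesis
  by (intro exI[of _ "of_real (R h)"]) (simp add: vec_eq_iff)
qed

text \<open>The vectors x, u1, u2 lie in the plane of slopes a, b, and m, m1, m2 in the plane of
  slopes \<alpha>, \<beta>. A determinant with two vectors from each plane is a product of 2 by 2
  minors, up to the constant (a - \<alpha>) (b - \<beta>).\<close>

lemma Omega_line_sum: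
 assumes "x $ 0 = a * x $ 1" "x $ 2 = b * x $ 3" "u1 $ 0 = a * u1 $ 1" "u1 $ 2 = b * u1 $ 3" "u2 $ 0 = a * u2 $ 1" "u2 $ 2 = b * u2 $ 3"
  and "m $ 0 = \<alpha> * m $ 1" "m $ 2 = \<beta> * m $ 3" "m1 $ 0 = \<alpha> * m1 $ 1" "m1 $ 2 = \<beta> * m1 $ 3" "m2 $ 0 = \<alpha> * m2 $ 1" "m2 $ 2 = \<beta> * m2 $ 3"
 shows "Omega x m1 u2 m + Omega x u1 m2 m = (a - \<alpha>) * (b - \<beta>) *
  ((x $ 1 * u2 $ 3 - x $ 3 * u2 $ 1) * (m1 $ 1 * m $ 3 - m1 $ 3 * m $ 1) -
   (x $ 1 * u1 $ 3 - x $ 3 * u1 $ 1) * (m2 $ 1 * m $ 3 - m2 $ 3 * m $ 1))"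
 unfolding Omega_def wedge3_def assms by Groebner_Basis.algebra

lemma pd_octic_0: "pd v (octic 0) x = (\<Sum>i\<in>UNIV. 8 * (x $ i) ^ 7 * v $ i)"
 using frechet_derivative_at[OF octic_has_derivative[of 0 x], symmetric] by simp

lemma root_cnj:
 fixes a :: complex assumes "a ^ 8 = - 1"
 shows "norm a = 1" "cnj a ^ 7 = - a" "a ~= 0"
proof -
 have "norm a ^ 8 = 1" using arg_cong[OF assms, of norm] by (simp add: norm_power)
 then have "norm a ^ 8 = 1 ^ 8" by simp
 then show n: "norm a = 1" by (rule power_eq_imp_eq_base) auto
 then show "a ~= 0" by auto
 have "cnj a * a = 1" using n complex_norm_square[of a] by (simp add: mult.commute)
 then have "(cnj a * a) ^ 7 * a = a" by simp
 then have "cnj a ^ 7 * a ^ 8 = a" by (simp add: power_mult_distrib eval_nat_numeral mult_ac)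
 then have "- (cnj a ^ 7) = a" by (simp add: assms)
 then show "cnj a ^ 7 = - a" by (rule minus_equation_iff[THEN iffD1, symmetric])
qed

text \<open>The density of the double residue in the affine coordinate w = x_1 / x_3 of a line, with
  the constant 7 pi / 16 split off.\<close>

definition line_density :: "complex => real" where
 "line_density w = norm w ^ 12 / (1 + norm w ^ 14)\<^sup>2"

text \<open>On the line the normal has slopes -a, -b by \<open>root_cnj\<close>, so
  \<open>Omega_line_sum\<close> gives 4 a b, and differentiating the seventh power gives 7. The two
  terms differ by conjugation of \<tau>, which leaves -2 i Im \<tau>. As df(n) is 16 |x|^-6 times
  |x_1|^14 + |x_3|^14, the constant is 2 pi i times 28 times -2 i over 256, that is 7 pi / 16. The
  squared norm times Im \<tau> is the Jacobian of w = x_1 / x_3.\<close>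

lemma residue_line:
 fixes a b c \<tau> :: complex
 assumes a: "a ^ 8 = - 1" and b: "b ^ 8 = - 1"
  and x: "x $ 0 = a * x $ 1" "x $ 2 = b * x $ 3" "x $ 3 ~= 0" and u1: "u1 $ 0 = a * u1 $ 1" "u1 $ 2 = b * u1 $ 3"
  and u2: "u2 = \<tau> *s u1 + c *s x"
  and n1: "n1 = r1 *s (\<chi> i. cnj (x $ i) ^ 7) + complex_of_real (inverse (norm x ^ 6)) *s (\<chi> i. 7 * cnj (x $ i) ^ 6 * cnj (u1 $ i))"
  and n2: "n2 = r2 *s (\<chi> i. cnj (x $ i) ^ 7) + complex_of_real (inverse (norm x ^ 6)) *s (\<chi> i. 7 * cnj (x $ i) ^ 6 * cnj (u2 $ i))"
  and e: "e 0 + e 1 = 6" "e 2 + e 3 = 6"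
 shows "2 * pi * \<i> * (monomial e x * (Omega x n1 u2 (normal x) + Omega x u1 n2 (normal x)) / pd (normal x) (octic 0) x ^ 2) =
  7 * pi / 16 * a ^ (e 0 + 1) * b ^ (e 2 + 1) *
   of_real ((norm ((u1 $ 1 * x $ 3 - u1 $ 3 * x $ 1) / (x $ 3)\<^sup>2))\<^sup>2 * Im \<tau> * line_density (x $ 1 / x $ 3))"
proof -
 define \<rho> where "\<rho> = complex_of_real (inverse (norm x ^ 6))"
 define m where "m = (\<chi> i. cnj (x $ i) ^ 7)"
 define k where "k = (%u :: complex ^ 4. \<chi> i. 7 * cnj (x $ i) ^ 6 * cnj (u $ i))"
 define p q where "p = x $ 1" and "q = x $ 3"
 define D where "D = u1 $ 1 * q - u1 $ 3 * p"
 have x0: "x ~= 0" using x(3) by auto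
 then have \<rho>: "\<rho> ~= 0" by (simp add: \<rho>_def)
 note ra = root_cnj[OF a] and rb = root_cnj[OF b]
 have n: "normal x = \<rho> *s m" unfolding \<rho>_def m_def by (rule normal_eq)
 have n12: "n1 = r1 *s m + \<rho> *s k u1" "n2 = r2 *s m + \<rho> *s k u2"
  unfolding n1 n2 m_def k_def \<rho>_def by (rule refl)+
 have u2': "u2 $ 0 = a * u2 $ 1" "u2 $ 2 = b * u2 $ 3" by (simp_all add: u2 x u1 algebra_simps)
 have "Omega x n1 u2 (normal x) + Omega x u1 n2 (normal x) = \<rho>\<^sup>2 * (Omega x (k u1) u2 m + Omega x u1 (k u2) m)"
  unfolding n n12 by (simp add: Omega_add Omega_smult Omega_eq algebra_simps power2_eq_square)
 also have "Omega x (k u1) u2 m + Omega x u1 (k u2) m = (a - (- a)) * (b - (- b)) *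
  ((p * u2 $ 3 - q * u2 $ 1) * (k u1 $ 1 * m $ 3 - k u1 $ 3 * m $ 1) -
   (p * u1 $ 3 - q * u1 $ 1) * (k u2 $ 1 * m $ 3 - k u2 $ 3 * m $ 1))"
  unfolding p_def q_def
 proof (rule Omega_line_sum[OF x(1,2) u1 u2'])
  have a7: "cnj a * cnj a ^ 6 = - a" and b7: "cnj b * cnj b ^ 6 = - b"
   using ra(2) rb(2) by (simp_all add: eval_nat_numeral)
  have "k u $ 0 = - a * k u $ 1" if "u $ 0 = a * u $ 1" for u
  proof -
   have "k u $ 0 = (cnj a * cnj a ^ 6) * (7 * cnj (x $ 1) ^ 6 * cnj (u $ 1))"
    unfolding k_def vec_lambda_beta x that complex_cnj_mult power_mult_distrib by (simp only: mult_ac)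
   then show ?thesis unfolding a7 by (simp add: k_def)
  qed
  then show "k u1 $ 0 = - a * k u1 $ 1" "k u2 $ 0 = - a * k u2 $ 1" using u1 u2' by auto
  have "k u $ 2 = - b * k u $ 3" if "u $ 2 = b * u $ 3" for u
  proof -
   have "k u $ 2 = (cnj b * cnj b ^ 6) * (7 * cnj (x $ 3) ^ 6 * cnj (u $ 3))"
    unfolding k_def vec_lambda_beta x that complex_cnj_mult power_mult_distrib by (simp only: mult_ac)
   then show ?thesis unfolding b7 by (simp add: k_def)
  qed
  then show "k u1 $ 2 = - b * k u1 $ 3" "k u2 $ 2 = - b * k u2 $ 3" using u1 u2' by auto
  show "m $ 0 = - a * m $ 1" "m $ 2 = - b * m $ 3"
   by (simp_all add: m_def x power_mult_distrib ra(2) rb(2))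
 qed
 also have "\<dots> = 28 * a * b * (cnj p * cnj q) ^ 6 * (D * cnj (\<tau> * D) - \<tau> * D * cnj D)"
 proof -
  have kD: "k u $ 1 * m $ 3 - k u $ 3 * m $ 1 = 7 * (cnj p * cnj q) ^ 6 * cnj (u $ 1 * q - u $ 3 * p)" for u
   by (simp add: k_def m_def p_def q_def eval_nat_numeral algebra_simps)
  have "u2 $ 1 * q - u2 $ 3 * p = \<tau> * D" by (simp add: u2 D_def p_def q_def algebra_simps)
  then have d2: "u2 $ 1 * q - u2 $ 3 * p = \<tau> * D" "p * u2 $ 3 - q * u2 $ 1 = - (\<tau> * D)"
   by (simp_all add: algebra_simps)
  have d1: "p * u1 $ 3 - q * u1 $ 1 = - D" by (simp add: D_def)
  show ?thesis unfolding kD d1 d2 D_def[symmetric] by (simp add: algebra_simps)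
 qed
 also have "D * cnj (\<tau> * D) - \<tau> * D * cnj D = - 2 * \<i> * of_real ((norm D)\<^sup>2 * Im \<tau>)"
 proof -
  have "D * cnj (\<tau> * D) - \<tau> * D * cnj D = (D * cnj D) * (cnj \<tau> - \<tau>)" by (simp add: algebra_simps)
  also have "cnj \<tau> - \<tau> = - 2 * \<i> * of_real (Im \<tau>)" by (simp add: complex_eq_iff)
  finally show ?thesis unfolding complex_norm_square[symmetric] by simp
 qed
 finally have num: "Omega x n1 u2 (normal x) + Omega x u1 n2 (normal x) =
  \<rho>\<^sup>2 * (28 * a * b * (cnj p * cnj q) ^ 6 * (- 2 * \<i> * of_real ((norm D)\<^sup>2 * Im \<tau>)))" .
 have nn: "z ^ 7 * cnj z ^ 7 = of_real (norm z ^ 14)" for z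
  unfolding power_mult_distrib[symmetric] complex_norm_square[symmetric] by (simp flip: power_mult)
 have "pd (normal x) (octic 0) x = 8 * \<rho> * (of_real (norm (x $ 0) ^ 14) + of_real (norm (x $ 1) ^ 14) + of_real (norm (x $ 2) ^ 14) + of_real (norm (x $ 3) ^ 14))"
  unfolding pd_octic_0 sum_4' n nn[symmetric] by (simp add: m_def algebra_simps)
 also have "\<dots> = 16 * \<rho> * of_real (norm p ^ 14 + norm q ^ 14)"
  by (simp add: x norm_mult ra rb p_def q_def)
 finally have den: "pd (normal x) (octic 0) x = 16 * \<rho> * of_real (norm p ^ 14 + norm q ^ 14)" .
 have mon: "monomial e x = a ^ e 0 * b ^ e 2 * (p * q) ^ 6"
 proof -
  have "p ^ 6 = p ^ e 0 * p ^ e 1" "q ^ 6 = q ^ e 2 * q ^ e 3" using power_add[of p "e 0" "e 1"] power_add[of q "e 2" "e 3"] e by simp_all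
  then show ?thesis by (simp add: monomial_def prod_4' x p_def q_def power_mult_distrib mult_ac)
 qed
 have q0: "norm q > 0" using x(3) by (simp add: q_def)
 have pos: "norm p ^ 14 + norm q ^ 14 > 0" using q0 by (intro add_nonneg_pos) auto
 have pq: "(p * q) ^ 6 * (cnj p * cnj q) ^ 6 = of_real (norm p ^ 12 * norm q ^ 12)"
  unfolding power_mult_distrib[symmetric] complex_cnj_mult[symmetric] complex_norm_square[symmetric]
  by (simp add: norm_mult power_mult_distrib flip: power_mult)
 have "(norm ((u1 $ 1 * x $ 3 - u1 $ 3 * x $ 1) / (x $ 3)\<^sup>2))\<^sup>2 = (norm D)\<^sup>2 / norm q ^ 4"
  by (simp add: D_def p_def q_def norm_divide norm_power power_divide flip: power_mult)
 moreover have "line_density (x $ 1 / x $ 3) = norm p ^ 12 * norm q ^ 16 / (norm p ^ 14 + norm q ^ 14)\<^sup>2"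
 proof -
  define X Y where "X = norm p ^ 14 + norm q ^ 14" and "Y = norm q"
  have Y: "Y > 0" and X: "X > 0" using q0 pos by (simp_all add: Y_def X_def)
  have 1: "1 + norm (p / q) ^ 14 = X / Y ^ 14" and 2: "norm (p / q) ^ 12 = norm p ^ 12 / Y ^ 12"
   using q0 by (simp_all add: X_def Y_def norm_divide power_divide field_simps)
  have b: "(Y ^ 14)\<^sup>2 = Y ^ 12 * Y ^ 16" by (simp flip: power_add power_mult)
  have r: "n / a / (x / b) = n * c / x" if "b = a * c" "a ~= 0" for n a b c x :: real using that by simp
  have 3: "norm p ^ 12 / Y ^ 12 / (X\<^sup>2 / (Y ^ 14)\<^sup>2) = norm p ^ 12 * Y ^ 16 / X\<^sup>2"
   by (rule r[OF b]) (use Y in simp)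
  have "line_density (p / q) = norm p ^ 12 * Y ^ 16 / X\<^sup>2"
   unfolding line_density_def 1 2 power_divide by (rule 3)
  then show ?thesis by (simp add: p_def q_def X_def Y_def)
 qed
 ultimately have J: "(norm ((u1 $ 1 * x $ 3 - u1 $ 3 * x $ 1) / (x $ 3)\<^sup>2))\<^sup>2 * Im \<tau> * line_density (x $ 1 / x $ 3) =
  (norm D)\<^sup>2 * Im \<tau> * (norm p ^ 12 * norm q ^ 12) / (norm p ^ 14 + norm q ^ 14)\<^sup>2"
 proof -
  have b: "norm q ^ 16 = norm q ^ 4 * norm q ^ 12" by (simp flip: power_add)
  have r: "n / a * t * (m * b / x) = n * t * (m * c) / x" if "b = a * c" "a ~= 0" for n t m a b c x :: real
   using that by simp
  show ?thesis
   unfolding \<open>(norm ((u1 $ 1 * x $ 3 - u1 $ 3 * x $ 1) / (x $ 3)\<^sup>2))\<^sup>2 = (norm D)\<^sup>2 / norm q ^ 4\<close>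
    \<open>line_density (x $ 1 / x $ 3) = norm p ^ 12 * norm q ^ 16 / (norm p ^ 14 + norm q ^ 14)\<^sup>2\<close>
   by (rule r[OF b]) (use q0 in simp)
 qed
 define P where "P = complex_of_real (norm p ^ 14 + norm q ^ 14)"
 have P0: "P ~= 0" using pos unfolding P_def of_real_eq_0_iff by linarith
 define R where "R = complex_of_real (norm p ^ 12 * norm q ^ 12)"
 define T where "T = complex_of_real ((norm D)\<^sup>2 * Im \<tau>)"
 have "monomial e x * (Omega x n1 u2 (normal x) + Omega x u1 n2 (normal x)) / pd (normal x) (octic 0) x ^ 2
  = \<rho>\<^sup>2 * 28 * (a ^ e 0 * a) * (b ^ e 2 * b) * ((p * q) ^ 6 * (cnj p * cnj q) ^ 6) * (- 2 * \<i> * T) / (16 * \<rho> * P)\<^sup>2"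
  unfolding num den mon P_def[symmetric] T_def[symmetric] by (simp add: mult_ac)
 also have "\<dots> = - 7 / 32 * \<i> * (a ^ e 0 * a) * (b ^ e 2 * b) * (R * T / P\<^sup>2)"
  unfolding pq R_def[symmetric] using \<rho> P0 by (simp add: field_simps)
 finally have fin: "monomial e x * (Omega x n1 u2 (normal x) + Omega x u1 n2 (normal x)) / pd (normal x) (octic 0) x ^ 2 =
   - 7 / 32 * \<i> * (a ^ e 0 * a) * (b ^ e 2 * b) * (R * T / P\<^sup>2)" .
 have "of_real ((norm D)\<^sup>2 * Im \<tau> * (norm p ^ 12 * norm q ^ 12) / (norm p ^ 14 + norm q ^ 14)\<^sup>2) = R * T / P\<^sup>2"
  by (simp add: R_def T_def P_def)
 then show ?thesis unfolding J fin by (simp add: field_simps)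
qed

section \<open>Periods of unions of lines\<close>

definition grid :: "complex set => complex set => point set" where
 "grid S S' = {pt x | x. x ~= 0 & (\<exists>a\<in>S. x $ 0 = a * x $ 1) & (\<exists>b\<in>S'. x $ 2 = b * x $ 3)}"

definition line_point :: "complex => complex => real \<times> real => complex ^ 4" where
 "line_point a b p = (\<chi> i. if i = 0 then a * Complex (fst p) (snd p) else if i = 1 then Complex (fst p) (snd p)
   else if i = 2 then b else 1)"

lemma line_point_nth [simp]:
 "line_point a b p $ 0 = a * Complex (fst p) (snd p)" "line_point a b p $ 1 = Complex (fst p) (snd p)"
 "line_point a b p $ 2 = b" "line_point a b p $ 3 = 1"
 by (simp_all add: line_point_def)

lemma line_point_neq_0 [simp]: "line_point a b p ~= 0"
 by (simp add: vec_eq_4)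

definition plane_density :: "real \<times> real => complex" where
 "plane_density p = of_real (line_density (Complex (fst p) (snd p)))"

text \<open>The origin is left out: there all lines with the same b meet, so it does not belong to a
  single line.\<close>

definition line_image :: "((nat => real) => point) => complex => complex => (real \<times> real) set" where
 "line_image \<sigma> a b = {p. p ~= 0 & pt (line_point a b p) \<in> tri \<sigma> ` box 0 One}"

lemma grid_lift:
 assumes "x ~= 0" "pt x \<in> grid S S'"
 shows "\<exists>a\<in>S. x $ 0 = a * x $ 1" "\<exists>b\<in>S'. x $ 2 = b * x $ 3"
proof -
 obtain y where y: "y ~= 0" "pt x = pt y" "\<exists>a\<in>S. y $ 0 = a * y $ 1" "\<exists>b\<in>S'. y $ 2 = b * y $ 3"
  using assms(2) unfolding grid_def by blast
 obtain k where "x = k *s y" using pt_eq_iff[OF y(1) assms(1)] y(2) by metis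
 then show "\<exists>a\<in>S. x $ 0 = a * x $ 1" "\<exists>b\<in>S'. x $ 2 = b * x $ 3" using y(3,4) by (auto simp: mult_ac)
qed

lemma bary2_q2_box: "e \<in> box 0 One ==> bary2 (q2 e) \<in> open_triangle"
proof -
 assume e: "e \<in> box 0 One"
 have "q2 e \<in> otri" using q2_image imageI[OF e, of q2] by simp
 moreover have "bary2 (q2 e) \<in> standard_simplex 2" using e box_subset_cbox bary2_q2 by blast
 ultimately show ?thesis
  by (auto simp: open_triangle_def bary2_def otri_def eval_nat_numeral le_Suc_eq split: prod.splits)
qed

lemma bary2_q2_inj: "inj_on (%e. bary2 (q2 e)) (box 0 One)"
proof (rule inj_onI)
 fix e e' assume e: "e \<in> box (0 :: real \<times> real) One" "e' \<in> box 0 One" and eq: "bary2 (q2 e) = bary2 (q2 e')"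
 have "q2 e = q2 e'" using fun_cong[OF eq, of 1] fun_cong[OF eq, of 2]
  by (auto simp: bary2_def split: prod.splits)
 then show "e = e'" using q2_inj e by (auto dest: inj_onD)
qed

lemma bary2_q2_surj:
 assumes "x \<in> standard_simplex 2"
 shows "\<exists>e\<in>ucube. x = bary2 (q2 e)"
proof -
 have x: "x 0 + x 1 + x 2 = 1" "x i \<ge> 0" "!!i. i > 2 ==> x i = 0" for i
  using assms by (auto simp: standard_simplex_def sum_atMost_2_3 eval_nat_numeral)
 have ge: "x 0 \<ge> 0" "x 1 \<ge> 0" "x 2 \<ge> 0" by (rule x(2))+
 define y where "y = x 2"
 \<comment> \<open>Over the collapsed edge y = 1 every z gives a preimage; 0 is a choice.\<close>
 define z where "z = (if y = 1 then 0 else x 1 / (1 - y))"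
 have z: "(1 - y) * z = x 1" using x(1) ge by (auto simp: z_def y_def)
 have "(z, y) \<in> ucube" using x(1) ge by (auto simp: ucube_Pair ucube_real z_def y_def divide_le_eq_1)
 moreover have "x = bary2 (q2 (z, y))"
 proof
  fix i show "x i = bary2 (q2 (z, y)) i"
   using x(1) x(3)[of i] z by (cases "i = 0"; cases "i = 1"; cases "i = 2") (auto simp: bary2_def q2_def y_def)
 qed
 ultimately show ?thesis by blast
qed

section \<open>Periods of cycles carried by a grid of lines\<close>

locale fermat_cycle = octic_tube +
 fixes S S' :: "complex set" and c :: qchain
 assumes S: "finite S" "!!a. a \<in> S ==> a ^ 8 = - 1" and S': "finite S'" "!!b. b \<in> S' ==> b ^ 8 = - 1"
  and c: "fundamental_cycle (grid S S') c"
begin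

lemma grid_surface: "grid S S' \<subseteq> surface 0"
proof
 fix p assume "p \<in> grid S S'"
 then obtain x a b where x: "p = pt x" "x ~= 0" "a \<in> S" "x $ 0 = a * x $ 1" "b \<in> S'" "x $ 2 = b * x $ 3"
  unfolding grid_def by blast
 then have "octic 0 x = 0" using S(2) S'(2) by (simp add: octic_def sum_4' power_mult_distrib)
 then show "p \<in> surface 0" using x(1,2) by (auto simp: surface_def)
qed

lemma cycle: "cycle2 (grid S S') c"
 using c by (simp add: fundamental_cycle_def)

lemma simplex: "\<sigma> \<in> Poly_Mapping.keys c ==> smooth_simplex 2 (grid S S') \<sigma>"
 using cycle by (auto simp: cycle2_def smooth_chain_def)

lemma tri_grid: "\<sigma> \<in> Poly_Mapping.keys c ==> e \<in> ucube ==> tri \<sigma> e \<in> grid S S'"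
 using simplex bary2_q2 unfolding smooth_simplex_def by blast

lemma tubular_grid: "tubular_points (off 0) eps (grid S S')"
 by (rule tubular_points_subset[OF tubular_surface grid_surface]) (use \<rho> in simp_all)

lemma tubular_tri: "\<sigma> \<in> Poly_Mapping.keys c ==> tubular_points (off 0) eps (tri \<sigma> ` ucube)"
 by (rule tubular_points_subset[OF tubular_grid]) (use tri_grid in blast)

lemma tri_inj:
 assumes "\<sigma> \<in> Poly_Mapping.keys c"
 shows "inj_on (tri \<sigma>) (box 0 One)"
proof (rule inj_onI)
 fix e e' assume e: "e \<in> box (0 :: real \<times> real) One" "e' \<in> box 0 One" and eq: "tri \<sigma> e = tri \<sigma> e'"
 have "inj_on \<sigma> open_triangle" using c assms by (auto simp: fundamental_cycle_def)
 from inj_onD[OF this eq bary2_q2_box[OF e(1)] bary2_q2_box[OF e(2)]]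
 show "e = e'" using inj_onD[OF bary2_q2_inj _ e] by simp
qed

text \<open>Passing from the triangle to the square replaces \<tau> by (\<tau> - x) / (1 - y), whose
  imaginary part has the same sign.\<close>

lemma oriented_square:
 assumes \<sigma>: "\<sigma> \<in> Poly_Mapping.keys c"
 obtains Y V where "lifts (tri \<sigma>) Y" "open V" "ucube \<subseteq> V" "smooth_on V Y" "!!e. e \<in> V ==> Y e ~= 0"
  "!!e. e \<in> ucube ==> tri \<sigma> e = pt (Y e)"
  "!!e. e \<in> box 0 One ==> \<exists>\<tau> k. 0 < of_rat (Poly_Mapping.lookup c \<sigma>) * Im \<tau> & pd (0, 1) Y e = \<tau> *s pd (1, 0) Y e + k *s Y e"
proof -
 let ?s = "of_rat (Poly_Mapping.lookup c \<sigma>) :: real"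
 have "oriented_immersion (Poly_Mapping.lookup c \<sigma>) \<sigma>" using c \<sigma> by (auto simp: fundamental_cycle_def)
 then obtain G where G: "smooth_lift 2 \<sigma> G" and or: "!!a b. 0 < a ==> 0 < b ==> a + b < 1 ==>
   \<exists>\<tau> k. 0 < ?s * Im \<tau> & d2 G a b = \<tau> *s d1 G a b + k *s G (a, b, 0)"
  unfolding oriented_immersion_def by blast
 define Y where "Y = (%e. G (fst (q2 e), snd (q2 e), 0))"
 have L: "lifts (tri \<sigma>) Y" unfolding Y_def by (rule lifts_tri[OF G])
 then obtain V where V: "open V" "ucube \<subseteq> V" "smooth_on V Y" "\<forall>e\<in>V. Y e ~= 0" "\<forall>e\<in>ucube. tri \<sigma> e = pt (Y e)"
  unfolding lifts_def by (elim exE conjE)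
 show thesis
 proof (rule that[OF L V(1-3) bspec[OF V(4)] bspec[OF V(5)]], assumption, assumption)
  fix e :: "real \<times> real" assume e: "e \<in> box 0 One"
  obtain x y where xy: "e = (x, y)" by (cases e)
  have e': "(x, y) \<in> box 0 One" using e xy by simp
  define a where "a = (1 - y) * x"
  have q: "q2 (x, y) = (a, y)" by (simp add: q2_def a_def)
  have ab: "(a, y) \<in> otri" using q2_image imageI[OF e', of q2] q by simp
  obtain \<tau> k where \<tau>: "0 < ?s * Im \<tau>" "d2 G a y = \<tau> *s d1 G a y + k *s G (a, y, 0)"
   using or[of a y] ab by (auto simp: otri_def)
  note der = smooth_lift_derivatives(1,2)[OF G e', folded a_def Y_def]
  have y: "1 - y > 0" using e' by (simp add: box_pair)
  let ?\<tau> = "(\<tau> - of_real x) / of_real (1 - y)"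
  have 1: "pd (1, 0) Y e = complex_of_real (1 - y) *s d1 G a y" and 2: "pd (0, 1) Y e = d2 G a y + complex_of_real (- x) *s d1 G a y"
   unfolding xy by (rule der)+
  have "Y e = G (a, y, 0)" by (simp add: Y_def xy q)
  moreover have "?\<tau> *s (complex_of_real (1 - y) *s v) = (\<tau> - of_real x) *s v" for v :: "complex ^ 4"
   using y by (simp add: vec_eq_iff del: of_real_diff)
  ultimately have "pd (0, 1) Y e = ?\<tau> *s pd (1, 0) Y e + k *s Y e"
   unfolding 1 2 \<tau>(2) by (simp add: vec_eq_iff algebra_simps)
  moreover have "Im ?\<tau> = Im \<tau> / (1 - y)" by (simp add: Im_divide_of_real)
  then have "0 < ?s * Im ?\<tau>" using \<tau>(1) y by simp
  ultimately show "\<exists>\<tau> k. 0 < ?s * Im \<tau> & pd (0, 1) Y e = \<tau> *s pd (1, 0) Y e + k *s Y e" by blast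
 qed
qed

text \<open>The second tangent vector is a complex multiple of the first modulo x, so the residue
  form restricts to 0 on the curve. This removes the constant term of the periods.\<close>

lemma period_1:
 assumes "total \<beta> = 4"
 shows "tube_integral (quot 0 1 \<beta>) eps c = 0"
proof -
 have "square_integral (quot 0 1 \<beta>) eps (tri \<sigma>) = 0" if \<sigma>: "\<sigma> \<in> Poly_Mapping.keys c" for \<sigma>
 proof -
  obtain Y V where Y: "lifts (tri \<sigma>) Y" "ucube \<subseteq> V" "!!e. e \<in> V ==> Y e ~= 0"
   "!!e. e \<in> ucube ==> tri \<sigma> e = pt (Y e)"
   "!!e. e \<in> box 0 One ==> \<exists>\<tau> k. 0 < of_rat (Poly_Mapping.lookup c \<sigma>) * Im \<tau> & pd (0, 1) Y e = \<tau> *s pd (1, 0) Y e + k *s Y e"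
   using oriented_square[OF \<sigma>] by metis
  have gr: "graded 4 (off 0) (quot 0 1 \<beta>)" by (rule graded_quot) (use assms in simp)
  have z: "tden (quot 0 1 \<beta>) eps Y (1, 0) (0, 1) e = 0" if e: "e \<in> box 0 One" for e
  proof -
   have e': "e \<in> ucube" using e box_subset_cbox by blast
   have nz: "Y e ~= 0" by (rule Y(3)[OF subsetD[OF Y(2) e']])
   have o: "octic 0 (Y e) = 0"
    using pt_in_surface nz subsetD[OF grid_surface tri_grid[OF \<sigma> e']] Y(4)[OF e'] by metis
   obtain k where k: "k > 0" "!!z. norm z \<le> eps ==> norm (octic 0 (Y e + z *s normal (Y e))) \<ge> k * norm z"
    using bd[of 0, OF _ nz o] \<rho> by auto
   obtain \<tau> l where "pd (0, 1) Y e = \<tau> *s pd (1, 0) Y e + l *s Y e" using Y(5)[OF e] by blast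
   then have "Omega (Y e) (pd (1, 0) Y e) (pd (0, 1) Y e) (normal (Y e)) = 0"
    by (simp only: Omega_add Omega_smult Omega_eq) simp
   moreover have "tden (quot 0 1 \<beta>) eps Y (1, 0) (0, 1) e = 2 * pi * \<i> * (monomial \<beta> (Y e) *
     Omega (Y e) (pd (1, 0) Y e) (pd (0, 1) Y e) (normal (Y e)) / pd (normal (Y e)) (octic 0) (Y e))"
    unfolding tden_def by (rule residue_simple(1)[OF k eps o])
   ultimately show ?thesis by simp
  qed
  have "integral (box 0 One) (tden (quot 0 1 \<beta>) eps Y (1, 0) (0, 1)) = integral (box 0 One) (%e :: real \<times> real. 0)"
   by (rule integral_cong) (rule z)
  then show ?thesis
   unfolding square_integral_eq[OF Y(1) gr tubular_tri[OF \<sigma>] eps] integral_open_interval[symmetric] by simp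
 qed
 then have "tube_integral (quot 0 1 \<beta>) eps c = chain_sum (%\<sigma>. 0) c"
  unfolding tube_integral_def by (rule chain_sum_cong)
 then show ?thesis by (simp add: chain_sum_def)
qed

text \<open>The torus acts on x^e Omega with weight e 0 + e 1 + 2, the 2 coming from Omega; a
  primitive eighth root of unity detects weights not divisible by 8.\<close>

lemma period_vanishing:
 assumes "total e + 4 = 8 * k" "\<not> 8 dvd e 0 + e 1 + 2"
 shows "tube_integral (quot 0 k e) eps c = 0"
proof (rule torus_vanishing[OF cycle graded_quot[OF assms(1)] tubular_grid eps])
 let ?\<zeta> = "cis (pi / 4)"
 show "quot 0 k e (torus ?\<zeta> y) = ?\<zeta> ^ (e 0 + e 1) * quot 0 k e y" for y
 proof -
  have "?\<zeta> ^ 8 = 1" by (simp add: Complex.DeMoivre)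
  then have "octic 0 (torus ?\<zeta> y) = octic 0 y" by (simp add: octic_def sum_4' power_mult_distrib)
  moreover have "monomial e (torus ?\<zeta> y) = ?\<zeta> ^ (e 0 + e 1) * monomial e y"
   by (simp add: monomial_def prod_4' power_mult_distrib power_add mult_ac)
  ultimately show ?thesis by (simp add: quot_def)
 qed
 show "?\<zeta>\<^sup>2 * ?\<zeta> ^ (e 0 + e 1) ~= 1"
 proof
  assume "?\<zeta>\<^sup>2 * ?\<zeta> ^ (e 0 + e 1) = 1"
  then have "cis (of_nat (e 0 + e 1 + 2) * (pi / 4)) = 1"
   unfolding power_add[symmetric] unfolding Complex.DeMoivre by (simp only: add.commute)
  then have "cos (of_nat (e 0 + e 1 + 2) * (pi / 4)) = 1" by (metis cis.simps(1) one_complex.simps(1))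
  then obtain j :: int where "of_nat (e 0 + e 1 + 2) * (pi / 4) = of_int j * 2 * pi"
   unfolding cos_one_2pi_int by blast
  then have "pi * real (e 0 + e 1 + 2) = pi * of_int (8 * j)" by (simp add: mult_ac)
  then have "real (e 0 + e 1 + 2) = of_int (8 * j)" unfolding mult_cancel_left using pi_neq_zero by blast
  then have "of_int (int (e 0 + e 1 + 2)) = (of_int (8 * j) :: real)" by simp
  then have "int (e 0 + e 1 + 2) = 8 * j" by (simp only: of_int_eq_iff)
  then have "int 8 dvd int (e 0 + e 1 + 2)" by simp
  then show False using assms(2) unfolding int_dvd_int_iff by simp
 qed
 fix \<zeta> :: complex and x assume \<zeta>: "norm \<zeta> = 1" and x: "x ~= 0" "pt x \<in> grid S S'"
 have "\<zeta> ~= 0" using \<zeta> by auto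
 moreover have "\<exists>a\<in>S. torus \<zeta> x $ 0 = a * torus \<zeta> x $ 1" "\<exists>b\<in>S'. torus \<zeta> x $ 2 = b * torus \<zeta> x $ 3"
  using grid_lift[OF x] by (auto simp: mult_ac)
 ultimately show "pt (torus \<zeta> x) \<in> grid S S'" using x(1) torus_eq_0 unfolding grid_def by blast
qed

end

context fermat_cycle
begin

lemma line_images_disjoint:
 assumes "\<sigma> \<in> Poly_Mapping.keys c" "\<tau> \<in> Poly_Mapping.keys c" "\<sigma> ~= \<tau>"
 shows "line_image \<sigma> a b \<inter> line_image \<tau> a b = {}"
proof -
 have "\<sigma> ` open_triangle \<inter> \<tau> ` open_triangle = {}" using c assms by (simp add: fundamental_cycle_def)
 then have "tri \<sigma> ` box 0 One \<inter> tri \<tau> ` box 0 One = {}" using bary2_q2_box by blast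
 then show ?thesis unfolding line_image_def by blast
qed

text \<open>The triangles cover the grid, so apart from the origin a point of the line missed by all
  open triangles lies on an edge. Edges have measure zero, and so has their image under the
  differentiable map to the affine coordinate.\<close>

lemma line_images_cover:
 assumes a: "a \<in> S" and b: "b \<in> S'"
 shows "negligible (- (\<Union>\<sigma>\<in>Poly_Mapping.keys c. line_image \<sigma> a b))"
proof -
 have "\<exists>N. negligible N & (\<forall>p. pt (line_point a b p) \<in> tri \<sigma> ` (ucube - box 0 One) --> p \<in> N)"
  if \<sigma>: "\<sigma> \<in> Poly_Mapping.keys c" for \<sigma>
 proof -
  obtain Y V where V: "open V" "ucube \<subseteq> V" "smooth_on V Y" "!!e. e \<in> V ==> Y e ~= 0"
   "!!e. e \<in> ucube ==> tri \<sigma> e = pt (Y e)"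
   using oriented_square[OF \<sigma>] by metis
  define w where "w = (%e. (Re (Y e $ 1 / Y e $ 3), Im (Y e $ 1 / Y e $ 3)))"
  define E where "E = {e \<in> ucube - box 0 One. Y e $ 3 ~= 0}"
  have neg: "negligible E"
   by (rule negligible_subset[OF negligible_frontier_interval[of 0 One]]) (auto simp: E_def)
  have dif: "w differentiable_on E"
   unfolding differentiable_on_def
  proof
   fix e assume e: "e \<in> E"
   have "e \<in> V" using e V(2) by (auto simp: E_def)
   from smooth_on_differentiable[OF V(3) this]
   have "(Y has_derivative frechet_derivative Y (at e)) (at e)" .
   from has_derivative_divide[OF has_derivative_vec_nth[OF this] has_derivative_vec_nth[OF this], of 3 1] e
   obtain D where D: "((%e. Y e $ 1 / Y e $ 3) has_derivative D) (at e)" by (auto simp: E_def)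
   have "(w has_derivative (%h. (Re (D h), Im (D h)))) (at e)"
    unfolding w_def by (intro has_derivative_Pair bounded_linear.has_derivative[OF bounded_linear_Re D]
     bounded_linear.has_derivative[OF bounded_linear_Im D])
   then show "w differentiable (at e within E)"
    unfolding differentiable_def using has_derivative_at_withinI by blast
  qed
  have "negligible (w ` E)" by (rule negligible_differentiable_image_negligible[OF order_refl neg dif])
  moreover have "p \<in> w ` E" if "pt (line_point a b p) \<in> tri \<sigma> ` (ucube - box 0 One)" for p
  proof -
   from that obtain e where e: "e \<in> ucube" "e \<notin> box 0 One" "pt (line_point a b p) = tri \<sigma> e" by blast
   note e(3)[unfolded V(5)[OF e(1)]]
   note e = e(1,2) this
   obtain k where k: "k ~= 0" "Y e = k *s line_point a b p"
    using pt_eq_iff[OF line_point_neq_0 V(4)[OF subsetD[OF V(2) e(1)]]] e(3) by metis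
   have "e \<in> E" "w e = p" using e(1,2) k by (simp_all add: E_def w_def)
   then show ?thesis by blast
  qed
  ultimately show ?thesis by blast
 qed
 then obtain N where N: "!!\<sigma>. \<sigma> \<in> Poly_Mapping.keys c ==> negligible (N \<sigma>)"
  "!!\<sigma> p. \<sigma> \<in> Poly_Mapping.keys c ==> pt (line_point a b p) \<in> tri \<sigma> ` (ucube - box 0 One) ==> p \<in> N \<sigma>"
  by metis
 have "- (\<Union>\<sigma>\<in>Poly_Mapping.keys c. line_image \<sigma> a b) \<subseteq> {0} \<union> (\<Union>\<sigma>\<in>Poly_Mapping.keys c. N \<sigma>)"
 proof
  fix p assume p: "p \<in> - (\<Union>\<sigma>\<in>Poly_Mapping.keys c. line_image \<sigma> a b)"
  have "\<exists>a\<in>S. line_point a0 b p $ 0 = a * line_point a0 b p $ 1" if "a0 \<in> S" for a0 using that by auto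
  then have "pt (line_point a b p) \<in> grid S S'"
   unfolding grid_def using a b by (auto intro!: exI[of _ "line_point a b p"])
  also have "grid S S' = (\<Union>\<sigma>\<in>Poly_Mapping.keys c. \<sigma> ` standard_simplex 2)"
   using c by (simp add: fundamental_cycle_def)
  finally obtain \<sigma> x where \<sigma>: "\<sigma> \<in> Poly_Mapping.keys c" "x \<in> standard_simplex 2" "pt (line_point a b p) = \<sigma> x" by blast
  obtain e where e: "e \<in> ucube" "x = bary2 (q2 e)" using bary2_q2_surj[OF \<sigma>(2)] by blast
  have eq: "pt (line_point a b p) = tri \<sigma> e" using \<sigma>(3) e(2) by simp
  show "p \<in> {0} \<union> (\<Union>\<sigma>\<in>Poly_Mapping.keys c. N \<sigma>)"
  proof (cases "p = 0 \<or> e \<notin> box 0 One")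
   case True
   then show ?thesis using N(2)[OF \<sigma>(1), of p] eq e(1) \<sigma>(1) by auto
  next
   case False
   then have "p \<in> line_image \<sigma> a b" using eq by (auto simp: line_image_def)
   then show ?thesis using p \<sigma>(1) by blast
  qed
 qed
 then show ?thesis
  by (rule negligible_subset[rotated]) (intro negligible_Un negligible_sing negligible_Union, use N(1) in auto)
qed

text \<open>The square is cut into open pieces, each mapping into one line away from x_1 = 0 and x_3
  = 0. On a piece the affine coordinate w is injective and its Jacobian appears in
  \<open>residue_line\<close>; the coefficient of the triangle has the sign of Im \<tau>, which
  turns it into the absolute Jacobian required by the change of variables.\<close>

lemma line_residue:
 assumes \<sigma>: "\<sigma> \<in> Poly_Mapping.keys c" and e: "e 0 + e 1 = 6" "e 2 + e 3 = 6"
 shows "!!a b. a \<in> S ==> b \<in> S' ==> plane_density absolutely_integrable_on line_image \<sigma> a b"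
  "of_rat (Poly_Mapping.lookup c \<sigma>) * square_integral (quot 0 2 e) eps (tri \<sigma>) =
   7 * pi / 16 * (\<Sum>(a, b)\<in>S \<times> S'. a ^ (e 0 + 1) * b ^ (e 2 + 1) * integral (line_image \<sigma> a b) plane_density)"
proof -
 let ?r = "Poly_Mapping.lookup c \<sigma>"
 define s where "s = (of_rat ?r :: real)"
 have "\<bar>?r\<bar> = 1" using c \<sigma> by (simp add: fundamental_cycle_def)
 then have s: "s = 1 \<or> s = - 1" and sc: "of_rat ?r = complex_of_real s" by (auto simp: s_def abs_if split: if_splits)
 obtain Y V where L: "lifts (tri \<sigma>) Y" and V: "open V" "ucube \<subseteq> V" "smooth_on V Y" "!!e. e \<in> V ==> Y e ~= 0"
   and tri: "!!e. e \<in> ucube ==> tri \<sigma> e = pt (Y e)"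
   and or: "!!e. e \<in> box 0 One ==> \<exists>\<tau> k. 0 < s * Im \<tau> & pd (0, 1) Y e = \<tau> *s pd (1, 0) Y e + k *s Y e"
  using oriented_square[OF \<sigma>, folded s_def] by metis
 let ?g = "quot 0 2 e"
 have gr: "graded 4 (off 0) ?g" by (rule graded_quot) (simp add: total_def sum_4' e)
 interpret t: tube_form V Y eps "off 0" ?g 4
  by standard (use V eps gr tubular_lift[OF tubular_tri[OF \<sigma>] L] in auto)
 let ?T = "tden ?g eps Y (1, 0) (0, 1)"
 have boxV: "e \<in> V" "e \<in> ucube" if "e \<in> box 0 One" for e using that V(2) box_subset_cbox by blast+
 have Tint: "?T absolutely_integrable_on U" if "U \<in> sets lebesgue" "U \<subseteq> box 0 One" for U
 proof (rule set_integrable_subset[OF absolutely_integrable_continuous[OF t.continuous_tden] that(1)])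
  show "U \<subseteq> ucube" using that(2) boxV by blast
 qed
 define Q where "Q = (%e. Y e $ 1 / Y e $ 3)"
 define w where "w = (%e. (Re (Q e), Im (Q e)))"
 define O' where "O' = (%a b. {e \<in> box 0 One. Y e $ 1 ~= 0 & Y e $ 3 ~= 0 & Y e $ 0 = a * Y e $ 1 & Y e $ 2 = b * Y e $ 3})"
 have on: "\<exists>a\<in>S. Y e $ 0 = a * Y e $ 1" "\<exists>b\<in>S'. Y e $ 2 = b * Y e $ 3" "octic 0 (Y e) = 0" if "e \<in> ucube" for e
 proof -
  have g: "pt (Y e) \<in> grid S S'" using tri_grid[OF \<sigma> that] tri[OF that] by simp
  have nz: "Y e ~= 0" using V(2,4) that by blast
  show "\<exists>a\<in>S. Y e $ 0 = a * Y e $ 1" "\<exists>b\<in>S'. Y e $ 2 = b * Y e $ 3" using grid_lift[OF nz g] by blast+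
  show "octic 0 (Y e) = 0" using pt_in_surface nz subsetD[OF grid_surface g] by metis
 qed
 have O_open: "open (O' a b)" if "a \<in> S" "b \<in> S'" for a b
 proof -
  \<comment> \<open>On the grid, \<open>h\<close> vanishes on every other line and where x_1 or x_3
    is 0, so its nonvanishing cuts the piece out as an open set.\<close>
  define h where "h = (%e. Y e $ 1 * Y e $ 3 * (\<Prod>a'\<in>S-{a}. Y e $ 0 - a' * Y e $ 1) * (\<Prod>b'\<in>S'-{b}. Y e $ 2 - b' * Y e $ 3))"
  have "continuous_on (box 0 One) Y"
   by (rule continuous_on_subset[OF smooth_on_continuous[OF V(3)]]) (use boxV in blast)
  then have "continuous_on (box 0 One) h" unfolding h_def by (intro continuous_intros)
  from continuous_open_preimage[OF this open_box, of "- {0}"]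
  have "open {e \<in> box 0 One. h e ~= 0}" by (simp add: vimage_def Int_def open_Compl)
  also have "{e \<in> box 0 One. h e ~= 0} = O' a b"
  proof -
   have "h e ~= 0 \<longleftrightarrow> e \<in> O' a b" if e: "e \<in> box 0 One" for e
    using on(1,2)[OF boxV(2)[OF e]] e S(1) S'(1) \<open>a \<in> S\<close> \<open>b \<in> S'\<close> by (auto simp: h_def O'_def)
   then show ?thesis by (auto simp: O'_def)
  qed
  finally show ?thesis .
 qed
 have O_sub: "O' a b \<subseteq> box 0 One" for a b by (auto simp: O'_def)
 have wO: "w ` O' a b = line_image \<sigma> a b" for a b
 proof (rule Set.set_eqI)
  fix p
  show "p \<in> w ` O' a b \<longleftrightarrow> p \<in> line_image \<sigma> a b"
  proof
   assume "p \<in> w ` O' a b"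
   then obtain e where e: "e \<in> O' a b" "p = w e" by blast
   have "Y e = Y e $ 3 *s line_point a b p" using e by (simp add: vec_eq_4 O'_def w_def Q_def)
   moreover have "Y e $ 3 ~= 0" using e(1) by (simp add: O'_def)
   ultimately have "pt (Y e) = pt (line_point a b p)" using pt_smult by metis
   moreover have "Q e ~= 0" using e(1) by (simp add: O'_def Q_def)
   then have "p ~= 0" by (simp add: e(2) w_def prod_eq_iff complex_eq_iff)
   moreover have eb: "e \<in> box 0 One" by (rule subsetD[OF O_sub e(1)])
   ultimately show "p \<in> line_image \<sigma> a b"
    unfolding line_image_def mem_Collect_eq using tri[OF boxV(2)[OF eb]] imageI[OF eb, of "tri \<sigma>"] by simp
  next
   assume "p \<in> line_image \<sigma> a b"
   then obtain e where e: "p ~= 0" "e \<in> box 0 One" "pt (line_point a b p) = tri \<sigma> e" unfolding line_image_def by blast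
   then have "pt (line_point a b p) = pt (Y e)" using tri[OF boxV(2)] by simp
   then obtain k where k: "k ~= 0" "Y e = k *s line_point a b p"
    using pt_eq_iff[OF line_point_neq_0 V(4)[OF boxV(1)[OF e(2)]]] by metis
   have "Complex (fst p) (snd p) ~= 0" using e(1) by (simp add: prod_eq_iff complex_eq_iff)
   then have "e \<in> O' a b" "w e = p" using k e(2) by (simp_all add: O'_def w_def Q_def)
   then show "p \<in> w ` O' a b" by blast
  qed
 qed
 have w_inj: "inj_on w (O' a b)" for a b
 proof (rule inj_onI)
  fix e e' assume e: "e \<in> O' a b" "e' \<in> O' a b" and eq: "w e = w e'"
  have "Q e = Q e'" using eq by (simp add: w_def complex_eq_iff)
  then have "Y e = (Y e $ 3 / Y e' $ 3) *s Y e'" using e by (simp add: vec_eq_4 O'_def Q_def field_simps)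
  moreover have "Y e $ 3 / Y e' $ 3 ~= 0" using e by (simp add: O'_def)
  ultimately have "pt (Y e) = pt (Y e')" using pt_smult by metis
  then have "tri \<sigma> e = tri \<sigma> e'" using e O_sub tri boxV(2) by (metis subsetD)
  then show "e = e'" using inj_onD[OF tri_inj[OF \<sigma>]] e O_sub by blast
 qed
 define D where "D = (%e h. (pd h Y e $ 1 * Y e $ 3 - pd h Y e $ 3 * Y e $ 1) / (Y e $ 3)\<^sup>2)"
 have Y': "(Y has_derivative frechet_derivative Y (at e)) (at e)" if "e \<in> box 0 One" for e
  by (rule smooth_on_differentiable[OF V(3) boxV(1)[OF that]])
 have w': "(w has_derivative (%h. (Re (D e h), Im (D e h)))) (at e)" if "e \<in> O' a b" for e a b
 proof -
  have eb: "e \<in> box 0 One" and nz: "Y e $ 3 ~= 0" using that by (simp_all add: O'_def)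
  note d = has_derivative_vec_nth[OF Y'[OF eb]]
  have "(Q has_derivative D e) (at e)"
   unfolding Q_def
   by (rule has_derivative_eq_rhs[OF has_derivative_divide'[OF d d nz]]) (simp add: D_def fun_eq_iff power2_eq_square)
  from bounded_linear.has_derivative[OF bounded_linear_Re this] bounded_linear.has_derivative[OF bounded_linear_Im this]
  show ?thesis unfolding w_def by (rule has_derivative_Pair)
 qed
 define J where "J = (%e. Re (D e (1, 0)) * Im (D e (0, 1)) - Im (D e (1, 0)) * Re (D e (0, 1)))"
 define K where "K = (%a b. complex_of_real (7 * pi / 16) * (a ^ (e 0 + 1) * b ^ (e 2 + 1)))"
 have K0: "K a b ~= 0" if "a \<in> S" "b \<in> S'" for a b
  using root_cnj(3)[OF S(2)[OF that(1)]] root_cnj(3)[OF S'(2)[OF that(2)]] by (simp add: K_def)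
 have T: "complex_of_real s * ?T p = K a b * (\<bar>J p\<bar> *\<^sub>R plane_density (w p))"
  if p: "p \<in> O' a b" and a: "a \<in> S" and b: "b \<in> S'" for p a b
 proof -
  have pb: "p \<in> box 0 One" and x: "Y p $ 0 = a * Y p $ 1" "Y p $ 2 = b * Y p $ 3" "Y p $ 3 ~= 0"
   using p by (simp_all add: O'_def)
  note d = has_derivative_vec_nth[OF Y'[OF pb]]
  have der: "pd h Y p $ 0 = a * pd h Y p $ 1" "pd h Y p $ 2 = b * pd h Y p $ 3" for h
  proof -
   have "((%e. a * Y e $ 1) has_derivative (%h. pd h Y p $ 0)) (at p)"
    by (rule has_derivative_transform_within_open[OF d O_open[OF a b] p]) (simp add: O'_def)
   from has_derivative_unique[OF this has_derivative_mult_right[OF d]]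
   show "pd h Y p $ 0 = a * pd h Y p $ 1" by (rule fun_cong)
   have "((%e. b * Y e $ 3) has_derivative (%h. pd h Y p $ 2)) (at p)"
    by (rule has_derivative_transform_within_open[OF d O_open[OF a b] p]) (simp add: O'_def)
   from has_derivative_unique[OF this has_derivative_mult_right[OF d]]
   show "pd h Y p $ 2 = b * pd h Y p $ 3" by (rule fun_cong)
  qed
  have nz: "Y p ~= 0" by (rule V(4)[OF boxV(1)[OF pb]])
  note o = on(3)[OF boxV(2)[OF pb]]
  obtain k where k: "k > 0" "!!z. norm z \<le> eps ==> norm (octic 0 (Y p + z *s normal (Y p))) \<ge> k * norm z"
   using bd[of 0, OF _ nz o] \<rho> by auto
  obtain \<tau> l where \<tau>: "0 < s * Im \<tau>" "pd (0, 1) Y p = \<tau> *s pd (1, 0) Y p + l *s Y p" using or[OF pb] by blast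
  have zero: "Omega (Y p) (pd (1, 0) Y p) (pd (0, 1) Y p) (normal (Y p)) = 0"
   using \<tau>(2) by (simp only: Omega_add Omega_smult Omega_eq) simp
  have gd: "Y differentiable (at p)" using Y'[OF pb] by (auto simp: differentiable_def)
  obtain r1 where r1: "pd (1, 0) (%e. normal (Y e)) p = r1 *s (\<chi> i. cnj (Y p $ i) ^ 7) +
    complex_of_real (inverse (norm (Y p) ^ 6)) *s (\<chi> i. 7 * cnj (Y p $ i) ^ 6 * cnj (pd (1, 0) Y p $ i))"
   using normal_derivative[OF gd nz, of "(1, 0)"] by (elim exE)
  obtain r2 where r2: "pd (0, 1) (%e. normal (Y e)) p = r2 *s (\<chi> i. cnj (Y p $ i) ^ 7) +
    complex_of_real (inverse (norm (Y p) ^ 6)) *s (\<chi> i. 7 * cnj (Y p $ i) ^ 6 * cnj (pd (0, 1) Y p $ i))"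
   using normal_derivative[OF gd nz, of "(0, 1)"] by (elim exE)
  have D2: "D p (0, 1) = \<tau> * D p (1, 0)"
   unfolding D_def \<tau>(2) using x(3) by (simp add: field_simps)
  have J: "J p = (norm (D p (1, 0)))\<^sup>2 * Im \<tau>"
   unfolding J_def D2 cmod_power2 by (simp add: algebra_simps power2_eq_square)
  have "?T p = 7 * pi / 16 * a ^ (e 0 + 1) * b ^ (e 2 + 1) *
   of_real ((norm (D p (1, 0)))\<^sup>2 * Im \<tau> * line_density (Y p $ 1 / Y p $ 3))"
   unfolding tden_def D_def
   by (rule trans[OF residue_double[OF k eps o zero] residue_line[OF S(2)[OF a] S'(2)[OF b] x der \<tau>(2) r1 r2 e]])
  also have "\<dots> = K a b * (complex_of_real (J p) * plane_density (w p))"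
   by (simp add: J K_def plane_density_def w_def Q_def mult_ac)
  finally have "complex_of_real s * ?T p = K a b * (complex_of_real (s * J p) * plane_density (w p))" by simp
  also have "s * J p = \<bar>J p\<bar>"
  proof -
   have "s * J p = (norm (D p (1, 0)))\<^sup>2 * (s * Im \<tau>)" by (simp add: J)
   also have "\<dots> \<ge> 0" by (rule mult_nonneg_nonneg) (use \<tau>(1) in \<open>simp_all del: zero_less_mult_iff\<close>)
   finally have "s * J p \<ge> 0" .
   then show ?thesis using s by auto
  qed
  finally show ?thesis by (simp add: scaleR_conv_of_real)
 qed
 have cv: "plane_density absolutely_integrable_on line_image \<sigma> a b"
  "integral (O' a b) (%p. complex_of_real s * ?T p) = K a b * integral (line_image \<sigma> a b) plane_density"
  if a: "a \<in> S" and b: "b \<in> S'" for a b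
 proof -
  let ?H = "%p. \<bar>J p\<bar> *\<^sub>R plane_density (w p)"
  note Tab = T[OF _ a b]
  have "(%p. (complex_of_real s / K a b) * ?T p) absolutely_integrable_on O' a b"
   by (intro set_integrable_mult_right Tint O_sub) (simp add: borel_open[OF O_open[OF a b]])
  moreover have "(complex_of_real s / K a b) * ?T p = ?H p" if "p \<in> O' a b" for p
   using Tab[OF that] K0[OF a b] by (simp add: field_simps)
  ultimately have H: "?H absolutely_integrable_on O' a b"
   by (rule iffD1[OF set_integrable_cong[OF refl refl], rotated])
  have "?H absolutely_integrable_on O' a b & integral (O' a b) ?H = integral (O' a b) ?H
   \<longleftrightarrow> plane_density absolutely_integrable_on (w ` O' a b) & integral (w ` O' a b) plane_density = integral (O' a b) ?H"
   using change_of_variables_plane[where S = "O' a b" and g = w and g' = "%e h. (Re (D e h), Im (D e h))"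
     and f = plane_density and b = "integral (O' a b) ?H", OF borel_open[OF O_open[OF a b]] has_derivative_at_withinI[OF w'] w_inj]
   by (simp add: J_def)
  then have *: "plane_density absolutely_integrable_on line_image \<sigma> a b" "integral (line_image \<sigma> a b) plane_density = integral (O' a b) ?H"
   using H unfolding wO by blast+
  show "plane_density absolutely_integrable_on line_image \<sigma> a b" by (rule *(1))
  have "integral (O' a b) (%p. complex_of_real s * ?T p) = integral (O' a b) (%p. K a b * ?H p)"
   by (rule integral_cong) (rule Tab)
  then show "integral (O' a b) (%p. complex_of_real s * ?T p) = K a b * integral (line_image \<sigma> a b) plane_density"
   unfolding *(2) by (simp only: integral_mult_right)
 qed
 show "plane_density absolutely_integrable_on line_image \<sigma> a b" if "a \<in> S" "b \<in> S'" for a b by (rule cv(1)[OF that])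
 let ?U = "\<Union>ab\<in>S \<times> S'. O' (fst ab) (snd ab)"
 \<comment> \<open>Points outside all pieces map to the finitely many points of the grid with x_0 =
   x_1 = 0 or x_2 = x_3 = 0; as the triangle is injective on the open square, they are finite in
   number.\<close>
 have neg: "negligible (box 0 One - ?U)"
 proof -
  define Z where "Z = box 0 One - ?U"
  define v0 where "v0 = (%b :: complex. \<chi> i :: 4. if i = 2 then b else if i = 3 then 1 else 0)"
  define v1 where "v1 = (%a :: complex. \<chi> i :: 4. if i = 0 then a else if i = 1 then 1 else 0)"
  have "tri \<sigma> e \<in> (%b. pt (v0 b)) ` S' \<union> (%a. pt (v1 a)) ` S" if "e \<in> Z" for e
  proof -
   have eb: "e \<in> box 0 One" using that by (simp add: Z_def)
   obtain a b where ab: "a \<in> S" "b \<in> S'" "Y e $ 0 = a * Y e $ 1" "Y e $ 2 = b * Y e $ 3"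
    using on(1,2)[OF boxV(2)[OF eb]] by blast
   then have "e \<notin> O' a b" using that by (auto simp: Z_def)
   then consider "Y e $ 1 = 0" | "Y e $ 3 = 0" using ab eb by (auto simp: O'_def)
   then show ?thesis
   proof cases
    case 1
    then have eq: "Y e = Y e $ 3 *s v0 b" using ab by (simp add: vec_eq_4 v0_def)
    then have "Y e $ 3 ~= 0" using V(4)[OF boxV(1)[OF eb]] by (metis vector_smult_lzero)
    then have "pt (Y e) = pt (v0 b)" using eq pt_smult by metis
    then show ?thesis using tri[OF boxV(2)[OF eb]] ab by auto
   next
    case 2
    then have eq: "Y e = Y e $ 1 *s v1 a" using ab by (simp add: vec_eq_4 v1_def)
    then have "Y e $ 1 ~= 0" using V(4)[OF boxV(1)[OF eb]] by (metis vector_smult_lzero)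
    then have "pt (Y e) = pt (v1 a)" using eq pt_smult by metis
    then show ?thesis using tri[OF boxV(2)[OF eb]] ab by auto
   qed
  qed
  then have "tri \<sigma> ` Z \<subseteq> (%b. pt (v0 b)) ` S' \<union> (%a. pt (v1 a)) ` S" by blast
  moreover have "finite ((%b. pt (v0 b)) ` S' \<union> (%a. pt (v1 a)) ` S)" using S(1) S'(1) by simp
  ultimately have "finite (tri \<sigma> ` Z)" by (rule finite_subset)
  moreover have "inj_on (tri \<sigma>) Z" by (rule inj_on_subset[OF tri_inj[OF \<sigma>]]) (simp add: Z_def)
  ultimately have "finite Z" by (rule finite_imageD)
  then show ?thesis unfolding Z_def by (rule negligible_finite)
 qed
 have "((%p. complex_of_real s * ?T p) has_integral (\<Sum>ab\<in>S \<times> S'. K (fst ab) (snd ab) * integral (line_image \<sigma> (fst ab) (snd ab)) plane_density)) ?U"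
 proof (rule has_integral_UN)
  show "finite (S \<times> S')" using S(1) S'(1) by simp
  fix ab assume "ab \<in> S \<times> S'"
  then have ab: "fst ab \<in> S" "snd ab \<in> S'" by auto
  have "(%p. complex_of_real s * ?T p) absolutely_integrable_on O' (fst ab) (snd ab)"
   by (intro set_integrable_mult_right Tint O_sub) (simp add: borel_open[OF O_open[OF ab]])
  then have "(%p. complex_of_real s * ?T p) integrable_on O' (fst ab) (snd ab)" by (rule set_lebesgue_integral_eq_integral(1))
  then show "((%p. complex_of_real s * ?T p) has_integral K (fst ab) (snd ab) * integral (line_image \<sigma> (fst ab) (snd ab)) plane_density) (O' (fst ab) (snd ab))"
   unfolding cv(2)[OF ab, symmetric] by (rule integrable_integral)
 next
  show "pairwise (%i i'. negligible (O' (fst i) (snd i) \<inter> O' (fst i') (snd i'))) (S \<times> S')"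
  proof (rule pairwiseI)
   fix i i' :: "complex \<times> complex" assume "i ~= i'"
   then have "O' (fst i) (snd i) \<inter> O' (fst i') (snd i') = {}" by (auto simp: O'_def prod_eq_iff)
   then show "negligible (O' (fst i) (snd i) \<inter> O' (fst i') (snd i'))" by simp
  qed
 qed
 then have "integral ?U (%p. complex_of_real s * ?T p) = (\<Sum>ab\<in>S \<times> S'. K (fst ab) (snd ab) * integral (line_image \<sigma> (fst ab) (snd ab)) plane_density)"
  by (rule integral_unique)
 moreover have "integral ?U (%p. complex_of_real s * ?T p) = integral (box 0 One) (%p. complex_of_real s * ?T p)"
  by (rule integral_subset_negligible[OF _ neg]) (use O_sub in blast)
 moreover have "integral (box 0 One) (%p. complex_of_real s * ?T p) = complex_of_real s * square_integral ?g eps (tri \<sigma>)"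
  unfolding square_integral_eq[OF L gr tubular_tri[OF \<sigma>] eps] integral_open_interval by (rule integral_mult_right)
 ultimately have "complex_of_real s * square_integral ?g eps (tri \<sigma>) =
   (\<Sum>ab\<in>S \<times> S'. K (fst ab) (snd ab) * integral (line_image \<sigma> (fst ab) (snd ab)) plane_density)"
  by (simp only:)
 then show "of_rat ?r * square_integral ?g eps (tri \<sigma>) =
   7 * pi / 16 * (\<Sum>(a, b)\<in>S \<times> S'. a ^ (e 0 + 1) * b ^ (e 2 + 1) * integral (line_image \<sigma> a b) plane_density)"
  unfolding sc K_def split_def sum_distrib_left by (simp only: mult.assoc)
qed

text \<open>The images of the triangles tile the affine line up to a null set, so every line
  contributes the same mass, weighted by its powers of a and b.\<close>

theorem period_2:
 assumes e: "e 0 + e 1 = 6" "e 2 + e 3 = 6"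
 shows "tube_integral (quot 0 2 e) eps c =
  7 * pi / 16 * integral UNIV plane_density * ((\<Sum>a\<in>S. a ^ (e 0 + 1)) * (\<Sum>b\<in>S'. b ^ (e 2 + 1)))"
proof -
 have I: "(\<Sum>\<sigma>\<in>Poly_Mapping.keys c. integral (line_image \<sigma> a b) plane_density) = integral UNIV plane_density"
  if ab: "a \<in> S" "b \<in> S'" for a b
 proof -
  let ?U = "\<Union>\<sigma>\<in>Poly_Mapping.keys c. line_image \<sigma> a b"
  have "(plane_density has_integral (\<Sum>\<sigma>\<in>Poly_Mapping.keys c. integral (line_image \<sigma> a b) plane_density)) ?U"
  proof (rule has_integral_UN)
   show "(plane_density has_integral integral (line_image \<sigma> a b) plane_density) (line_image \<sigma> a b)"
    if "\<sigma> \<in> Poly_Mapping.keys c" for \<sigma>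
    by (rule integrable_integral[OF set_lebesgue_integral_eq_integral(1)[OF line_residue(1)[OF that e ab]]])
   show "pairwise (%\<sigma> \<tau>. negligible (line_image \<sigma> a b \<inter> line_image \<tau> a b)) (Poly_Mapping.keys c)"
    by (rule pairwiseI) (simp add: line_images_disjoint)
  qed simp
  then have "integral ?U plane_density = (\<Sum>\<sigma>\<in>Poly_Mapping.keys c. integral (line_image \<sigma> a b) plane_density)"
   by (rule integral_unique)
  moreover have "integral ?U plane_density = integral UNIV plane_density"
   by (rule integral_subset_negligible) (use line_images_cover[OF ab] in \<open>simp_all add: Compl_eq_Diff_UNIV\<close>)
  ultimately show ?thesis by simp
 qed
 have "tube_integral (quot 0 2 e) eps c = (\<Sum>\<sigma>\<in>Poly_Mapping.keys c. 7 * pi / 16 * (\<Sum>(a, b)\<in>S \<times> S'. a ^ (e 0 + 1) * b ^ (e 2 + 1) * integral (line_image \<sigma> a b) plane_density))"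
  unfolding tube_integral_def chain_sum_def by (rule sum.cong[OF refl line_residue(2)[OF _ e]])
 also have "\<dots> = 7 * pi / 16 * (\<Sum>(a, b)\<in>S \<times> S'. a ^ (e 0 + 1) * b ^ (e 2 + 1) * (\<Sum>\<sigma>\<in>Poly_Mapping.keys c. integral (line_image \<sigma> a b) plane_density))"
  unfolding sum_distrib_left split_def by (rule sum.swap)
 also have "(\<Sum>(a, b)\<in>S \<times> S'. a ^ (e 0 + 1) * b ^ (e 2 + 1) * (\<Sum>\<sigma>\<in>Poly_Mapping.keys c. integral (line_image \<sigma> a b) plane_density))
  = (\<Sum>(a, b)\<in>S \<times> S'. a ^ (e 0 + 1) * b ^ (e 2 + 1) * integral UNIV plane_density)"
  by (rule sum.cong) (auto simp: I)
 also have "\<dots> = integral UNIV plane_density * ((\<Sum>a\<in>S. a ^ (e 0 + 1)) * (\<Sum>b\<in>S'. b ^ (e 2 + 1)))"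
  unfolding sum_product sum.cartesian_product by (simp add: sum_distrib_left split_def mult_ac)
 finally show ?thesis by (simp only: mult.assoc)
qed

end

section \<open>Test functionals supported on a point and a grid\<close>

text \<open>The degree bound is put on functions rather than polynomials, because the test functions
  below arise as sums and products of functions.\<close>

definition deg_le :: "nat => (complex => complex) => bool" where
 "deg_le n f \<longleftrightarrow> (\<exists>p. Polynomial.degree p \<le> n & f = poly p)"

lemma deg_le_const [intro]: "deg_le n (%x. k)"
 unfolding deg_le_def by (intro exI[of _ "[:k:]"]) auto

lemma deg_le_diff_const: "1 \<le> n ==> deg_le n (%x. x - k)"
 unfolding deg_le_def by (intro exI[of _ "[:- k, 1:]"]) auto

lemma deg_le_power: "i \<le> n ==> deg_le n (%x. x ^ i)"
 unfolding deg_le_def by (intro exI[of _ "Polynomial.monom 1 i"]) (auto simp: poly_monom Polynomial.degree_monom_eq)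

lemma deg_le_mono: "deg_le m f ==> m \<le> n ==> deg_le n f"
 unfolding deg_le_def by (elim exE conjE, rule exI, rule conjI) (rule order_trans)

lemma deg_le_mult: "deg_le m f ==> deg_le n g ==> m + n \<le> k ==> deg_le k (%x. f x * g x)"
proof -
 assume a: "deg_le m f" "deg_le n g" "m + n \<le> k"
 obtain p q where p: "Polynomial.degree p \<le> m" "f = poly p" and q: "Polynomial.degree q \<le> n" "g = poly q" using a unfolding deg_le_def by blast
 have "Polynomial.degree (p * q) \<le> k" using degree_mult_le[of p q] p(1) q(1) a(3) by linarith
 moreover have "(%x. f x * g x) = poly (p * q)" by (simp add: p q fun_eq_iff)
 ultimately show ?thesis unfolding deg_le_def by blast
qed

lemma deg_le_diff: "deg_le n f ==> deg_le n g ==> deg_le n (%x. f x - g x)"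
proof -
 assume "deg_le n f" "deg_le n g"
 then obtain p q where p: "Polynomial.degree p \<le> n" "f = poly p" and q: "Polynomial.degree q \<le> n" "g = poly q" unfolding deg_le_def by blast
 have "Polynomial.degree (p - q) \<le> n" using p(1) q(1) by (rule degree_diff_le)
 moreover have "(%x. f x - g x) = poly (p - q)" by (simp add: p q fun_eq_iff)
 ultimately show ?thesis unfolding deg_le_def by blast
qed

lemma deg_le_cmult: "deg_le n f ==> deg_le n (%x. k * f x)"
 by (rule deg_le_mult[OF deg_le_const[of 0]]) auto

lemma deg_le_sum: "(!!i. i \<in> I ==> deg_le n (f i)) ==> deg_le n (%x. \<Sum>i\<in>I. f i x)"
proof (induction I rule: infinite_finite_induct)
 case (insert i I)
 have "deg_le n (%x. f i x - (- 1) * (\<Sum>i\<in>I. f i x))"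
  by (intro deg_le_diff deg_le_cmult insert.IH insert.prems) auto
 then show ?case using insert.hyps by simp
qed auto

lemma deg_le_prod: "finite I ==> card I \<le> n ==> deg_le n (%x. \<Prod>a\<in>I. x - a)"
proof (induction I arbitrary: n rule: finite_induct)
 case (insert a I)
 then obtain m where m: "n = Suc m" by (cases n) auto
 have "deg_le n (%x. (x - a) * (\<Prod>a\<in>I. x - a))"
  by (rule deg_le_mult[OF deg_le_diff_const[OF order_refl] insert.IH[of m]]) (use insert m in auto)
 then show ?case using insert.hyps by simp
qed auto

lemma deg_le_expand:
 assumes "deg_le n f"
 obtains k where "!!x. f x = (\<Sum>i\<le>n. k i * x ^ i)"
proof -
 obtain p where p: "Polynomial.degree p \<le> n" "f = poly p" using assms unfolding deg_le_def by blast
 have "f x = (\<Sum>i\<le>n. Polynomial.coeff p i * x ^ i)" for x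
  unfolding p(2) poly_altdef by (rule sum.mono_neutral_left) (use p(1) Polynomial.le_degree in auto)
 then show thesis by (rule that)
qed

lemma deg_le_zero:
 assumes "deg_le n f" "finite A" "n < card A" "!!a. a \<in> A ==> f a = 0"
 shows "f x = 0"
proof -
 obtain p where p: "Polynomial.degree p \<le> n" "f = poly p" using assms unfolding deg_le_def by blast
 have "p = 0"
 proof (rule ccontr)
  assume "p ~= 0"
  then have "card {x. poly p x = 0} \<le> Polynomial.degree p" "finite {x. poly p x = 0}"
   using card_poly_roots_bound poly_roots_finite by auto
  moreover have "A \<subseteq> {x. poly p x = 0}" using assms(4) p(2) by auto
  ultimately have "card A \<le> Polynomial.degree p" using card_mono order_trans by metis
  then show False using assms(3) p(1) by linarith
 qed
 then show ?thesis by (simp add: p(2))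
qed

lemma deg_le_0: "deg_le 0 f ==> f x = f y"
 unfolding deg_le_def by (auto elim!: degree_eq_zeroE)

locale test_grid =
 fixes r a1 b1 :: complex and A B :: "complex set"
 assumes r: "r ~= 0" and a1: "a1 ~= 0" "a1 \<notin> A" and b1: "b1 ~= 0" "b1 \<notin> B"
  and A: "card A = 3" "0 \<notin> A" and B: "card B = 3" "0 \<notin> B"
begin

text \<open>Up to a constant, the period of the double pole as a functional of the polynomial f; the
  weights a b account for the exponents e 0 + 1 and e 2 + 1.\<close>

definition pairing :: "(complex => complex => complex) => complex" where
 "pairing f = a1 * b1 * f a1 b1 + r * (\<Sum>a\<in>A. \<Sum>b\<in>B. a * b * f a b)"

definition orth :: "nat => nat => (complex => complex => complex) => bool" where
 "orth m n f \<longleftrightarrow> (\<forall>q u. deg_le m q --> deg_le n u --> pairing (%a b. f a b * (q a * u b)) = 0)"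

lemma fin: "finite A" "finite B"
 using A B by (auto intro: card_ge_0_finite)

text \<open>The node polynomial of \<open>A\<close> and, on the next line, the numerators of its
  Lagrange basis.\<close>

abbreviation "F x \<equiv> \<Prod>a\<in>A. x - a"
abbreviation "L a x \<equiv> \<Prod>a'\<in>A-{a}. x - a'"

lemma F_zero: "a \<in> A ==> F a = 0" and F_a1: "F a1 ~= 0" and L_diag: "L a a ~= 0"
 and L_zero: "a' \<in> A ==> a' ~= a ==> L a a' = 0" and F_L: "a \<in> A ==> F x = (x - a) * L a x"
 using fin a1 by (auto simp: prod.remove)

lemma deg_L: "a \<in> A ==> deg_le 2 (L a)" and deg_F: "deg_le 3 F"
 using fin A by (auto intro!: deg_le_prod)

text \<open>The quadratic test function \<open>L a\<close> isolates one column of the grid, at the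
  price of a value at the extra point.\<close>

lemma pairing_L:
 assumes "orth m n f" "2 \<le> m" "deg_le n u" "a \<in> A"
 shows "r * (a * L a a * (\<Sum>b\<in>B. b * (f a b * u b))) = - (a1 * b1 * (f a1 b1 * (L a a1 * u b1)))"
proof -
 have 1: "pairing (%a' b. f a' b * (L a a' * u b)) = 0"
  using assms(1,3) deg_le_mono[OF deg_L[OF assms(4)] assms(2)] unfolding orth_def by blast
 have "(\<Sum>a'\<in>A. \<Sum>b\<in>B. a' * b * (f a' b * (L a a' * u b))) = (\<Sum>b\<in>B. a * b * (f a b * (L a a * u b)))"
 proof -
  have "(\<Sum>a'\<in>A-{a}. \<Sum>b\<in>B. a' * b * (f a' b * (L a a' * u b))) = 0"
   by (intro sum.neutral ballI, subst L_zero) auto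
  then show ?thesis by (subst sum.remove[OF fin(1) assms(4)]) simp
 qed
 also have "(\<Sum>b\<in>B. a * b * (f a b * (L a a * u b))) = a * L a a * (\<Sum>b\<in>B. b * (f a b * u b))" by (simp add: sum_distrib_left mult_ac)
 finally show ?thesis using 1 unfolding pairing_def by (simp add: eq_neg_iff_add_eq_0 add.commute)
qed

text \<open>Degree three admits the test function \<open>F\<close>, which kills the whole grid and
  leaves the extra point. Once its contribution is 0, \<open>pairing_L\<close> frees each
  column.\<close>

lemma orth_separate:
 assumes "orth m n f" "3 \<le> m" "deg_le n u"
 shows "f a1 b1 * u b1 = 0" "a \<in> A ==> (\<Sum>b\<in>B. b * (f a b * u b)) = 0"
proof -
 have "pairing (%a' b. f a' b * (F a' * u b)) = 0"
  using assms(1,3) deg_le_mono[OF deg_F assms(2)] unfolding orth_def by blast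
 then have "a1 * b1 * (f a1 b1 * (F a1 * u b1)) = 0" using F_zero unfolding pairing_def by simp
 then show "f a1 b1 * u b1 = 0" using a1 b1 F_a1 by auto
 assume a: "a \<in> A"
 have "r * (a * L a a * (\<Sum>b\<in>B. b * (f a b * u b))) = - (a1 * b1 * (f a1 b1 * (L a a1 * u b1)))"
  by (rule pairing_L[OF assms(1) _ assms(3) a]) (use assms(2) in simp)
 also have "\<dots> = 0" using \<open>f a1 b1 * u b1 = 0\<close> by auto
 finally show "(\<Sum>b\<in>B. b * (f a b * u b)) = 0" using r A(2) a L_diag by auto
qed

end

text \<open>The situation is symmetric in the two factors, so every lemma is also available with
  \<open>A\<close> and \<open>B\<close> exchanged.\<close>

sublocale test_grid \<subseteq> swap: test_grid r b1 a1 B A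
 by unfold_locales (use r a1 b1 A B in auto)

context test_grid
begin

lemma swap_pairing: "swap.pairing (%b a. f a b) = pairing f"
 unfolding pairing_def swap.pairing_def by (subst sum.swap) (simp add: mult_ac)

lemma swap_orth: "orth m n f ==> swap.orth n m (%b a. f a b)"
 unfolding orth_def swap.orth_def
proof (intro allI impI)
 fix q u assume o: "\<forall>q u. deg_le m q --> deg_le n u --> pairing (%a b. f a b * (q a * u b)) = 0" and q: "deg_le n q" "deg_le m u"
 have "swap.pairing (%b a. f a b * (q b * u a)) = pairing (%a b. f a b * (u a * q b))"
  unfolding swap_pairing[of "%a b. f a b * (u a * q b)", symmetric] by (simp add: mult.commute)
 then show "swap.pairing (%b a. f a b * (q b * u a)) = 0" using o q by simp
qed

lemma orth_separate':
 assumes "orth m n f" "3 \<le> n" "deg_le m q"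
 shows "f a1 b1 * q a1 = 0" "b \<in> B ==> (\<Sum>a\<in>A. a * (f a b * q a)) = 0"
 by (rule swap.orth_separate(1)[OF swap_orth[OF assms(1)] assms(2,3)])
  (rule swap.orth_separate(2)[OF swap_orth[OF assms(1)] assms(2,3)])

text \<open>Three points carry, up to scale, a single functional orthogonal to the polynomials of
  degree at most 1: the second divided difference, with weights 1 / L a a.\<close>

lemma const_L:
 assumes "(\<Sum>a\<in>A. h a) = 0" "(\<Sum>a\<in>A. a * h a) = 0"
 obtains s where "!!a. a \<in> A ==> h a * L a a = s"
proof -
 obtain x y z where xyz: "A = {x, y, z}" "x ~= y" "y ~= z" "x ~= z"
  using A(1) by (auto simp: card_3_iff)
 have D: "A - {x} = {y, z}" "A - {y} = {x, z}" "A - {z} = {x, y}" using xyz by auto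
 have 1: "h x = - h y - h z" using assms(1) xyz by (simp add: algebra_simps eq_neg_iff_add_eq_0)
 have 2: "x * h x + y * h y + z * h z = 0" using assms(2) xyz by (simp add: add.assoc)
 have 3: "h y * (y - x) + h z * (z - x) = 0" using 2 unfolding 1 by (simp add: algebra_simps)
 have "h x * ((x - y) * (x - z)) = h z * ((z - x) * (z - y))" "h y * ((y - x) * (y - z)) = h z * ((z - x) * (z - y))"
  using 3 unfolding 1 by Groebner_Basis.algebra+
 note h = this
 have L3: "L x x = (x - y) * (x - z)" "L y y = (y - x) * (y - z)" "L z z = (z - x) * (z - y)"
  unfolding D using xyz(2-4) by simp_all
 show thesis
 proof (rule that[of "h z * ((z - x) * (z - y))"])
  fix a assume "a \<in> A"
  then consider "a = x" | "a = y" | "a = z" using xyz(1) by blast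
  then show "h a * L a a = h z * ((z - x) * (z - y))" by cases (simp_all only: L3 h)
 qed
qed

definition bideg :: "nat => nat => (complex => complex => complex) => bool" where
 "bideg m n f \<longleftrightarrow> (\<forall>b. deg_le m (%a. f a b)) & (\<forall>a. deg_le n (f a))"

text \<open>One of the degrees reaches 3 and separates the extra point; for the other, degree 2 is
  enough to single out a point of the grid by a Lagrange numerator.\<close>

lemma orth_zero:
 assumes "orth m n f" "2 \<le> m" "2 \<le> n" "3 \<le> m \<or> 3 \<le> n"
 shows "f a1 b1 = 0" "a \<in> A ==> b \<in> B ==> f a b = 0"
proof -
 show "f a1 b1 = 0"
  using assms(4) orth_separate(1)[OF assms(1) _ deg_le_const[of _ 1]] orth_separate'(1)[OF assms(1) _ deg_le_const[of _ 1]]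
  by auto
 assume ab: "a \<in> A" "b \<in> B"
 show "f a b = 0"
 proof (cases "3 \<le> m")
  case True
  have "(\<Sum>b'\<in>B. b' * (f a b' * swap.L b b')) = 0"
   by (rule orth_separate(2)[OF assms(1) True deg_le_mono[OF swap.deg_L assms(3)]]) (use ab in auto)
  moreover have "(\<Sum>b'\<in>B. b' * (f a b' * swap.L b b')) = b * (f a b * swap.L b b)"
  proof -
   have "(\<Sum>b'\<in>B-{b}. b' * (f a b' * swap.L b b')) = 0"
    by (intro sum.neutral ballI, subst swap.L_zero) auto
   then show ?thesis by (subst sum.remove[OF fin(2) ab(2)]) simp
  qed
  ultimately show ?thesis using ab B(2) swap.L_diag by auto
 next
  case False
  then have "3 \<le> n" using assms(4) by simp
  have "(\<Sum>a'\<in>A. a' * (f a' b * L a a')) = 0"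
   by (rule orth_separate'(2)[OF assms(1) \<open>3 \<le> n\<close> deg_le_mono[OF deg_L assms(2)]]) (use ab in auto)
  moreover have "(\<Sum>a'\<in>A. a' * (f a' b * L a a')) = a * (f a b * L a a)"
  proof -
   have "(\<Sum>a'\<in>A-{a}. a' * (f a' b * L a a')) = 0"
    by (intro sum.neutral ballI, subst L_zero) auto
   then show ?thesis by (subst sum.remove[OF fin(1) ab(1)]) simp
  qed
  ultimately show ?thesis using ab A(2) L_diag by auto
 qed
qed

lemma F_deriv:
 assumes "a \<in> A"
 shows "(F has_field_derivative L a a) (at a)"
proof -
 obtain p where "L a = poly p" using deg_L[OF assms] unfolding deg_le_def by blast
 then have p: "(L a has_field_derivative poly (pderiv p) a) (at a)" using poly_DERIV[of p a] by simp
 have "((%x. (x - a) * L a x) has_field_derivative 1 * L a a + poly (pderiv p) a * (a - a)) (at a)"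
  by (intro DERIV_mult p) (auto intro!: derivative_eq_intros)
 then show ?thesis unfolding F_L[OF assms] by simp
qed

text \<open>The Euler operator a d/da, which multiplies a^p by p; it turns the weights 7 - p coming
  from pole reduction into derivatives.\<close>

abbreviation xd :: "(complex => complex => complex) => complex => complex => complex" where
 "xd f a b \<equiv> a * deriv (%a. f a b) a"

text \<open>The bidegrees leave ten cases. Vanishing on the support turns \<open>P k\<close> into a multiple of \<open>F\<close> for
 \<open>k = 3, 4\<close>, and \<open>a * v 5 a b * L a a\<close> does not depend on \<open>a\<close>, which is the only way to be orthogonal
 to linear polynomials on three points.\<close>

theorem pairing_derivative_zero:
 assumes P: "!!k. k \<le> 4 ==> bideg k (4 - k) (P k)" "!!k. k \<le> 4 ==> orth (6 - k) (k + 2) (P k)"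
  and v: "!!k. k \<le> 8 ==> bideg k (8 - k) (v k)" "!!k. 2 \<le> k ==> k \<le> 6 ==> orth (6 - k) (k - 2) (v k)"
  and klm: "k + l + m = 14" "k \<le> 4" "l \<le> 8" "m \<le> 8"
 shows "pairing (%a b. xd (P k) a b * (v l a b * v m a b)) = 0"
proof -
 have Pdeg: "deg_le k (%a. P k a b)" "deg_le (4 - k) (P k a)" if "k \<le> 4" for a b k
  using P(1)[OF that] by (simp_all add: bideg_def)
 have vdeg: "deg_le k (%a. v k a b)" "deg_le (8 - k) (v k a)" if "k \<le> 8" for a b k
  using v(1)[OF that] by (simp_all add: bideg_def)
 have P0: "P k a1 b1 = 0" "!!a b. a \<in> A ==> b \<in> B ==> P k a b = 0" if "k \<le> 4" for k
  using orth_zero[OF P(2)[OF that]] that by (auto simp: le_Suc_eq eval_nat_numeral)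
 have v56: "v 5 a1 b1 = 0" "v 6 a1 b1 = 0"
  using orth_separate'(1)[OF v(2)[of 5] _ deg_le_const[of _ 1]] orth_separate'(1)[OF v(2)[of 6] _ deg_le_const[of _ 1]] by simp_all
 \<comment> \<open>Degree 2 in b and three zeros on \<open>B\<close>: the sum vanishes for every b,
   in particular at b1, where the case k = 4, l = 6, m = 4 uses it.\<close>
 have v6sum: "(\<Sum>a\<in>A. a * v 6 a b) = 0" for b
 proof (rule deg_le_zero[where f = "%b. \<Sum>a\<in>A. a * v 6 a b" and n = 2 and A = B])
  show "deg_le 2 (%b. \<Sum>a\<in>A. a * v 6 a b)" using vdeg(2)[of 6] by (intro deg_le_sum deg_le_cmult) simp
  show "(\<Sum>a\<in>A. a * v 6 a b) = 0" if "b \<in> B" for b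
   using orth_separate'(2)[OF v(2)[of 6] _ deg_le_const[of _ 1] that] by simp
 qed (use fin B in auto)
 have v5orth: "(\<Sum>a\<in>A. a * (v 5 a b * q a)) = 0" if "b \<in> B" "deg_le 1 q" for b q
  by (rule orth_separate'(2)[OF v(2)[of 5]]) (use that in auto)
 have "\<exists>s. \<forall>a\<in>A. a * v 5 a b * L a a = s" if b: "b \<in> B" for b
 proof -
  have "(\<Sum>a\<in>A. a * v 5 a b) = 0" using v5orth[OF b deg_le_const[of 1 1]] by simp
  moreover have "(\<Sum>a\<in>A. a * (a * v 5 a b)) = 0" using v5orth[OF b deg_le_power[of 1 1]] by (simp add: mult_ac)
  ultimately obtain s where "!!a. a \<in> A ==> a * v 5 a b * L a a = s" by (rule const_L) blast
  then show ?thesis by blast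
 qed
 then obtain s where s: "!!a b. a \<in> A ==> b \<in> B ==> a * v 5 a b * L a a = s b" by metis
 \<comment> \<open>\<open>P 4\<close> has degree 0 in b and at most 4 in a, so its zeros on
   \<open>A\<close> and at a1 leave one constant; comparing values at the fifth point 0 determines
   it.\<close>
 have P4: "\<exists>\<gamma>. \<forall>a b. P 4 a b = \<gamma> * ((a - a1) * F a)"
 proof -
  define \<gamma> where "\<gamma> = P 4 0 0 / ((0 - a1) * F 0)"
  have nz: "(0 - a1) * F 0 ~= 0" using a1 A fin by simp
  have "P 4 a 0 - \<gamma> * ((a - a1) * F a) = 0" for a
  proof (rule deg_le_zero[where n = 4 and A = "insert 0 (insert a1 A)" and f = "%a. P 4 a 0 - \<gamma> * ((a - a1) * F a)"])
   show "deg_le 4 (%a. P 4 a 0 - \<gamma> * ((a - a1) * F a))"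
    by (intro deg_le_diff deg_le_cmult Pdeg(1) deg_le_mult[OF deg_le_diff_const[OF order_refl] deg_F]) auto
   have c: "P 4 a b = P 4 a b'" for a b b' using deg_le_0[OF Pdeg(2)[of 4, simplified]] by simp
   obtain b0 where "b0 \<in> B" using B(1) by fastforce
   then show "P 4 a 0 - \<gamma> * ((a - a1) * F a) = 0" if "a \<in> insert 0 (insert a1 A)" for a
    using that P0[of 4] c[of a 0 b1] c[of a 0 b0] nz F_zero by (auto simp: \<gamma>_def)
   show "4 < card (insert 0 (insert a1 A))" using a1 A fin by simp
  qed (use fin in auto)
  moreover have "P 4 a b = P 4 a 0" for a b using deg_le_0[OF Pdeg(2)[of 4, simplified]] by simp
  ultimately show ?thesis by (intro exI[of _ \<gamma>]) (metis eq_iff_diff_eq_0)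
 qed
 then obtain \<gamma> where \<gamma>: "!!a b. P 4 a b = \<gamma> * ((a - a1) * F a)" by blast
 have xP4: "xd (P 4) a b = \<gamma> * (a * (a - a1) * L a a)" if "a \<in> A" for a b
 proof -
  have "((%x. \<gamma> * ((x - a1) * F x)) has_field_derivative \<gamma> * (1 * F a + L a a * (a - a1))) (at a)"
   by (intro DERIV_cmult DERIV_mult F_deriv[OF that]) (auto intro!: derivative_eq_intros)
  then show ?thesis unfolding \<gamma> by (simp add: DERIV_imp_deriv F_zero[OF that] mult_ac)
 qed
 \<comment> \<open>Degree 1 in b with three zeros on \<open>B\<close> makes \<open>P 3\<close>
   vanish on \<open>A\<close> for all b; the cofactor of \<open>F\<close> is then read off at
   a1.\<close>
 have P3: "\<exists>\<eta>. deg_le 1 \<eta> & \<eta> b1 = 0 & (\<forall>a b. P 3 a b = \<eta> b * F a)"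
 proof (intro exI conjI allI)
  let ?\<eta> = "%b. 1 / F a1 * P 3 a1 b"
  show "deg_le 1 ?\<eta>" using Pdeg(2)[of 3] by (intro deg_le_cmult) simp
  show "?\<eta> b1 = 0" using P0(1)[of 3] by simp
  have z: "P 3 a b = 0" if "a \<in> A" for a b
   by (rule deg_le_zero[where n = 1 and A = B and f = "P 3 a"]) (use Pdeg(2)[of 3 a] P0(2)[of 3] fin B that in auto)
  fix a b
  have "P 3 a b - ?\<eta> b * F a = 0"
  proof (rule deg_le_zero[where n = 3 and A = "insert a1 A" and f = "%a. P 3 a b - ?\<eta> b * F a"])
   show "deg_le 3 (%a. P 3 a b - ?\<eta> b * F a)" by (intro deg_le_diff deg_le_cmult Pdeg(1) deg_F) auto
   show "P 3 a b - ?\<eta> b * F a = 0" if "a \<in> insert a1 A" for a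
    using that z F_zero F_a1 by auto
  qed (use a1 A fin in auto)
  then show "P 3 a b = ?\<eta> b * F a" by simp
 qed
 then obtain \<eta> where \<eta>: "deg_le 1 \<eta>" "\<eta> b1 = 0" "!!a b. P 3 a b = \<eta> b * F a" by blast
 have xP3: "xd (P 3) a1 b1 = 0" "!!a b. a \<in> A ==> xd (P 3) a b = \<eta> b * (a * L a a)"
 proof -
  show "xd (P 3) a1 b1 = 0" unfolding \<eta>(3) \<eta>(2) by simp
  show "xd (P 3) a b = \<eta> b * (a * L a a)" if "a \<in> A" for a b
   unfolding \<eta>(3) by (simp add: DERIV_imp_deriv[OF DERIV_cmult[OF F_deriv[OF that]]])
 qed
 have P2: "P 2 a b = 0" for a b
 proof -
  have z: "P 2 a b = 0" if "a \<in> A" for a b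
   by (rule deg_le_zero[where n = 2 and A = B and f = "P 2 a"]) (use Pdeg(2)[of 2 a] P0(2)[of 2] fin B that in auto)
  show ?thesis
   by (rule deg_le_zero[where n = 2 and A = A and f = "%a. P 2 a b"]) (use Pdeg(1)[of 2 b] z fin A in auto)
 qed
 have P1: "P 1 a b = 0" if "b \<in> B" for a b
  by (rule deg_le_zero[where n = 1 and A = A and f = "%a. P 1 a b"]) (use Pdeg(1)[of 1 b] P0(2)[of 1] fin A that in auto)
 have Pc: "P 0 a b = P 0 0 b" for a b using deg_le_0[OF Pdeg(1)[of 0, simplified]] by simp
 have zeroI: "pairing f = 0" if "f a1 b1 = 0" "!!a. a \<in> A ==> (\<Sum>b\<in>B. b * f a b) = 0" for f
 proof -
  have "(\<Sum>b\<in>B. a * b * f a b) = a * (\<Sum>b\<in>B. b * f a b)" for a by (simp add: sum_distrib_left mult_ac)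
  then show ?thesis using that by (simp add: pairing_def)
 qed
 have zeroI': "pairing f = 0" if "f a1 b1 = 0" "!!b. b \<in> B ==> (\<Sum>a\<in>A. a * f a b) = 0" for f
 proof -
  have "(\<Sum>a\<in>A. a * b * f a b) = b * (\<Sum>a\<in>A. a * f a b)" for b by (simp add: sum_distrib_left mult_ac)
  then show ?thesis using that by (subst pairing_def, subst sum.swap) simp
 qed
 \<comment> \<open>The two factors v commute, so m \<le> l may be assumed; k + l + m = 14 then
   leaves only the cases listed in \<open>cs\<close>.\<close>
 have main: "pairing (%a b. xd (P k) a b * (v l a b * v m a b)) = 0"
  if "k + l + m = 14" "k \<le> 4" "l \<le> 8" "m \<le> l" for k l m
 proof -
  have cs: "k = 0 \<or> (k = 1 & (l = 8 & m = 5 \<or> l = 7 & m = 6)) \<or> k = 2 \<or> (k = 3 & l = 8 & m = 3) \<or> (k = 3 & l = 7 & m = 4)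
   \<or> (k = 3 & l = 6 & m = 5) \<or> (k = 4 & l = 8 & m = 2) \<or> (k = 4 & l = 7 & m = 3) \<or> (k = 4 & l = 6 & m = 4) \<or> (k = 4 & l = 5 & m = 5)"
  proof -
   have d: "k = 0 \<or> k = 1 \<or> k = 2 \<or> k = 3 \<or> k = 4" using that(2) by presburger
   have k1: "l = 8 & m = 5 \<or> l = 7 & m = 6" if "k = 1" using \<open>k + l + m = 14\<close> \<open>l \<le> 8\<close> \<open>m \<le> l\<close> \<open>k = 1\<close> by presburger
   have k3: "l = 8 & m = 3 \<or> l = 7 & m = 4 \<or> l = 6 & m = 5" if "k = 3" using \<open>k + l + m = 14\<close> \<open>l \<le> 8\<close> \<open>m \<le> l\<close> \<open>k = 3\<close> by presburger
   have k4: "l = 8 & m = 2 \<or> l = 7 & m = 3 \<or> l = 6 & m = 4 \<or> l = 5 & m = 5" if "k = 4" using \<open>k + l + m = 14\<close> \<open>l \<le> 8\<close> \<open>m \<le> l\<close> \<open>k = 4\<close> by presburger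
   from d show ?thesis by (elim disjE) (use k1 k3 k4 in simp_all)
  qed
  consider "k = 0" | "k = 1" "l = 8 & m = 5 \<or> l = 7 & m = 6" | "k = 2" | "k = 3" "l = 8" "m = 3" | "k = 3" "l = 7" "m = 4"
   | "k = 3" "l = 6" "m = 5" | "k = 4" "l = 8" "m = 2" | "k = 4" "l = 7" "m = 3" | "k = 4" "l = 6" "m = 4" | "k = 4" "l = 5" "m = 5"
   using cs by (elim disjE conjE) simp_all
  then show ?thesis
  proof cases
   case 1
   have "(%a. P 0 a b) = (%a. P 0 0 b)" for b by (rule ext) (rule Pc)
   then have "xd (P 0) a b = 0" for a b by (simp only: deriv_const mult_zero_right)
   then show ?thesis unfolding 1 by (intro zeroI) (simp_all only: mult_zero_left mult_zero_right sum.neutral_const)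
  next
   case 2
   have "deriv (%a. P (Suc 0) a b) a = 0" if "b \<in> B" for a b using P1[OF that] by simp
   then show ?thesis using 2 v56 by (intro zeroI) auto
  next
   case 3
   then show ?thesis by (intro zeroI) (simp_all add: P2)
  next
   case 4
   show ?thesis unfolding 4
   proof (rule zeroI)
    show "(\<Sum>b\<in>B. b * (xd (P 3) a b * (v 8 a b * v 3 a b))) = 0" if a: "a \<in> A" for a
    proof -
     have "(\<Sum>b\<in>B. b * (v 3 a b * (\<eta> b * v 8 a b))) = 0"
      by (rule orth_separate(2)[OF v(2)[of 3] _ deg_le_mult[OF \<eta>(1) vdeg(2)[of 8]] a]) auto
     then have "a * L a a * (\<Sum>b\<in>B. b * (v 3 a b * (\<eta> b * v 8 a b))) = 0" by simp
     then show ?thesis unfolding xP3(2)[OF a] by (simp add: sum_distrib_left mult_ac)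
    qed
   qed (simp add: xP3(1)[simplified])
  next
   case 5
   show ?thesis unfolding 5
   proof (rule zeroI)
    show "(\<Sum>b\<in>B. b * (xd (P 3) a b * (v 7 a b * v 4 a b))) = 0" if a: "a \<in> A" for a
    proof -
     have "r * (a * L a a * (\<Sum>b\<in>B. b * (v 4 a b * (\<eta> b * v 7 a b)))) = - (a1 * b1 * (v 4 a1 b1 * (L a a1 * (\<eta> b1 * v 7 a b1))))"
      by (rule pairing_L[OF v(2)[of 4] _ deg_le_mult[OF \<eta>(1) vdeg(2)[of 7]] a]) auto
     then have "a * L a a * (\<Sum>b\<in>B. b * (v 4 a b * (\<eta> b * v 7 a b))) = 0" using \<eta>(2) r by simp
     then show ?thesis unfolding xP3(2)[OF a] by (simp only: sum_distrib_left mult_ac)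
    qed
   qed (simp add: xP3(1)[simplified])
  next
   case 6
   show ?thesis unfolding 6
   proof (rule zeroI')
    show "(\<Sum>a\<in>A. a * (xd (P 3) a b * (v 6 a b * v 5 a b))) = 0" if b: "b \<in> B" for b
    proof -
     have "(\<Sum>a\<in>A. a * (xd (P 3) a b * (v 6 a b * v 5 a b))) = (\<Sum>a\<in>A. \<eta> b * s b * (a * v 6 a b))"
      by (rule sum.cong[OF refl], subst xP3(2), assumption, subst s[OF _ b, symmetric], assumption) (simp only: mult_ac)
     also have "\<dots> = 0" unfolding sum_distrib_left[symmetric] v6sum by simp
     finally show ?thesis .
    qed
   qed (simp add: xP3(1)[simplified])
  next
   case 7
   show ?thesis unfolding 7
   proof (rule zeroI)
    have "v 2 a1 b1 * v 8 a1 b1 = 0"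
     by (rule orth_separate(1)[OF v(2)[of 2]]) (use vdeg(2)[of 8] in auto)
    then show "xd (P 4) a1 b1 * (v 8 a1 b1 * v 2 a1 b1) = 0" by auto
    show "(\<Sum>b\<in>B. b * (xd (P 4) a b * (v 8 a b * v 2 a b))) = 0" if a: "a \<in> A" for a
    proof -
     have "(\<Sum>b\<in>B. b * (v 2 a b * v 8 a b)) = 0"
      by (rule orth_separate(2)[OF v(2)[of 2] _ _ a]) (use vdeg(2)[of 8] in auto)
     then have "\<gamma> * (a * (a - a1) * L a a) * (\<Sum>b\<in>B. b * (v 2 a b * v 8 a b)) = 0" by simp
     then show ?thesis unfolding xP4[OF a] by (simp only: sum_distrib_left mult_ac)
    qed
   qed
  next
   case 8
   show ?thesis unfolding 8
   proof (rule zeroI)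
    have "v 3 a1 b1 * v 7 a1 b1 = 0"
     by (rule orth_separate(1)[OF v(2)[of 3]]) (use vdeg(2)[of 7] in auto)
    then show "xd (P 4) a1 b1 * (v 7 a1 b1 * v 3 a1 b1) = 0" by auto
    show "(\<Sum>b\<in>B. b * (xd (P 4) a b * (v 7 a b * v 3 a b))) = 0" if a: "a \<in> A" for a
    proof -
     have "(\<Sum>b\<in>B. b * (v 3 a b * v 7 a b)) = 0"
      by (rule orth_separate(2)[OF v(2)[of 3] _ _ a]) (use vdeg(2)[of 7] in auto)
     then have "\<gamma> * (a * (a - a1) * L a a) * (\<Sum>b\<in>B. b * (v 3 a b * v 7 a b)) = 0" by simp
     then show ?thesis unfolding xP4[OF a] by (simp only: sum_distrib_left mult_ac)
    qed
   qed
  next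
   case 9
   \<comment> \<open>Here the columns do not vanish one by one. Since F a1 = (a1 - a) L a a1, each
     is a common constant times a v 6 a b1, and these add up to 0 by \<open>v6sum\<close>.\<close>
   have "r * (\<Sum>b\<in>B. a * b * (xd (P 4) a b * (v 6 a b * v 4 a b))) = \<gamma> * a1 * b1 * v 4 a1 b1 * F a1 * (a * v 6 a b1)"
    if a: "a \<in> A" for a
   proof -
    have "r * (a * L a a * (\<Sum>b\<in>B. b * (v 4 a b * v 6 a b))) = - (a1 * b1 * (v 4 a1 b1 * (L a a1 * v 6 a b1)))"
     by (rule pairing_L[OF v(2)[of 4] _ _ a]) (use vdeg(2)[of 6] in auto)
    moreover have "r * (\<Sum>b\<in>B. a * b * (xd (P 4) a b * (v 6 a b * v 4 a b)))
     = \<gamma> * a * (a - a1) * (r * (a * L a a * (\<Sum>b\<in>B. b * (v 4 a b * v 6 a b))))"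
     unfolding xP4[OF a] by (simp only: sum_distrib_left mult_ac)
    ultimately show ?thesis unfolding F_L[OF a, of a1] by (simp add: algebra_simps)
   qed
   then have "r * (\<Sum>a\<in>A. \<Sum>b\<in>B. a * b * (xd (P 4) a b * (v 6 a b * v 4 a b)))
    = \<gamma> * a1 * b1 * v 4 a1 b1 * F a1 * (\<Sum>a\<in>A. a * v 6 a b1)"
    unfolding sum_distrib_left[of r] sum_distrib_left[of _ _ A] by (intro sum.cong refl) (simp add: sum_distrib_left)
   then show ?thesis unfolding 9 pairing_def by (simp add: v6sum v56)
  next
   case 10
   show ?thesis unfolding 10
   proof (rule zeroI')
    show "(\<Sum>a\<in>A. a * (xd (P 4) a b * (v 5 a b * v 5 a b))) = 0" if b: "b \<in> B" for b
    proof -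
     have "(\<Sum>a\<in>A. a * (xd (P 4) a b * (v 5 a b * v 5 a b))) = (\<Sum>a\<in>A. \<gamma> * s b * (a * (v 5 a b * (a - a1))))"
      by (rule sum.cong[OF refl], subst xP4, assumption, subst s[OF _ b, symmetric], assumption) (simp only: mult_ac)
     also have "\<dots> = 0" unfolding sum_distrib_left[symmetric] v5orth[OF b deg_le_diff_const[OF order_refl]] by simp
     finally show ?thesis .
    qed
   qed (simp add: v56)
  qed
 qed
 show ?thesis
 proof (cases "m \<le> l")
  case True
  then show ?thesis using main klm by blast
 next
  case False
  then have "pairing (%a b. xd (P k) a b * (v m a b * v l a b)) = 0" using klm by (intro main) auto
  then show ?thesis by (simp only: mult.commute)
 qed
qed

end

context test_grid
begin

lemma pairing_sum: "pairing (%a b. \<Sum>i\<in>I. k i * f i a b) = (\<Sum>i\<in>I. k i * pairing (f i))"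
proof -
 have "(\<Sum>a\<in>A. \<Sum>b\<in>B. a * b * (\<Sum>i\<in>I. k i * f i a b)) = (\<Sum>a\<in>A. \<Sum>b\<in>B. \<Sum>i\<in>I. k i * (a * b * f i a b))"
  by (intro sum.cong refl) (simp add: sum_distrib_left mult_ac)
 also have "\<dots> = (\<Sum>a\<in>A. \<Sum>i\<in>I. \<Sum>b\<in>B. k i * (a * b * f i a b))"
  by (intro sum.cong refl sum.swap)
 also have "\<dots> = (\<Sum>i\<in>I. k i * (\<Sum>a\<in>A. \<Sum>b\<in>B. a * b * f i a b))"
  by (subst sum.swap) (simp add: sum_distrib_left)
 finally have 1: "(\<Sum>a\<in>A. \<Sum>b\<in>B. a * b * (\<Sum>i\<in>I. k i * f i a b)) = (\<Sum>i\<in>I. k i * (\<Sum>a\<in>A. \<Sum>b\<in>B. a * b * f i a b))" .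
 show ?thesis
  unfolding pairing_def 1 by (simp add: distrib_left sum.distrib sum_distrib_left mult_ac)
qed

lemma pairing_cong: "f a1 b1 = g a1 b1 ==> (!!a b. a \<in> A ==> b \<in> B ==> f a b = g a b) ==> pairing f = pairing g"
 by (simp add: pairing_def)

lemma orthI:
 assumes "!!i j. i \<le> m ==> j \<le> n ==> pairing (%a b. f a b * (a ^ i * b ^ j)) = 0"
 shows "orth m n f"
 unfolding orth_def
proof (intro allI impI)
 fix q u assume q: "deg_le m q" and u: "deg_le n u"
 obtain x where x: "!!z. q z = (\<Sum>i\<le>m. x i * z ^ i)" using deg_le_expand[OF q] by metis
 obtain y where y: "!!z. u z = (\<Sum>j\<le>n. y j * z ^ j)" using deg_le_expand[OF u] by metis
 have "f a b * (q a * u b) = (\<Sum>i\<le>m. x i * (\<Sum>j\<le>n. y j * (f a b * (a ^ i * b ^ j))))" for a b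
  unfolding x y sum_product unfolding sum_distrib_left by (intro sum.cong refl) (simp only: mult_ac)
 then have "pairing (%a b. f a b * (q a * u b)) = (\<Sum>i\<le>m. x i * (\<Sum>j\<le>n. y j * pairing (%a b. f a b * (a ^ i * b ^ j))))"
  by (simp only: pairing_sum)
 also have "\<dots> = 0" using assms by simp
 finally show "pairing (%a b. f a b * (q a * u b)) = 0" .
qed

text \<open>The component of degree k in (x_0, x_1) of a form, dehomogenised by x_1 = x_3 = 1: d
  records that degree, p and q the exponents of x_0 and x_2.\<close>

definition part :: "'i set => ('i => complex) => ('i => nat) => ('i => nat) => ('i => nat) => nat => complex => complex => complex" where
 "part I c d p q k a b = (\<Sum>i\<in>{i\<in>I. d i = k}. c i * (a ^ p i * b ^ q i))"

lemma bideg_part: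
 assumes "!!i. i \<in> I ==> d i = k ==> p i \<le> m" "!!i. i \<in> I ==> d i = k ==> q i \<le> n"
 shows "bideg m n (part I c d p q k)"
 unfolding bideg_def
proof (intro conjI allI)
 fix b show "deg_le m (%a. part I c d p q k a b)"
  unfolding part_def by (intro deg_le_sum deg_le_cmult deg_le_mult[OF deg_le_power deg_le_const[of 0]]) (use assms in auto)
next
 fix a show "deg_le n (part I c d p q k a)"
  unfolding part_def by (intro deg_le_sum deg_le_cmult deg_le_power) (use assms in auto)
qed

lemma xd_part: "xd (part I c d p q k) a b = (\<Sum>i\<in>{i\<in>I. d i = k}. of_nat (p i) * (c i * (a ^ p i * b ^ q i)))"
proof -
 have "((%a. part I c d p q k a b) has_field_derivative (\<Sum>i\<in>{i\<in>I. d i = k}. c i * ((of_nat (p i) * a ^ (p i - 1)) * b ^ q i))) (at a)"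
  unfolding part_def by (intro DERIV_sum DERIV_cmult DERIV_cmult_right) (rule DERIV_cong[OF DERIV_power[OF DERIV_ident]], simp)
 then have "xd (part I c d p q k) a b = a * (\<Sum>i\<in>{i\<in>I. d i = k}. c i * ((of_nat (p i) * a ^ (p i - 1)) * b ^ q i))"
  by (simp add: DERIV_imp_deriv)
 also have "\<dots> = (\<Sum>i\<in>{i\<in>I. d i = k}. of_nat (p i) * (c i * (a ^ p i * b ^ q i)))"
  unfolding sum_distrib_left
 proof (rule sum.cong[OF refl])
  fix i show "a * (c i * ((of_nat (p i) * a ^ (p i - 1)) * b ^ q i)) = of_nat (p i) * (c i * (a ^ p i * b ^ q i))"
   by (cases "p i") simp_all
 qed
 finally show ?thesis .
qed

lemma sum_triple:
 fixes x y z :: "_ => complex"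
 shows "(\<Sum>i\<in>I. \<Sum>j\<in>J. \<Sum>k\<in>K. (h - x' i - y' j - z' k) * (x i * y j * z k)) =
  (h * (\<Sum>i\<in>I. x i) - (\<Sum>i\<in>I. x' i * x i)) * (\<Sum>j\<in>J. y j) * (\<Sum>k\<in>K. z k)
  - (\<Sum>i\<in>I. x i) * ((\<Sum>j\<in>J. y' j * y j) * (\<Sum>k\<in>K. z k) + (\<Sum>j\<in>J. y j) * (\<Sum>k\<in>K. z' k * z k))"
proof -
 define Z Z' Y Y' where "Z = (\<Sum>k\<in>K. z k)" and "Z' = (\<Sum>k\<in>K. z' k * z k)" and "Y = (\<Sum>j\<in>J. y j)" and "Y' = (\<Sum>j\<in>J. y' j * y j)"
 have 1: "(\<Sum>k\<in>K. (h - x' i - y' j - z' k) * (x i * y j * z k)) = (h - x' i - y' j) * (x i * y j) * Z - x i * y j * Z'" for i j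
  unfolding Z_def Z'_def sum_distrib_left sum_subtractf[symmetric] by (intro sum.cong refl) (simp add: algebra_simps)
 have 2: "(\<Sum>j\<in>J. (h - x' i - y' j) * (x i * y j) * Z - x i * y j * Z') = (h - x' i) * x i * Z * Y - x i * Z * Y' - x i * Z' * Y" for i
  unfolding Y_def Y'_def sum_distrib_left sum_subtractf[symmetric] by (intro sum.cong refl) (simp add: algebra_simps)
 have 3: "(\<Sum>i\<in>I. (h - x' i) * x i * Z * Y - x i * Z * Y' - x i * Z' * Y) =
  (h * Z * Y - Z * Y' - Z' * Y) * (\<Sum>i\<in>I. x i) - Z * Y * (\<Sum>i\<in>I. x' i * x i)"
  unfolding sum_distrib_left sum_subtractf[symmetric] by (intro sum.cong refl) (simp add: algebra_simps)
 show ?thesis unfolding 1 2 3 unfolding Z_def[symmetric] Z'_def[symmetric] Y_def[symmetric] Y'_def[symmetric]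
  by (simp add: algebra_simps)
qed

text \<open>The exponent p is additive over the three factors, so multiplication by it acts as a
  derivation. The factor from \<open>I\<close> vanishes on the support, hence only the term in which
  it is differentiated survives, and \<open>pairing_derivative_zero\<close> disposes of
  that.\<close>

lemma pairing_cubic:
 fixes c :: "'i => complex" and v :: "'j => complex"
 assumes I: "finite I" "!!i. i \<in> I ==> d i \<le> 4 & p i \<le> d i & q i \<le> 4 - d i"
  and J: "finite J" "!!j. j \<in> J ==> d' j \<le> 8 & p' j \<le> d' j & q' j \<le> 8 - d' j"
  and P: "!!k. k \<le> 4 ==> orth (6 - k) (k + 2) (part I c d p q k)"
  and V: "!!k. 2 \<le> k ==> k \<le> 6 ==> orth (6 - k) (k - 2) (part J v d' p' q' k)"
 shows "(\<Sum>i\<in>I. \<Sum>j\<in>J. \<Sum>k\<in>J. c i * v j * v k * (if d i + d' j + d' k = 14 then (7 - of_nat (p i + p' j + p' k)) *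
  pairing (%a b. a ^ (p i + p' j + p' k) * b ^ (q i + q' j + q' k)) else 0)) = 0"
proof -
 let ?P = "part I c d p q" and ?V = "part J v d' p' q'"
 let ?I = "%k. {i\<in>I. d i = k}" and ?J = "%k. {j\<in>J. d' j = k}"
 have P0: "?P k a1 b1 = 0" "!!a b. a \<in> A ==> b \<in> B ==> ?P k a b = 0" if "k \<le> 4" for k
  using orth_zero[OF P[OF that]] that by (auto simp: le_Suc_eq eval_nat_numeral)
 define T where "T = (%i j k. c i * v j * v k * (if d i + d' j + d' k = 14 then (7 - of_nat (p i + p' j + p' k)) *
  pairing (%a b. a ^ (p i + p' j + p' k) * b ^ (q i + q' j + q' k)) else 0))"
 have block: "(\<Sum>i\<in>?I k. \<Sum>j\<in>?J l. \<Sum>j'\<in>?J m. T i j j') = 0" if k: "k \<le> 4" "l \<le> 8" "m \<le> 8" for k l m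
 proof (cases "k + l + m = 14")
  case True
  have "(\<Sum>i\<in>?I k. \<Sum>j\<in>?J l. \<Sum>j'\<in>?J m. T i j j') = (\<Sum>i\<in>?I k. 1 * (\<Sum>j\<in>?J l. 1 * (\<Sum>j'\<in>?J m. (c i * v j * v j' * (7 - of_nat (p i + p' j + p' j'))) *
    pairing (%a b. a ^ (p i + p' j + p' j') * b ^ (q i + q' j + q' j')))))"
   unfolding mult_1 T_def by (intro sum.cong refl) (use True in \<open>auto simp: mult_ac\<close>)
  also have "\<dots> = pairing (%a b. \<Sum>i\<in>?I k. 1 * (\<Sum>j\<in>?J l. 1 * (\<Sum>j'\<in>?J m. (c i * v j * v j' * (7 - of_nat (p i + p' j + p' j'))) *
    (a ^ (p i + p' j + p' j') * b ^ (q i + q' j + q' j')))))"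
   by (simp only: pairing_sum)
  also have "\<dots> = pairing (%a b. - 1 * (xd (?P k) a b * (?V l a b * ?V m a b)))"
  proof -
   have eq: "(\<Sum>i\<in>?I k. 1 * (\<Sum>j\<in>?J l. 1 * (\<Sum>j'\<in>?J m. (c i * v j * v j' * (7 - of_nat (p i + p' j + p' j'))) *
    (a ^ (p i + p' j + p' j') * b ^ (q i + q' j + q' j'))))) = - 1 * (xd (?P k) a b * (?V l a b * ?V m a b))"
    if z: "?P k a b = 0" for a b
   proof -
    let ?x = "%i. c i * (a ^ p i * b ^ q i)" and ?y = "%j. v j * (a ^ p' j * b ^ q' j)"
    have "(\<Sum>i\<in>?I k. 1 * (\<Sum>j\<in>?J l. 1 * (\<Sum>j'\<in>?J m. (c i * v j * v j' * (7 - of_nat (p i + p' j + p' j'))) *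
     (a ^ (p i + p' j + p' j') * b ^ (q i + q' j + q' j'))))) =
     (\<Sum>i\<in>?I k. \<Sum>j\<in>?J l. \<Sum>j'\<in>?J m. (7 - of_nat (p i) - of_nat (p' j) - of_nat (p' j')) * (?x i * ?y j * ?y j'))"
     unfolding mult_1 by (intro sum.cong refl) (simp add: power_add mult_ac diff_diff_eq[symmetric])
    also have "\<dots> = - 1 * (xd (?P k) a b * (?V l a b * ?V m a b))"
     unfolding sum_triple xd_part unfolding part_def[symmetric] z by (simp add: mult_ac)
    finally show ?thesis .
   qed
   show ?thesis
    by (rule pairing_cong) (simp_all only: eq[OF P0(1)[OF k(1)]] eq[OF P0(2)[OF k(1)]])
  qed
  also have "\<dots> = pairing (%a b. \<Sum>x\<in>{()}. - 1 * (xd (?P k) a b * (?V l a b * ?V m a b)))" by simp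
  also have "\<dots> = - 1 * pairing (%a b. xd (?P k) a b * (?V l a b * ?V m a b))"
   unfolding pairing_sum by simp
  also have "\<dots> = 0"
  proof -
   have "pairing (%a b. xd (?P k) a b * (?V l a b * ?V m a b)) = 0"
    by (rule pairing_derivative_zero[where P = ?P and v = ?V])
     (use P V I J True k in \<open>auto intro!: bideg_part\<close>)
   then show ?thesis by simp
  qed
  finally show ?thesis .
 next
  case False
  then show ?thesis by (intro sum.neutral ballI) (auto simp: T_def)
 qed
 have "(\<Sum>i\<in>I. \<Sum>j\<in>J. \<Sum>j'\<in>J. T i j j') = (\<Sum>k\<le>4. \<Sum>i\<in>?I k. \<Sum>l\<le>8. \<Sum>j\<in>?J l. \<Sum>m\<le>8. \<Sum>j'\<in>?J m. T i j j')"
 proof -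
  have i: "(\<Sum>i\<in>I. f i) = (\<Sum>k\<le>4. \<Sum>i\<in>?I k. f i)" for f :: "'i => complex"
   by (rule sum.group[symmetric]) (use I in auto)
  have j: "(\<Sum>j\<in>J. f j) = (\<Sum>k\<le>8. \<Sum>j\<in>?J k. f j)" for f :: "'j => complex"
   by (rule sum.group[symmetric]) (use J in auto)
  show ?thesis unfolding i j ..
 qed
 also have "\<dots> = (\<Sum>k\<le>4. \<Sum>l\<le>8. \<Sum>m\<le>8. \<Sum>i\<in>?I k. \<Sum>j\<in>?J l. \<Sum>j'\<in>?J m. T i j j')"
 proof (rule sum.cong[OF refl])
  fix k
  have "(\<Sum>i\<in>?I k. \<Sum>l\<le>8. \<Sum>j\<in>?J l. \<Sum>m\<le>8. \<Sum>j'\<in>?J m. T i j j') = (\<Sum>i\<in>?I k. \<Sum>l\<le>8. \<Sum>m\<le>8. \<Sum>j\<in>?J l. \<Sum>j'\<in>?J m. T i j j')"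
   by (intro sum.cong refl sum.swap)
  also have "\<dots> = (\<Sum>l\<le>8. \<Sum>i\<in>?I k. \<Sum>m\<le>8. \<Sum>j\<in>?J l. \<Sum>j'\<in>?J m. T i j j')" by (rule sum.swap)
  also have "\<dots> = (\<Sum>l\<le>8. \<Sum>m\<le>8. \<Sum>i\<in>?I k. \<Sum>j\<in>?J l. \<Sum>j'\<in>?J m. T i j j')"
   by (intro sum.cong refl sum.swap)
  finally show "(\<Sum>i\<in>?I k. \<Sum>l\<le>8. \<Sum>j\<in>?J l. \<Sum>m\<le>8. \<Sum>j'\<in>?J m. T i j j') = (\<Sum>l\<le>8. \<Sum>m\<le>8. \<Sum>i\<in>?I k. \<Sum>j\<in>?J l. \<Sum>j'\<in>?J m. T i j j')" .
 qed
 also have "\<dots> = 0" by (intro sum.neutral ballI block) auto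
 finally show ?thesis unfolding T_def .
qed

text \<open>\<open>plane_mass * phi e\<close> and \<open>plane_mass / 16 * psi e\<close> will be the
  tube integrals of x^e Omega over f_0^2 and f_0^3.\<close>

definition phi :: "(4 => nat) => complex" where
 "phi e = (if e 0 + e 1 = 6 then pairing (%a b. a ^ e 0 * b ^ e 2) else 0)"

definition psi :: "(4 => nat) => complex" where
 "psi e = (if e 0 + e 1 = 14 then (7 - of_nat (e 0)) * pairing (%a b. a ^ e 0 * b ^ e 2) else 0)
  + (if e 0 + e 1 = 6 then (7 - of_nat (e 2)) * pairing (%a b. a ^ e 0 * b ^ e 2) else 0)"

definition quad :: "nat => nat => nat => nat => 4 => nat" where
 "quad i j k l = (%x. if x = 0 then i else if x = 1 then j else if x = 2 then k else l)"

lemma quad: "quad i j k l 0 = i" "quad i j k l 1 = j" "quad i j k l 2 = k" "quad i j k l 3 = l"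
 by (simp_all add: quad_def)

text \<open>Test monomials of degree 6 - k in (x_0, x_1) see only the component of degree k, and
  after dehomogenising they are exactly the a^i b^j in the stated range.\<close>

lemma orth_part:
 fixes c :: "'i => complex" and e :: "'i => 4 => nat"
 assumes I: "finite I" and n: "n + N = 12" "!!i. i \<in> I ==> total (e i) = n"
  and H: "!!\<alpha>. total \<alpha> = N ==> (\<Sum>i\<in>I. c i * phi (%x. e i x + \<alpha> x)) = 0" and k: "k \<le> 6" "n \<le> k + 6"
 shows "orth (6 - k) (k + 6 - n) (part I c (%i. e i 0 + e i 1) (%i. e i 0) (%i. e i 2) k)"
proof (rule orthI)
 fix i j assume ij: "i \<le> 6 - k" "j \<le> k + 6 - n"
 define \<alpha> where "\<alpha> = quad i (6 - k - i) j (k + 6 - n - j)"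
 have "total \<alpha> = N" using ij n k by (simp add: \<alpha>_def total_def sum_4' quad)
 note h = H[OF this]
 have 1: "e l 0 + \<alpha> 0 + (e l 1 + \<alpha> 1) = 6 \<longleftrightarrow> e l 0 + e l 1 = k" for l
  using ij k by (auto simp: \<alpha>_def quad)
 have eq: "part I c (%i. e i 0 + e i 1) (%i. e i 0) (%i. e i 2) k a b * (a ^ i * b ^ j) =
  (\<Sum>l\<in>{l\<in>I. e l 0 + e l 1 = k}. c l * (a ^ (e l 0 + \<alpha> 0) * b ^ (e l 2 + \<alpha> 2)))" for a b
  unfolding part_def sum_distrib_right by (intro sum.cong refl) (simp add: \<alpha>_def quad power_add mult_ac)
 have "pairing (%a b. part I c (%i. e i 0 + e i 1) (%i. e i 0) (%i. e i 2) k a b * (a ^ i * b ^ j)) =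
  (\<Sum>l\<in>{l\<in>I. e l 0 + e l 1 = k}. c l * pairing (%a b. a ^ (e l 0 + \<alpha> 0) * b ^ (e l 2 + \<alpha> 2)))"
  unfolding eq by (rule pairing_sum)
 also have "\<dots> = (\<Sum>l\<in>{l\<in>I. e l 0 + e l 1 = k}. c l * phi (%x. e l x + \<alpha> x))"
  by (intro sum.cong refl) (simp add: phi_def 1)
 also have "\<dots> = (\<Sum>l\<in>I. c l * phi (%x. e l x + \<alpha> x))"
  by (intro sum.mono_neutral_left I) (auto simp: phi_def 1)
 also note h
 finally show "pairing (%a b. part I c (%i. e i 0 + e i 1) (%i. e i 0) (%i. e i 2) k a b * (a ^ i * b ^ j)) = 0" .
qed

end

context test_grid
begin

text \<open>In total degree 20, degree 6 in (x_0, x_1) is the same as degree 14 in (x_2, x_3), so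
  the second half of \<open>psi\<close> is the first with \<open>A\<close> and \<open>B\<close>
  exchanged.\<close>

theorem psi_vanishes:
 fixes c :: "'i => complex" and v :: "'j => complex"
 assumes I: "finite I" "!!i. i \<in> I ==> total (e i) = 4" and J: "finite J" "!!j. j \<in> J ==> total (e' j) = 8"
  and H: "!!\<alpha>. total \<alpha> = 8 ==> (\<Sum>i\<in>I. c i * phi (%x. e i x + \<alpha> x)) = 0"
  and H': "!!\<beta>. total \<beta> = 4 ==> (\<Sum>j\<in>J. v j * phi (%x. e' j x + \<beta> x)) = 0"
 shows "(\<Sum>i\<in>I. \<Sum>j\<in>J. \<Sum>k\<in>J. c i * v j * v k * psi (%x. e i x + e' j x + e' k x)) = 0"
proof -
 have t: "e i 0 + e i 1 + e i 2 + e i 3 = 4" if "i \<in> I" for i using I(2)[OF that] by (simp add: total_def sum_4')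
 have t': "e' j 0 + e' j 1 + e' j 2 + e' j 3 = 8" if "j \<in> J" for j using J(2)[OF that] by (simp add: total_def sum_4')
 note P = orth_part[of I 4 8 e c, OF I(1) _ I(2) H, simplified]
 note V = orth_part[of J 8 4 e' v, OF J(1) _ J(2) H', simplified]
 have sw: "part I c (%i. e i 2 + e i 3) (%i. e i 2) (%i. e i 0) k = (%b a. part I c (%i. e i 0 + e i 1) (%i. e i 0) (%i. e i 2) (n - k) a b)"
  if "k \<le> n" "!!i. i \<in> I ==> e i 0 + e i 1 + e i 2 + e i 3 = n" for I :: "'x set" and c e k n
 proof -
  have "{i \<in> I. e i 2 + e i 3 = k} = {i \<in> I. e i 0 + e i 1 = n - k}" using that by fastforce
  then show ?thesis unfolding part_def by (simp add: mult.commute)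
 qed
 have 1: "(\<Sum>i\<in>I. \<Sum>j\<in>J. \<Sum>k\<in>J. c i * v j * v k * (if e i 0 + e i 1 + (e' j 0 + e' j 1) + (e' k 0 + e' k 1) = 14 then
  (7 - of_nat (e i 0 + e' j 0 + e' k 0)) * pairing (%a b. a ^ (e i 0 + e' j 0 + e' k 0) * b ^ (e i 2 + e' j 2 + e' k 2)) else 0)) = 0"
 proof (rule pairing_cubic[OF I(1) _ J(1)])
  show "e i 0 + e i 1 \<le> 4 & e i 0 \<le> e i 0 + e i 1 & e i 2 \<le> 4 - (e i 0 + e i 1)" if "i \<in> I" for i using t[OF that] by linarith
  show "e' j 0 + e' j 1 \<le> 8 & e' j 0 \<le> e' j 0 + e' j 1 & e' j 2 \<le> 8 - (e' j 0 + e' j 1)" if "j \<in> J" for j using t'[OF that] by linarith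
  show "orth (6 - k) (k + 2) (part I c (%i. e i 0 + e i 1) (%i. e i 0) (%i. e i 2) k)" if "k \<le> 4" for k
   using P[of k] that by simp
  show "orth (6 - k) (k - 2) (part J v (%j. e' j 0 + e' j 1) (%j. e' j 0) (%j. e' j 2) k)" if "2 \<le> k" "k \<le> 6" for k
   using V[of k] that by simp
 qed
 have 2: "(\<Sum>i\<in>I. \<Sum>j\<in>J. \<Sum>k\<in>J. c i * v j * v k * (if e i 2 + e i 3 + (e' j 2 + e' j 3) + (e' k 2 + e' k 3) = 14 then
  (7 - of_nat (e i 2 + e' j 2 + e' k 2)) * swap.pairing (%b a. b ^ (e i 2 + e' j 2 + e' k 2) * a ^ (e i 0 + e' j 0 + e' k 0)) else 0)) = 0"
 proof (rule swap.pairing_cubic[OF I(1) _ J(1)])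
  show "e i 2 + e i 3 \<le> 4 & e i 2 \<le> e i 2 + e i 3 & e i 0 \<le> 4 - (e i 2 + e i 3)" if "i \<in> I" for i using t[OF that] by linarith
  show "e' j 2 + e' j 3 \<le> 8 & e' j 2 \<le> e' j 2 + e' j 3 & e' j 0 \<le> 8 - (e' j 2 + e' j 3)" if "j \<in> J" for j using t'[OF that] by linarith
  show "swap.orth (6 - k) (k + 2) (part I c (%i. e i 2 + e i 3) (%i. e i 2) (%i. e i 0) k)" if "k \<le> 4" for k
  proof -
   have "6 - (4 - k) = k + 2" "4 - k + 6 - 4 = 6 - k" using that by auto
   then have "orth (k + 2) (6 - k) (part I c (%i. e i 0 + e i 1) (%i. e i 0) (%i. e i 2) (4 - k))"
    using P[of "4 - k"] by simp
   from swap_orth[OF this] show ?thesis by (subst sw[OF that t])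
  qed
  show "swap.orth (6 - k) (k - 2) (part J v (%i. e' i 2 + e' i 3) (%i. e' i 2) (%i. e' i 0) k)" if k: "2 \<le> k" "k \<le> 6" for k
  proof -
   have k8: "k \<le> 8" using k by simp
   have "6 - (8 - k) = k - 2" "8 - k + 6 - 8 = 6 - k" using k by auto
   then have "orth (k - 2) (6 - k) (part J v (%i. e' i 0 + e' i 1) (%i. e' i 0) (%i. e' i 2) (8 - k))"
    using V[of "8 - k"] k by simp
   from swap_orth[OF this] show ?thesis by (subst sw[OF k8 t'])
  qed
 qed
 have sp: "swap.pairing (%b a. b ^ m * a ^ n) = pairing (%a b. a ^ n * b ^ m)" for m n
  unfolding swap_pairing[symmetric] by (simp add: mult.commute)
 have "(\<Sum>i\<in>I. \<Sum>j\<in>J. \<Sum>k\<in>J. c i * v j * v k * psi (%x. e i x + e' j x + e' k x)) = 0 + 0"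
 proof (rule trans[OF _ arg_cong2[where f = "(+)", OF 1 2]], unfold sum.distrib[symmetric], intro sum.cong refl)
  fix i j k assume ijk: "i \<in> I" "j \<in> J" "k \<in> J"
  have "e i 0 + e' j 0 + e' k 0 + (e i 1 + e' j 1 + e' k 1) = 14 \<longleftrightarrow> e i 0 + e i 1 + (e' j 0 + e' j 1) + (e' k 0 + e' k 1) = 14"
   "e i 0 + e' j 0 + e' k 0 + (e i 1 + e' j 1 + e' k 1) = 6 \<longleftrightarrow> e i 2 + e i 3 + (e' j 2 + e' j 3) + (e' k 2 + e' k 3) = 14"
   using t[OF ijk(1)] t'[OF ijk(2)] t'[OF ijk(3)] by linarith+
  then show "c i * v j * v k * psi (%x. e i x + e' j x + e' k x) =
   c i * v j * v k * (if e i 0 + e i 1 + (e' j 0 + e' j 1) + (e' k 0 + e' k 1) = 14 then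
  (7 - of_nat (e i 0 + e' j 0 + e' k 0)) * pairing (%a b. a ^ (e i 0 + e' j 0 + e' k 0) * b ^ (e i 2 + e' j 2 + e' k 2)) else 0) +
   c i * v j * v k * (if e i 2 + e i 3 + (e' j 2 + e' j 3) + (e' k 2 + e' k 3) = 14 then
  (7 - of_nat (e i 2 + e' j 2 + e' k 2)) * swap.pairing (%b a. b ^ (e i 2 + e' j 2 + e' k 2) * a ^ (e i 0 + e' j 0 + e' k 0)) else 0)"
   unfolding psi_def sp distrib_left by (simp only:)
 qed
 then show ?thesis by simp
qed

end

section \<open>Expansion of the periods to second order\<close>

lemma integrable_circle:
 assumes "graded k D g" "tubular D eps x" "eps > 0"
 shows "(%th. tint g (circ eps th) x (normal x) u1 n1 u2 n2) integrable_on {0..1}"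
proof -
 have "continuous_on {0..1} (%th. tint g (circ eps th) x (normal x) u1 n1 u2 n2)"
  by (rule continuous_on_compose2[OF continuous_on_circle[OF assms(1,2)]
    continuous_on_subset[OF smooth_on_continuous[OF smooth_on_circ] subset_UNIV]]) (use norm_circ[OF assms(3)] in auto)
 then show ?thesis by (simp add: integrable_continuous_real)
qed

lemma tube_integral_linear:
 assumes c: "smooth_chain 2 X c" and X: "tubular_points D eps X" and eps: "eps > 0" and G: "graded 4 D G"
  and g: "!!i. i \<in> I ==> graded 4 D (g i)" and eq: "!!x. x \<in> D ==> G x = (\<Sum>i\<in>I. k i * g i x)" and I: "finite I"
 shows "tube_integral G eps c = (\<Sum>i\<in>I. k i * tube_integral (g i) eps c)"
proof -
 have "square_integral G eps (tri \<sigma>) = (\<Sum>i\<in>I. k i * square_integral (g i) eps (tri \<sigma>))" if \<sigma>: "\<sigma> \<in> Poly_Mapping.keys c" for \<sigma>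
 proof -
  have s: "smooth_simplex 2 X \<sigma>" using c \<sigma> by (simp add: smooth_chain_def)
  then obtain Y where L: "lifts (tri \<sigma>) Y" using lifts_tri unfolding smooth_simplex_def by blast
  have tX: "tubular_points D eps (tri \<sigma> ` ucube)"
   by (rule tubular_points_subset[OF X]) (use s bary2_q2 in \<open>auto simp: smooth_simplex_def\<close>)
  obtain V where V: "open V" "ucube \<subseteq> V" "smooth_on V Y" "\<forall>e\<in>V. Y e ~= 0"
   using L unfolding lifts_def by (elim exE conjE)
  note tub = tubular_lift[OF tX L]
  have cont: "continuous_on ucube (tden (g i) eps Y (1, 0) (0, 1))" if "i \<in> I" for i
  proof -
   interpret t: tube_form V Y eps D "g i" 4 by standard (use V eps g[OF that] tub in auto)
   show ?thesis by (rule t.continuous_tden)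
  qed
  have t: "tden G eps Y (1, 0) (0, 1) e = (\<Sum>i\<in>I. k i * tden (g i) eps Y (1, 0) (0, 1) e)" if e: "e \<in> ucube" for e
  proof -
   let ?t = "%g th. tint g (circ eps th) (Y e) (normal (Y e)) (pd (1, 0) Y e) (pd (1, 0) (%e. normal (Y e)) e)
    (pd (0, 1) Y e) (pd (0, 1) (%e. normal (Y e)) e)"
   have "tden G eps Y (1, 0) (0, 1) e = integral {0..1} (%th. \<Sum>i\<in>I. k i * ?t (g i) th)"
    unfolding tden_def
   proof (rule integral_cong)
    fix th
    have "Y e + circ eps th *s normal (Y e) \<in> D" using tub[OF e] norm_circ[OF eps] by (simp add: tubular_def)
    from eq[OF this] show "?t G th = (\<Sum>i\<in>I. k i * ?t (g i) th)"
     unfolding tint_def by (simp add: sum_distrib_right mult.assoc)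
   qed
   also have "\<dots> = (\<Sum>i\<in>I. integral {0..1} (%th. k i * ?t (g i) th))"
    by (intro integral_sum I integrable_on_mult_right integrable_circle[OF g tub[OF e] eps])
   finally show ?thesis unfolding tden_def by (simp only: integral_mult_right)
  qed
  have "square_integral G eps (tri \<sigma>) = integral ucube (%e. \<Sum>i\<in>I. k i * tden (g i) eps Y (1, 0) (0, 1) e)"
   unfolding square_integral_eq[OF L G tX eps] by (rule integral_cong) (rule t)
  also have "\<dots> = (\<Sum>i\<in>I. integral ucube (%e. k i * tden (g i) eps Y (1, 0) (0, 1) e))"
   by (intro integral_sum I integrable_on_mult_right integrable_continuous cont)
  also have "\<dots> = (\<Sum>i\<in>I. k i * square_integral (g i) eps (tri \<sigma>))"
   by (rule sum.cong[OF refl]) (simp only: integral_mult_right square_integral_eq[OF L g tX eps])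
  finally show ?thesis .
 qed
 then have "tube_integral G eps c = chain_sum (%\<sigma>. \<Sum>i\<in>I. k i * square_integral (g i) eps (tri \<sigma>)) c"
  unfolding tube_integral_def by (rule chain_sum_cong)
 also have "\<dots> = (\<Sum>\<sigma>\<in>Poly_Mapping.keys c. \<Sum>i\<in>I. k i * (of_rat (Poly_Mapping.lookup c \<sigma>) * square_integral (g i) eps (tri \<sigma>)))"
  unfolding chain_sum_def by (intro sum.cong refl) (simp add: sum_distrib_left mult_ac)
 also have "\<dots> = (\<Sum>i\<in>I. k i * tube_integral (g i) eps c)"
  unfolding tube_integral_def chain_sum_def by (subst sum.swap) (simp add: sum_distrib_left)
 finally show ?thesis .
qed

lemma graded_lincomb:
 assumes "graded k D g" "graded k D h"
 shows "graded k D (%x. a * g x + b * h x)"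
 unfolding graded_def
proof (intro conjI ballI allI impI)
 show D: "open D" using assms by (simp add: graded_def)
 show "smooth_on D (%x. a * g x + b * h x)"
  using assms by (intro smooth_on_add smooth_on_mult smooth_on_const D) (simp_all add: graded_def)
 fix x assume x: "x \<in> D"
 obtain d d' where d: "(g has_derivative (%v. \<Sum>i\<in>UNIV. d $ i * v $ i)) (at x)" "(h has_derivative (%v. \<Sum>i\<in>UNIV. d' $ i * v $ i)) (at x)"
  using assms x unfolding graded_def by meson
 show "\<exists>d. ((%x. a * g x + b * h x) has_derivative (%v. \<Sum>i\<in>UNIV. d $ i * v $ i)) (at x)"
  by (rule exI[of _ "a *s d + b *s d'"], rule has_derivative_eq_rhs,
    rule has_derivative_add[OF has_derivative_mult_right[OF d(1)] has_derivative_mult_right[OF d(2)]])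
   (simp add: fun_eq_iff sum_4' algebra_simps)
 fix c :: complex assume c: "c ~= 0"
 show "c *s x \<in> D" using assms(1) x c by (simp add: graded_def)
 have "c ^ k * (a * g (c *s x) + b * h (c *s x)) = a * (c ^ k * g (c *s x)) + b * (c ^ k * h (c *s x))" by (simp add: algebra_simps)
 also have "\<dots> = a * g x + b * h x" using assms x c by (simp add: graded_def)
 finally show "c ^ k * (a * g (c *s x) + b * h (c *s x)) = a * g x + b * h x" .
qed

lemma graded_subset:
 assumes "graded k D g" "open D'" "D' \<subseteq> D" "!!x c. x \<in> D' ==> c ~= 0 ==> c *s x \<in> D'"
 shows "graded k D' g"
 using assms unfolding graded_def by (meson smooth_on_subset subsetD)

context octic_tube
begin

text \<open>\<open>\<partial>\<^sub>i (x\<^sup>e / f\<^sup>2)\<close> with \<open>\<partial>\<^sub>i f = 8 x\<^sub>i\<^sup>7\<close> (pole order reduction).\<close>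

lemma exact_quot:
 assumes c: "cycle2 X c" "X \<subseteq> surface 0" and e: "total e = 13"
 shows "16 * tube_integral (quot 0 3 (e(i := e i + 7))) eps c = of_nat (e i) * tube_integral (quot 0 2 (e(i := e i - 1))) eps c"
proof -
 let ?g = "quot 0 3 (e(i := e i + 7))" and ?h = "quot 0 2 (e(i := e i - 1))"
 have tot: "total (e(i := m)) + e i = 13 + m" for m
 proof -
  have "total e = e i + sum e (UNIV - {i})" unfolding total_def by (rule sum.remove) auto
  moreover have "total (e(i := m)) = m + sum e (UNIV - {i})" unfolding total_def by (subst sum.remove[of _ i]) auto
  ultimately show ?thesis using e by simp
 qed
 have X: "tubular_points (off 0) eps X"
  by (rule tubular_points_subset[OF tubular_surface c(2)]) (use \<rho> in simp_all)
 have sm: "smooth_chain 2 X c" using c by (simp add: cycle2_def)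
 have g: "graded 4 (off 0) ?g" by (rule graded_quot) (use tot[of "e i + 7"] in simp)
 have q: "graded 3 (off 0) (quot 0 2 e)" by (rule graded_quot) (simp add: e)
 have d: "pd (axis i 1) (quot 0 2 e) x = of_nat (e i) * ?h x - 16 * ?g x" if "x \<in> off 0" for x
  using pd_quot_0[where i = i and k = 2 and e = e and x = x] that by (simp add: eval_nat_numeral)
 show ?thesis
 proof (cases "e i = 0")
  \<comment> \<open>Truncated subtraction would leave the exponent at 0 and spoil the degree of
    \<open>?h\<close>, so its term, whose coefficient is 0, is kept out here.\<close>
  case True
  have G: "graded 4 (off 0) (%x. - 16 * ?g x + 0 * ?g x)" by (rule graded_lincomb[OF g g])
  have "tube_integral (%x. - 16 * ?g x + 0 * ?g x) eps c = 0"
   by (rule tube_integral_exact[OF c(1) q G X eps, of "axis i 1"]) (use d True in simp)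
  moreover have "tube_integral (%x. - 16 * ?g x + 0 * ?g x) eps c = (\<Sum>u\<in>{()}. - 16 * tube_integral ?g eps c)"
   by (rule tube_integral_linear[OF sm X eps G g]) auto
  ultimately show ?thesis using True by simp
 next
  case False
  have h: "graded 4 (off 0) ?h" by (rule graded_quot) (use tot[of "e i - 1"] False in simp)
  have G: "graded 4 (off 0) (%x. of_nat (e i) * ?h x + (- 16) * ?g x)" by (rule graded_lincomb[OF h g])
  have "tube_integral (%x. of_nat (e i) * ?h x + (- 16) * ?g x) eps c = 0"
   by (rule tube_integral_exact[OF c(1) q G X eps, of "axis i 1"]) (use d in simp)
  moreover have "tube_integral (%x. of_nat (e i) * ?h x + (- 16) * ?g x) eps c =
   (\<Sum>b\<in>{True, False}. (if b then of_nat (e i) else - 16) * tube_integral (if b then ?h else ?g) eps c)"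
   by (rule tube_integral_linear[OF sm X eps G]) (use g h in auto)
  ultimately show ?thesis by simp
 qed
qed

end

definition plane_mass :: complex where
 "plane_mass = 7 * pi / 16 * integral UNIV plane_density"

context fermat_cycle
begin

lemma period_2':
 assumes "total e = 12"
 shows "tube_integral (quot 0 2 e) eps c =
  (if e 0 + e 1 = 6 then plane_mass * ((\<Sum>a\<in>S. a ^ (e 0 + 1)) * (\<Sum>b\<in>S'. b ^ (e 2 + 1))) else 0)"
proof (cases "e 0 + e 1 = 6")
 case True
 then have "e 2 + e 3 = 6" using assms by (simp add: total_def sum_4')
 then show ?thesis using period_2[of e] True by (simp add: plane_mass_def)
next
 case False
 have "e 0 + e 1 \<le> 12" using assms by (simp add: total_def sum_4')
 then have "\<not> 8 dvd e 0 + e 1 + 2" using False by presburger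
 then show ?thesis using period_vanishing[of e 2] assms False by simp
qed

lemma power_sum_shift: "8 \<le> n ==> (\<Sum>a\<in>S. a ^ (n - 8 + 1)) = - (\<Sum>a\<in>S. a ^ (n + 1))"
 "8 \<le> n ==> (\<Sum>b\<in>S'. b ^ (n - 8 + 1)) = - (\<Sum>b\<in>S'. b ^ (n + 1))"
proof -
 have "a ^ (n - 8 + 1) = - (a ^ (n + 1))" if "8 \<le> n" "a ^ 8 = - 1" for a :: complex
 proof -
  have "n + 1 = 8 + (n - 8 + 1)" using that(1) by simp
  then show ?thesis by (simp only: power_add that(2)) simp
 qed
 then show "8 \<le> n ==> (\<Sum>a\<in>S. a ^ (n - 8 + 1)) = - (\<Sum>a\<in>S. a ^ (n + 1))"
  "8 \<le> n ==> (\<Sum>b\<in>S'. b ^ (n - 8 + 1)) = - (\<Sum>b\<in>S'. b ^ (n + 1))"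
  using S(2) S'(2) by (simp_all add: sum_negf[symmetric])
qed

text \<open>In the pair of degree 14 some exponent is at least 7; reducing the pole along it shifts
  it down by 8 overall. Along x_0 this costs e 0 - 7 and a sign from a^8 = -1, along x_1 it costs e
  1 - 7 = 7 - e 0; both give the same formula.\<close>

lemma period_3:
 assumes t: "total e = 20"
 shows "tube_integral (quot 0 3 e) eps c =
  plane_mass / 16 * (((if e 0 + e 1 = 14 then 7 - of_nat (e 0) else 0) + (if e 0 + e 1 = 6 then 7 - of_nat (e 2) else 0)) *
   ((\<Sum>a\<in>S. a ^ (e 0 + 1)) * (\<Sum>b\<in>S'. b ^ (e 2 + 1))))"
proof -
 have reduce: "16 * tube_integral (quot 0 3 e) eps c = of_nat (e i - 7) * tube_integral (quot 0 2 (e(i := e i - 8))) eps c"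
  "e i \<ge> 8 ==> total (e(i := e i - 8)) = 12" if i: "e i \<ge> 7" for i
 proof -
  have r: "total e = e i + sum e (UNIV - {i})" "total (e(i := m)) = m + sum e (UNIV - {i})" for m
   unfolding total_def by (simp_all add: sum.remove[of UNIV i])
  have "total (e(i := e i - 7)) = 13" "e i \<ge> 8 ==> total (e(i := e i - 8)) = 12" using r t i by simp_all
  then show "e i \<ge> 8 ==> total (e(i := e i - 8)) = 12" by blast
  show "16 * tube_integral (quot 0 3 e) eps c = of_nat (e i - 7) * tube_integral (quot 0 2 (e(i := e i - 8))) eps c"
   using exact_quot[OF cycle grid_surface \<open>total (e(i := e i - 7)) = 13\<close>, of i] i by simp
 qed
 have s: "e 0 + e 1 + e 2 + e 3 = 20" using t by (simp add: total_def sum_4')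
 let ?p = "%n. \<Sum>a\<in>S. a ^ (n + 1)" and ?q = "%n. \<Sum>b\<in>S'. b ^ (n + 1)"
 consider "e 0 + e 1 = 14" | "e 0 + e 1 = 6" | "e 0 + e 1 ~= 14" "e 0 + e 1 ~= 6" by blast
 then show ?thesis
 proof cases
  case 1
  have "16 * tube_integral (quot 0 3 e) eps c = plane_mass * ((7 - of_nat (e 0)) * (?p (e 0) * ?q (e 2)))"
  proof (cases "e 0 \<ge> 7")
   case True
   show ?thesis
   proof (cases "e 0 = 7")
    case False
    then have 8: "8 \<le> e 0" using True by simp
    have "16 * tube_integral (quot 0 3 e) eps c = of_nat (e 0 - 7) * (plane_mass * (?p (e 0 - 8) * ?q (e 2)))"
     using reduce[OF True] 8 1 by (subst (asm) period_2') simp_all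
    then show ?thesis unfolding power_sum_shift(1)[OF 8] using True by (simp add: of_nat_diff algebra_simps)
   qed (use reduce(1)[OF True] in simp)
  next
   case False
   then have 8: "8 \<le> e 1" and 7: "7 \<le> e 1" using 1 by simp_all
   then have "16 * tube_integral (quot 0 3 e) eps c = of_nat (e 1 - 7) * (plane_mass * (?p (e 0) * ?q (e 2)))"
    using reduce[OF 7] 8 1 by (subst (asm) period_2') simp_all
   moreover have "of_nat (e 1 - 7) = (7 - of_nat (e 0) :: complex)"
   proof -
    have "e 1 - 7 = 7 - e 0" using 1 8 by simp
    then show ?thesis using False by (simp add: of_nat_diff)
   qed
   ultimately show ?thesis by simp
  qed
  then show ?thesis using 1 by (simp add: mult_ac)
 next
  case 2
  have "16 * tube_integral (quot 0 3 e) eps c = plane_mass * ((7 - of_nat (e 2)) * (?p (e 0) * ?q (e 2)))"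
  proof (cases "e 2 \<ge> 7")
   case True
   show ?thesis
   proof (cases "e 2 = 7")
    case False
    then have 8: "8 \<le> e 2" using True by simp
    have "16 * tube_integral (quot 0 3 e) eps c = of_nat (e 2 - 7) * (plane_mass * (?p (e 0) * ?q (e 2 - 8)))"
     using reduce[OF True] 8 2 by (subst (asm) period_2') simp_all
    then show ?thesis unfolding power_sum_shift(2)[OF 8] using True by (simp add: of_nat_diff algebra_simps)
   qed (use reduce(1)[OF True] in simp)
  next
   case False
   then have 8: "8 \<le> e 3" and 7: "7 \<le> e 3" using 2 s by simp_all
   then have "16 * tube_integral (quot 0 3 e) eps c = of_nat (e 3 - 7) * (plane_mass * (?p (e 0) * ?q (e 2)))"
    using reduce[OF 7] 8 2 by (subst (asm) period_2') simp_all
   moreover have "of_nat (e 3 - 7) = (7 - of_nat (e 2) :: complex)"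
   proof -
    have "e 3 - 7 = 7 - e 2" using 2 s 8 by simp
    then show ?thesis using False by (simp add: of_nat_diff)
   qed
   ultimately show ?thesis by simp
  qed
  then show ?thesis using 2 by (simp add: mult_ac)
 next
  case 3
  have "e 0 + e 1 \<le> 20" using s by simp
  then have "\<not> 8 dvd e 0 + e 1 + 2" using 3 by presburger
  then show ?thesis using period_vanishing[of e 3] t 3 by simp
 qed
qed

end

section \<open>Expansion of 1 / f_t with an exact remainder\<close>

definition mixed :: "nat => (4 => nat) => params => complex ^ 4 => complex" where
 "mixed k e t x = monomial e x / (octic 0 x ^ k * octic t x)"

lemma graded_mixed:
 assumes "total e = 8 * k + 4"
 shows "graded 4 (off 0 \<inter> off t) (mixed k e t)"
 unfolding graded_def
proof (intro conjI ballI allI impI)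
 show D: "open (off 0 \<inter> off t)" by (intro open_Int open_off)
 show "smooth_on (off 0 \<inter> off t) (mixed k e t)"
  unfolding mixed_def divide_inverse
  by (intro smooth_on_mult smooth_on_inverse smooth_on_power D)
   (auto intro: smooth_on_subset[OF smooth_on_monomial] smooth_on_subset[OF smooth_on_octic])
 fix x assume x: "x \<in> off 0 \<inter> off t"
 obtain d where d: "(quot 0 k e has_derivative (%v. \<Sum>i\<in>UNIV. d $ i * v $ i)) (at x)"
  using quot_has_derivative x by blast
 obtain d' where d': "(quot t 1 (%_. 0) has_derivative (%v. \<Sum>i\<in>UNIV. d' $ i * v $ i)) (at x)"
  using quot_has_derivative x by blast
 have eq: "mixed k e t = (%x. quot 0 k e x * quot t 1 (%_. 0) x)"
  by (simp add: fun_eq_iff mixed_def quot_def monomial_def)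
 show "\<exists>d. (mixed k e t has_derivative (%v. \<Sum>i\<in>UNIV. d $ i * v $ i)) (at x)"
  unfolding eq by (rule exI[of _ "quot 0 k e x *s d' + quot t 1 (%_. 0) x *s d"],
    rule has_derivative_eq_rhs[OF has_derivative_mult[OF d d']]) (simp add: fun_eq_iff sum_4' algebra_simps)
 fix c :: complex assume c: "c ~= 0"
 show "c *s x \<in> off 0 \<inter> off t" using x c by (simp add: octic_smult)
 have "c ^ 4 * c ^ total e = (c ^ 8) ^ k * c ^ 8" unfolding assms by (simp flip: power_add power_mult add: add.commute)
 then show "c ^ 4 * mixed k e t (c *s x) = mixed k e t x"
  using x c by (simp add: mixed_def monomial_smult octic_smult power_mult_distrib field_simps)
qed

lemma monomial_add: "monomial (%i. e i + e' i) x = monomial e x * monomial e' x"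
 by (simp add: monomial_def power_add prod.distrib)

lemma octic_0_t: "octic 0 x = octic t x + (\<Sum>\<alpha>\<in>UNIV. t $ \<alpha> * monomial (exponents \<alpha>) x)"
 by (simp add: octic_def)

text \<open>One step of the geometric series: f_0 exceeds f_t by the perturbation, so 1 / (f_0^k
  f_t) is 1 / f_0^(k + 1) plus the perturbation over f_0^(k + 1) f_t. The remainder stays exact, so
  no convergence is involved.\<close>

lemma mixed_step:
 assumes "octic 0 x ~= 0" "octic t x ~= 0"
 shows "mixed k e t x = quot 0 (Suc k) e x + (\<Sum>\<alpha>\<in>UNIV. t $ \<alpha> * mixed (Suc k) (%i. e i + exponents \<alpha> i) t x)"
proof -
 let ?v = "\<Sum>\<alpha>\<in>UNIV. t $ \<alpha> * monomial (exponents \<alpha>) x"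
 have "(\<Sum>\<alpha>\<in>UNIV. t $ \<alpha> * mixed (Suc k) (%i. e i + exponents \<alpha> i) t x) = monomial e x * ?v / (octic 0 x ^ Suc k * octic t x)"
  by (simp add: mixed_def monomial_add sum_distrib_left sum_divide_distrib mult_ac)
 moreover have "mixed k e t x = monomial e x * octic 0 x / (octic 0 x ^ Suc k * octic t x)"
  using assms by (simp add: mixed_def)
 moreover have "quot 0 (Suc k) e x = monomial e x * octic t x / (octic 0 x ^ Suc k * octic t x)"
  using assms by (simp add: quot_def)
 ultimately show ?thesis
  unfolding octic_0_t[of x t] by (simp only: add_divide_distrib[symmetric] distrib_left)
qed

text \<open>Differentiation under the integral, with the complex linearity that germs require. For
  denominators u at y and w at t, n / u - n / w - n (w - u) / w^2 equals n (w - u)^2 / (w^2 u),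
  which is quadratic in y - t uniformly over the compact box.\<close>

lemma resolvent_integral:
 fixes N h :: "'q::euclidean_space => complex" and m :: "'n::finite => 'q => complex" and t :: "complex ^ 'n"
 assumes N: "continuous_on (cbox a b) N" and h: "continuous_on (cbox a b) h" and m: "!!\<alpha>. continuous_on (cbox a b) (m \<alpha>)"
  and nz: "!!s q. norm s < \<rho> ==> q \<in> cbox a b ==> h q - (\<Sum>\<alpha>\<in>UNIV. s $ \<alpha> * m \<alpha> q) ~= 0" and t: "norm t < \<rho>"
 shows "\<exists>D. ((%t. integral (cbox a b) (%q. N q / (h q - (\<Sum>\<alpha>\<in>UNIV. t $ \<alpha> * m \<alpha> q)))) has_derivative D) (at t)
  & (\<forall>c v. D (c *s v) = c * D v)"
proof -
 let ?C = "cbox a b"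
 define den where "den = (%s q. h q - (\<Sum>\<alpha>\<in>UNIV. s $ \<alpha> * m \<alpha> q))"
 define \<delta> where "\<delta> = (%v :: complex ^ 'n. %q. \<Sum>\<alpha>\<in>UNIV. v $ \<alpha> * m \<alpha> q)"
 have c\<delta>: "continuous_on ?C (\<delta> v)" and cden: "continuous_on ?C (den v)" for v
  unfolding \<delta>_def den_def by (intro continuous_intros h m)+
 define r where "r = (\<rho> - norm t) / 2"
 have rt: "norm s < \<rho>" if "s \<in> cball t r" for s
  using t that norm_triangle_ineq2[of s t] by (simp add: r_def dist_norm norm_minus_commute field_simps)
 have r0: "r > 0" using t by (simp add: r_def)
 have "continuous_on (cball t r \<times> ?C) (%p. den (fst p) (snd p))"
  unfolding den_def by (intro continuous_intros continuous_on_compose2[OF h] continuous_on_compose2[OF m]) auto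
 then have "continuous_on (cball t r \<times> ?C) (%p. inverse (den (fst p) (snd p)))"
  by (rule continuous_on_inverse) (use nz rt in \<open>auto simp: den_def\<close>)
 then have "bounded ((%p. inverse (den (fst p) (snd p))) ` (cball t r \<times> ?C))"
  by (intro compact_imp_bounded compact_continuous_image compact_Times) auto
 then obtain B where "\<forall>x\<in>(%p. inverse (den (fst p) (snd p))) ` (cball t r \<times> ?C). norm x \<le> B" by (auto simp: bounded_iff)
 then have "norm (inverse (den s q)) \<le> \<bar>B\<bar>" if "s \<in> cball t r" "q \<in> ?C" for s q using that by force
 then obtain B where B: "B \<ge> 0" "!!s q. s \<in> cball t r ==> q \<in> ?C ==> norm (inverse (den s q)) \<le> B" by (metis abs_ge_zero)
 have bnd: "\<exists>M. \<forall>q\<in>?C. norm (f q) \<le> M" if "continuous_on ?C f" for f :: "'q => complex"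
  using compact_imp_bounded[OF compact_continuous_image[OF that compact_cbox]] by (force simp: bounded_iff)
 obtain B0 where "!!q. q \<in> ?C ==> norm (N q) \<le> B0" using bnd[OF N] by blast
 then obtain B' where B': "B' \<ge> 0" "!!q. q \<in> ?C ==> norm (N q) \<le> B'" by (metis max.cobounded1 max.coboundedI2)
 obtain M' where M': "!!\<alpha> q. q \<in> ?C ==> norm (m \<alpha> q) \<le> M' \<alpha>" using bnd[OF m] by metis
 define M where "M = (\<Sum>\<alpha>\<in>UNIV. M' \<alpha>)"
 have M: "norm (\<delta> v q) \<le> norm v * M" if "q \<in> ?C" for v q
 proof -
  have "norm (\<delta> v q) \<le> (\<Sum>\<alpha>\<in>UNIV. norm v * M' \<alpha>)"
   unfolding \<delta>_def by (rule sum_norm_le) (auto simp: norm_mult intro!: mult_mono Finite_Cartesian_Product.norm_nth_le M'[OF that])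
  then show ?thesis by (simp add: M_def sum_distrib_left)
 qed
 define L where "L = (%v. integral ?C (%q. N q * \<delta> v q / (den t q)\<^sup>2))"
 have t0: "den t q ~= 0" if "q \<in> ?C" for q using nz[OF t that] by (simp add: den_def)
 have ci: "(%q. N q * \<delta> v q / (den t q)\<^sup>2) integrable_on ?C" for v
  by (intro integrable_continuous continuous_intros N c\<delta> cden) (use t0 in auto)
 have lin: "L (c *s v) = c * L v" "L (v + w) = L v + L w" for c v w
 proof -
  have "\<delta> (c *s v) q = c * \<delta> v q" "\<delta> (v + w) q = \<delta> v q + \<delta> w q" for q
   by (simp_all add: \<delta>_def sum_distrib_left mult.assoc distrib_right sum.distrib)
  then have e: "N q * \<delta> (c *s v) q / (den t q)\<^sup>2 = c * (N q * \<delta> v q / (den t q)\<^sup>2)"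
   "N q * \<delta> (v + w) q / (den t q)\<^sup>2 = N q * \<delta> v q / (den t q)\<^sup>2 + N q * \<delta> w q / (den t q)\<^sup>2" for q
   by (simp_all add: distrib_left add_divide_distrib)
  show "L (c *s v) = c * L v" unfolding L_def e by (rule integral_mult_right)
  show "L (v + w) = L v + L w" unfolding L_def e by (rule integral_add[OF ci ci])
 qed
 have "L (x *\<^sub>R v) = x *\<^sub>R L v" for x v
 proof -
  have "x *\<^sub>R v = complex_of_real x *s v"
   unfolding vec_eq_iff vector_scaleR_component vector_smult_component by (simp add: scaleR_conv_of_real)
  then show ?thesis by (simp only: lin scaleR_conv_of_real)
 qed
 then have bl: "bounded_linear L" using lin(2) by (intro linear_conv_bounded_linear[THEN iffD1] linearI)
 have "((%t. integral ?C (%q. N q / den t q)) has_derivative L) (at t)"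
 proof (rule has_derivativeI_sandwich[OF r0 bl])
  let ?K = "B' * M\<^sup>2 * B ^ 3 * measure lborel ?C"
  show "((%y. ?K * norm (y - t)) \<longlongrightarrow> 0) (at t)"
  proof -
   have "((%y. ?K * norm (y - t)) \<longlongrightarrow> ?K * norm (t - t)) (at t)" by (intro tendsto_intros)
   then show ?thesis by simp
  qed
  fix y assume y: "y ~= t" "dist y t < r"
  then have yb: "y \<in> cball t r" by (simp add: dist_commute)
  have y0: "den y q ~= 0" if "q \<in> ?C" for q using nz[OF rt[OF yb] that] by (simp add: den_def)
  have i1: "(%q. N q / den y q) integrable_on ?C" "(%q. N q / den t q) integrable_on ?C"
   by (intro integrable_continuous continuous_intros N cden; use t0 y0 in auto)+
  have "integral ?C (%q. N q / den y q) - integral ?C (%q. N q / den t q) - L (y - t) =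
   integral ?C (%q. N q / den y q - N q / den t q - N q * \<delta> (y - t) q / (den t q)\<^sup>2)"
   unfolding L_def using i1 ci by (simp add: integral_diff integrable_diff)
  also have "norm \<dots> \<le> B' * (norm (y - t) * M)\<^sup>2 * B ^ 3 * measure lborel ?C"
  proof (rule integrable_bound)
   show "(%q. N q / den y q - N q / den t q - N q * \<delta> (y - t) q / (den t q)\<^sup>2) integrable_on ?C"
    by (intro integrable_diff i1 ci)
   show bound: "norm (N q / den y q - N q / den t q - N q * \<delta> (y - t) q / (den t q)\<^sup>2) \<le> B' * (norm (y - t) * M)\<^sup>2 * B ^ 3"
    if q: "q \<in> ?C" for q
   proof -
    have d: "\<delta> (y - t) q = den t q - den y q" by (simp add: den_def \<delta>_def left_diff_distrib sum_subtractf)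
    have "n / u - n / w - n * (w - u) / w\<^sup>2 = n * (w - u)\<^sup>2 * (inverse w ^ 2 * inverse u)" if "u ~= 0" "w ~= 0" for n u w :: complex
     using that by (simp add: field_simps power2_eq_square)
    from this[OF y0[OF q] t0[OF q]] have E: "N q / den y q - N q / den t q - N q * \<delta> (y - t) q / (den t q)\<^sup>2 =
     N q * (\<delta> (y - t) q)\<^sup>2 * (inverse (den t q) ^ 2 * inverse (den y q))" unfolding d .
    have M0: "0 \<le> M" unfolding M_def by (intro sum_nonneg order_trans[OF norm_ge_zero M'[OF q]])
    have "norm (N q * (\<delta> (y - t) q)\<^sup>2 * (inverse (den t q) ^ 2 * inverse (den y q))) \<le> B' * (norm (y - t) * M)\<^sup>2 * (B ^ 2 * B)"
     unfolding norm_mult norm_power using M0 B' B'(2)[OF q] M[OF q] B(1) B(2)[OF yb q] B(2)[of t q] r0 q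
     by (intro mult_mono power_mono mult_nonneg_nonneg zero_le_power) (auto intro: order_trans[OF norm_ge_zero])
    then show ?thesis unfolding E unfolding power3_eq_cube power2_eq_square by (simp only: mult.assoc)
   qed
   show "0 \<le> B' * (norm (y - t) * M)\<^sup>2 * B ^ 3" using B(1) B'(1) by simp
  qed
  finally have "norm (integral ?C (%q. N q / den y q) - integral ?C (%q. N q / den t q) - L (y - t))
   \<le> ?K * norm (y - t) * norm (y - t)" by (simp add: power_mult_distrib power2_eq_square mult_ac)
  then show "norm (integral ?C (%q. N q / den y q) - integral ?C (%q. N q / den t q) - L (y - t)) / norm (y - t) \<le> ?K * norm (y - t)"
   using y(1) by (simp add: divide_le_eq)
 qed
 then show ?thesis unfolding den_def using lin(1) by blast
qed

context octic_tube
begin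

lemma tubular_mixed:
 assumes "norm t < \<rho>"
 shows "tubular_points (off 0 \<inter> off t) eps (surface 0)"
 using tubular_surface[of 0 0] tubular_surface[of 0 t] assms \<rho> unfolding tubular_points_def tubular_def by auto

text \<open>On the circle bundle over a fixed chain of X_0 the parameter occurs only in the
  denominator f_t, which is affine in t; this is the situation of
  \<open>resolvent_integral\<close>.\<close>

lemma mixed_holomorphic:
 assumes c: "smooth_chain 2 (surface 0) c" and e: "total e = 8 * k + 4"
 shows "(%t. tube_integral (mixed k e t) eps c) \<in> holomorphic_germs"
proof -
 have sq: "\<exists>D. ((%t. square_integral (mixed k e t) eps (tri \<sigma>)) has_derivative D) (at t) & (\<forall>c v. D (c *s v) = c * D v)"
  if \<sigma>: "\<sigma> \<in> Poly_Mapping.keys c" and t: "norm t < \<rho>" for \<sigma> t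
 proof -
  have sm: "smooth_simplex 2 (surface 0) \<sigma>" using c \<sigma> by (simp add: smooth_chain_def)
  then obtain Y where L: "lifts (tri \<sigma>) Y" using lifts_tri unfolding smooth_simplex_def by blast
  have sub: "tri \<sigma> ` ucube \<subseteq> surface 0" using sm bary2_q2 by (auto simp: smooth_simplex_def)
  obtain V where V: "open V" "ucube \<subseteq> V" "smooth_on V Y" "\<forall>e\<in>V. Y e ~= 0"
   using L unfolding lifts_def by (elim exE conjE)
  interpret t: tube V Y eps by standard (use V eps in auto)
  let ?K = "t.K" and ?a = "((1, 0), 0) :: (real \<times> real) \<times> real" and ?b = "((0, 1), 0) :: (real \<times> real) \<times> real"
  have uV: "ucube \<subseteq> V \<times> (UNIV :: real set)" using V(2) by (auto simp: ucube_Pair)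
  have K: "continuous_on ucube ?K" by (rule continuous_on_subset[OF smooth_on_continuous[OF t.K] uV])
  have O: "continuous_on ucube (%q. Omega (?K q) (pd ?a ?K q) (pd ?b ?K q) (pd (0, 1) ?K q))"
   by (rule continuous_on_subset[OF smooth_on_continuous[OF smooth_on_Omega[OF t.openVU t.K
     smooth_on_derivative[OF t.K] smooth_on_derivative[OF t.K] smooth_on_derivative[OF t.K]]] uV])
  have tubs: "tubular (off 0 \<inter> off s) eps (Y q)" if "norm s < \<rho>" "q \<in> ucube" for s q
   by (rule tubular_lift[OF tubular_points_subset[OF tubular_mixed[OF that(1)] sub] L that(2)])
  have Ko: "octic 0 (?K q) ~= 0" "octic s (?K q) ~= 0" if "norm s < \<rho>" "q \<in> ucube" for s q
  proof -
   have "fst q \<in> ucube" using that(2) by (auto simp: ucube_Pair)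
   from tubs[OF that(1) this] norm_circ[OF eps, of "snd q"] have "?K q \<in> off 0 \<inter> off s"
    unfolding tubular_def by (cases q) (simp add: t.K_apply)
   then show "octic 0 (?K q) ~= 0" "octic s (?K q) ~= 0" by auto
  qed
  have mc: "continuous_on ucube (%q. monomial m (?K q))" and oc: "continuous_on ucube (%q. octic s (?K q))" for m s
   by (rule continuous_on_compose2[OF smooth_on_continuous[OF smooth_on_monomial] K], simp,
     rule continuous_on_compose2[OF smooth_on_continuous[OF smooth_on_octic] K], simp)
  define N where "N = (%q. monomial e (?K q) / octic 0 (?K q) ^ k * Omega (?K q) (pd ?a ?K q) (pd ?b ?K q) (pd (0, 1) ?K q))"
  have Nc: "continuous_on ucube N"
   unfolding N_def by (intro continuous_intros mc oc O) (use Ko(1)[of 0] \<rho> in auto)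
  have os: "octic 0 x - (\<Sum>\<alpha>\<in>UNIV. s $ \<alpha> * monomial (exponents \<alpha>) x) = octic s x" for s x
   using octic_0_t[of x s] by simp
  have eq: "square_integral (mixed k e s) eps (tri \<sigma>) =
   integral ucube (%q. N q / (octic 0 (?K q) - (\<Sum>\<alpha>\<in>UNIV. s $ \<alpha> * monomial (exponents \<alpha>) (?K q))))" if s: "norm s < \<rho>" for s
  proof -
   have "square_integral (mixed k e s) eps (tri \<sigma>) = integral ucube (tden (mixed k e s) eps Y (1, 0) (0, 1))"
    by (rule square_integral_eq[OF L graded_mixed[OF e] tubular_points_subset[OF tubular_mixed[OF s] sub] eps])
   also have "\<dots> = integral ucube (%x. integral ucube (%th. N (x, th) / octic s (?K (x, th))))"
    unfolding tden_def ucube_real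
   proof (intro integral_cong)
    fix x :: "real \<times> real" and th :: real assume x: "x \<in> ucube"
    have "x \<in> V" using V(2) x by blast
    note pd = t.pd_K[OF this]
    show "tint (mixed k e s) (circ eps th) (Y x) (normal (Y x)) (pd (1, 0) Y x) (pd (1, 0) (%e. normal (Y e)) x)
     (pd (0, 1) Y x) (pd (0, 1) (%e. normal (Y e)) x) = N (x, th) / octic s (?K (x, th))"
     unfolding tint_def N_def pd t.K_apply mixed_def by simp
   qed
   also have "\<dots> = integral ucube (%q. N q / octic s (?K q))"
    by (rule integral_ucube_Pair[symmetric]) (use Ko(2)[OF s] in \<open>intro continuous_intros Nc oc\<close>, auto)
   finally show ?thesis unfolding os .
  qed
  obtain D where D: "((%s. integral ucube (%q. N q / (octic 0 (?K q) - (\<Sum>\<alpha>\<in>UNIV. s $ \<alpha> * monomial (exponents \<alpha>) (?K q))))) has_derivative D) (at t)"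
   "\<forall>c v. D (c *s v) = c * D v"
   using resolvent_integral[where m = "%\<alpha> q. monomial (exponents \<alpha>) (?K q)", OF Nc oc[of 0] mc _ t, unfolded os, OF Ko(2)]
   unfolding os by blast
  have "((%t. square_integral (mixed k e t) eps (tri \<sigma>)) has_derivative D) (at t)"
   by (rule has_derivative_transform_within_open[OF D(1) open_ball[of 0 \<rho>]]) (use t eq in \<open>auto simp: os\<close>)
  then show ?thesis using D(2) by blast
 qed
 have ex: "\<exists>D. ((%t. tube_integral (mixed k e t) eps c) has_derivative D) (at t) & (\<forall>c v. D (c *s v) = c * D v)" if t: "norm t < \<rho>" for t
 proof -
  obtain D where D: "!!\<sigma>. \<sigma> \<in> Poly_Mapping.keys c ==> ((%t. square_integral (mixed k e t) eps (tri \<sigma>)) has_derivative D \<sigma>) (at t)"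
   "!!\<sigma> z v. \<sigma> \<in> Poly_Mapping.keys c ==> D \<sigma> (z *s v) = z * D \<sigma> v"
   using sq[OF _ t] by metis
  let ?D = "%h. \<Sum>\<sigma>\<in>Poly_Mapping.keys c. of_rat (Poly_Mapping.lookup c \<sigma>) * D \<sigma> h"
  have "((%t. tube_integral (mixed k e t) eps c) has_derivative ?D) (at t)"
   unfolding tube_integral_def chain_sum_def by (intro has_derivative_sum has_derivative_mult_right D(1))
  moreover have "?D (z *s v) = z * ?D v" for z v by (simp add: D(2) sum_distrib_left mult_ac)
  ultimately show ?thesis by blast
 qed
 have "\<forall>\<^sub>F t in nhds (0 :: params). norm t < \<rho>"
  by (rule eventually_nhds_in_open[of "ball 0 \<rho>", THEN eventually_mono]) (use \<rho> in auto)
 then show ?thesis unfolding holomorphic_germs_def mem_Collect_eq by (rule eventually_mono) (rule ex)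
qed

lemma tube_integral_step:
 assumes c: "smooth_chain 2 (surface 0) c" and e: "total e = 8 * k + 4" and t: "norm t < \<rho>"
 shows "tube_integral (mixed k e t) eps c = tube_integral (quot 0 (Suc k) e) eps c +
  (\<Sum>\<alpha>\<in>UNIV. t $ \<alpha> * tube_integral (mixed (Suc k) (%i. e i + exponents \<alpha> i) t) eps c)"
proof -
 let ?D = "off 0 \<inter> off t"
 define g where "g = (%x. case x of None => quot 0 (Suc k) e | Some \<alpha> => mixed (Suc k) (%i. e i + exponents \<alpha> i) t)"
 define a where "a = (%x. case x of None => 1 | Some \<alpha> => t $ \<alpha>)"
 have sum: "(\<Sum>x\<in>UNIV. f x) = f None + (\<Sum>\<alpha>\<in>UNIV. f (Some \<alpha>))" for f :: "octic_monomial option => complex"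
  by (simp add: UNIV_option_conv sum.reindex)
 have g: "graded 4 ?D (g x)" for x
 proof (cases x)
  case None
  have "graded 4 (off 0) (quot 0 (Suc k) e)" by (rule graded_quot) (use e in simp)
  then have "graded 4 ?D (quot 0 (Suc k) e)" by (rule graded_subset) (auto simp: open_Int open_off octic_smult)
  then show ?thesis by (simp add: None g_def)
 next
  case (Some \<alpha>)
  have "total (%i. e i + exponents \<alpha> i) = 8 * Suc k + 4"
   using e exponents[of \<alpha>] by (simp add: total_def sum.distrib)
  then show ?thesis unfolding Some g_def by (simp add: graded_mixed)
 qed
 have "tube_integral (mixed k e t) eps c = (\<Sum>x\<in>UNIV. a x * tube_integral (g x) eps c)"
  by (rule tube_integral_linear[OF c tubular_mixed[OF t] eps graded_mixed[OF e] g])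
   (use mixed_step in \<open>auto simp: sum a_def g_def\<close>)
 then show ?thesis by (simp add: sum a_def g_def)
qed

theorem period_expansion:
 assumes c: "smooth_chain 2 (surface 0) c" and \<beta>: "total \<beta> = 4" and t: "norm t < \<rho>"
 shows "tube_integral (quot t 1 \<beta>) eps c = tube_integral (quot 0 1 \<beta>) eps c +
  (\<Sum>\<alpha>\<in>UNIV. t $ \<alpha> * (tube_integral (quot 0 2 (%i. \<beta> i + exponents \<alpha> i)) eps c +
  (\<Sum>\<alpha>'\<in>UNIV. t $ \<alpha>' * (tube_integral (quot 0 3 (%i. \<beta> i + exponents \<alpha> i + exponents \<alpha>' i)) eps c +
  (\<Sum>\<alpha>''\<in>UNIV. t $ \<alpha>'' * tube_integral (mixed 3 (%i. \<beta> i + exponents \<alpha> i + exponents \<alpha>' i + exponents \<alpha>'' i) t) eps c)))))"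
proof -
 have tot: "total (%i. e i + exponents \<alpha> i) = total e + 8" for e \<alpha>
  using exponents[of \<alpha>] by (simp add: total_def sum.distrib)
 have "quot t 1 \<beta> = mixed 0 \<beta> t" by (simp add: fun_eq_iff quot_def mixed_def)
 then show ?thesis
  using tube_integral_step[OF c _ t, of \<beta> 0] tube_integral_step[OF c _ t, of "%i. \<beta> i + exponents _ i" 1]
   tube_integral_step[OF c _ t, of "%i. \<beta> i + exponents _ i + exponents _ i" 2]
  by (simp add: tot \<beta> numeral_2_eq_2 numeral_3_eq_3)
qed

end

section \<open>Ideals of germs modulo cubes\<close>

definition clinear :: "(complex ^ 'n => complex) => bool" where
 "clinear f \<longleftrightarrow> (\<forall>v w. f (v + w) = f v + f w) & (\<forall>c v. f (c *s v) = c * f v)"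

lemma clinear_add: "clinear f ==> f (v + w) = f v + f w" and clinear_smult: "clinear f ==> f (c *s v) = c * f v"
 by (simp_all add: clinear_def)

lemma clinear_0: "clinear f ==> f 0 = 0"
 using clinear_smult[of f 0 0] by simp

lemma clinear_diff: "clinear f ==> f (v - w) = f v - f w"
 using clinear_add[of f v "(- 1) *s w"] clinear_smult[of f "- 1" w] by (simp add: vec.scale_minus_left)

lemma clinear_sum: "clinear f ==> f (\<Sum>i\<in>I. c i *s v i) = (\<Sum>i\<in>I. c i * f (v i))"
 by (induction I rule: infinite_finite_induct) (auto simp: clinear_0 clinear_add clinear_smult)

lemma clinear_lincomb: "(!!i. i \<in> I ==> clinear (f i)) ==> clinear (%v. \<Sum>i\<in>I. c i * f i v)"
 by (simp add: clinear_def distrib_left sum.distrib sum_distrib_left mult_ac)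

lemma clinear_nth: "clinear (%v. v $ i)"
 by (simp add: clinear_def)

lemma clinear_expand:
 assumes "clinear f"
 shows "f v = (\<Sum>i\<in>UNIV. v $ i * f (axis i 1))"
 using clinear_sum[OF assms, of "%i. v $ i" "%i. axis i 1" UNIV] by (simp add: basis_expansion)

lemma hol_at_0: "h \<in> holomorphic_germs ==> \<exists>D. (h has_derivative D) (at 0)"
 unfolding holomorphic_germs_def by (auto dest: eventually_nhds_x_imp_x)

lemma hol_const: "(%t. c) \<in> holomorphic_germs"
 unfolding holomorphic_germs_def by (auto intro!: always_eventually exI[of _ "%_. 0"])

lemma hol_clinear:
 assumes "clinear f"
 shows "f \<in> holomorphic_germs" "(f has_derivative f) (at t)"
proof -
 have "f (x *\<^sub>R v) = x *\<^sub>R f v" for x v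
 proof -
  have "x *\<^sub>R v = complex_of_real x *s v"
   unfolding vec_eq_iff vector_scaleR_component vector_smult_component by (simp add: scaleR_conv_of_real)
  then show ?thesis by (simp only: clinear_smult[OF assms] scaleR_conv_of_real)
 qed
 then have "bounded_linear f" by (intro linear_conv_bounded_linear[THEN iffD1] linearI clinear_add[OF assms])
 then show d: "(f has_derivative f) (at t)" for t by (rule bounded_linear_imp_has_derivative)
 then show "f \<in> holomorphic_germs" using clinear_smult[OF assms] unfolding holomorphic_germs_def mem_Collect_eq
  by (intro always_eventually allI exI[of _ f]) auto
qed

lemma hol_add_mult:
 assumes "g \<in> holomorphic_germs" "h \<in> holomorphic_germs"
 shows "(%t. g t + h t) \<in> holomorphic_germs" "(%t. g t * h t) \<in> holomorphic_germs"
proof -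
 have a: "\<forall>\<^sub>F t in nhds 0. \<exists>D. (f has_derivative D) (at t) & (\<forall>c v. D (c *s v) = c * D v)" if "f \<in> holomorphic_germs" for f :: "complex ^ 'a => complex"
  using that by (simp add: holomorphic_germs_def)
 note ev = a[OF assms(1)] a[OF assms(2)]
 show "(%t. g t + h t) \<in> holomorphic_germs" "(%t. g t * h t) \<in> holomorphic_germs"
  unfolding holomorphic_germs_def mem_Collect_eq
 proof -
  show "\<forall>\<^sub>F t in nhds 0. \<exists>D. ((%t. g t + h t) has_derivative D) (at t) & (\<forall>c v. D (c *s v) = c * D v)"
   using ev
  proof eventually_elim
   case (elim t)
   then obtain D D' where "(g has_derivative D) (at t)" "\<forall>c v. D (c *s v) = c * D v" "(h has_derivative D') (at t)" "\<forall>c v. D' (c *s v) = c * D' v"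
    by blast
   then show ?case by (intro exI[of _ "%v. D v + D' v"]) (auto intro: has_derivative_add simp: distrib_left)
  qed
  show "\<forall>\<^sub>F t in nhds 0. \<exists>D. ((%t. g t * h t) has_derivative D) (at t) & (\<forall>c v. D (c *s v) = c * D v)"
   using ev
  proof eventually_elim
   case (elim t)
   then obtain D D' where "(g has_derivative D) (at t)" "\<forall>c v. D (c *s v) = c * D v" "(h has_derivative D') (at t)" "\<forall>c v. D' (c *s v) = c * D' v"
    by blast
   from has_derivative_mult[OF this(1,3)] this(2,4) show ?case
    by (intro exI[of _ "%v. g t * D' v + D v * h t"]) (simp add: distrib_left mult_ac)
  qed
 qed
qed

lemma hol_sum: "(!!i. i \<in> I ==> f i \<in> holomorphic_germs) ==> (%t. \<Sum>i\<in>I. f i t) \<in> holomorphic_germs"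
 by (induction I rule: infinite_finite_induct) (auto intro: hol_add_mult hol_const)

text \<open>Functions that agree near 0 agree near every nearby point, so the derivatives at those
  points transfer as well.\<close>

lemma hol_cong:
 assumes "h \<in> holomorphic_germs" and eq: "\<forall>\<^sub>F t in nhds 0. g t = h t"
 shows "g \<in> holomorphic_germs"
proof -
 have "\<forall>\<^sub>F t in nhds 0. \<exists>D. (h has_derivative D) (at t) & (\<forall>c v. D (c *s v) = c * D v)"
  using assms(1) by (simp add: holomorphic_germs_def)
 moreover have "\<forall>\<^sub>F t in nhds 0. \<forall>\<^sub>F s in nhds t. g s = h s" using eq by (simp add: eventually_eventually)
 ultimately have "\<forall>\<^sub>F t in nhds 0. \<exists>D. (g has_derivative D) (at t) & (\<forall>c v. D (c *s v) = c * D v)"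
 proof eventually_elim
  case (elim t)
  then obtain D where D: "(h has_derivative D) (at t)" "\<forall>c v. D (c *s v) = c * D v" by blast
  have e: "g t = h t" by (rule eventually_nhds_x_imp_x[OF elim(2)])
  have "\<forall>\<^sub>F s in at t. h s = g s" using elim(2) by (auto simp: eventually_at_filter elim: eventually_mono)
  from has_derivative_transform_eventually[OF D(1) this] e D(2) show ?case by auto
 qed
 then show ?thesis by (simp add: holomorphic_germs_def)
qed

lemma max_idealD: "h \<in> max_ideal ==> h \<in> holomorphic_germs" "h \<in> max_ideal ==> h 0 = 0"
 by (simp_all add: max_ideal_def)

lemma max_ideal_clinear: "clinear f ==> f \<in> max_ideal"
 by (simp add: max_ideal_def hol_clinear clinear_0)

lemma product_derivative_zero:
 assumes "u \<in> max_ideal" "v \<in> max_ideal"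
 shows "((%t. u t * v t) has_derivative (%_. 0)) (at 0)"
proof -
 obtain D D' where D: "(u has_derivative D) (at 0)" "(v has_derivative D') (at 0)" using assms hol_at_0 max_idealD(1) by blast
 from has_derivative_mult[OF this] show ?thesis using assms by (simp add: max_idealD(2))
qed

lemma ideal_generator: "s \<in> S ==> s \<in> germ_ideal S"
 unfolding germ_ideal_def by (auto intro!: exI[of _ "{s}"] exI[of _ "%_ _. 1"] hol_const)

lemma ideal_cong:
 assumes "h \<in> germ_ideal S" "\<forall>\<^sub>F t in nhds 0. g t = h t"
 shows "g \<in> germ_ideal S"
proof -
 obtain A c where A: "finite A" "A \<subseteq> S" "\<forall>s\<in>A. c s \<in> holomorphic_germs" "\<forall>\<^sub>F t in nhds 0. h t = (\<Sum>s\<in>A. c s t * s t)"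
  using assms(1) unfolding germ_ideal_def by blast
 have "\<forall>\<^sub>F t in nhds 0. g t = (\<Sum>s\<in>A. c s t * s t)" using assms(2) A(4) by eventually_elim simp
 then show ?thesis using A(1-3) unfolding germ_ideal_def by blast
qed

lemma ideal_mult:
 assumes "h \<in> germ_ideal S" "k \<in> holomorphic_germs"
 shows "(%t. k t * h t) \<in> germ_ideal S"
proof -
 obtain A c where A: "finite A" "A \<subseteq> S" "\<forall>s\<in>A. c s \<in> holomorphic_germs" "\<forall>\<^sub>F t in nhds 0. h t = (\<Sum>s\<in>A. c s t * s t)"
  using assms(1) unfolding germ_ideal_def by blast
 have "\<forall>\<^sub>F t in nhds 0. k t * h t = (\<Sum>s\<in>A. (k t * c s t) * s t)"
  using A(4) by eventually_elim (simp add: sum_distrib_left mult_ac)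
 moreover have "\<forall>s\<in>A. (%t. k t * c s t) \<in> holomorphic_germs" using A(3) assms(2) hol_add_mult(2) by blast
 ultimately show ?thesis using A(1,2) unfolding germ_ideal_def
  by (intro CollectI exI[of _ A] exI[of _ "%s t. k t * c s t"]) auto
qed

lemma ideal_add:
 assumes "g \<in> germ_ideal S" "h \<in> germ_ideal S"
 shows "(%t. g t + h t) \<in> germ_ideal S"
proof -
 obtain A c where A: "finite A" "A \<subseteq> S" "\<forall>s\<in>A. c s \<in> holomorphic_germs" "\<forall>\<^sub>F t in nhds 0. g t = (\<Sum>s\<in>A. c s t * s t)"
  using assms(1) unfolding germ_ideal_def by blast
 obtain A' c' where A': "finite A'" "A' \<subseteq> S" "\<forall>s\<in>A'. c' s \<in> holomorphic_germs" "\<forall>\<^sub>F t in nhds 0. h t = (\<Sum>s\<in>A'. c' s t * s t)"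
  using assms(2) unfolding germ_ideal_def by blast
 define k where "k = (%s t. (if s \<in> A then c s t else 0) + (if s \<in> A' then c' s t else 0))"
 have "k s \<in> holomorphic_germs" for s
  unfolding k_def using A(3) A'(3) by (intro hol_add_mult; cases "s \<in> A"; cases "s \<in> A'") (auto intro: hol_const)
 moreover have "\<forall>\<^sub>F t in nhds 0. g t + h t = (\<Sum>s\<in>A \<union> A'. k s t * s t)"
  using A(4) A'(4)
 proof eventually_elim
  case (elim t)
  have "(\<Sum>s\<in>A. c s t * s t) = (\<Sum>s\<in>A \<union> A'. (if s \<in> A then c s t else 0) * s t)"
   using A(1) A'(1) by (intro sum.mono_neutral_cong_left) auto
  moreover have "(\<Sum>s\<in>A'. c' s t * s t) = (\<Sum>s\<in>A \<union> A'. (if s \<in> A' then c' s t else 0) * s t)"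
   using A(1) A'(1) by (intro sum.mono_neutral_cong_left) auto
  ultimately show ?case using elim by (simp add: k_def distrib_right sum.distrib)
 qed
 ultimately show ?thesis using A(1,2) A'(1,2) unfolding germ_ideal_def
  by (intro CollectI exI[of _ "A \<union> A'"] exI[of _ k]) auto
qed

lemma ideal_sum: "(!!i. i \<in> I ==> f i \<in> germ_ideal S) ==> (%t. \<Sum>i\<in>I. f i t) \<in> germ_ideal S"
proof (induction I rule: infinite_finite_induct)
 case (insert i I)
 then show ?case by (auto intro: ideal_add)
qed (auto simp: germ_ideal_def intro!: exI[of _ "{}"])

lemma ideal_least: "S \<subseteq> germ_ideal T ==> germ_ideal S \<subseteq> germ_ideal T"
proof
 fix h assume S: "S \<subseteq> germ_ideal T" and h: "h \<in> germ_ideal S"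
 obtain A c where A: "finite A" "A \<subseteq> S" "\<forall>s\<in>A. c s \<in> holomorphic_germs" "\<forall>\<^sub>F t in nhds 0. h t = (\<Sum>s\<in>A. c s t * s t)"
  using h unfolding germ_ideal_def by blast
 have "(%t. \<Sum>s\<in>A. c s t * s t) \<in> germ_ideal T" by (intro ideal_sum ideal_mult) (use A S in auto)
 then show "h \<in> germ_ideal T" using A(4) by (rule ideal_cong)
qed

lemma cube_in_power:
 assumes "u \<in> max_ideal" "v \<in> max_ideal" "w \<in> max_ideal"
 shows "(%t. u t * v t * w t) \<in> max_ideal_power 3"
 unfolding max_ideal_power_def
proof (rule ideal_generator, rule CollectI, intro exI conjI)
 let ?u = "%i :: nat. if i = 0 then u else if i = 1 then v else w"
 show "(%t. u t * v t * w t) = (%t. \<Prod>i<3. ?u i t)" by (simp add: eval_nat_numeral)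
 show "\<forall>i<3. ?u i \<in> max_ideal" using assms by simp
qed

text \<open>Each generator is a product of two germs vanishing at 0, one of them itself a product,
  so its derivative there is 0.\<close>

lemma power_3_derivative:
 assumes "h \<in> max_ideal_power 3"
 shows "(h has_derivative (%_. 0)) (at 0)" "h \<in> holomorphic_germs" "h 0 = 0"
proof -
 obtain A c where A: "finite A" "A \<subseteq> {%t. \<Prod>i<(3::nat). u i t | u. \<forall>i<3. u i \<in> max_ideal}" "\<forall>s\<in>A. c s \<in> holomorphic_germs"
  and eq: "\<forall>\<^sub>F t in nhds 0. h t = (\<Sum>s\<in>A. c s t * s t)"
  using assms unfolding max_ideal_power_def germ_ideal_def mem_Collect_eq by (elim exE conjE)
 have s: "s \<in> holomorphic_germs & s 0 = 0 & (s has_derivative (%_. 0)) (at 0)" if "s \<in> A" for s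
 proof -
  from subsetD[OF A(2) that] obtain u :: "nat => _" where u: "s = (%t. \<Prod>i<3. u i t)" "\<forall>i<3. u i \<in> max_ideal"
   unfolding mem_Collect_eq by (elim exE conjE)
  have u': "u 0 \<in> max_ideal" "u 1 \<in> max_ideal" "u 2 \<in> max_ideal" using u(2) by auto
  have s: "s = (%t. u 0 t * (u 1 t * u 2 t))" unfolding u(1) by (simp add: eval_nat_numeral mult_ac)
  have m: "(%t. u 1 t * u 2 t) \<in> max_ideal" using u' by (simp add: max_ideal_def hol_add_mult)
  show ?thesis unfolding s using u'(1) m product_derivative_zero[OF u'(1) m] by (auto simp: max_ideal_def intro: hol_add_mult)
 qed
 have hol: "(%t. \<Sum>s\<in>A. c s t * s t) \<in> holomorphic_germs" using s A(3) by (intro hol_sum hol_add_mult) auto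
 show "h \<in> holomorphic_germs" by (rule hol_cong[OF hol eq])
 have z: "(\<Sum>s\<in>A. c s 0 * s 0) = 0"
 proof (rule sum.neutral, rule ballI)
  fix x assume "x \<in> A"
  from s[OF this] show "c x 0 * x 0 = 0" by simp
 qed
 then show h0: "h 0 = 0" using eventually_nhds_x_imp_x[OF eq] by simp
 have "((%t. \<Sum>s\<in>A. c s t * s t) has_derivative (%v. \<Sum>s\<in>A. 0)) (at 0)"
 proof (rule has_derivative_sum)
  fix x assume x: "x \<in> A"
  obtain D where "(c x has_derivative D) (at 0)" using hol_at_0 A(3) x by blast
  from has_derivative_mult[OF this, of x "%_. 0"] s[OF x] show "((%t. c x t * x t) has_derivative (%_. 0)) (at 0)" by simp
 qed
 moreover have "\<forall>\<^sub>F t in at 0. (\<Sum>s\<in>A. c s t * s t) = h t" using eq by (auto simp: eventually_at_filter elim: eventually_mono)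
 ultimately show "(h has_derivative (%_. 0)) (at 0)"
  using has_derivative_transform_eventually[of "%t. \<Sum>s\<in>A. c s t * s t" "%_. \<Sum>s\<in>A. 0" 0 UNIV h] h0 z by simp
qed

text \<open>An independent subfamily is built one functional at a time together with dual vectors. A
  functional outside the span so far differs at some v from the combination expected of it;
  projecting v along the e j and rescaling gives its dual vector w, and the old e j are corrected by
  multiples of w.\<close>

lemma dual_basis:
 assumes "finite B" "!!i. i \<in> B ==> clinear (L i)"
 shows "\<exists>B' e. B' \<subseteq> B & (\<forall>i\<in>B'. \<forall>j\<in>B'. L i (e j) = (if i = j then 1 else 0)) &
  (\<forall>i\<in>B. \<forall>v. L i v = (\<Sum>j\<in>B'. L i (e j) * L j v))"
 using assms
proof (induction B rule: finite_induct)
 case (insert b B)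
 then obtain B' e where B': "B' \<subseteq> B" and e: "\<forall>i\<in>B'. \<forall>j\<in>B'. L i (e j) = (if i = j then 1 else 0)"
  and sp: "\<forall>i\<in>B. \<forall>v. L i v = (\<Sum>j\<in>B'. L i (e j) * L j v)" by auto
 have fin: "finite B'" using B' insert.hyps finite_subset by blast
 have lin: "clinear (L i)" if "i \<in> B' \<or> i = b" for i using insert.prems B' that by auto
 show ?case
 proof (cases "\<forall>v. L b v = (\<Sum>j\<in>B'. L b (e j) * L j v)")
  case True
  have "\<forall>v. L i v = (\<Sum>j\<in>B'. L i (e j) * L j v)" if "i \<in> insert b B" for i
  proof (cases "i = b")
   case t: True
   show ?thesis unfolding t by (rule True)
  next
   case False
   then have "i \<in> B" using that by blast
   then show ?thesis by (rule bspec[OF sp])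
  qed
  then have "\<forall>i\<in>insert b B. \<forall>v. L i v = (\<Sum>j\<in>B'. L i (e j) * L j v)" by (rule ballI)
  with e show ?thesis by (intro exI[of _ B'] exI[of _ e] conjI subset_insertI2 B')
 next
  case False
  then obtain v where v: "L b v - (\<Sum>j\<in>B'. L b (e j) * L j v) ~= 0" by auto
  define k where "k = L b v - (\<Sum>j\<in>B'. L b (e j) * L j v)"
  define w where "w = (1 / k) *s (v - (\<Sum>j\<in>B'. L j v *s e j))"
  have Lw: "L i w = (1 / k) * (L i v - (\<Sum>j\<in>B'. L j v * L i (e j)))" if "i \<in> B' \<or> i = b" for i
   unfolding w_def clinear_smult[OF lin[OF that]] clinear_diff[OF lin[OF that]] clinear_sum[OF lin[OF that]] ..
  have w0: "L i w = 0" if "i \<in> B'" for i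
  proof -
   have "(\<Sum>j\<in>B'. L j v * L i (e j)) = (\<Sum>j\<in>B'. if i = j then L j v else 0)"
    by (rule sum.cong) (use e that in auto)
   then show ?thesis using Lw[of i] that fin by simp
  qed
  have w1: "L b w = 1" using Lw[of b] v by (simp add: k_def mult.commute)
  have bB: "b \<notin> B'" using B' insert.hyps by blast
  define e' where "e' = (%j. if j = b then w else e j - L b (e j) *s w)"
  have e'1: "L i (e' j) = L i (e j) - L b (e j) * L i w" if "i \<in> B' \<or> i = b" "j \<in> B'" for i j
   using that bB by (auto simp: e'_def clinear_diff[OF lin] clinear_smult[OF lin])
  have d: "\<forall>i\<in>insert b B'. \<forall>j\<in>insert b B'. L i (e' j) = (if i = j then 1 else 0)"
   using e'1 w0 w1 e bB by (auto simp: e'_def)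
  have "L i v = (\<Sum>j\<in>insert b B'. L i (e' j) * L j v)" if i: "i \<in> insert b B" for i v
  proof (cases "i = b")
   case True
   have "(\<Sum>j\<in>B'. L b (e' j) * L j v) = 0" by (rule sum.neutral) (use e'1 w1 in auto)
   then show ?thesis using True fin bB w1 by (simp add: e'_def)
  next
   case False
   then have iB: "i \<in> B" using i by blast
   have li: "clinear (L i)" using insert.prems iB by blast
   have "L i w = (\<Sum>j\<in>B'. L i (e j) * L j w)" using sp iB by blast
   also have "\<dots> = 0" using w0 by simp
   finally have iw: "L i w = 0" .
   then have "L i (e' j) = L i (e j)" if "j \<in> B'" for j
    using that bB by (auto simp: e'_def clinear_diff[OF li] clinear_smult[OF li])
   note ie = this
   have ib: "L i (e' b) = 0" using iw by (simp add: e'_def)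
   have "L i v = (\<Sum>j\<in>B'. L i (e j) * L j v)" by (rule bspec[OF sp iB, THEN spec])
   also have "\<dots> = (\<Sum>j\<in>B'. L i (e' j) * L j v)" by (rule sum.cong[OF refl]) (simp only: ie)
   also have "\<dots> = (\<Sum>j\<in>insert b B'. L i (e' j) * L j v)" unfolding sum.insert[OF fin bB] ib by simp
   finally show ?thesis .
  qed
  then have "\<forall>i\<in>insert b B. \<forall>v. L i v = (\<Sum>j\<in>insert b B'. L i (e' j) * L j v)" by (intro ballI allI)
  with d show ?thesis by (intro exI[of _ "insert b B'"] exI[of _ e'] conjI insert_mono B')
 qed
qed auto

text \<open>The quadratic part of a combination of generators without linear part vanishes on the common
 kernel of the linear parts, hence lies in the ideal of the independent generators modulo cubes.\<close>

theorem N_smooth_2I: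
 fixes L T F :: "'i => complex ^ 'n => complex" and b :: "'i => complex ^ 'n => complex ^ 'n => complex"
 assumes B: "finite B" and L: "!!i. i \<in> B ==> clinear (L i)"
  and b: "!!i v. i \<in> B ==> clinear (b i v)" "!!i w. i \<in> B ==> clinear (%v. b i v w)"
  and T: "!!i. i \<in> B ==> T i \<in> max_ideal_power 3"
  and F: "!!i. i \<in> B ==> \<forall>\<^sub>F t in nhds 0. F i t = L i t + b i t t + T i t"
  and kernel: "!!c v. (!!t. (\<Sum>i\<in>B. c i * L i t) = 0) ==> (!!i. i \<in> B ==> L i v = 0) ==> (\<Sum>i\<in>B. c i * b i v v) = 0"
 shows "N_smooth 2 (germ_ideal (F ` B))"
proof -
 obtain B' e where B': "B' \<subseteq> B" and e: "!!i j. i \<in> B' ==> j \<in> B' ==> L i (e j) = (if i = j then 1 else 0)"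
  and sp: "!!i v. i \<in> B ==> L i v = (\<Sum>j\<in>B'. L i (e j) * L j v)"
  using dual_basis[of B L, OF B L] by metis
 have fin: "finite B'" using B' B finite_subset by blast
 have bt: "b i t t = (\<Sum>\<alpha>\<in>UNIV. t $ \<alpha> * b i (axis \<alpha> 1) t)" if "i \<in> B" for i t
  by (rule clinear_expand[OF b(2)[OF that], of t t])
 have bh: "(%t. b i t t) \<in> holomorphic_germs" "((%t. b i t t) has_derivative (%_. 0)) (at 0)" if "i \<in> B" for i
 proof -
  show "(%t. b i t t) \<in> holomorphic_germs"
   unfolding bt[OF that] by (intro hol_sum hol_add_mult hol_clinear clinear_nth b(1)[OF that])
  have "((%t. \<Sum>\<alpha>\<in>UNIV. t $ \<alpha> * b i (axis \<alpha> 1) t) has_derivative (%_. \<Sum>\<alpha>\<in>(UNIV :: 'n set). 0)) (at 0)"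
   by (intro has_derivative_sum product_derivative_zero max_ideal_clinear clinear_nth b(1)[OF that])
  then show "((%t. b i t t) has_derivative (%_. 0)) (at 0)" unfolding bt[OF that] by simp
 qed
 have F0: "F i \<in> max_ideal" "frechet_derivative (F i) (at 0) = L i" if i: "i \<in> B" for i
 proof -
  note T' = power_3_derivative[OF T[OF i]] and f = F[OF i]
  have f0: "F i 0 = 0" using eventually_nhds_x_imp_x[OF f] T'(3) clinear_0[OF L[OF i]] clinear_0[OF b(1)[OF i]] by simp
  have "F i \<in> holomorphic_germs"
   by (rule hol_cong[OF _ f]) (intro hol_add_mult hol_clinear L i bh T')
  then show "F i \<in> max_ideal" using f0 by (simp add: max_ideal_def)
  have "((%t. L i t + b i t t + T i t) has_derivative (%v. L i v + 0 + 0)) (at 0)"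
   by (intro has_derivative_add hol_clinear L i bh T')
  moreover have "\<forall>\<^sub>F t in at 0. L i t + b i t t + T i t = F i t" using f by (auto simp: eventually_at_filter elim: eventually_mono)
  ultimately have "(F i has_derivative (%v. L i v + 0 + 0)) (at 0)"
   using has_derivative_transform_eventually[of "%t. L i t + b i t t + T i t" _ 0 UNIV "F i"] eventually_nhds_x_imp_x[OF f] by simp
  then show "frechet_derivative (F i) (at 0) = L i" using frechet_derivative_at by fastforce
 qed
 define J where "J = germ_ideal (F ` B')"
 let ?I = "germ_ideal (F ` B)" and ?M = "max_ideal_power 3 :: (complex ^ 'n => complex) set"
 have "smooth_germ_ideal J"
 proof -
  obtain h where h: "bij_betw h {..<card B'} B'" using ex_bij_betw_nat_finite[OF fin] by (auto simp: atLeast0LessThan)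
  have hB: "h i \<in> B'" if "i < card B'" for i using h that by (auto simp: bij_betw_def)
  show ?thesis
   unfolding smooth_germ_ideal_def
  proof (intro exI[of _ "card B'"] exI[of _ "%i. F (h i)"] conjI allI impI)
   show "F (h i) \<in> max_ideal" if "i < card B'" for i using F0(1) hB[OF that] B' by blast
   have "(%i. F (h i)) ` {..<card B'} = F ` B'" using h by (auto simp: bij_betw_def image_image[symmetric])
   then show "J = germ_ideal ((%i. F (h i)) ` {..<card B'})" by (simp add: J_def)
   fix c :: "nat => complex" and i assume c: "\<forall>v. (\<Sum>i<card B'. c i * frechet_derivative (F (h i)) (at 0) v) = 0" and i: "i < card B'"
   have "(\<Sum>j<card B'. c j * frechet_derivative (F (h j)) (at 0) (e (h i))) = (\<Sum>j<card B'. if j = i then c j else 0)"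
   proof (rule sum.cong[OF refl])
    fix j assume "j \<in> {..<card B'}"
    then have j: "j < card B'" by simp
    have "h j = h i \<longleftrightarrow> j = i" using h i j by (auto simp: bij_betw_def inj_on_def)
    then show "c j * frechet_derivative (F (h j)) (at 0) (e (h i)) = (if j = i then c j else 0)"
     using F0(2)[of "h j"] hB[OF i] hB[OF j] B' e[OF hB[OF j] hB[OF i]] by auto
   qed
   then show "c i = 0" using c i by simp
  qed
 qed
 moreover have "germ_ideal (?I \<union> ?M) = germ_ideal (J \<union> ?M)"
 proof
  have "J \<subseteq> ?I" unfolding J_def by (rule ideal_least) (use B' ideal_generator in blast)
  then show "germ_ideal (J \<union> ?M) \<subseteq> germ_ideal (?I \<union> ?M)" by (intro ideal_least) (use ideal_generator in blast)
  let ?R = "germ_ideal (J \<union> ?M)"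
  have JR: "F j \<in> ?R" if "j \<in> B'" for j
   by (rule ideal_generator) (use that in \<open>auto simp: J_def intro: ideal_generator\<close>)
  have MR: "h \<in> ?R" if "h \<in> ?M" for h by (rule ideal_generator) (use that in auto)
  have "F i \<in> ?R" if i: "i \<in> B" for i
  proof -
   define a where "a = (%j. L i (e j))"
   \<comment> \<open>The quadratic part of \<open>F i\<close> minus the combination of chosen
     generators that has the same linear part.\<close>
   define q where "q = (%v w. b i v w - (\<Sum>j\<in>B'. a j * b j v w))"
   have q: "clinear (q v)" "clinear (%v. q v w)" for v w
    using b i B' unfolding q_def clinear_def
    by (simp_all add: subset_iff distrib_left sum.distrib sum_distrib_left right_diff_distrib mult_ac)
   \<comment> \<open>The projection along the vectors e j onto the common kernel of the linear
     parts; there \<open>kernel\<close> makes \<open>q\<close> vanish.\<close>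
   define P where "P = (%t. t - (\<Sum>j\<in>B'. L j t *s e j))"
   have P: "L l (P t) = 0" if "l \<in> B" for l t
    unfolding P_def clinear_diff[OF L[OF that]] clinear_sum[OF L[OF that]] using sp[OF that, of t] by (simp add: mult.commute)
   have P': "clinear (%t. q (P t) w)" for w
   proof -
    have "q (P t) w = q t w - (\<Sum>j\<in>B'. L j t * q (e j) w)" for t
     unfolding P_def clinear_diff[OF q(2)[of w]] clinear_sum[OF q(2)[of w]] ..
    then show ?thesis using q(2)[of w] L B' unfolding clinear_def
     by (simp add: subset_iff distrib_left distrib_right sum.distrib sum_distrib_left right_diff_distrib mult_ac)
   qed
   have qP: "q (P t) (P t) = 0" for t
   proof -
    \<comment> \<open>The coefficients of the relation that expresses \<open>L i\<close> by the
      chosen \<open>L j\<close>, moved to one side.\<close>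
    define c where "c = (%l. (if l = i then 1 else 0) - (if l \<in> B' then a l else 0))"
    have s: "(\<Sum>l\<in>B. c l * f l) = f i - (\<Sum>j\<in>B'. a j * f j)" for f
    proof -
     have "(\<Sum>l\<in>B. (if l = i then 1 else 0) * f l) = (\<Sum>l\<in>B. if l = i then f l else 0)" by (intro sum.cong) auto
     moreover have "(\<Sum>l\<in>B. (if l \<in> B' then a l else 0) * f l) = (\<Sum>j\<in>B'. a j * f j)"
      using B B' by (intro sum.mono_neutral_cong_right) auto
     ultimately show ?thesis using B i by (simp add: c_def left_diff_distrib sum_subtractf)
    qed
    have "(\<Sum>l\<in>B. c l * b l (P t) (P t)) = 0"
     by (rule kernel) (simp_all only: s a_def sp[OF i, symmetric] diff_self P)
    then show ?thesis by (simp only: s q_def)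
   qed
   \<comment> \<open>Expanding t as P t plus its components along the e j leaves in q t t only terms
     with a factor L j t; \<open>m j\<close> is the cofactor.\<close>
   define m where "m = (%j t. q (e j) t + q (P t) (e j))"
   have m: "clinear (m j)" for j
    using q(1)[of "e j"] P'[of "e j"] unfolding m_def clinear_def by (simp add: distrib_left)
   have tP: "t = P t + (\<Sum>j\<in>B'. L j t *s e j)" for t by (simp add: P_def)
   have qt: "q t t = (\<Sum>j\<in>B'. L j t * m j t)" for t
   proof -
    have "q t t = q (P t) t + (\<Sum>j\<in>B'. L j t * q (e j) t)"
     using clinear_add[OF q(2)[of t], of "P t" "\<Sum>j\<in>B'. L j t *s e j"] clinear_sum[OF q(2)[of t], of "%j. L j t" e B'] tP[of t] by simp
    moreover have "q (P t) t = q (P t) (P t) + (\<Sum>j\<in>B'. L j t * q (P t) (e j))"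
     using clinear_add[OF q(1)[of "P t"], of "P t" "\<Sum>j\<in>B'. L j t *s e j"] clinear_sum[OF q(1)[of "P t"], of "%j. L j t" e B'] tP[of t] by simp
    ultimately show ?thesis by (simp add: qP m_def distrib_left sum.distrib)
   qed
   have "\<forall>\<^sub>F t in nhds 0. \<forall>j\<in>insert i B'. F j t = L j t + b j t t + T j t"
    using F i B' fin by (intro eventually_ball_finite) auto
   \<comment> \<open>Replacing L j by F j in these terms costs only products of three functions
     vanishing at 0 and multiples of the tails T.\<close>
   then have "\<forall>\<^sub>F t in nhds 0. F i t = (\<Sum>j\<in>B'. (a j + m j t) * F j t) +
    ((\<Sum>j\<in>B'. (- 1) * (\<Sum>\<alpha>\<in>UNIV. t $ \<alpha> * b j (axis \<alpha> 1) t * m j t)) + (T i t + (\<Sum>j\<in>B'. - (a j + m j t) * T j t)))"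
   proof eventually_elim
    case (elim t)
    have "(\<Sum>j\<in>B'. (a j + m j t) * F j t) = (\<Sum>j\<in>B'. a j * L j t) + (\<Sum>j\<in>B'. a j * b j t t) + (\<Sum>j\<in>B'. L j t * m j t)
     + (\<Sum>j\<in>B'. b j t t * m j t) + (\<Sum>j\<in>B'. (a j + m j t) * T j t)"
     using elim by (simp add: sum.distrib[symmetric] algebra_simps)
    also have "(\<Sum>j\<in>B'. a j * L j t) = L i t" unfolding a_def by (rule sp[OF i, symmetric])
    also have "(\<Sum>j\<in>B'. L j t * m j t) = b i t t - (\<Sum>j\<in>B'. a j * b j t t)" unfolding qt[symmetric] q_def ..
    also have "(\<Sum>j\<in>B'. b j t t * m j t) = (\<Sum>j\<in>B'. \<Sum>\<alpha>\<in>UNIV. t $ \<alpha> * b j (axis \<alpha> 1) t * m j t)"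
    proof (rule sum.cong[OF refl])
     fix j assume "j \<in> B'"
     then have "j \<in> B" using B' by blast
     from bt[OF this, of t] show "b j t t * m j t = (\<Sum>\<alpha>\<in>UNIV. t $ \<alpha> * b j (axis \<alpha> 1) t * m j t)" by (simp add: sum_distrib_right)
    qed
    finally show ?case using elim unfolding mult_minus_left sum_negf by simp
   qed
   moreover have "(%t. (\<Sum>j\<in>B'. (a j + m j t) * F j t) +
    ((\<Sum>j\<in>B'. (- 1) * (\<Sum>\<alpha>\<in>UNIV. t $ \<alpha> * b j (axis \<alpha> 1) t * m j t)) + (T i t + (\<Sum>j\<in>B'. - (a j + m j t) * T j t)))) \<in> ?R"
   proof (intro ideal_add ideal_sum)
    have k: "(%t. a j + m j t) \<in> holomorphic_germs" for j by (intro hol_add_mult hol_const hol_clinear m)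
    have "(%t. (- 1) * (a j + m j t)) \<in> holomorphic_germs" for j by (intro hol_add_mult(2) hol_const k)
    then have k': "(%t. - (a j + m j t)) \<in> holomorphic_germs" for j by simp
    show "(%t. (a j + m j t) * F j t) \<in> ?R" if "j \<in> B'" for j by (rule ideal_mult[OF JR[OF that] k])
    show "T i \<in> ?R" by (rule MR[OF T[OF i]])
    fix j assume j: "j \<in> B'"
    then have jB: "j \<in> B" using B' by blast
    show "(%t. - (a j + m j t) * T j t) \<in> ?R" by (rule ideal_mult[OF MR[OF T[OF jB]] k'])
    show "(%t. (- 1) * (\<Sum>\<alpha>\<in>UNIV. t $ \<alpha> * b j (axis \<alpha> 1) t * m j t)) \<in> ?R"
     by (intro ideal_mult ideal_sum MR cube_in_power max_ideal_clinear clinear_nth b(1)[OF jB] m hol_const)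
   qed
   ultimately show ?thesis by (rule ideal_cong[rotated])
  qed
  then have "?I \<subseteq> ?R" by (intro ideal_least) blast
  then show "germ_ideal (?I \<union> ?M) \<subseteq> ?R" by (intro ideal_least) (use MR in blast)
 qed
 ultimately show ?thesis unfolding N_smooth_def by (intro exI[of _ J]) simp
qed

section \<open>The fundamental cycles of the two curves\<close>

text \<open>Every zero with y nonzero is determined by the ratio x / y. For y = 0 both sides say x =
  0: the left because F 1 0 is nonzero, the right because R is nonempty.\<close>

lemma binary_form_roots:
 assumes F: "binary_form d F" "F 1 0 ~= 0" "F 0 1 ~= 0" "0 < d"
 defines "R \<equiv> {a. F a 1 = 0}"
 shows "finite R" "card R \<le> d" "R ~= {} ==> F x y = 0 \<longleftrightarrow> (\<exists>a\<in>R. x = a * y)"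
proof -
 obtain k where k: "!!x y. F x y = (\<Sum>j\<le>d. k j * x ^ j * y ^ (d - j))" using F(1) unfolding binary_form_def by blast
 have "deg_le d (%x. F x 1)" unfolding k power_one mult_1_right by (intro deg_le_sum deg_le_cmult deg_le_power) simp
 then obtain p where p: "Polynomial.degree p \<le> d" "(%x. F x 1) = poly p" unfolding deg_le_def by blast
 have px: "F x 1 = poly p x" for x using p(2) by (rule fun_cong)
 have "p ~= 0" using F(3) px[of 0] by auto
 then show "finite R" "card R \<le> d"
  using card_poly_roots_bound[of p] poly_roots_finite[of p] p(1) by (auto simp: R_def px)
 assume R: "R ~= {}"
 show "F x y = 0 \<longleftrightarrow> (\<exists>a\<in>R. x = a * y)"
 proof (cases "y = 0")
  case True
  have "F z 0 = k d * z ^ d" for z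
  proof -
   have "F z 0 = (\<Sum>j\<le>d. if j = d then k d * z ^ d else 0)" unfolding k by (intro sum.cong) auto
   then show ?thesis by simp
  qed
  then show ?thesis using True F(2,4) R by auto
 next
  case False
  have "F x y = y ^ d * F (x / y) 1"
   unfolding k sum_distrib_left
  proof (rule sum.cong[OF refl])
   fix j assume "j \<in> {..d}"
   then have "y ^ d = y ^ j * y ^ (d - j)" by (simp flip: power_add)
   then show "k j * x ^ j * y ^ (d - j) = y ^ d * (k j * (x / y) ^ j * 1 ^ (d - j))" using False by (simp add: power_divide)
  qed
  then show ?thesis using False by (auto simp: R_def field_simps intro!: bexI[of _ "x / y"])
 qed
qed

text \<open>There are eight distinct eighth roots of -1, and the three factors have at most 1 + 3 +
  4 roots. So the bounds are attained and the root sets of the first two factors are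
  disjoint.\<close>

lemma factor_roots:
 assumes f: "binary_form 1 f1" "binary_form 3 f3" "binary_form 4 f4" "!!x y. x ^ 8 + y ^ 8 = f1 x y * f3 x y * f4 x y"
 obtains a1 A where "a1 \<notin> A" "card A = 3" "finite A" "a1 ^ 8 = - 1" "!!a. a \<in> A ==> a ^ 8 = - 1"
  "!!x y. f1 x y = 0 \<longleftrightarrow> x = a1 * y" "!!x y. f3 x y = 0 \<longleftrightarrow> (\<exists>a\<in>A. x = a * y)"
proof -
 have nz: "f1 1 0 ~= 0" "f1 0 1 ~= 0" "f3 1 0 ~= 0" "f3 0 1 ~= 0" "f4 1 0 ~= 0" "f4 0 1 ~= 0" using f(4)[of 1 0] f(4)[of 0 1] by auto
 define R where "R = (%f :: complex => complex => complex. {a. f a 1 = 0})"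
 have R: "{a. f a 1 = 0} = R f" for f by (simp add: R_def)
 note r1 = binary_form_roots[OF f(1) nz(1,2), unfolded R] and r3 = binary_form_roots[OF f(2) nz(3,4), unfolded R]
  and r4 = binary_form_roots[OF f(3) nz(5,6), unfolded R]
 have root: "a ^ 8 = - 1 \<longleftrightarrow> a \<in> R f1 \<union> R f3 \<union> R f4" for a
  using f(4)[of a 1] by (auto simp: R_def eq_neg_iff_add_eq_0)
 have "card {a :: complex. a ^ 8 = - 1} = 8" by (rule card_nth_roots) auto
 also have "{a. a ^ 8 = - 1} = R f1 \<union> R f3 \<union> R f4" using root by blast
 finally have c8: "card (R f1 \<union> R f3 \<union> R f4) = 8" .
 have "8 \<le> card (R f1 \<union> R f3) + card (R f4)" using card_Un_le[of "R f1 \<union> R f3" "R f4"] c8 by simp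
 moreover have "card (R f1 \<union> R f3) + card (R f1 \<inter> R f3) = card (R f1) + card (R f3)"
  using card_Un_Int[of "R f1" "R f3"] r1(1) r3(1) by simp
 ultimately have c: "card (R f1) = 1" "card (R f3) = 3" "card (R f1 \<inter> R f3) = 0" using r1(2) r3(2) r4(2) by linarith+
 obtain a1 where a1: "R f1 = {a1}" using c(1) card_1_singletonE by blast
 have "R f1 \<inter> R f3 = {}" using c(3) r1(1) by simp
 then have "a1 \<notin> R f3" using a1 by blast
 moreover have "R f3 ~= {}" using c(2) by auto
 ultimately show thesis
  using that[of a1 "R f3"] c(2) r3 r1(3) a1 root by auto
qed

theorem proposition3:
  fixes f\<^sub>1 f\<^sub>3 f\<^sub>4 g\<^sub>1 g\<^sub>3 g\<^sub>4 :: "complex \<Rightarrow> complex \<Rightarrow> complex"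
    and r :: rat
    and c\<^sub>1 c\<^sub>2 :: qchain
    and \<delta> :: "params \<Rightarrow> qchain set"
  assumes "binary_form 1 f\<^sub>1" "binary_form 3 f\<^sub>3" "binary_form 4 f\<^sub>4"
    and "binary_form 1 g\<^sub>1" "binary_form 3 g\<^sub>3" "binary_form 4 g\<^sub>4"
    and "\<And>x y. x ^ 8 + y ^ 8 = f\<^sub>1 x y * f\<^sub>3 x y * f\<^sub>4 x y"
    and "\<And>x y. x ^ 8 + y ^ 8 = g\<^sub>1 x y * g\<^sub>3 x y * g\<^sub>4 x y"
    and "fundamental_cycle (split_curve f\<^sub>1 g\<^sub>1) c\<^sub>1"
    and "fundamental_cycle (split_curve f\<^sub>3 g\<^sub>3) c\<^sub>2"
    and "r \<noteq> 0"
    and "parallel_transport (homology_class2 (surface 0) (c\<^sub>1 + qchain_scale r c\<^sub>2)) \<delta>"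
  shows "N_smooth 2 (Noether_Lefschetz_ideal \<delta>)"
proof -
 obtain a1 A where A: "a1 \<notin> A" "card A = 3" "finite A" "a1 ^ 8 = - 1" "!!a. a \<in> A ==> a ^ 8 = - 1"
  "!!x y. f\<^sub>1 x y = 0 \<longleftrightarrow> x = a1 * y" "!!x y. f\<^sub>3 x y = 0 \<longleftrightarrow> (\<exists>a\<in>A. x = a * y)"
  by (rule factor_roots[OF assms(1-3,7)]) (rule that; simp)
 obtain b1 B where B: "b1 \<notin> B" "card B = 3" "finite B" "b1 ^ 8 = - 1" "!!b. b \<in> B ==> b ^ 8 = - 1"
  "!!x y. g\<^sub>1 x y = 0 \<longleftrightarrow> x = b1 * y" "!!x y. g\<^sub>3 x y = 0 \<longleftrightarrow> (\<exists>b\<in>B. x = b * y)"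
  by (rule factor_roots[OF assms(4-6,8)]) (rule that; simp)
 have curves: "split_curve f\<^sub>1 g\<^sub>1 = grid {a1} {b1}" "split_curve f\<^sub>3 g\<^sub>3 = grid A B"
  by (simp_all add: split_curve_def grid_def A B)
 obtain eps \<rho> :: real where tube: "eps > 0" "\<rho> > 0"
  "!!s t x. norm s < \<rho> ==> norm t < \<rho> ==> x ~= 0 ==> octic s x = 0 ==> tubular (off t) eps x"
  "!!t x. norm t < \<rho> ==> x ~= 0 ==> octic t x = 0 ==> \<exists>c>0. \<forall>z. norm z \<le> eps --> norm (octic t (x + z *s normal x)) \<ge> c * norm z"
  by (rule tubular_neighbourhood) (rule that; blast)
 interpret octic_tube eps \<rho> by unfold_locales (use tube in auto)
 interpret C1: fermat_cycle eps \<rho> "{a1}" "{b1}" c\<^sub>1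
  by unfold_locales (use A B assms(9) in \<open>simp_all add: curves\<close>)
 interpret C2: fermat_cycle eps \<rho> A B c\<^sub>2
  by unfold_locales (use A B assms(10) in \<open>simp_all add: curves\<close>)
 interpret G: test_grid "of_rat r" a1 b1 A B
 proof
  show "0 \<notin> A" "0 \<notin> B" using A(5)[of 0] B(5)[of 0] by auto
  show "a1 ~= 0" "b1 ~= 0" using A(4) B(4) by auto
 qed (use A B assms(11) in auto)
 define c where "c = c\<^sub>1 + qchain_scale r c\<^sub>2"
 have tc: "tube_integral g eps c = tube_integral g eps c\<^sub>1 + of_rat r * tube_integral g eps c\<^sub>2" for g
  by (simp add: c_def tube_integral_def chain_sum_add chain_sum_scale)
 have cyc: "cycle2 (surface 0) c"
 proof -
  have "smooth_simplex 2 (surface 0) \<sigma>" if "\<sigma> \<in> Poly_Mapping.keys c" for \<sigma>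
  proof -
   have "Poly_Mapping.lookup c \<sigma> ~= 0" using that by (simp add: in_keys_iff)
   then have "\<sigma> \<in> Poly_Mapping.keys c\<^sub>1 \<or> \<sigma> \<in> Poly_Mapping.keys c\<^sub>2"
    by (auto simp: c_def lookup_add lookup_qchain_scale in_keys_iff)
   then show ?thesis
    using C1.simplex C2.simplex C1.grid_surface C2.grid_surface unfolding smooth_simplex_def by blast
  qed
  moreover have "qchain_scale r 0 = 0" by (rule poly_mapping_eqI) (simp add: lookup_qchain_scale)
  then have "qchain_boundary 2 (qchain_scale r c\<^sub>2) = 0"
   unfolding qchain_boundary_scale using C2.cycle by (simp add: cycle2_def)
  then have "qchain_boundary 2 c = 0"
   using C1.cycle by (simp add: c_def qchain_boundary_add cycle2_def)
  ultimately show ?thesis by (simp add: cycle2_def smooth_chain_def)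
 qed
 then have sm: "smooth_chain 2 (surface 0) c" by (simp add: cycle2_def)
 \<comment> \<open>The extra point of the pairing is the line C_1, and the grid consists of the nine
   lines of C_2.\<close>
 have p: "G.pairing (%a b. a ^ m * b ^ n) = a1 ^ (m + 1) * b1 ^ (n + 1) + of_rat r * ((\<Sum>a\<in>A. a ^ (m + 1)) * (\<Sum>b\<in>B. b ^ (n + 1)))" for m n
  unfolding G.pairing_def sum_product by (simp add: mult_ac)
 have L2: "tube_integral (quot 0 2 e) eps c = plane_mass * G.phi e" if "total e = 12" for e
  unfolding tc C1.period_2'[OF that] C2.period_2'[OF that] G.phi_def p by (simp add: algebra_simps)
 have L3: "tube_integral (quot 0 3 e) eps c = plane_mass / 16 * G.psi e" if "total e = 20" for e
 proof -
  have "G.psi e = ((if e 0 + e 1 = 14 then 7 - of_nat (e 0) else 0) + (if e 0 + e 1 = 6 then 7 - of_nat (e 2) else 0)) *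
   G.pairing (%a b. a ^ e 0 * b ^ e 2)" by (simp add: G.psi_def)
  moreover have "h * (x * u) + s * (h * (x * w)) = h * (x * (u + s * w))" for h x u s w :: complex by (simp add: algebra_simps)
  ultimately show ?thesis unfolding tc C1.period_3[OF that] C2.period_3[OF that] p by simp
 qed
 obtain r0 where r0: "r0 > 0" "r0 \<le> \<rho>"
  "!!t \<beta>. norm t < r0 ==> total \<beta> = 4 ==> 2 * pi * \<i> * period t \<beta> (\<delta> t) = tube_integral (quot t 1 \<beta>) eps c"
  by (rule period_eq_tube_integral[OF cyc assms(12)[folded c_def]]) (rule that; blast)
 define I where "I = {\<beta> :: 4 => nat. total \<beta> = 4}"
 have I: "finite I"
 proof (rule finite_subset)
  have "\<beta> i \<le> 4" if "\<beta> \<in> I" for \<beta> i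
   using that member_le_sum[of i UNIV \<beta>] by (simp add: I_def total_def)
  then show "I \<subseteq> Pi\<^sub>E UNIV (%_. {..4})" by (auto simp: PiE_def)
 qed (simp add: finite_PiE)
 \<comment> \<open>Undoes the factor 2 pi i between tube integrals and periods.\<close>
 define q where "q = 1 / (2 * complex_of_real pi * \<i>)"
 define k where "k = q * plane_mass"
 have tot: "total (%i. e i + exponents \<alpha> i) = total e + 8" for e \<alpha>
  using exponents[of \<alpha>] by (simp add: total_def sum.distrib)
 let ?s = "%\<beta> \<alpha> i. \<beta> i + exponents \<alpha> i"
 \<comment> \<open>\<open>L\<close>, \<open>b\<close> and \<open>T\<close> are the linear part, the
   quadratic part and the remainder of \<open>period_expansion\<close>; the coefficients of
   \<open>T\<close> still depend on t, holomorphically.\<close>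
 define L where "L = (%\<beta> t. \<Sum>\<alpha>\<in>UNIV. (k * G.phi (?s \<beta> \<alpha>)) * t $ \<alpha>)"
 define b where "b = (%\<beta> (v :: params) (w :: params). \<Sum>\<alpha>\<in>UNIV. \<Sum>\<alpha>'\<in>UNIV. k / 16 * (v $ \<alpha> * w $ \<alpha>' * G.psi (?s (?s \<beta> \<alpha>) \<alpha>')))"
 define T where "T = (%\<beta> t. \<Sum>\<alpha>\<in>UNIV. \<Sum>\<alpha>'\<in>UNIV. \<Sum>\<alpha>''\<in>UNIV. q * tube_integral (mixed 3 (?s (?s (?s \<beta> \<alpha>) \<alpha>') \<alpha>'') t) eps c * (t $ \<alpha> * t $ \<alpha>' * t $ \<alpha>''))"
 have "N_smooth 2 (germ_ideal ((%\<beta> t. period t \<beta> (\<delta> t)) ` I))"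
 proof (rule N_smooth_2I[where L = L and b = b and T = T, OF I])
  fix \<beta> v assume "\<beta> \<in> I"
  then have \<beta>: "total \<beta> = 4" by (simp add: I_def)
  show "clinear (L \<beta>)" unfolding L_def by (intro clinear_lincomb clinear_nth)
  show "clinear (b \<beta> v)" "clinear (%w. b \<beta> w v)"
   unfolding b_def clinear_def
   by (simp_all add: sum_distrib_left sum.distrib distrib_left distrib_right mult_ac)
  show "T \<beta> \<in> max_ideal_power 3"
  proof -
   have "(%t :: params. q * tube_integral (mixed 3 (?s (?s (?s \<beta> \<alpha>) \<alpha>') \<alpha>'') t) eps c * (t $ \<alpha> * t $ \<alpha>' * t $ \<alpha>'')) \<in> max_ideal_power 3" for \<alpha> \<alpha>' \<alpha>''
    unfolding max_ideal_power_def
    by (intro ideal_mult[OF _ hol_add_mult(2)[OF hol_const mixed_holomorphic[OF sm]]] cube_in_power[unfolded max_ideal_power_def]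
      max_ideal_clinear clinear_nth) (simp add: tot \<beta>)
   then show ?thesis unfolding T_def max_ideal_power_def by (intro ideal_sum)
  qed
  have "\<forall>\<^sub>F t :: params in nhds 0. norm t < r0"
   by (rule eventually_nhds_in_open[of "ball 0 r0", THEN eventually_mono]) (use r0 in auto)
  then show "\<forall>\<^sub>F t in nhds 0. period t \<beta> (\<delta> t) = L \<beta> t + b \<beta> t t + T \<beta> t"
  proof (rule eventually_mono)
   fix t :: params assume t: "norm t < r0"
   have "period t \<beta> (\<delta> t) = q * tube_integral (quot t 1 \<beta>) eps c"
    unfolding r0(3)[OF t \<beta>, symmetric] by (simp add: q_def)
   also have "\<dots> = q * (\<Sum>\<alpha>\<in>UNIV. t $ \<alpha> * (plane_mass * G.phi (?s \<beta> \<alpha>) +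
    (\<Sum>\<alpha>'\<in>UNIV. t $ \<alpha>' * (plane_mass / 16 * G.psi (?s (?s \<beta> \<alpha>) \<alpha>') +
    (\<Sum>\<alpha>''\<in>UNIV. t $ \<alpha>'' * tube_integral (mixed 3 (?s (?s (?s \<beta> \<alpha>) \<alpha>') \<alpha>'') t) eps c)))))"
   proof -
    have t': "norm t < \<rho>" using t r0(2) by simp
    have l1: "tube_integral (quot 0 1 \<beta>) eps c = 0" unfolding tc C1.period_1[OF \<beta>] C2.period_1[OF \<beta>] by simp
    have l2: "tube_integral (quot 0 2 (?s \<beta> \<alpha>)) eps c = plane_mass * G.phi (?s \<beta> \<alpha>)" for \<alpha>
     by (rule L2) (simp add: tot \<beta>)
    have l3: "tube_integral (quot 0 3 (?s (?s \<beta> \<alpha>) \<alpha>')) eps c = plane_mass / 16 * G.psi (?s (?s \<beta> \<alpha>) \<alpha>')" for \<alpha> \<alpha>'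
     by (rule L3) (simp add: tot \<beta>)
    show ?thesis unfolding period_expansion[OF sm \<beta> t'] l1 l2 l3 add_0_left ..
   qed
   also have "\<dots> = L \<beta> t + b \<beta> t t + T \<beta> t"
    unfolding L_def b_def T_def k_def sum.distrib[symmetric] sum_distrib_left
    by (intro sum.cong refl) (simp add: distrib_left sum.distrib sum_distrib_left mult_ac)
   finally show "period t \<beta> (\<delta> t) = L \<beta> t + b \<beta> t t + T \<beta> t" .
  qed
 next
  fix x :: "(4 => nat) => complex" and v
  assume 1: "!!t. (\<Sum>\<beta>\<in>I. x \<beta> * L \<beta> t) = 0" and 2: "!!\<beta>. \<beta> \<in> I ==> L \<beta> v = 0"
  show "(\<Sum>\<beta>\<in>I. x \<beta> * b \<beta> v v) = 0"
  \<comment> \<open>The total mass has not been shown to be nonzero; if it vanishes, so do all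
    quadratic parts.\<close>
  proof (cases "k = 0")
   case False
   have "(\<Sum>\<beta>\<in>I. \<Sum>\<alpha>\<in>UNIV. \<Sum>\<alpha>'\<in>UNIV. x \<beta> * v $ \<alpha> * v $ \<alpha>' * G.psi (?s (?s \<beta> \<alpha>) \<alpha>')) = 0"
   proof (rule G.psi_vanishes[OF I])
    show "total \<beta> = 4" if "\<beta> \<in> I" for \<beta> using that by (simp add: I_def)
    show "total (exponents \<alpha>) = 8" for \<alpha> by (rule total_exponents)
   next
    fix \<alpha> :: "4 => nat" assume "total \<alpha> = 8"
    then have \<alpha>: "exponents (Octic_monomial \<alpha>) = \<alpha>" by (simp add: Octic_monomial_inverse total_def)
    \<comment> \<open>Evaluating the relation between the linear parts at a basis vector isolates
      one monomial of degree 8.\<close>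
    have "L \<beta> (axis (Octic_monomial \<alpha>) 1) = k * G.phi (%i. \<beta> i + \<alpha> i)" for \<beta>
     unfolding L_def axis_def by (simp add: if_distrib \<alpha> cong: if_cong)
    then have "k * (\<Sum>\<beta>\<in>I. x \<beta> * G.phi (%i. \<beta> i + \<alpha> i)) = 0"
     using 1[of "axis (Octic_monomial \<alpha>) 1"] by (simp add: sum_distrib_left mult_ac)
    then show "(\<Sum>\<beta>\<in>I. x \<beta> * G.phi (%i. \<beta> i + \<alpha> i)) = 0" using False by simp
   next
    fix \<beta> :: "4 => nat" assume "total \<beta> = 4"
    then have "L \<beta> v = 0" using 2 by (simp add: I_def)
    then have "k * (\<Sum>\<alpha>\<in>UNIV. v $ \<alpha> * G.phi (%i. exponents \<alpha> i + \<beta> i)) = 0"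
     by (simp add: L_def sum_distrib_left mult_ac add.commute)
    then show "(\<Sum>\<alpha>\<in>UNIV. v $ \<alpha> * G.phi (%i. exponents \<alpha> i + \<beta> i)) = 0" using False by simp
   qed simp
   then have "k / 16 * (\<Sum>\<beta>\<in>I. \<Sum>\<alpha>\<in>UNIV. \<Sum>\<alpha>'\<in>UNIV. x \<beta> * v $ \<alpha> * v $ \<alpha>' * G.psi (?s (?s \<beta> \<alpha>) \<alpha>')) = 0" by simp
   then show ?thesis unfolding b_def sum_distrib_left by (simp only: mult_ac)
  qed (simp add: b_def)
 qed
 also have "(%\<beta> t. period t \<beta> (\<delta> t)) ` I = {%t. period t \<beta> (\<delta> t) | \<beta>. (\<Sum>i\<in>UNIV. \<beta> i) = 4}"
  by (auto simp: I_def total_def)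
 finally show ?thesis unfolding Noether_Lefschetz_ideal_def .
qed

end
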